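(* Let $\vec{U}$ be a coherent sequence on $\kappa$ and let $G\subseteq\mathbb{M}[\vec{U}]$ be $V$-generic. If $A\in V[G]$ is a fresh set of ordinals with respect to $V$, then $\mathrm{cf}^{V[G]}(\sup(A))=\omega$.
   Context: A coherent sequence is $\vec U=\langle U(\alpha,\beta)\mid \alpha\le\kappa,\ \beta<o^{\vec U}(\alpha)\rangle$ of normal measures $U(\alpha,\beta)$ on $\alpha$ such that for $j=j_{U(\alpha,\beta)}$, $j(\vec U)\restriction(\alpha+1)=\langle U(\alpha',\beta')\mid \alpha'<\alpha,\beta'<o^{\vec U}(\alpha')\text{ or }\alpha'=\alpha,\beta'<\beta\rangle$; $\kappa$ is its maximal measurable (no bound on $o^{\vec U}(\kappa)$ is assumed); $\bigcap\vec U(\alpha)=\bigcap_{i<o^{\vec U}(\alpha)}U(\alpha,i)$. Magidor(-Radin) forcing $\mathbb M[\vec U]$: conditions $p=\langle t_1,\dots,t_n,\langle\kappa,B\rangle\rangle$, each $t_i$ an ordinal $\kappa_i$ with $o^{\vec U}(\kappa_i)=0$ or a pair $\langle\kappa_i,B_i\rangle$ with $o^{\vec U}(\kappa_i)>0$, $\kappa_1<\dots<\kappa_n<\kappa$, $B_i\in\bigcap\vec U(\kappa_i)$, $\min B_i>\kappa_{i-1}$, $B\in\bigcap\vec U(\kappa)$, $\min B>\kappa_n$; with $\kappa(t_i)=\kappa_i$, $B(t_i)=B_i$ ($\emptyset$ for ordinals), $t_{n+1}=\langle\kappa,B\rangle$, for $q=\langle s_1,\dots,s_m,\langle\kappa,C\rangle\rangle$,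 $p\le q$ ($q$ stronger) iff $n\le m$, $C\subseteq B$, and there are $i_1<\dots<i_n$ with $\kappa(s_{i_r})=\kappa(t_r)$, $B(s_{i_r})\subseteq B(t_r)$, and for other $j$ with $i_{r-1}<j<i_r$ ($i_0=0,i_{n+1}=m+1$), $\kappa(s_j)\in B(t_r)$, $B(s_j)\subseteq B(t_r)\cap\kappa(s_j)$. A set of ordinals $A\in V[G]$ is fresh with respect to $V$ if $A\notin V$ but $A\cap\alpha\in V$ for every $\alpha<\sup(A)$. *)

theory Defs
  imports Main
begin

section \<open>The ambient universe\<close>

text \<open>
  The ground model \<open>V\<close>, the generic filter \<open>G\<close> and the extension \<open>V[G]\<close> all live in an
  ambient well-founded universe of sets, given by the type class below.  Only the closure needed
  for evaluating names is required of it.  \<open>V\<close> is a transitive class (possibly a set) of that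
  universe which satisfies first-order ZFC.
\<close>

class set_universe =
  fixes elts :: "'a \<Rightarrow> 'a set"
  assumes elts_extensionality: "elts x = elts y \<Longrightarrow> x = y"
    and wf_elts: "wf {(x, y). x \<in> elts y}"
    and elts_pairing: "\<exists>z. elts z = {x, y}"
    and elts_union: "\<exists>z. elts z = \<Union> (elts ` elts x)"
    and elts_replacement: "S \<subseteq> elts x \<Longrightarrow> \<exists>z. elts z = f ` S"

text \<open>The set of the universe with a given extension; only meaningful if there is one.\<close>

definition vset :: "'a set \<Rightarrow> 'a::set_universe" where
  "vset X = (THE x. elts x = X)"

lemma elts_vset: "\<exists>z. elts z = X \<Longrightarrow> elts (vset X) = X"
  unfolding vset_def by (rule theI') (auto intro: elts_extensionality)

definition opair :: "'a \<Rightarrow> 'a \<Rightarrow> 'a::set_universe" where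
  "opair x y = vset {vset {x}, vset {x, y}}"

definition is_fun :: "'a::set_universe \<Rightarrow> 'a \<Rightarrow> bool" where
  "is_fun f a \<longleftrightarrow> (\<forall>z\<in>elts f. \<exists>x\<in>elts a. \<exists>y. z = opair x y) \<and>
     (\<forall>x\<in>elts a. \<exists>!y. opair x y \<in> elts f)"

definition app :: "'a \<Rightarrow> 'a \<Rightarrow> 'a::set_universe" where
  "app f x = (THE y. opair x y \<in> elts f)"

definition const_fun :: "'a \<Rightarrow> 'a \<Rightarrow> 'a::set_universe" where
  "const_fun a x = vset {opair \<xi> x | \<xi>. \<xi> \<in> elts a}"

definition Ord :: "'a::set_universe \<Rightarrow> bool" where
  "Ord x \<longleftrightarrow> (\<forall>y\<in>elts x. elts y \<subseteq> elts x) \<and> (\<forall>y\<in>elts x. \<forall>z\<in>elts y. elts z \<subseteq> elts y)"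

primrec nat_ord :: "nat \<Rightarrow> 'a::set_universe" where
  "nat_ord 0 = vset {}"
| "nat_ord (Suc n) = vset (insert (nat_ord n) (elts (nat_ord n)))"

definition omega :: "'a::set_universe" where
  "omega = vset (range nat_ord)"

definition sup_ord :: "'a \<Rightarrow> 'a::set_universe" where
  "sup_ord A = vset (\<Union> (elts ` elts A))"

section \<open>Transitive models of ZFC\<close>

datatype fm = Mem nat nat | Eq nat nat | Neg fm | Conj fm fm | Ex nat fm

primrec sat :: "'a::set_universe set \<Rightarrow> (nat \<Rightarrow> 'a) \<Rightarrow> fm \<Rightarrow> bool" where
  "sat V s (Mem i k) \<longleftrightarrow> s i \<in> elts (s k)"
| "sat V s (Eq i k) \<longleftrightarrow> s i = s k"
| "sat V s (Neg \<phi>) \<longleftrightarrow> \<not> sat V s \<phi>"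
| "sat V s (Conj \<phi> \<psi>) \<longleftrightarrow> sat V s \<phi> \<and> sat V s \<psi>"
| "sat V s (Ex i \<phi>) \<longleftrightarrow> (\<exists>a\<in>V. sat V (s(i := a)) \<phi>)"

text \<open>
  The single axioms are written in the form they take in a transitive class; extensionality and
  foundation hold automatically there.  In the two schemes, the variable 0 (and in replacement
  also the variable 1) is the distinguished one, all others are parameters.
\<close>

definition zfc_model :: "'a::set_universe set \<Rightarrow> bool" where
  "zfc_model V \<longleftrightarrow>
     V \<noteq> {} \<and>
     (\<forall>x\<in>V. elts x \<subseteq> V) \<and>
     \<comment> \<open>pairing\<close>
     (\<forall>x\<in>V. \<forall>y\<in>V. \<exists>z\<in>V. elts z = {x, y}) \<and>
     \<comment> \<open>union\<close>
     (\<forall>x\<in>V. \<exists>z\<in>V. elts z = \<Union> (elts ` elts x)) \<and>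
     \<comment> \<open>power set\<close>
     (\<forall>x\<in>V. \<exists>z\<in>V. elts z = {y \<in> V. elts y \<subseteq> elts x}) \<and>
     \<comment> \<open>infinity\<close>
     (\<exists>z\<in>V. (\<exists>e\<in>elts z. elts e = {}) \<and>
        (\<forall>x\<in>elts z. \<exists>y\<in>elts z. elts y = insert x (elts x))) \<and>
     \<comment> \<open>separation\<close>
     (\<forall>\<phi> s. \<forall>x\<in>V. range s \<subseteq> V \<longrightarrow>
        (\<exists>z\<in>V. elts z = {y \<in> elts x. sat V (s(0 := y)) \<phi>})) \<and>
     \<comment> \<open>replacement\<close>
     (\<forall>\<phi> s. \<forall>x\<in>V. range s \<subseteq> V \<longrightarrow>
        (\<forall>y\<in>elts x. \<exists>!w. w \<in> V \<and> sat V (s(0 := y, 1 := w)) \<phi>) \<longrightarrow>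
        (\<exists>z\<in>V. elts z = {w \<in> V. \<exists>y\<in>elts x. sat V (s(0 := y, 1 := w)) \<phi>})) \<and>
     \<comment> \<open>choice\<close>
     (\<forall>x\<in>V. (\<forall>y\<in>elts x. elts y \<noteq> {}) \<and>
        (\<forall>y\<in>elts x. \<forall>z\<in>elts x. y \<noteq> z \<longrightarrow> elts y \<inter> elts z = {}) \<longrightarrow>
        (\<exists>c\<in>V. \<forall>y\<in>elts x. \<exists>w. elts c \<inter> elts y = {w}))"

section \<open>Normal measures and ultrapower embeddings, as computed in \<open>V\<close>\<close>

text \<open>An ultrafilter with these properties makes \<open>\<alpha>\<close> an uncountable regular cardinal of \<open>V\<close>.\<close>

definition normal_measure :: "'a::set_universe set \<Rightarrow> 'a \<Rightarrow> 'a \<Rightarrow> bool" where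
  "normal_measure V \<alpha> D \<longleftrightarrow>
     D \<in> V \<and> \<alpha> \<in> V \<and> Ord \<alpha> \<and> omega \<in> elts \<alpha> \<and>
     (\<forall>X\<in>elts D. elts X \<subseteq> elts \<alpha>) \<and>
     \<comment> \<open>nonprincipal ultrafilter on the subsets of \<open>\<alpha>\<close> in \<open>V\<close>\<close>
     vset {} \<notin> elts D \<and>
     (\<forall>X\<in>elts D. \<forall>Y\<in>V. elts X \<subseteq> elts Y \<and> elts Y \<subseteq> elts \<alpha> \<longrightarrow> Y \<in> elts D) \<and>
     (\<forall>X\<in>elts D. \<forall>Y\<in>elts D. vset (elts X \<inter> elts Y) \<in> elts D) \<and>
     (\<forall>X\<in>V. elts X \<subseteq> elts \<alpha> \<longrightarrow> X \<in> elts D \<or> vset (elts \<alpha> - elts X) \<in> elts D) \<and>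
     (\<forall>\<xi>\<in>elts \<alpha>. vset {\<xi>} \<notin> elts D) \<and>
     \<comment> \<open>\<open>\<alpha>\<close>-completeness\<close>
     (\<forall>\<gamma>\<in>elts \<alpha>. \<forall>f\<in>V. is_fun f \<gamma> \<and> (\<forall>\<xi>\<in>elts \<gamma>. app f \<xi> \<in> elts D) \<longrightarrow>
        vset {\<eta> \<in> elts \<alpha>. \<forall>\<xi>\<in>elts \<gamma>. \<eta> \<in> elts (app f \<xi>)} \<in> elts D) \<and>
     \<comment> \<open>closure under diagonal intersections\<close>
     (\<forall>f\<in>V. is_fun f \<alpha> \<and> (\<forall>\<xi>\<in>elts \<alpha>. app f \<xi> \<in> elts D) \<longrightarrow>
        vset {\<eta> \<in> elts \<alpha>. \<forall>\<xi>\<in>elts \<eta>. \<eta> \<in> elts (app f \<xi>)} \<in> elts D)"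

text \<open>
  \<open>j\<close> is the canonical embedding of \<open>V\<close> into the transitive collapse of its ultrapower by \<open>D\<close>:
  \<open>\<pi> f\<close> is the collapse of the class of \<open>f\<close>, for \<open>f\<close> in \<open>V\<close> with domain \<open>\<alpha>\<close>.
\<close>

definition ultrapower_embedding ::
    "'a::set_universe set \<Rightarrow> 'a \<Rightarrow> 'a \<Rightarrow> ('a \<Rightarrow> 'a) \<Rightarrow> bool" where
  "ultrapower_embedding V \<alpha> D j \<longleftrightarrow>
     (let F = {f \<in> V. is_fun f \<alpha>} in
      \<exists>\<pi> :: 'a \<Rightarrow> 'a.
        (\<forall>f\<in>F. \<forall>g\<in>F. \<pi> f = \<pi> g \<longleftrightarrow>
           vset {\<xi> \<in> elts \<alpha>. app f \<xi> = app g \<xi>} \<in> elts D) \<and>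
        (\<forall>f\<in>F. \<forall>g\<in>F. \<pi> f \<in> elts (\<pi> g) \<longleftrightarrow>
           vset {\<xi> \<in> elts \<alpha>. app f \<xi> \<in> elts (app g \<xi>)} \<in> elts D) \<and>
        (\<forall>f\<in>F. elts (\<pi> f) \<subseteq> \<pi> ` F) \<and>
        (\<forall>x\<in>V. j x = \<pi> (const_fun \<alpha> x)))"

section \<open>Coherent sequences\<close>

text \<open>
  The sequence \<open>U\<close> is an element of \<open>V\<close>: a function on pairs of ordinals
  \<open>(\<alpha>, \<beta>)\<close> with \<open>\<alpha> \<le> \<kappa>\<close> and \<open>\<beta> < o(\<alpha>)\<close>, from whose domain \<open>o(\<alpha>)\<close> is read off.
\<close>

definition o_seq :: "'a \<Rightarrow> 'a \<Rightarrow> 'a::set_universe" where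
  "o_seq U \<alpha> = vset {\<beta>. \<exists>y. opair (opair \<alpha> \<beta>) y \<in> elts U}"

definition coherent_sequence :: "'a::set_universe set \<Rightarrow> 'a \<Rightarrow> 'a \<Rightarrow> bool" where
  "coherent_sequence V \<kappa> U \<longleftrightarrow>
     U \<in> V \<and> \<kappa> \<in> V \<and> Ord \<kappa> \<and>
     (\<forall>z\<in>elts U. \<exists>\<alpha>\<in>insert \<kappa> (elts \<kappa>). \<exists>\<beta> y. z = opair (opair \<alpha> \<beta>) y) \<and>
     (\<forall>x y y'. opair x y \<in> elts U \<and> opair x y' \<in> elts U \<longrightarrow> y = y') \<and>
     (\<forall>\<alpha>\<in>insert \<kappa> (elts \<kappa>). Ord (o_seq U \<alpha>)) \<and>
     \<comment> \<open>\<open>\<kappa>\<close> itself carries a measure\<close>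
     elts (o_seq U \<kappa>) \<noteq> {} \<and>
     (\<forall>\<alpha>\<in>insert \<kappa> (elts \<kappa>). \<forall>\<beta>\<in>elts (o_seq U \<alpha>).
        normal_measure V \<alpha> (app U (opair \<alpha> \<beta>)) \<and>
        (\<exists>j. ultrapower_embedding V \<alpha> (app U (opair \<alpha> \<beta>)) j \<and>
          {z \<in> elts (j U). \<exists>\<alpha>' \<beta>' y. z = opair (opair \<alpha>' \<beta>') y \<and>
              (\<alpha>' \<in> elts \<alpha> \<or> \<alpha>' = \<alpha>)} =
          {z \<in> elts U. \<exists>\<alpha>' \<beta>' y. z = opair (opair \<alpha>' \<beta>') y \<and>
              (\<alpha>' \<in> elts \<alpha> \<or> \<alpha>' = \<alpha> \<and> \<beta>' \<in> elts \<beta>)}))"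

definition measure_inter :: "'a \<Rightarrow> 'a \<Rightarrow> 'a::set_universe set" where
  "measure_inter U \<alpha> = {X. \<forall>\<beta>\<in>elts (o_seq U \<alpha>). X \<in> elts (app U (opair \<alpha> \<beta>))}"

section \<open>Magidor-Radin forcing\<close>

datatype 'a block = Point 'a | Large 'a 'a

primrec kap :: "'a block \<Rightarrow> 'a" where
  "kap (Point a) = a"
| "kap (Large a B) = a"

primrec bset :: "'a::set_universe block \<Rightarrow> 'a set" where
  "bset (Point a) = {}"
| "bset (Large a B) = elts B"

text \<open>
  A condition is the whole list \<open>t\<^sub>1, \<dots>, t\<^sub>n, t\<^sub>n\<^sub>+\<^sub>1\<close> with \<open>t\<^sub>n\<^sub>+\<^sub>1 = \<langle>\<kappa>, B\<rangle>\<close>.  The requirements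
  on \<open>B\<close> are the instances for the last entry of those on all entries, as \<open>o(\<kappa>) > 0\<close>.
\<close>

definition magidor_seq :: "'a::set_universe \<Rightarrow> 'a \<Rightarrow> 'a block list \<Rightarrow> bool" where
  "magidor_seq \<kappa> U ts \<longleftrightarrow>
     ts \<noteq> [] \<and> (\<exists>B. last ts = Large \<kappa> B) \<and>
     (\<forall>i k. i < k \<and> k < length ts \<longrightarrow> kap (ts ! i) \<in> elts (kap (ts ! k))) \<and>
     (\<forall>a. Point a \<in> set ts \<longrightarrow> elts (o_seq U a) = {}) \<and>
     (\<forall>a B. Large a B \<in> set ts \<longrightarrow> elts (o_seq U a) \<noteq> {} \<and> B \<in> measure_inter U a) \<and>
     (\<forall>i. Suc i < length ts \<longrightarrow> (\<forall>\<xi>\<in>bset (ts ! Suc i). kap (ts ! i) \<in> elts \<xi>))"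

text \<open>
  \<open>magidor_seq_le ts ss\<close> means that \<open>ss\<close> is the stronger one.  The entry \<open>t\<^sub>r\<close> is \<open>ts ! (r - 1)\<close>,
  and \<open>length ts = n + 1\<close>, \<open>length ss = m + 1\<close>, so that \<open>r = n + 1\<close> is the clause \<open>C \<subseteq> B\<close>
  together with the one for the entries added between \<open>t\<^sub>n\<close> and \<open>\<langle>\<kappa>, B\<rangle>\<close>.
\<close>

definition magidor_seq_le :: "'a::set_universe block list \<Rightarrow> 'a block list \<Rightarrow> bool" where
  "magidor_seq_le ts ss \<longleftrightarrow>
     (\<exists>i :: nat \<Rightarrow> nat. i 0 = 0 \<and> i (length ts) = length ss \<and>
        strict_mono_on {0..length ts} i \<and>
        (\<forall>r\<in>{1..length ts}.
           kap (ss ! (i r - 1)) = kap (ts ! (r - 1)) \<and>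
           bset (ss ! (i r - 1)) \<subseteq> bset (ts ! (r - 1)) \<and>
           (\<forall>k. i (r - 1) < k \<and> k < i r \<longrightarrow>
              kap (ss ! (k - 1)) \<in> bset (ts ! (r - 1)) \<and>
              bset (ss ! (k - 1)) \<subseteq> bset (ts ! (r - 1)) \<inter> elts (kap (ss ! (k - 1))))))"

text \<open>
  Conditions as elements of \<open>V\<close>, finite sequences being iterated ordered pairs.  The coding is
  injective on conditions since a Kuratowski pair is never an ordinal.
\<close>

primrec code_block :: "'a::set_universe block \<Rightarrow> 'a" where
  "code_block (Point a) = a"
| "code_block (Large a B) = opair a B"

primrec code_seq :: "'a::set_universe block list \<Rightarrow> 'a" where
  "code_seq [] = vset {}"
| "code_seq (t # ts) = opair (code_block t) (code_seq ts)"

definition magidor :: "'a::set_universe \<Rightarrow> 'a \<Rightarrow> 'a set" where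
  "magidor \<kappa> U = code_seq ` {ts. magidor_seq \<kappa> U ts}"

definition magidor_le :: "'a::set_universe \<Rightarrow> 'a \<Rightarrow> 'a \<Rightarrow> 'a \<Rightarrow> bool" where
  "magidor_le \<kappa> U p q \<longleftrightarrow>
     (\<exists>ts ss. magidor_seq \<kappa> U ts \<and> magidor_seq \<kappa> U ss \<and>
        p = code_seq ts \<and> q = code_seq ss \<and> magidor_seq_le ts ss)"

section \<open>Generic extensions\<close>

text \<open>Throughout, \<open>le p q\<close> means that \<open>q\<close> is stronger than \<open>p\<close>.\<close>

definition V_generic ::
    "'a::set_universe set \<Rightarrow> 'a set \<Rightarrow> ('a \<Rightarrow> 'a \<Rightarrow> bool) \<Rightarrow> 'a set \<Rightarrow> bool" where
  "V_generic V P le G \<longleftrightarrow>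
     G \<subseteq> P \<and> G \<noteq> {} \<and>
     (\<forall>q\<in>G. \<forall>p\<in>P. le p q \<longrightarrow> p \<in> G) \<and>
     (\<forall>p\<in>G. \<forall>q\<in>G. \<exists>r\<in>G. le p r \<and> le q r) \<and>
     (\<forall>D\<in>V. elts D \<subseteq> P \<and> (\<forall>p\<in>P. \<exists>q\<in>elts D. le p q) \<longrightarrow> G \<inter> elts D \<noteq> {})"

inductive is_name :: "'a::set_universe set \<Rightarrow> 'a \<Rightarrow> bool" for P where
  "(\<And>z. z \<in> elts \<tau> \<Longrightarrow> \<exists>\<sigma> p. z = opair \<sigma> p \<and> is_name P \<sigma> \<and> p \<in> P) \<Longrightarrow> is_name P \<tau>"

lemma opair_trancl:
  assumes "opair \<sigma> p \<in> elts \<tau>"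
  shows "(\<sigma>, \<tau>) \<in> {(x, y). x \<in> elts y}\<^sup>+"
proof -
  have 1: "elts (vset {x, y}) = {x, y}" for x y :: 'a
    by (rule elts_vset) (rule elts_pairing)
  let ?E = "{(x, y). x \<in> elts (y :: 'a)}"
  have "(\<sigma>, vset {\<sigma>}) \<in> ?E"
    using 1[of \<sigma> \<sigma>] by simp
  moreover have "(vset {\<sigma>}, opair \<sigma> p) \<in> ?E"
    unfolding opair_def by (simp add: 1)
  moreover have "(opair \<sigma> p, \<tau>) \<in> ?E"
    using assms by simp
  ultimately show ?thesis
    by (meson r_into_trancl trancl_into_trancl)
qed

function val :: "'a::set_universe set \<Rightarrow> 'a \<Rightarrow> 'a" where
  "val G \<tau> = vset (val G ` {\<sigma>. \<exists>p\<in>G. opair \<sigma> p \<in> elts \<tau>})"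
  by auto
termination
  by (relation "inv_image ({(x, y). x \<in> elts y}\<^sup>+) snd")
    (auto intro: wf_inv_image wf_trancl wf_elts opair_trancl)

declare val.simps [simp del]

definition gen_ext :: "'a::set_universe set \<Rightarrow> 'a set \<Rightarrow> 'a set \<Rightarrow> 'a set" where
  "gen_ext V P G = {val G \<tau> | \<tau>. \<tau> \<in> V \<and> is_name P \<tau>}"

section \<open>Fresh sets and cofinality\<close>

definition fresh :: "'a::set_universe set \<Rightarrow> 'a \<Rightarrow> bool" where
  "fresh V A \<longleftrightarrow> A \<notin> V \<and> (\<forall>\<alpha>\<in>elts (sup_ord A). vset (elts A \<inter> elts \<alpha>) \<in> V)"

definition cofinal_map :: "'a::set_universe \<Rightarrow> 'a \<Rightarrow> 'a \<Rightarrow> bool" where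
  "cofinal_map f \<gamma> \<delta> \<longleftrightarrow>
     is_fun f \<gamma> \<and> (\<forall>\<xi>\<in>elts \<gamma>. app f \<xi> \<in> elts \<delta>) \<and>
     (\<forall>\<eta>\<in>elts \<delta>. \<exists>\<xi>\<in>elts \<gamma>. \<eta> \<in> elts (app f \<xi>) \<or> \<eta> = app f \<xi>)"

text \<open>The cofinality of \<open>\<delta>\<close> as computed in the transitive class \<open>M\<close>.\<close>

definition cof :: "'a::set_universe set \<Rightarrow> 'a \<Rightarrow> 'a" where
  "cof M \<delta> = (THE \<gamma>. \<gamma> \<in> M \<and> Ord \<gamma> \<and> (\<exists>f\<in>M. cofinal_map f \<gamma> \<delta>) \<and>
     (\<forall>\<gamma>'\<in>elts \<gamma>. \<not> (\<exists>f\<in>M. cofinal_map f \<gamma>' \<delta>)))"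

end

(*
  Let \<delta> be the supremum of the fresh set A. Take the least \<gamma> such that, for some fixed list v, every
  A \<inter> \<zeta> with \<zeta> < \<delta> is decided by a condition in G whose part above \<gamma> is v; then \<gamma> carries measures.
  Call a lower part l deciding for \<zeta> if some l, <\<gamma>, B>, v decides A \<inter> \<zeta>. As A is not in V, some map \<epsilon>
  in V from lower parts to \<delta> has unbounded range, and for each \<nu> < \<gamma> the generic lower parts below \<nu>
  do not decide all initial segments of A. Hence there are \<nu>_0 < \<nu>_1 < ... and z_n < \<delta> such
  that no generic lower part below \<nu>_n decides A \<inter> z_n, while one below \<nu>_(n+1) decides A \<inter> e_n for some
  value e_n \<ge> z_n of \<epsilon>. If the e_n were bounded by some \<zeta> < \<delta>, the limit \<nu>_\<omega> of the \<nu>_n would be \<gamma>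
  or a point added by G. In the first case a generic lower part deciding A \<inter> \<zeta> lies below some \<nu>_n; in
  the second, normality and coherence turn the decisions made by points close to \<nu>_\<omega> into a decision
  by a lower part that was not deciding. So (z_n) is cofinal in \<delta>, and it is definable over (V, \<in>, G).
*)
theory Submission
  imports Defs
begin

section \<open>Sets of the universe and ordinals\<close>

text \<open>The order of \<kappa> is unrestricted, so no induction on it is at hand; the choice of
  \<gamma>, which freezes the part above it, takes its place. The obstacle is that the set B of a
  deciding condition is any suitable set of V, not one from the filter. This makes deciding
  definable in V, but a decision can be lost when a block is added after the last one of l. What
  controls this is \<open>one_step\<close>: a decision shared by almost all one-point extensions,
  for a single measure on \<gamma>, belongs to l already. Coherence transports it from \<gamma> to
  almost every smaller point. Freshness lets it be applied at the limit \<nu>_\<omega>: neither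
  (\<nu>_n) nor (e_n) need be in V, but A \<inter> \<zeta> is, so correctness of a decision below
  \<zeta> is a statement of V, and the measures on \<nu>_\<omega> can judge it. The logical side is
  kept small: predicates definable over V are closed under the logical operations, forcing is set up
  only for a name being equal to a set of V, and sets enter V[G] through explicit names.\<close>

lemma elts_induct [case_names step]: "(\<And>x. (\<And>y. y \<in> elts x \<Longrightarrow> P y) \<Longrightarrow> P x) \<Longrightarrow> P (x::'a::set_universe)"
  using wf_induct_rule[OF wf_elts, of P x] by auto

lemma elts_irrefl [simp]: "x \<notin> elts (x::'a::set_universe)"
  using wf_elts wf_not_refl by fastforce

lemma elts_asym: "x \<in> elts y \<Longrightarrow> y \<notin> elts (x::'a::set_universe)"
  using wf_elts wf_not_sym by fastforce

text \<open>Only classes of this kind are extensions of sets; on others \<open>vset\<close> has no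
  meaning. Every evaluation of \<open>elts (vset _)\<close> passes through this predicate.\<close>

definition small :: "'a::set_universe set \<Rightarrow> bool" where
  "small S \<longleftrightarrow> (\<exists>x. elts x = S)"

lemma elts_vset_small: "small S \<Longrightarrow> elts (vset S) = S"
  unfolding small_def by (rule elts_vset)

lemma small_elts [simp]: "small (elts x)"
  by (auto simp: small_def)

lemma vset_elts [simp]: "vset (elts x) = x"
  by (rule elts_extensionality) (simp add: elts_vset_small)

lemma vset_eqI: "elts x = S \<Longrightarrow> vset S = x"
  using vset_elts by blast

lemma small_image: "small S \<Longrightarrow> small ((f :: 'a \<Rightarrow> 'a::set_universe) ` S)"
  unfolding small_def by (metis elts_replacement subset_refl)

lemma small_subset: "small T \<Longrightarrow> S \<subseteq> T \<Longrightarrow> small S"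
proof -
  assume "small T" "S \<subseteq> T"
  then obtain x where "S \<subseteq> elts x" by (auto simp: small_def)
  from elts_replacement[OF this, of "\<lambda>y. y"] show "small S" by (simp add: small_def)
qed

lemma small_empty [simp]: "small {}"
  using small_subset[OF small_elts] by blast

lemma small_pair [simp]: "small {x, y}"
  using elts_pairing by (auto simp: small_def)

lemma small_single [simp]: "small {x}"
  using small_pair[of x x] by simp

lemma small_UN:
  fixes S :: "'a::set_universe set" and f :: "'a \<Rightarrow> 'a set"
  assumes "small S" "\<And>x. x \<in> S \<Longrightarrow> small (f x)"
  shows "small (\<Union>x\<in>S. f x)"
proof -
  obtain z where z: "elts z = (\<lambda>x. vset (f x)) ` S"
    using small_image[OF assms(1)] unfolding small_def by blast
  have "\<Union> (elts ` elts z) = (\<Union>x\<in>S. f x)"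
    using assms(2) by (auto simp: z elts_vset_small)
  then show ?thesis
    using elts_union[of z] unfolding small_def by auto
qed

lemma small_Un [simp]: "small S \<Longrightarrow> small T \<Longrightarrow> small (S \<union> T)"
  using small_UN[of "{vset S, vset T}" elts] by (auto simp: elts_vset_small)

lemma small_insert [simp]: "small S \<Longrightarrow> small (insert x S)"
  using small_Un[of "{x}" S] by simp

lemma small_Int [simp]: "small S \<Longrightarrow> small (S \<inter> T)"
  using small_subset by blast

lemma small_Diff [simp]: "small S \<Longrightarrow> small (S - T)"
  using small_subset by blast

lemma small_Collect [simp]: "small {y \<in> elts x. P y}"
  by (rule small_subset[OF small_elts[of x]]) auto

lemma elts_vset_pair [simp]: "elts (vset {x, y}) = {x, y}"
  and elts_vset_single [simp]: "elts (vset {x}) = {x}"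
  and elts_vset_empty [simp]: "elts (vset {}) = {}"
  and elts_vset_Un [simp]: "elts (vset (elts a \<union> elts b)) = elts a \<union> elts b"
  and elts_vset_Int [simp]: "elts (vset (elts a \<inter> T)) = elts a \<inter> T"
  and elts_vset_Diff [simp]: "elts (vset (elts a - T)) = elts a - T"
  and elts_vset_insert [simp]: "elts (vset (insert x (elts a))) = insert x (elts a)"
  and elts_vset_Collect [simp]: "elts (vset {y \<in> elts a. P y}) = {y \<in> elts a. P y}"
  and elts_vset_Union [simp]: "elts (vset (\<Union> (elts ` elts a))) = \<Union> (elts ` elts a)"
  and elts_vset_image [simp]: "elts (vset ((f :: 'a \<Rightarrow> 'a) ` elts a)) = f ` elts (a::'a::set_universe)"
  by (auto intro!: elts_vset_small small_UN simp: small_image simp del: image_eqI)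

lemma opair_eq_iff [simp]: "opair a b = opair c d \<longleftrightarrow> a = c \<and> b = (d::'a::set_universe)"
proof
  assume "opair a b = opair c d"
  then have "{vset {a}, vset {a, b}} = {vset {c}, vset {c, d}}"
    unfolding opair_def using elts_vset_pair by metis
  moreover have "vset {x, y} = vset {z, w} \<longleftrightarrow> {x, y} = {z, w}" for x y z w :: 'a
    using elts_vset_pair by metis
  moreover have "vset {x} = vset {z, w} \<longleftrightarrow> {x} = {z, w}" for x z w :: 'a
    using elts_vset_pair elts_vset_single by metis
  moreover have "vset {z, w} = vset {x} \<longleftrightarrow> {x} = {z, w}" for x z w :: 'a
    using elts_vset_pair elts_vset_single by metis
  moreover have "vset {x} = vset {y} \<longleftrightarrow> x = y" for x y :: 'a
    using elts_vset_single by (metis singleton_inject)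
  ultimately show "a = c \<and> b = d"
    by (auto simp: doubleton_eq_iff)
qed auto

lemma elts_opair: "elts (opair x y) = {vset {x}, vset {x, y}}"
  by (simp add: opair_def)

lemma vset_subset_iff: "elts x \<subseteq> elts y \<Longrightarrow> elts y \<subseteq> elts x \<Longrightarrow> x = y"
  by (rule elts_extensionality) auto

lemma Ord_trans: "Ord x \<Longrightarrow> z \<in> elts y \<Longrightarrow> y \<in> elts x \<Longrightarrow> z \<in> elts x"
  by (auto simp: Ord_def)

lemma Ord_in_Ord: "Ord x \<Longrightarrow> y \<in> elts x \<Longrightarrow> Ord y"
  unfolding Ord_def by blast

lemma Ord_subset: "Ord x \<Longrightarrow> y \<in> elts x \<Longrightarrow> elts y \<subseteq> elts x"
  by (auto simp: Ord_def)

lemma Ord_linear: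
  assumes "Ord x" "Ord y"
  shows "x \<in> elts y \<or> x = y \<or> y \<in> elts x"
proof -
  have "\<forall>y. Ord x \<longrightarrow> Ord y \<longrightarrow> x \<in> elts y \<or> x = y \<or> y \<in> elts x" for x :: 'a
  proof (induction x rule: elts_induct)
    case (step x)
    show ?case
    proof
      fix y
      show "Ord x \<longrightarrow> Ord y \<longrightarrow> x \<in> elts y \<or> x = y \<or> y \<in> elts x"
      proof (induction y rule: elts_induct)
        case inner: (step y)
        show ?case
        proof (intro impI)
          assume o: "Ord x" "Ord y"
          show "x \<in> elts y \<or> x = y \<or> y \<in> elts x"
          proof (rule ccontr)
            assume n: "\<not> ?thesis"
            have "elts x \<subseteq> elts y"
              using step n o Ord_in_Ord Ord_trans by blast
            moreover have "elts y \<subseteq> elts x"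
              using inner n o Ord_in_Ord Ord_trans by blast
            ultimately show False
              using n vset_subset_iff by blast
          qed
        qed
      qed
    qed
  qed
  then show ?thesis using assms by blast
qed

lemma Ord_subset_iff: "Ord x \<Longrightarrow> Ord y \<Longrightarrow> elts x \<subseteq> elts y \<longleftrightarrow> x = y \<or> x \<in> elts y"
  by (metis Ord_linear Ord_subset elts_irrefl subsetD subset_refl)

lemma elts_least:
  assumes "P x"
  obtains y where "P y" "\<And>z. z \<in> elts y \<Longrightarrow> \<not> P z"
  using assms wfE_min[OF wf_elts, of x "{x. P x}"] by auto

lemma Ord_least:
  assumes "Ord d" "x \<in> elts d" "P x"
  obtains y where "y \<in> elts d" "P y" "\<And>z. z \<in> elts y \<Longrightarrow> \<not> P z"
proof -
  obtain y where y: "y \<in> elts d \<and> P y" "\<And>z. z \<in> elts y \<Longrightarrow> \<not> (z \<in> elts d \<and> P z)"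
    using elts_least[of "\<lambda>x. x \<in> elts d \<and> P x" x] assms by blast
  then show ?thesis
    using that assms(1) Ord_trans by blast
qed

lemma Ord_empty_mem: "Ord x \<Longrightarrow> x \<noteq> vset {} \<Longrightarrow> vset {} \<in> elts x"
proof -
  assume o: "Ord x" "x \<noteq> vset {}"
  have "Ord (vset {} :: 'a)" by (simp add: Ord_def)
  then show "vset {} \<in> elts x" using Ord_linear[OF o(1)] o(2) by fastforce
qed

text \<open>A nonempty ordinal has zero as a member, but both members of a Kuratowski pair are
  inhabited. Hence a point, coded by its ordinal, is never confused with a pair <a, B>.\<close>

lemma not_Ord_opair: "\<not> Ord (opair x y)"
proof
  assume o: "Ord (opair x y)"
  have "opair x y \<noteq> vset {}"
    by (metis elts_opair elts_vset_empty insert_not_empty)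
  then have "vset {} \<in> elts (opair x y)"
    using Ord_empty_mem o by blast
  then show False
    using elts_vset_pair elts_vset_single elts_vset_empty unfolding elts_opair
    by (metis insert_iff insert_not_empty singletonD)
qed

definition sucO :: "'a::set_universe \<Rightarrow> 'a" where
  "sucO x = vset (insert x (elts x))"

lemma elts_sucO [simp]: "elts (sucO x) = insert x (elts x)"
  by (simp add: sucO_def)

lemma Ord_sucO: "Ord x \<Longrightarrow> Ord (sucO x)"
  by (auto simp: Ord_def)

lemma Ord_Union: "(\<And>y. y \<in> elts x \<Longrightarrow> Ord y) \<Longrightarrow> Ord (vset (\<Union> (elts ` elts x)))"
  unfolding Ord_def elts_vset_Union by blast

lemma Ord_nat_ord: "Ord (nat_ord n :: 'a::set_universe)"
proof (induction n)
  case 0 show ?case by (simp add: Ord_def)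
next
  case (Suc n)
  then show ?case using Ord_sucO[of "nat_ord n"] by (simp add: sucO_def)
qed

lemma elts_nat_ord: "elts (nat_ord n :: 'a::set_universe) = nat_ord ` {..<n}"
proof (induction n)
  case (Suc n)
  show ?case unfolding nat_ord.simps(2) elts_vset_insert by (simp add: Suc lessThan_Suc)
qed simp

lemma nat_ord_inj: "nat_ord m = (nat_ord n :: 'a::set_universe) \<longleftrightarrow> m = n"
proof -
  have "m < n \<Longrightarrow> nat_ord m \<noteq> (nat_ord n :: 'a)" for m n
    by (metis elts_irrefl elts_nat_ord imageI lessThan_iff)
  then show ?thesis by (metis nat_neq_iff)
qed

lemma nat_ord_mem: "nat_ord m \<in> elts (nat_ord n :: 'a::set_universe) \<longleftrightarrow> m < n"
  by (auto simp: elts_nat_ord nat_ord_inj)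

section \<open>Definability over a transitive model\<close>

primrec rn :: "(nat \<Rightarrow> nat) \<Rightarrow> fm \<Rightarrow> fm" where
  "rn f (Mem i k) = Mem (f i) (f k)"
| "rn f (Eq i k) = Eq (f i) (f k)"
| "rn f (Neg \<phi>) = Neg (rn f \<phi>)"
| "rn f (Conj \<phi> \<psi>) = Conj (rn f \<phi>) (rn f \<psi>)"
| "rn f (Ex i \<phi>) = Ex (f i) (rn f \<phi>)"

lemma sat_rn: "inj f \<Longrightarrow> sat V s (rn f \<phi>) = sat V (s \<circ> f) \<phi>"
proof (induction \<phi> arbitrary: s)
  case (Ex i \<phi>)
  have "(s(f i := a)) \<circ> f = (s \<circ> f)(i := a)" for a
    using Ex(2) by (auto simp: fun_eq_iff inj_eq)
  then have "(\<lambda>n. (s(f i := a)) (f n)) = (s \<circ> f)(i := a)" for a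
    by (simp add: comp_def)
  then show ?case using Ex by (simp add: comp_def del: fun_upd_apply)
qed auto

text \<open>Variables sit at the even positions of an assignment, parameters at the odd ones.\<close>

definition mix :: "(nat \<Rightarrow> 'a) \<Rightarrow> (nat \<Rightarrow> 'a) \<Rightarrow> nat \<Rightarrow> 'a" where
  "mix s c n = (if even n then s (n div 2) else c (n div 2))"

lemma mix_simps [simp]: "mix s c (2 * n) = s n" "mix s c (Suc (2 * n)) = c n" "mix s c 0 = s 0"
  by (auto simp: mix_def)

named_theorems df

locale zfc =
  fixes V :: "'a::set_universe set"
  assumes zfc: "zfc_model V"
begin

lemma V_trans: "x \<in> V \<Longrightarrow> y \<in> elts x \<Longrightarrow> y \<in> V"
proof -
  have "\<forall>x\<in>V. elts x \<subseteq> V" using zfc unfolding zfc_model_def by (elim conjE) assumption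
  then show "x \<in> V \<Longrightarrow> y \<in> elts x \<Longrightarrow> y \<in> V" by blast
qed

lemma V_ex: "\<exists>x. x \<in> V"
proof -
  have "V \<noteq> {}" using zfc unfolding zfc_model_def by (elim conjE) assumption
  then show ?thesis by blast
qed

lemma V_pair: "x \<in> V \<Longrightarrow> y \<in> V \<Longrightarrow> vset {x, y} \<in> V"
proof -
  assume a: "x \<in> V" "y \<in> V"
  have "\<forall>x\<in>V. \<forall>y\<in>V. \<exists>z\<in>V. elts z = {x, y}" using zfc unfolding zfc_model_def by (elim conjE) assumption
  then show ?thesis using a vset_eqI by metis
qed

lemma V_single: "x \<in> V \<Longrightarrow> vset {x} \<in> V"
  using V_pair[of x x] by simp

lemma V_opair: "x \<in> V \<Longrightarrow> y \<in> V \<Longrightarrow> opair x y \<in> V"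
  by (simp add: opair_def V_pair V_single)

lemma V_opairD: "opair x y \<in> V \<Longrightarrow> x \<in> V \<and> y \<in> V"
  by (metis V_trans elts_opair elts_vset_pair insertI1 insertI2)

lemma V_Union: "x \<in> V \<Longrightarrow> vset (\<Union> (elts ` elts x)) \<in> V"
proof -
  assume a: "x \<in> V"
  have "\<forall>x\<in>V. \<exists>z\<in>V. elts z = \<Union> (elts ` elts x)" using zfc unfolding zfc_model_def by (elim conjE) assumption
  then show ?thesis using a vset_eqI by metis
qed

lemma V_Un: "x \<in> V \<Longrightarrow> y \<in> V \<Longrightarrow> vset (elts x \<union> elts y) \<in> V"
  using V_Union[OF V_pair[of x y]] by simp

lemma V_insert: "x \<in> V \<Longrightarrow> y \<in> V \<Longrightarrow> vset (insert x (elts y)) \<in> V"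
  using V_Un[OF V_single[of x], of y] by simp

lemma V_sucO: "x \<in> V \<Longrightarrow> sucO x \<in> V"
  by (simp add: sucO_def V_insert)

definition powV :: "'a \<Rightarrow> 'a" where
  "powV x = vset {y \<in> V. elts y \<subseteq> elts x}"

lemma powV: assumes "x \<in> V" shows "powV x \<in> V" "elts (powV x) = {y \<in> V. elts y \<subseteq> elts x}"
proof -
  have "\<forall>x\<in>V. \<exists>z\<in>V. elts z = {y \<in> V. elts y \<subseteq> elts x}" using zfc unfolding zfc_model_def by (elim conjE) assumption
  then obtain z where "z \<in> V" "elts z = {y \<in> V. elts y \<subseteq> elts x}" using assms by blast
  then show "powV x \<in> V" "elts (powV x) = {y \<in> V. elts y \<subseteq> elts x}"
    unfolding powV_def by (simp_all add: vset_eqI)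
qed

text \<open>Definability over \<^term>\<open>V\<close> with parameters, for predicates and for functions of an assignment. Below,
  \<open>dfn\<close> is the version for unary functions and \<open>dfl\<close> the one for functions with
  values in the finite sequences of blocks. A quantifier is removed by shifting the assignment.\<close>

definition dfp :: "((nat \<Rightarrow> 'a) \<Rightarrow> bool) \<Rightarrow> bool" where
  "dfp P \<longleftrightarrow> (\<exists>\<phi> c. range c \<subseteq> V \<and> (\<forall>s. range s \<subseteq> V \<longrightarrow> P s = sat V (mix s c) \<phi>))"

definition dff :: "((nat \<Rightarrow> 'a) \<Rightarrow> 'a) \<Rightarrow> bool" where
  "dff t \<longleftrightarrow> (\<forall>s. range s \<subseteq> V \<longrightarrow> t s \<in> V) \<and> dfp (\<lambda>s. s 0 = t (\<lambda>n. s (Suc n)))"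

lemma dfp_cong: "dfp P \<Longrightarrow> (\<And>s. range s \<subseteq> V \<Longrightarrow> P s = Q s) \<Longrightarrow> dfp Q"
  unfolding dfp_def by metis

lemma dfp_not [df]: "dfp P \<Longrightarrow> dfp (\<lambda>s. \<not> P s)"
  unfolding dfp_def by (metis sat.simps(3))

lemma dfp_conj [df]:
  assumes "dfp P" "dfp Q" shows "dfp (\<lambda>s. P s \<and> Q s)"
proof -
  obtain \<phi> c where p: "range c \<subseteq> V" "\<And>s. range s \<subseteq> V \<Longrightarrow> P s = sat V (mix s c) \<phi>"
    using assms unfolding dfp_def by blast
  obtain \<psi> d where q: "range d \<subseteq> V" "\<And>s. range s \<subseteq> V \<Longrightarrow> Q s = sat V (mix s d) \<psi>"
    using assms unfolding dfp_def by blast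
  \<comment> \<open>\<open>mix c d\<close> interleaves the two parameter sequences;
    \<open>?f\<close> and \<open>?g\<close> send the odd positions, those of the parameters, of
    either formula to its own half.\<close>
  let ?f = "\<lambda>n::nat. if even n then n else 2 * n - 1"
  let ?g = "\<lambda>n::nat. if even n then n else 2 * n + 1"
  have f: "inj ?f" and g: "inj ?g"
    unfolding inj_def by (auto split: if_splits)
  have "mix s (mix c d) (?f n) = mix s c n" for s n
  proof (cases "even n")
    case False
    then obtain k where "n = 2 * k + 1" by (rule oddE)
    then show ?thesis by (simp add: mix_def)
  qed (simp add: mix_def)
  then have "mix s (mix c d) \<circ> ?f = mix s c" for s by (simp only: fun_eq_iff o_apply) blast
  moreover have "mix s (mix c d) (?g n) = mix s d n" for s n
  proof (cases "even n")
    case False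
    then obtain k where "n = 2 * k + 1" by (rule oddE)
    then show ?thesis by (simp add: mix_def)
  qed (simp add: mix_def)
  then have "mix s (mix c d) \<circ> ?g = mix s d" for s by (simp only: fun_eq_iff o_apply) blast
  ultimately have "\<forall>s. range s \<subseteq> V \<longrightarrow> (P s \<and> Q s) = sat V (mix s (mix c d)) (Conj (rn ?f \<phi>) (rn ?g \<psi>))"
    using p q by (simp add: sat_rn f g)
  moreover have "range (mix c d) \<subseteq> V"
    using p(1) q(1) by (auto simp: mix_def)
  ultimately show ?thesis unfolding dfp_def by blast
qed

lemma range_case_nat: "x \<in> V \<Longrightarrow> range s \<subseteq> V \<Longrightarrow> range (case_nat x s) \<subseteq> V"
  by (force split: nat.splits)

lemma dfp_ex [df]:
  assumes "dfp (\<lambda>s. Q (s 0) (\<lambda>n. s (Suc n)))" shows "dfp (\<lambda>s. \<exists>x\<in>V. Q x s)"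
proof -
  obtain \<phi> c where p: "range c \<subseteq> V"
      "\<And>s. range s \<subseteq> V \<Longrightarrow> Q (s 0) (\<lambda>n. s (Suc n)) = sat V (mix s c) \<phi>"
    using assms unfolding dfp_def by blast
  obtain v where v: "v \<in> V" using V_ex by blast
  \<comment> \<open>A dummy parameter \<open>v\<close> in front of \<open>c\<close> frees position 1
    for the bound variable. The old variable 0 goes there, the other variables move down and the
    parameters up by one place.\<close>
  let ?f = "\<lambda>n::nat. if n = 0 then 1 else if even n then n - 2 else n + 2"
  have f: "inj ?f"
  proof (rule injI)
    fix x y assume "?f x = ?f y"
    then show "x = y" by (auto split: if_splits) presburger+
  qed
  have *: "(mix s (case_nat v c))(1 := x) \<circ> ?f = mix (case_nat x s) c" for s x
  proof
    fix n show "((mix s (case_nat v c))(1 := x) \<circ> ?f) n = mix (case_nat x s) c n"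
    proof (cases "even n")
      case True
      then obtain k where "n = 2 * k" by blast
      then show ?thesis by (cases k) (auto simp: mix_def)
    next
      case False
      then obtain k where "n = 2 * k + 1" by (elim oddE)
      then show ?thesis by (auto simp: mix_def)
    qed
  qed
  have "(\<exists>x\<in>V. Q x s) = sat V (mix s (case_nat v c)) (Ex 1 (rn ?f \<phi>))" if "range s \<subseteq> V" for s
  proof -
    have "Q x s = sat V (mix (case_nat x s) c) \<phi>" if "x \<in> V" for x
      using p(2)[OF range_case_nat[OF that \<open>range s \<subseteq> V\<close>]] by simp
    then show ?thesis
      using * by (simp add: sat_rn[OF f])
  qed
  then show ?thesis unfolding dfp_def using range_case_nat[OF v p(1)] by blast
qed

lemma dfp_shift:
  assumes "dfp P" "inj g" shows "dfp (\<lambda>s. P (\<lambda>n. s (g n)))"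
proof -
  obtain \<phi> c where p: "range c \<subseteq> V" "\<And>s. range s \<subseteq> V \<Longrightarrow> P s = sat V (mix s c) \<phi>"
    using assms unfolding dfp_def by blast
  let ?f = "\<lambda>n. if even n then 2 * g (n div 2) else n"
  have f: "inj ?f"
  proof (rule injI)
    fix x y assume *: "?f x = ?f y"
    show "x = y"
    proof (cases "even x \<and> even y")
      case True
      with * have "x div 2 = y div 2" using assms(2) by (simp add: inj_eq)
      with True show ?thesis by (metis even_two_times_div_two)
    qed (use * in \<open>metis dvd_triv_left\<close>)
  qed
  have "mix s c \<circ> ?f = mix (\<lambda>n. s (g n)) c" for s
    by (auto simp: fun_eq_iff mix_def)
  then have "range s \<subseteq> V \<longrightarrow> P (\<lambda>n. s (g n)) = sat V (mix s c) (rn ?f \<phi>)" for s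
    using p(2)[of "\<lambda>n. s (g n)"] by (auto simp: sat_rn[OF f])
  then show ?thesis unfolding dfp_def using p(1) by blast
qed

lemma dfp_mem_var: "dfp (\<lambda>s. s i \<in> elts (s j))"
proof -
  obtain v where "v \<in> V" using V_ex by blast
  then have "range (\<lambda>_::nat. v) \<subseteq> V" by auto
  then show ?thesis unfolding dfp_def
    by (intro exI[of _ "Mem (2*i) (2*j)"] exI[of _ "\<lambda>_. v"]) simp
qed

lemma dfp_eq_var: "dfp (\<lambda>s. s i = s j)"
proof -
  obtain v where "v \<in> V" using V_ex by blast
  then have "range (\<lambda>_::nat. v) \<subseteq> V" by auto
  then show ?thesis unfolding dfp_def
    by (intro exI[of _ "Eq (2*i) (2*j)"] exI[of _ "\<lambda>_. v"]) simp
qed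

lemma dfp_eq_const: "c \<in> V \<Longrightarrow> dfp (\<lambda>s. s i = c)"
  unfolding dfp_def
  by (rule exI[of _ "Eq (2*i) 1"], rule exI[of _ "\<lambda>_. c"]) (auto simp: mix_def)

lemma dfp_True: "dfp (\<lambda>s. True)"
  using dfp_eq_var[of 0 0] by simp

lemma dfp_bool [df]: "dfp (\<lambda>s. b)"
  using dfp_True dfp_not[OF dfp_True] by (cases b) auto

lemma dfp_disj [df]: "dfp P \<Longrightarrow> dfp Q \<Longrightarrow> dfp (\<lambda>s. P s \<or> Q s)"
  using dfp_not[OF dfp_conj[OF dfp_not dfp_not], of P Q] by simp

lemma dfp_imp [df]: "dfp P \<Longrightarrow> dfp Q \<Longrightarrow> dfp (\<lambda>s. P s \<longrightarrow> Q s)"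
  unfolding imp_conv_disj by (intro dfp_disj dfp_not)

lemma dfp_iff [df]: "dfp P \<Longrightarrow> dfp Q \<Longrightarrow> dfp (\<lambda>s. P s = Q s)"
proof -
  assume "dfp P" "dfp Q"
  then have "dfp (\<lambda>s. (P s \<longrightarrow> Q s) \<and> (Q s \<longrightarrow> P s))" by (intro dfp_conj dfp_imp)
  then show ?thesis by (rule dfp_cong) blast
qed

lemma dfp_all [df]:
  assumes "dfp (\<lambda>s. Q (s 0) (\<lambda>n. s (Suc n)))" shows "dfp (\<lambda>s. \<forall>x\<in>V. Q x s)"
proof -
  have "dfp (\<lambda>s. \<not> (\<exists>x\<in>V. \<not> Q x s))" by (intro dfp_not dfp_ex assms)
  then show ?thesis by simp
qed

lemma dff_var [df]: "dff (\<lambda>s. s i)"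
  unfolding dff_def using dfp_eq_var by auto

lemma dff_const [df]: "c \<in> V \<Longrightarrow> dff (\<lambda>s. c)"
  unfolding dff_def using dfp_eq_const by auto

lemma dff_V: "dff t \<Longrightarrow> range s \<subseteq> V \<Longrightarrow> t s \<in> V"
  by (simp add: dff_def)

text \<open>Substitution is a quantifier over the value: \<open>t s\<close> is the only element of V
  that satisfies the graph of \<open>t\<close>. So formulas need no terms.\<close>

lemma dfp_subst:
  assumes "dfp (\<lambda>s. Q (s 0) (\<lambda>n. s (Suc n)))" "dff t" shows "dfp (\<lambda>s. Q (t s) s)"
proof -
  have "dfp (\<lambda>s. \<exists>x\<in>V. x = t s \<and> Q x s)"
    using assms by (intro df) (auto simp: dff_def)
  then show ?thesis
    by (rule dfp_cong) (use dff_V[OF assms(2)] in auto)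
qed

lemma dff_shift: "dff t \<Longrightarrow> dff (\<lambda>s. t (\<lambda>n. s (Suc n)))"
proof -
  assume t: "dff t"
  then have "dfp (\<lambda>s. s 0 = t (\<lambda>n. s (Suc n)))" by (simp add: dff_def)
  from dfp_shift[OF this, of "\<lambda>n. case n of 0 \<Rightarrow> 0 | Suc n \<Rightarrow> Suc (Suc n)"]
  have "dfp (\<lambda>s. s 0 = t (\<lambda>n. s (Suc (Suc n))))" by (auto simp: inj_def split: nat.splits)
  moreover have "t (\<lambda>n. s (Suc n)) \<in> V" if "range s \<subseteq> V" for s
    using that by (intro dff_V[OF t]) auto
  ultimately show ?thesis by (auto simp: dff_def)
qed

lemma dfp1I: "dfp (\<lambda>s. Q (s 0)) \<Longrightarrow> dff t \<Longrightarrow> dfp (\<lambda>s. Q (t s))"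
  by (rule dfp_subst)

text \<open>The substitution is simultaneous because the \<open>T i\<close> may use the variables
  that are replaced. The induction treats the first k variables while the next one waits as variable
  0, which \<open>dfp_subst\<close> then removes.\<close>

lemma dfp_substs:
  "dfp P \<Longrightarrow> (\<And>i. i < k \<Longrightarrow> dff (T i)) \<Longrightarrow> dfp (\<lambda>s. P (\<lambda>i. if i < k then T i s else s (i - k)))"
proof (induction k arbitrary: T)
  case (Suc k)
  define Q where "Q = (\<lambda>x r. P (\<lambda>i. if i < k then T i r else if i = k then x else r (i - Suc k)))"
  have "dfp (\<lambda>s. P (\<lambda>i. if i < k then T i (\<lambda>n. s (Suc n)) else s (i - k)))"
    using Suc(3) dff_shift by (intro Suc(1)[of "\<lambda>i s. T i (\<lambda>n. s (Suc n))"] Suc(2)) auto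
  moreover have "(\<lambda>i. if i < k then T i (\<lambda>n. s (Suc n)) else s (i - k)) =
    (\<lambda>i. if i < k then T i (\<lambda>n. s (Suc n)) else if i = k then s 0 else s (Suc (i - Suc k)))" for s
    by (auto simp: fun_eq_iff Suc_diff_Suc)
  ultimately have "dfp (\<lambda>s. Q (s 0) (\<lambda>n. s (Suc n)))"
    by (simp add: Q_def)
  from dfp_subst[OF this Suc(3)[of k]] have "dfp (\<lambda>s. Q (T k s) s)" by simp
  moreover have "(\<lambda>i. if i < Suc k then T i s else s (i - Suc k)) =
     (\<lambda>i. if i < k then T i s else if i = k then T k s else s (i - Suc k))" for s
    by (auto simp: fun_eq_iff less_Suc_eq)
  ultimately show ?case by (simp add: Q_def)
qed simp

lemma dfp2I: "dfp (\<lambda>s. Q (s 0) (s 1)) \<Longrightarrow> dff t \<Longrightarrow> dff u \<Longrightarrow> dfp (\<lambda>s. Q (t s) (u s))"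
  using dfp_substs[of "\<lambda>s. Q (s 0) (s 1)" 2 "\<lambda>i. [t, u] ! i"]
  by (force simp: less_Suc_eq eval_nat_numeral)

lemma dfp3I: "dfp (\<lambda>s. Q (s 0) (s 1) (s 2)) \<Longrightarrow> dff t \<Longrightarrow> dff u \<Longrightarrow> dff v \<Longrightarrow>
  dfp (\<lambda>s. Q (t s) (u s) (v s))"
  using dfp_substs[of "\<lambda>s. Q (s 0) (s 1) (s 2)" 3 "\<lambda>i. [t, u, v] ! i"]
  by (force simp: less_Suc_eq eval_nat_numeral)

lemma dff1I:
  assumes "dfp (\<lambda>s. s 0 = h (s 1))" "\<And>x. x \<in> V \<Longrightarrow> h x \<in> V" "dff t"
  shows "dff (\<lambda>s. h (t s))"
  unfolding dff_def
  using dfp2I[of "\<lambda>x y. x = h y", OF assms(1) dff_var[of 0] dff_shift[OF assms(3)]]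
    assms(2) dff_V[OF assms(3)] by auto

lemma dff2I:
  assumes "dfp (\<lambda>s. s 0 = h (s 1) (s 2))" "\<And>x y. x \<in> V \<Longrightarrow> y \<in> V \<Longrightarrow> h x y \<in> V" "dff t" "dff u"
  shows "dff (\<lambda>s. h (t s) (u s))"
  unfolding dff_def
  using dfp3I[of "\<lambda>x y z. x = h y z", OF assms(1) dff_var[of 0] dff_shift[OF assms(3)] dff_shift[OF assms(4)]]
    assms(2) dff_V[OF assms(3)] dff_V[OF assms(4)] by auto

lemma dfp_mem [df]: "dff t \<Longrightarrow> dff u \<Longrightarrow> dfp (\<lambda>s. t s \<in> elts (u s))"
  by (rule dfp2I[of "\<lambda>x y. x \<in> elts y"]) (rule dfp_mem_var)

lemma dfp_eq [df]: "dff t \<Longrightarrow> dff u \<Longrightarrow> dfp (\<lambda>s. t s = u s)"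
  by (rule dfp2I[of "\<lambda>x y. x = y"]) (rule dfp_eq_var)

lemma dfp_bex [df]:
  assumes "dff t" "dfp (\<lambda>s. Q (s 0) (\<lambda>n. s (Suc n)))" shows "dfp (\<lambda>s. \<exists>x\<in>elts (t s). Q x s)"
proof -
  have "dfp (\<lambda>s. \<exists>x\<in>V. x \<in> elts (t s) \<and> Q x s)"
    using assms dff_shift by (intro df)
  then show ?thesis
    by (rule dfp_cong) (use dff_V[OF assms(1)] V_trans in blast)
qed

lemma dfp_ball [df]:
  assumes "dff t" "dfp (\<lambda>s. Q (s 0) (\<lambda>n. s (Suc n)))" shows "dfp (\<lambda>s. \<forall>x\<in>elts (t s). Q x s)"
  using dfp_not[OF dfp_bex[OF assms(1) dfp_not[OF assms(2)]]] by simp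

lemma dfp_subset [df]: "dff t \<Longrightarrow> dff u \<Longrightarrow> dfp (\<lambda>s. elts (t s) \<subseteq> elts (u s))"
  unfolding subset_eq by (intro df dff_shift)

text \<open>By extensionality a function is definable as soon as membership in its values is; set
  operations then need no formula for their graph.\<close>

lemma dff_elts:
  assumes "\<And>s. range s \<subseteq> V \<Longrightarrow> t s \<in> V" "dfp (\<lambda>s. s 0 \<in> elts (t (\<lambda>n. s (Suc n))))"
  shows "dff t"
proof -
  have "dfp (\<lambda>s. \<forall>x\<in>V. x \<in> elts (s 0) \<longleftrightarrow> x \<in> elts (t (\<lambda>n. s (Suc n))))"
  proof (intro dfp_all dfp_iff dfp_mem_var)
    have "inj (\<lambda>i::nat. case i of 0 \<Rightarrow> 0 | Suc n \<Rightarrow> Suc (Suc n))"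
      by (auto simp: inj_def split: nat.splits)
    from dfp_shift[OF assms(2) this] show "dfp (\<lambda>s. s 0 \<in> elts (t (\<lambda>n. (\<lambda>n. s (Suc n)) (Suc n))))"
      by simp
  qed
  then have "dfp (\<lambda>s. s 0 = t (\<lambda>n. s (Suc n)))"
  proof (rule dfp_cong)
    fix s :: "nat \<Rightarrow> 'a" assume s: "range s \<subseteq> V"
    then have "s 0 \<in> V" "t (\<lambda>n. s (Suc n)) \<in> V" using assms(1)[of "\<lambda>n. s (Suc n)"] by auto
    then show "(\<forall>x\<in>V. (x \<in> elts (s 0)) = (x \<in> elts (t (\<lambda>n. s (Suc n))))) = (s 0 = t (\<lambda>n. s (Suc n)))"
      using V_trans by (auto intro!: elts_extensionality)
  qed
  then show ?thesis using assms(1) by (simp add: dff_def)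
qed

lemma dff_pair [df]: "dff t \<Longrightarrow> dff u \<Longrightarrow> dff (\<lambda>s. vset {t s, u s})"
  by (rule dff_elts) (auto intro!: df dff_shift V_pair simp: dff_V)

lemma dff_single [df]: "dff t \<Longrightarrow> dff (\<lambda>s. vset {t s})"
  using dff_pair[of t t] by simp

lemma dff_opair [df]: "dff t \<Longrightarrow> dff u \<Longrightarrow> dff (\<lambda>s. opair (t s) (u s))"
  unfolding opair_def by (intro df)

lemma dff_Un [df]: "dff t \<Longrightarrow> dff u \<Longrightarrow> dff (\<lambda>s. vset (elts (t s) \<union> elts (u s)))"
  by (rule dff_elts) (auto intro!: df dff_shift V_Un simp: dff_V)

lemma dff_insert [df]: "dff t \<Longrightarrow> dff u \<Longrightarrow> dff (\<lambda>s. vset (insert (t s) (elts (u s))))"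
  by (rule dff_elts) (auto intro!: df dff_shift V_insert simp: dff_V)

lemma dff_sucO [df]: "dff t \<Longrightarrow> dff (\<lambda>s. sucO (t s))"
  unfolding sucO_def by (intro df)

lemma dff_Union [df]: "dff t \<Longrightarrow> dff (\<lambda>s. vset (\<Union> (elts ` elts (t s))))"
  by (rule dff_elts) (auto intro!: df dff_shift V_Union simp: dff_V)

lemma dff_pow [df]: "dff t \<Longrightarrow> dff (\<lambda>s. powV (t s))"
proof (rule dff_elts)
  assume t: "dff t"
  show "dfp (\<lambda>s. s 0 \<in> elts (powV (t (\<lambda>n. s (Suc n)))))"
    using dfp_subset[OF dff_var[of 0] dff_shift[OF t]]
    by (rule dfp_cong) (use dff_V[OF dff_shift[OF t]] in \<open>auto simp: powV(2)\<close>)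
qed (simp add: powV dff_V)

lemma dfp_Ord [df]: "dff t \<Longrightarrow> dfp (\<lambda>s. Ord (t s))"
  unfolding Ord_def by (intro df dff_shift)

lemma separation:
  assumes "x \<in> V" "dfp (\<lambda>s. Q (s 0))"
  shows "vset {y \<in> elts x. Q y} \<in> V"
proof -
  obtain \<phi> c where c: "range c \<subseteq> V" "\<And>s. range s \<subseteq> V \<Longrightarrow> Q (s 0) = sat V (mix s c) \<phi>"
    using assms(2) unfolding dfp_def by blast
  let ?s = "mix (\<lambda>_. x) c"
  have sep: "\<forall>\<phi> s. \<forall>x\<in>V. range s \<subseteq> V \<longrightarrow> (\<exists>z\<in>V. elts z = {y \<in> elts x. sat V (s(0 := y)) \<phi>})"
    using zfc unfolding zfc_model_def by (elim conjE) assumption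
  have "range ?s \<subseteq> V" using c(1) assms(1) by (auto simp: mix_def)
  then obtain z where z: "z \<in> V" "elts z = {y \<in> elts x. sat V (?s(0 := y)) \<phi>}"
    using sep assms(1) by blast
  have "Q y = sat V (?s(0 := y)) \<phi>" if "y \<in> elts x" for y
  proof -
    have "?s(0 := y) = mix ((\<lambda>_. x)(0 := y)) c" by (auto simp: mix_def fun_eq_iff elim!: evenE)
    then show ?thesis
      using c(2)[of "(\<lambda>_. x)(0 := y)"] assms(1) V_trans[OF assms(1) that] by auto
  qed
  then have "elts z = {y \<in> elts x. Q y}" using z(2) by auto
  then show ?thesis using z(1) vset_eqI by metis
qed

lemma replacement:
  assumes "x \<in> V" "dfp (\<lambda>s. s 1 = h (s 0))" "\<And>y. y \<in> elts x \<Longrightarrow> h y \<in> V"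
  shows "vset (h ` elts x) \<in> V"
proof -
  obtain \<phi> c where c: "range c \<subseteq> V" "\<And>s. range s \<subseteq> V \<Longrightarrow> (s 1 = h (s 0)) = sat V (mix s c) \<phi>"
    using assms(2) unfolding dfp_def by blast
  \<comment> \<open>The scheme reserves the positions 0 and 1 for argument and value, whereas
    \<open>mix\<close> has the second variable at position 2 and a parameter at position 1.\<close>
  let ?f = "\<lambda>n::nat. if n = 2 then 1 else if n = 0 then 0 else n + 2"
  have f: "inj ?f" by (auto simp: inj_def)
  let ?s = "\<lambda>n. if n < 3 then x else mix (\<lambda>_. x) c (n - 2)"
  have rep: "\<forall>\<phi> s. \<forall>x\<in>V. range s \<subseteq> V \<longrightarrow>
        (\<forall>y\<in>elts x. \<exists>!w. w \<in> V \<and> sat V (s(0 := y, 1 := w)) \<phi>) \<longrightarrow>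
        (\<exists>z\<in>V. elts z = {w \<in> V. \<exists>y\<in>elts x. sat V (s(0 := y, 1 := w)) \<phi>})"
    using zfc unfolding zfc_model_def by (elim conjE) assumption
  have s: "range ?s \<subseteq> V" using c(1) assms(1) by (auto simp: mix_def)
  have eq: "sat V (?s(0 := y, 1 := w)) (rn ?f \<phi>) \<longleftrightarrow> w = h y" if "y \<in> elts x" "w \<in> V" for y w
  proof -
    have "(?s(0 := y, 1 := w)) \<circ> ?f = mix ((\<lambda>_. x)(0 := y, 1 := w)) c"
      by (auto simp: mix_def fun_eq_iff)
    then show ?thesis
      using c(2)[of "(\<lambda>_. x)(0 := y, 1 := w)"] assms(1) V_trans[OF assms(1) that(1)] that(2)
      by (auto simp: sat_rn[OF f])
  qed
  have ex1: "\<forall>y\<in>elts x. \<exists>!w. w \<in> V \<and> sat V (?s(0 := y, 1 := w)) (rn ?f \<phi>)"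
  proof
    fix y assume y: "y \<in> elts x"
    show "\<exists>!w. w \<in> V \<and> sat V (?s(0 := y, 1 := w)) (rn ?f \<phi>)"
      by (rule ex1I[of _ "h y"]) (use eq[OF y] assms(3)[OF y] in blast)+
  qed
  have "\<exists>z\<in>V. elts z = {w \<in> V. \<exists>y\<in>elts x. sat V (?s(0 := y, 1 := w)) (rn ?f \<phi>)}"
    by (rule rep[rule_format, OF assms(1) s, rule_format, OF ex1[rule_format]])
  then obtain z where z: "z \<in> V" "elts z = {w \<in> V. \<exists>y\<in>elts x. sat V (?s(0 := y, 1 := w)) (rn ?f \<phi>)}"
    by blast
  have "elts z = h ` elts x" unfolding z(2) using eq assms(3) by auto
  then show ?thesis using z(1) vset_eqI by metis
qed

lemma V_empty: "vset {} \<in> V"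
proof -
  obtain v where "v \<in> V" using V_ex by blast
  from separation[OF this dfp_bool[of False]] show ?thesis by simp
qed

lemma V_Int: "x \<in> V \<Longrightarrow> y \<in> V \<Longrightarrow> vset (elts x \<inter> elts y) \<in> V"
  using separation[of x "\<lambda>u. u \<in> elts y"] by (simp add: df Int_def)

lemma V_Diff: "x \<in> V \<Longrightarrow> y \<in> V \<Longrightarrow> vset (elts x - elts y) \<in> V"
  using separation[of x "\<lambda>u. u \<notin> elts y"] by (simp add: df set_diff_eq)

lemma dff_Int [df]: "dff t \<Longrightarrow> dff u \<Longrightarrow> dff (\<lambda>s. vset (elts (t s) \<inter> elts (u s)))"
  by (rule dff_elts) (auto intro!: df dff_shift V_Int simp: dff_V)

lemma dff_Diff [df]: "dff t \<Longrightarrow> dff u \<Longrightarrow> dff (\<lambda>s. vset (elts (t s) - elts (u s)))"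
  by (rule dff_elts) (auto intro!: df dff_shift V_Diff simp: dff_V)

end

section \<open>Least witnesses, choice and recursion inside V\<close>

definition least_in :: "'a::set_universe \<Rightarrow> ('a \<Rightarrow> bool) \<Rightarrow> 'a" where
  "least_in d P = (if \<exists>y\<in>elts d. P y then (SOME y. y \<in> elts d \<and> P y \<and> (\<forall>z\<in>elts y. \<not> P z)) else vset {})"

lemma least_in:
  assumes "Ord d" "y \<in> elts d" "P y"
  shows "least_in d P \<in> elts d" "P (least_in d P)" "z \<in> elts (least_in d P) \<Longrightarrow> \<not> P z"
proof -
  have ex: "\<exists>y. y \<in> elts d \<and> P y \<and> (\<forall>z\<in>elts y. \<not> P z)"
    by (rule Ord_least[of d y P, OF assms]) blast
  have eq: "least_in d P = (SOME y. y \<in> elts d \<and> P y \<and> (\<forall>z\<in>elts y. \<not> P z))"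
    unfolding least_in_def by (rule if_P) (use assms(2,3) in blast)
  have "least_in d P \<in> elts d \<and> P (least_in d P) \<and> (\<forall>z\<in>elts (least_in d P). \<not> P z)"
    unfolding eq using someI_ex[OF ex] .
  then show "least_in d P \<in> elts d" "P (least_in d P)" "z \<in> elts (least_in d P) \<Longrightarrow> \<not> P z"
    by blast+
qed

lemma least_in_eq:
  assumes "Ord d" "y \<in> elts d" "P y" "\<forall>z\<in>elts y. \<not> P z"
  shows "least_in d P = y"
  using least_in[of d y P] assms Ord_linear Ord_in_Ord by metis

definition bigU :: "'a \<Rightarrow> 'a::set_universe" where
  "bigU x = vset (\<Union> (elts ` elts x))"

lemma elts_bigU: "elts (bigU x) = \<Union> (elts ` elts x)"
  by (simp add: bigU_def)

lemma opair_bigU: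
  assumes "opair u w \<in> elts g" shows "u \<in> elts (bigU (bigU g))" "w \<in> elts (bigU (bigU g))"
proof -
  have "vset {u, w} \<in> elts (bigU g)"
    using assms elts_opair[of u w] unfolding elts_bigU by blast
  then show "u \<in> elts (bigU (bigU g))" "w \<in> elts (bigU (bigU g))"
    using elts_vset_pair[of u w] elts_bigU[of "bigU g"] by blast+
qed

text \<open>\<open>H\<close> sees the set of the earlier values, not the function. This suffices for
  transitive closures, ranks, lists and check names, and keeps the approximations in V
  simple.\<close>

definition recF :: "('a \<Rightarrow> 'a \<Rightarrow> 'a) \<Rightarrow> 'a::set_universe \<Rightarrow> 'a" where
  "recF H = wfrec {(x, y). x \<in> elts y} (\<lambda>f x. H x (vset (f ` elts x)))"

lemma recF: "recF H x = H x (vset (recF H ` elts x))"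
proof -
  have "cut (recF H) {(x, y). x \<in> elts y} x ` elts x = recF H ` elts x"
    by (auto simp: cut_def)
  then show ?thesis
    unfolding recF_def by (subst wfrec[OF wf_elts]) simp
qed

definition prodV :: "'a \<Rightarrow> 'a \<Rightarrow> 'a::set_universe" where
  "prodV x y = vset (\<Union>u\<in>elts x. opair u ` elts y)"

lemma elts_prodV: "elts (prodV x y) = {opair u w | u w. u \<in> elts x \<and> w \<in> elts y}"
  unfolding prodV_def by (subst elts_vset_small) (auto intro!: small_UN small_image)

context zfc begin

lemma V_bigU: "x \<in> V \<Longrightarrow> bigU x \<in> V"
  by (simp add: bigU_def V_Union)

lemma dff_bigU [df]: "dff t \<Longrightarrow> dff (\<lambda>s. bigU (t s))"
  unfolding bigU_def by (intro df)

text \<open>The variables from k on become parameters. Separation and replacement take predicates of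
  one or two variables; a definition made under quantifiers is applied after the rest of the
  assignment has been frozen.\<close>

lemma dfp_fix:
  assumes "dfp P" "range r \<subseteq> V" shows "dfp (\<lambda>s. P (\<lambda>n. if n < k then s n else r n))"
proof -
  obtain \<phi> c where p: "range c \<subseteq> V" "\<And>s. range s \<subseteq> V \<Longrightarrow> P s = sat V (mix s c) \<phi>"
    using assms unfolding dfp_def by blast
  let ?f = "\<lambda>n::nat. if even n \<and> n < 2 * k then n else 2 * n + 1"
  have f: "inj ?f"
    unfolding inj_def by (auto split: if_splits)
  let ?c = "\<lambda>n. if even n then r (n div 2) else c (n div 2)"
  have "mix s (mix r c) (?f n) = mix (\<lambda>n. if n < k then s n else r n) c n" for s n
    by (cases "even n") (auto simp: mix_def elim!: evenE oddE)
  then have *: "mix s (mix r c) \<circ> ?f = mix (\<lambda>n. if n < k then s n else r n) c" for s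
    by (simp only: fun_eq_iff o_apply) blast
  have "P (\<lambda>n. if n < k then s n else r n) = sat V (mix s (mix r c)) (rn ?f \<phi>)" if "range s \<subseteq> V" for s
  proof -
    have "range (\<lambda>n. if n < k then s n else r n) \<subseteq> V" using that assms(2) by auto
    then show ?thesis using p(2) by (simp add: sat_rn[OF f] *)
  qed
  moreover have "range (mix r c) \<subseteq> V" using assms(2) p(1) by (auto simp: mix_def)
  ultimately show ?thesis unfolding dfp_def by blast
qed

lemma dfp_fix1:
  assumes "dfp (\<lambda>s. Q (s 0) (\<lambda>n. s (Suc n)))" "range r \<subseteq> V" shows "dfp (\<lambda>s. Q (s 0) r)"
proof -
  obtain v where v: "v \<in> V" using V_ex by blast
  have "dfp (\<lambda>s. Q (if 0 < (1::nat) then s 0 else case_nat v r 0)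
     (\<lambda>n. if Suc n < 1 then s (Suc n) else case_nat v r (Suc n)))"
    using dfp_fix[OF assms(1) range_case_nat[OF v assms(2)], of 1] by simp
  then show ?thesis by simp
qed

lemma dfp_fix2:
  assumes "dfp (\<lambda>s. Q (s 0) (s 1) (\<lambda>n. s (Suc (Suc n))))" "range r \<subseteq> V" shows "dfp (\<lambda>s. Q (s 0) (s 1) r)"
proof -
  obtain v where v: "v \<in> V" using V_ex by blast
  have "dfp (\<lambda>s. Q (if 0 < (2::nat) then s 0 else v) (if 1 < (2::nat) then s 1 else v)
     (\<lambda>n. if Suc (Suc n) < 2 then s (Suc (Suc n)) else case_nat v (case_nat v r) (Suc (Suc n))))"
    using dfp_fix[OF assms(1) range_case_nat[OF v range_case_nat[OF v assms(2)]], of 2] by simp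
  then show ?thesis by simp
qed

lemma separation_env:
  assumes "x \<in> V" "dfp (\<lambda>s. Q (s 0) (\<lambda>n. s (Suc n)))" "range r \<subseteq> V"
  shows "vset {y \<in> elts x. Q y r} \<in> V"
  using separation[OF assms(1) dfp_fix1[OF assms(2,3)]] .

lemma replacement_env:
  assumes "x \<in> V" "dff (\<lambda>s. h (s 0) (\<lambda>n. s (Suc n)))" "range r \<subseteq> V"
  shows "vset ((\<lambda>y. h y r) ` elts x) \<in> V"
proof (rule replacement[OF assms(1)])
  have "dfp (\<lambda>s. s 0 = h (s 1) (\<lambda>n. s (Suc (Suc n))))"
    using assms(2) by (simp add: dff_def)
  then have "dfp (\<lambda>s. s 1 = h (s 0) (\<lambda>n. s (Suc (Suc n))))"
    using dfp_shift[of "\<lambda>s. s 0 = h (s 1) (\<lambda>n. s (Suc (Suc n)))" "\<lambda>i. if i = 0 then 1 else if i = 1 then 0 else i"]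
    by (simp add: inj_def)
  then show "dfp (\<lambda>s. s 1 = h (s 0) r)"
    using dfp_fix2[of "\<lambda>x y r. y = h x r"] assms(3) by blast
  show "h y r \<in> V" if "y \<in> elts x" for y
  proof -
    have "y \<in> V" using V_trans[OF assms(1) that] .
    then show ?thesis
      using dff_V[OF assms(2) range_case_nat[OF _ assms(3)], of y] by simp
  qed
qed

lemma dff_Collect [df]:
  assumes "dff t" "dfp (\<lambda>s. Q (s 0) (\<lambda>n. s (Suc n)))"
  shows "dff (\<lambda>s. vset {x \<in> elts (t s). Q x s})"
proof (rule dff_elts)
  show "vset {x \<in> elts (t s). Q x s} \<in> V" if "range s \<subseteq> V" for s
    using separation_env[OF dff_V[OF assms(1) that] assms(2) that] .
  have "dfp (\<lambda>s. s 0 \<in> elts (t (\<lambda>n. s (Suc n))) \<and> Q (s 0) (\<lambda>n. s (Suc n)))"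
    using assms by (intro df dff_shift)
  then show "dfp (\<lambda>s. s 0 \<in> elts (vset {x \<in> elts (t (\<lambda>n. s (Suc n))). Q x (\<lambda>n. s (Suc n))}))"
    by simp
qed

lemma dff_image [df]:
  assumes "dff t" "dff (\<lambda>s. h (s 0) (\<lambda>n. s (Suc n)))"
  shows "dff (\<lambda>s. vset ((\<lambda>x. h x s) ` elts (t s)))"
proof (rule dff_elts)
  show "vset ((\<lambda>x. h x s) ` elts (t s)) \<in> V" if "range s \<subseteq> V" for s
    using replacement_env[OF dff_V[OF assms(1) that] assms(2) that] .
  have "dfp (\<lambda>s. s 0 = h (s (Suc 0)) (\<lambda>n. s (Suc (Suc n))))"
    using assms(2) by (simp add: dff_def)
  then have "dfp (\<lambda>s. s 1 = h (s 0) (\<lambda>n. s (Suc (Suc n))))"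
    using dfp_shift[of "\<lambda>s. s 0 = h (s (Suc 0)) (\<lambda>n. s (Suc (Suc n)))"
        "\<lambda>i. if i = 0 then 1 else if i = 1 then 0 else i"]
    by (simp add: inj_def)
  then have "dfp (\<lambda>s. \<exists>x\<in>elts (t (\<lambda>n. s (Suc n))). s 0 = h x (\<lambda>n. s (Suc n)))"
    by (intro dfp_bex dff_shift assms(1)) simp
  moreover have "(\<exists>x\<in>elts (t (\<lambda>n. s (Suc n))). s 0 = h x (\<lambda>n. s (Suc n))) \<longleftrightarrow>
     s 0 \<in> elts (vset ((\<lambda>x. h x (\<lambda>n. s (Suc n))) ` elts (t (\<lambda>n. s (Suc n)))))" for s
    by auto
  ultimately show "dfp (\<lambda>s. s 0 \<in> elts (vset ((\<lambda>x. h x (\<lambda>n. s (Suc n))) ` elts (t (\<lambda>n. s (Suc n))))))"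
    by simp
qed

definition dfn :: "('a \<Rightarrow> 'a) \<Rightarrow> bool" where
  "dfn h \<longleftrightarrow> dff (\<lambda>s. h (s 0))"

lemma dfnD: "dfn h \<Longrightarrow> dff t \<Longrightarrow> dff (\<lambda>s. h (t s))"
  by (rule dff1I) (auto simp: dfn_def dff_def dest: spec[of _ "\<lambda>_. x" for x])

lemma dfn_V: "dfn h \<Longrightarrow> x \<in> V \<Longrightarrow> h x \<in> V"
  unfolding dfn_def using dff_V[of "\<lambda>s. h (s 0)" "\<lambda>_. x"] by auto

lemma dfn_graph:
  assumes "\<And>x. x \<in> V \<Longrightarrow> h x \<in> V" "dfp (\<lambda>s. R (s 0) (s 1))" "\<And>x y. x \<in> V \<Longrightarrow> y \<in> V \<Longrightarrow> R x y \<longleftrightarrow> y = h x"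
  shows "dfn h"
proof -
  have "dfp (\<lambda>s. R (s 1) (s 0))"
    by (rule dfp2I[OF assms(2)]) (intro df)+
  then have "dfp (\<lambda>s. s 0 = h (s 1))"
    by (rule dfp_cong) (use assms(3) in \<open>auto simp: image_subset_iff\<close>)
  then show ?thesis
    using assms(1) by (auto simp: dfn_def dff_def image_subset_iff)
qed

lemma replacement_fn: "dfn h \<Longrightarrow> x \<in> V \<Longrightarrow> vset (h ` elts x) \<in> V"
  using dff_V[OF dff_image[of "\<lambda>s. s 0" "\<lambda>x s. h x"], of "\<lambda>_. x"] dfn_def df by auto

lemma dff_prodV [df]:
  assumes "dff t" "dff u" shows "dff (\<lambda>s. prodV (t s) (u s))"
proof -
  have "dff (\<lambda>s. vset (\<Union> (elts ` elts (vset ((\<lambda>a. vset ((\<lambda>b. opair a b) ` elts (u s))) ` elts (t s))))))"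
    using assms by (intro df dff_shift)
  moreover have "vset (\<Union> (elts ` elts (vset ((\<lambda>a. vset ((\<lambda>b. opair a b) ` elts y)) ` elts x)))) = prodV x y"
    for x y :: 'a
    unfolding prodV_def by (simp del: elts_vset_Union)
  ultimately show ?thesis by simp
qed

lemma V_prodV: "x \<in> V \<Longrightarrow> y \<in> V \<Longrightarrow> prodV x y \<in> V"
  using dff_V[OF dff_prodV[of "\<lambda>_. x" "\<lambda>_. y"], of "\<lambda>_. x"] by (auto intro: df)

lemma V_Collect: "x \<in> V \<Longrightarrow> dfp (\<lambda>s. Q (s 0)) \<Longrightarrow> vset {y \<in> elts x. Q y} \<in> V"
  by (rule separation)

text \<open>The axiom of choice yields uniformizing functions that are sets, hence definable.\<close>

lemma choice_fun:
  assumes X: "X \<in> V" and Y: "Y \<in> V" and d: "dfp (\<lambda>s. Q (s 0) (s 1))"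
    and ex: "\<And>u. u \<in> elts X \<Longrightarrow> \<exists>w\<in>elts Y. Q u w"
  obtains h where "dfn h" "\<And>u. u \<in> elts X \<Longrightarrow> h u \<in> elts Y \<and> Q u (h u)"
proof -
  \<comment> \<open>Tagging each value with its argument makes the sets \<open>?S u\<close> pairwise
    disjoint, as the transversal form of the axiom of choice demands.\<close>
  let ?S = "\<lambda>u. vset {z \<in> elts (prodV (vset {u}) Y). \<exists>w\<in>elts Y. z = opair u w \<and> Q u w}"
  let ?F = "vset (?S ` elts X)"
  have "dff (\<lambda>s. vset (?S ` elts X))"
    by (intro df X Y dfp2I[OF d])
  then have F: "?F \<in> V"
    using dff_V[of "\<lambda>s. vset (?S ` elts X)" "\<lambda>_. X"] X by auto
  have S: "elts (?S u) = {opair u w | w. w \<in> elts Y \<and> Q u w}" for u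
    unfolding elts_vset_Collect by (auto simp: elts_prodV)
  have ch: "\<forall>x\<in>V. (\<forall>y\<in>elts x. elts y \<noteq> {}) \<and>
        (\<forall>y\<in>elts x. \<forall>z\<in>elts x. y \<noteq> z \<longrightarrow> elts y \<inter> elts z = {}) \<longrightarrow>
        (\<exists>c\<in>V. \<forall>y\<in>elts x. \<exists>w. elts c \<inter> elts y = {w})"
    using zfc unfolding zfc_model_def by (elim conjE) assumption
  have disj: "(\<forall>y\<in>elts ?F. elts y \<noteq> {}) \<and> (\<forall>y\<in>elts ?F. \<forall>z\<in>elts ?F. y \<noteq> z \<longrightarrow> elts y \<inter> elts z = {})"
    using ex unfolding elts_vset_image ball_simps S by fastforce
  obtain c where c: "c \<in> V" "\<forall>y\<in>elts ?F. \<exists>w. elts c \<inter> elts y = {w}"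
    using mp[OF bspec[OF ch F] disj] by (elim bexE)
  have ex1: "\<exists>!w. w \<in> elts Y \<and> Q u w \<and> opair u w \<in> elts c" if "u \<in> elts X" for u
  proof -
    have "?S u \<in> elts ?F" using that by simp
    then obtain z where z: "elts c \<inter> elts (?S u) = {z}" using c(2) by blast
    then have "z \<in> elts (?S u)" "z \<in> elts c" by blast+
    then obtain w where w: "z = opair u w" "w \<in> elts Y" "Q u w" unfolding S by blast
    moreover have "w' = w" if "w' \<in> elts Y \<and> Q u w' \<and> opair u w' \<in> elts c" for w'
    proof -
      have "opair u w' \<in> elts c \<inter> elts (?S u)" using that unfolding S by blast
      then show ?thesis unfolding z w(1) by simp
    qed
    ultimately show ?thesis using \<open>z \<in> elts c\<close> by blast
  qed
  define h where "h u = (if u \<in> elts X then THE w. w \<in> elts Y \<and> Q u w \<and> opair u w \<in> elts c else vset {})" for u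
  have h: "h u \<in> elts Y \<and> Q u (h u) \<and> opair u (h u) \<in> elts c" if "u \<in> elts X" for u
    using theI'[OF ex1[OF that]] that by (simp add: h_def)
  have "dfn h"
  proof (rule dfn_graph)
    show "h x \<in> V" if "x \<in> V" for x
      using h[of x] V_trans[OF Y] V_empty by (cases "x \<in> elts X") (auto simp: h_def)
    show "dfp (\<lambda>s. (s 0 \<in> elts X \<and> s 1 \<in> elts Y \<and> Q (s 0) (s 1) \<and> opair (s 0) (s 1) \<in> elts c)
       \<or> (s 0 \<notin> elts X \<and> s 1 = vset {}))"
      by (intro df X Y c(1) d V_empty)
    show "(x \<in> elts X \<and> y \<in> elts Y \<and> Q x y \<and> opair x y \<in> elts c) \<or> x \<notin> elts X \<and> y = vset {} \<longleftrightarrow> y = h x" for x y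
      using h[of x] ex1[of x] by (cases "x \<in> elts X") (auto simp: h_def)
  qed
  then show thesis using that h by blast
qed

definition lamV :: "'a \<Rightarrow> ('a \<Rightarrow> 'a) \<Rightarrow> 'a" where
  "lamV x h = vset ((\<lambda>u. opair u (h u)) ` elts x)"

lemma elts_lamV: "elts (lamV x h) = {opair u (h u) | u. u \<in> elts x}"
  by (auto simp: lamV_def)

lemma V_lamV: "dfn h \<Longrightarrow> x \<in> V \<Longrightarrow> lamV x h \<in> V"
  unfolding lamV_def
  by (rule replacement_fn) (auto simp: dfn_def intro!: df)

lemma is_fun_lamV: "is_fun (lamV x h) x"
  by (auto simp: is_fun_def elts_lamV)

lemma app_lamV [simp]: "u \<in> elts x \<Longrightarrow> app (lamV x h) u = h u"
  by (auto simp: app_def elts_lamV)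

lemma app_eqI: "is_fun f x \<Longrightarrow> u \<in> elts x \<Longrightarrow> opair u w \<in> elts f \<Longrightarrow> app f u = w"
  unfolding is_fun_def app_def by (metis (no_types, lifting) the1_equality)

lemma opair_app: "is_fun f x \<Longrightarrow> u \<in> elts x \<Longrightarrow> opair u (app f u) \<in> elts f"
  unfolding is_fun_def app_def by (metis (no_types, lifting) theI')

lemma V_app: "f \<in> V \<Longrightarrow> is_fun f x \<Longrightarrow> u \<in> elts x \<Longrightarrow> app f u \<in> V"
  using opair_app V_trans V_opairD by metis

lemma fun_dfn:
  assumes "f \<in> V" "is_fun f x" "x \<in> V"
  obtains h where "dfn h" "\<And>u. u \<in> elts x \<Longrightarrow> h u = app f u"
proof -
  let ?h = "\<lambda>u. if u \<in> elts x then app f u else vset {}"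
  have "dfn ?h"
  proof (rule dfn_graph)
    show "?h u \<in> V" for u using assms V_app V_empty by auto
    show "dfp (\<lambda>s. (s 0 \<in> elts x \<and> opair (s 0) (s 1) \<in> elts f) \<or> (s 0 \<notin> elts x \<and> s 1 = vset {}))"
      by (intro df assms V_empty)
    show "(u \<in> elts x \<and> opair u y \<in> elts f) \<or> (u \<notin> elts x \<and> y = vset {}) \<longleftrightarrow> y = ?h u" for u y
      using opair_app[OF assms(2)] app_eqI[OF assms(2)] by (cases "u \<in> elts x") auto
  qed
  then show thesis using that by fastforce
qed

lemma dff_least_in [df]:
  assumes "d \<in> V" "Ord d" "dfp (\<lambda>s. Q (s 0) (\<lambda>n. s (Suc n)))"
  shows "dff (\<lambda>s. least_in d (\<lambda>y. Q y s))"
proof -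
  let ?R = "\<lambda>y s. (y \<in> elts d \<and> Q y s \<and> (\<forall>z\<in>elts y. \<not> Q z s)) \<or> (y = vset {} \<and> (\<forall>z\<in>elts d. \<not> Q z s))"
  have eq: "?R y s \<longleftrightarrow> y = least_in d (\<lambda>y. Q y s)" for y s
  proof (cases "\<exists>y\<in>elts d. Q y s")
    case True
    then obtain y0 where "y0 \<in> elts d" "Q y0 s" by blast
    from least_in[OF assms(2), of y0 "\<lambda>y. Q y s", OF this] True
    show ?thesis using least_in_eq[OF assms(2), of y "\<lambda>y. Q y s"] by blast
  next
    case False
    then have "least_in d (\<lambda>y. Q y s) = vset {}" by (simp add: least_in_def)
    with False show ?thesis by auto
  qed
  have "dfp (\<lambda>s. Q (s 0) (\<lambda>n. s (Suc (Suc n))))"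
    using dfp_shift[OF assms(3), of "\<lambda>n. case n of 0 \<Rightarrow> 0 | Suc n \<Rightarrow> Suc (Suc n)"]
    by (auto simp: inj_def split: nat.splits)
  then have "dfp (\<lambda>s. ?R (s 0) (\<lambda>n. s (Suc n)))"
    using assms by (intro df V_empty)
  then have "dfp (\<lambda>s. s 0 = least_in d (\<lambda>y. Q y (\<lambda>n. s (Suc n))))"
    unfolding eq .
  moreover have "least_in d (\<lambda>y. Q y s) \<in> V" for s
    using eq[of "least_in d (\<lambda>y. Q y s)" s] V_trans[OF assms(1)] V_empty by metis
  ultimately show ?thesis by (simp add: dff_def)
qed

text \<open>Definable recursion along the membership relation: \<^term>\<open>att\<close> describes the set-sized approximations.\<close>

context
  fixes H :: "'a \<Rightarrow> 'a \<Rightarrow> 'a"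
  assumes H: "dff (\<lambda>s. H (s 0) (s 1))"
begin

definition att :: "'a \<Rightarrow> bool" where
  "att g \<longleftrightarrow> (\<forall>z\<in>elts g. \<exists>u\<in>V. \<exists>w\<in>V. z = opair u w) \<and>
     (\<forall>u\<in>V. \<forall>w\<in>V. opair u w \<in> elts g \<longrightarrow> (\<exists>m\<in>V.
        (\<forall>u'\<in>elts u. \<exists>w'\<in>elts m. opair u' w' \<in> elts g) \<and>
        (\<forall>w'\<in>elts m. \<exists>u'\<in>elts u. opair u' w' \<in> elts g) \<and> w = H u m))"

lemma H_V: "x \<in> V \<Longrightarrow> y \<in> V \<Longrightarrow> H x y \<in> V"
  using dff_V[OF H, of "\<lambda>n. if n = 0 then x else y"] by auto

lemma dff_H: "dff t \<Longrightarrow> dff u \<Longrightarrow> dff (\<lambda>s. H (t s) (u s))"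
proof (rule dff2I[of H])
  show "dfp (\<lambda>s. s 0 = H (s 1) (s 2))"
    using H unfolding dff_def by (simp add: numeral_2_eq_2)
qed (auto simp: H_V)

lemma dfp_att: "dff t \<Longrightarrow> dfp (\<lambda>s. att (t s))"
  unfolding att_def by (intro df dff_H dff_shift)

lemma att_unique:
  assumes "att g" "g \<in> V" "opair u w \<in> elts g" shows "w = recF H u"
  using assms(3)
proof (induction u arbitrary: w rule: elts_induct)
  case (step u)
  have V: "u \<in> V" "w \<in> V" using V_trans[OF assms(2) step(2)] V_opairD by blast+
  then obtain m where m: "m \<in> V" "\<forall>u'\<in>elts u. \<exists>w'\<in>elts m. opair u' w' \<in> elts g"
       "\<forall>w'\<in>elts m. \<exists>u'\<in>elts u. opair u' w' \<in> elts g" "w = H u m"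
    using assms(1) step(2) unfolding att_def by blast
  have "elts m = recF H ` elts u"
    using m(2,3) step(1) by (auto simp: image_iff) metis+
  then have "m = vset (recF H ` elts u)" using vset_eqI by metis
  then show ?case using m(4) recF by metis
qed

lemma att_Int: "att g \<Longrightarrow> att g' \<Longrightarrow> g \<in> V \<Longrightarrow> g' \<in> V \<Longrightarrow> opair u w \<in> elts g \<inter> elts g' \<Longrightarrow>
  (\<forall>u'\<in>elts u. opair u' (recF H u') \<in> elts g \<inter> elts g')"
proof
  fix u' assume a: "att g" "att g'" "g \<in> V" "g' \<in> V" "opair u w \<in> elts g \<inter> elts g'" "u' \<in> elts u"
  have V: "u \<in> V" "w \<in> V" using a V_trans V_opairD by blast+
  have "\<exists>w. opair u' w \<in> elts g" "\<exists>w. opair u' w \<in> elts g'"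
    using a V unfolding att_def by blast+
  then show "opair u' (recF H u') \<in> elts g \<inter> elts g'"
    using att_unique a by blast
qed

lemma att_closed:
  assumes "g \<in> V" "\<And>z. z \<in> elts g \<Longrightarrow> \<exists>u. z = opair u (recF H u)"
    "\<And>u u'. opair u (recF H u) \<in> elts g \<Longrightarrow> u' \<in> elts u \<Longrightarrow> opair u' (recF H u') \<in> elts g"
  shows "att g"
  unfolding att_def
proof (intro conjI ballI impI)
  show "\<exists>u\<in>V. \<exists>w\<in>V. z = opair u w" if z: "z \<in> elts g" for z
    using assms(2)[OF z] V_trans[OF assms(1) z] V_opairD by blast
next
  fix u w assume V: "u \<in> V" "w \<in> V" and uw: "opair u w \<in> elts g"
  have w: "w = recF H u" using assms(2)[OF uw] by simp
  let ?m = "vset {y \<in> elts (bigU (bigU g)). \<exists>u'\<in>elts u. opair u' y \<in> elts g}"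
  have "?m \<in> V"
    by (intro separation V_bigU assms(1)) (intro df V assms(1))
  moreover have "elts ?m = recF H ` elts u"
  proof -
    have "recF H u' \<in> elts ?m" if "u' \<in> elts u" for u'
    proof -
      have "opair u' (recF H u') \<in> elts g" using assms(3) uw w that by blast
      moreover from this have "recF H u' \<in> elts (bigU (bigU g))" by (rule opair_bigU)
      ultimately show ?thesis using that by auto
    qed
    moreover have "y \<in> recF H ` elts u" if "y \<in> elts ?m" for y
      using that assms(2) by fastforce
    ultimately show ?thesis by blast
  qed
  ultimately obtain m where m: "m \<in> V" "elts m = recF H ` elts u" by blast
  have "w = H u m"
    unfolding w recF[of H u] using vset_eqI[OF m(2)] by simp
  then show "\<exists>m\<in>V. (\<forall>u'\<in>elts u. \<exists>w'\<in>elts m. opair u' w' \<in> elts g) \<and>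
        (\<forall>w'\<in>elts m. \<exists>u'\<in>elts u. opair u' w' \<in> elts g) \<and> w = H u m"
  proof (intro bexI[of _ m] conjI)
    have *: "opair u' (recF H u') \<in> elts g" if "u' \<in> elts u" for u'
      using assms(3)[OF uw[unfolded w] that] .
    show "\<forall>u'\<in>elts u. \<exists>w'\<in>elts m. opair u' w' \<in> elts g" "\<forall>w'\<in>elts m. \<exists>u'\<in>elts u. opair u' w' \<in> elts g"
      unfolding m(2) using * by blast+
  qed (use \<open>w = H u m\<close> m(1) in simp_all)
qed

lemma recF_att: "x \<in> V \<Longrightarrow> \<exists>g\<in>V. att g \<and> opair x (recF H x) \<in> elts g"
proof (induction x rule: elts_induct)
  case (step x)
  \<comment> \<open>Replacement needs one definite approximation for each \<open>y\<close>. The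
    intersection of all those defined at \<open>y\<close> is again one, and being least it is
    unique.\<close>
  let ?least = "\<lambda>y M. att M \<and> (\<exists>w\<in>V. opair y w \<in> elts M) \<and>
     (\<forall>g\<in>V. att g \<and> (\<exists>w\<in>V. opair y w \<in> elts g) \<longrightarrow> elts M \<subseteq> elts g)"
  have ex: "\<exists>M. M \<in> V \<and> ?least y M" if y: "y \<in> elts x" for y
  proof -
    obtain g where g: "g \<in> V" "att g" "opair y (recF H y) \<in> elts g"
      using step y V_trans by blast
    let ?M = "vset {z \<in> elts g. \<forall>g\<in>V. att g \<and> (\<exists>w\<in>V. opair y w \<in> elts g) \<longrightarrow> z \<in> elts g}"
    have yV: "y \<in> V" using V_trans[OF step(2) y] .
    have M: "?M \<in> V" by (intro separation g(1)) (intro df dfp_att yV)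
    have yM: "opair y (recF H y) \<in> elts ?M" using g(3) att_unique by auto
    have "att ?M"
    proof (rule att_closed[OF M])
      show "\<exists>u. z = opair u (recF H u)" if "z \<in> elts ?M" for z
      proof -
        have z: "z \<in> elts g" using that by simp
        then obtain u w where "z = opair u w" using g(2) unfolding att_def by blast
        then show ?thesis using att_unique[OF g(2,1)] z by blast
      qed
      fix u u' assume u: "opair u (recF H u) \<in> elts ?M" "u' \<in> elts u"
      then show "opair u' (recF H u') \<in> elts ?M"
        using att_Int[OF g(2) _ g(1)] g by auto
    qed
    moreover have "\<exists>w\<in>V. opair y w \<in> elts ?M"
      using yM V_trans[OF M] V_opairD by blast
    ultimately show ?thesis using M by (intro exI[of _ ?M]) auto
  qed
  define h where "h y = (if y \<in> elts x then (SOME M. M \<in> V \<and> ?least y M) else vset {})" for y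
  have h: "h y \<in> V" "?least y (h y)" if "y \<in> elts x" for y
    using someI_ex[OF ex[OF that]] that by (simp_all add: h_def)
  have "dfn h"
  proof (rule dfn_graph)
    show "h y \<in> V" for y using h(1)[of y] V_empty by (cases "y \<in> elts x") (auto simp: h_def)
    show "dfp (\<lambda>s. (s 0 \<in> elts x \<and> ?least (s 0) (s 1)) \<or> (s 0 \<notin> elts x \<and> s 1 = vset {}))"
      by (intro df dfp_att step(2) V_empty)
    show "(y \<in> elts x \<and> ?least y M) \<or> (y \<notin> elts x \<and> M = vset {}) \<longleftrightarrow> M = h y" if "M \<in> V" for y M
    proof (cases "y \<in> elts x")
      case True
      then show ?thesis using h[OF True] that by (auto intro!: vset_subset_iff)
    qed (simp add: h_def)
  qed
  then have hx: "vset (h ` elts x) \<in> V" using replacement_fn step(2) by blast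
  let ?g = "bigU (vset (h ` elts x))"
  have gV: "?g \<in> V" using hx V_bigU by blast
  have eg: "elts ?g = (\<Union>y\<in>elts x. elts (h y))" by (simp only: elts_bigU elts_vset_image) auto
  have hM: "opair y (recF H y) \<in> elts (h y)" if "y \<in> elts x" for y
    using h[OF that] att_unique by blast
  have zfun: "\<exists>u. z = opair u (recF H u)" if zg: "z \<in> elts ?g" for z
  proof -
    obtain y where y: "y \<in> elts x" "z \<in> elts (h y)" using zg unfolding eg by blast
    then obtain u w where "z = opair u w" using h(2)[OF y(1)] unfolding att_def by blast
    then show ?thesis using att_unique h[OF y(1)] y(2) by blast
  qed
  have clos: "opair u' (recF H u') \<in> elts ?g" if u: "opair u (recF H u) \<in> elts ?g" "u' \<in> elts u" for u u'
  proof -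
    obtain y where y: "y \<in> elts x" "opair u (recF H u) \<in> elts (h y)" using u(1) unfolding eg by blast
    then have "opair u' (recF H u') \<in> elts (h y)"
      using att_Int[of "h y" "h y" u] h[OF y(1)] u(2) by blast
    then show ?thesis using y(1) unfolding eg by blast
  qed
  let ?m = "vset {w \<in> elts (bigU (bigU ?g)). \<exists>y\<in>elts x. opair y w \<in> elts ?g}"
  have mV: "?m \<in> V"
    by (intro separation V_bigU gV) (intro df gV step(2))
  have em: "elts ?m = recF H ` elts x"
  proof -
    have "recF H y \<in> elts ?m" if "y \<in> elts x" for y
    proof -
      have *: "opair y (recF H y) \<in> elts ?g" using hM that unfolding eg by blast
      then have "recF H y \<in> elts (bigU (bigU ?g))"
        by (rule opair_bigU)
      then show ?thesis using that * by (simp only: elts_vset_Collect) blast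
    qed
    moreover have "w \<in> recF H ` elts x" if w: "w \<in> elts ?m" for w
    proof -
      obtain y where "y \<in> elts x" "opair y w \<in> elts ?g" using w unfolding elts_vset_Collect by blast
      then show ?thesis using zfun[of "opair y w"] by auto
    qed
    ultimately show ?thesis by blast
  qed
  have "recF H x = H x ?m" using recF[of H x] unfolding vset_eqI[OF em] .
  with H_V[OF step(2) mV] have rV: "recF H x \<in> V" by (simp only:)
  let ?g' = "vset (insert (opair x (recF H x)) (elts ?g))"
  have g'V: "?g' \<in> V" by (intro V_insert V_opair step(2) rV gV)
  have "att ?g'"
  proof (rule att_closed[OF g'V])
    show "\<exists>u. z = opair u (recF H u)" if "z \<in> elts ?g'" for z
      using that zfun unfolding elts_vset_insert by blast
    show "opair u' (recF H u') \<in> elts ?g'" if u: "opair u (recF H u) \<in> elts ?g'" "u' \<in> elts u" for u u'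
    proof (cases "u = x")
      case True
      then have "opair u' (recF H u') \<in> elts ?g" using hM u(2) unfolding eg by blast
      then show ?thesis unfolding elts_vset_insert by blast
    next
      case False
      then show ?thesis using u clos unfolding elts_vset_insert by simp
    qed
  qed
  then show ?case using g'V by (intro bexI[of _ ?g']) (auto simp only: elts_vset_insert)
qed

lemma dfn_recF: "dfn (recF H)"
proof (rule dfn_graph)
  show "recF H x \<in> V" if "x \<in> V" for x
    using recF_att[OF that] V_trans V_opairD by blast
  show "dfp (\<lambda>s. \<exists>g\<in>V. att g \<and> opair (s 0) (s 1) \<in> elts g)"
    by (intro df dfp_att)
  show "(\<exists>g\<in>V. att g \<and> opair x y \<in> elts g) \<longleftrightarrow> y = recF H x" if "x \<in> V" for x y
    using recF_att[OF that] att_unique by blast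
qed

end

text \<open>Knaster-Tarski in V: the least closed subset of \<open>X\<close> is cut out by
  quantifying over the closed sets of V. It serves for recursions on codes and on names, where the
  fixed point equation alone is used, by induction on the lists or names.\<close>

lemma fixpoint:
  assumes X: "X \<in> V" and d: "dfp (\<lambda>s. Q (s 0) (s 1))"
    and mono: "\<And>z W W'. W \<in> V \<Longrightarrow> W' \<in> V \<Longrightarrow> elts W \<subseteq> elts W' \<Longrightarrow> Q z W \<Longrightarrow> Q z W'"
  obtains Z where "Z \<in> V" "elts Z \<subseteq> elts X" "\<And>z. z \<in> elts X \<Longrightarrow> z \<in> elts Z \<longleftrightarrow> Q z Z"
proof -
  let ?cl = "\<lambda>W. elts W \<subseteq> elts X \<and> (\<forall>z\<in>elts X. Q z W \<longrightarrow> z \<in> elts W)"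
  obtain Z where Z: "Z \<in> V" and eZ: "elts Z = {z \<in> elts X. \<forall>W\<in>V. ?cl W \<longrightarrow> z \<in> elts W}"
  proof
    show "vset {z \<in> elts X. \<forall>W\<in>V. ?cl W \<longrightarrow> z \<in> elts W} \<in> V"
      by (intro separation X) (intro df X dfp2I[OF d])
  qed simp
  have le: "elts Z \<subseteq> elts W" if "W \<in> V" "?cl W" for W using that unfolding eZ by blast
  have cl: "z \<in> elts Z" if z: "z \<in> elts X" "Q z Z" for z
  proof -
    have "z \<in> elts W" if W: "W \<in> V" "?cl W" for W
      using mono[OF Z W(1) le[OF W] z(2)] z(1) W(2) by blast
    then show ?thesis using z(1) unfolding eZ by blast
  qed
  have "Q z Z" if z: "z \<in> elts Z" for z
  proof -
    \<comment> \<open>By monotonicity this subset of \<open>Z\<close> is closed as well, so by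
      leastness it is all of \<open>Z\<close>.\<close>
    obtain W where W: "W \<in> V" and eW: "elts W = {z \<in> elts Z. Q z Z}"
    proof
      show "vset {z \<in> elts Z. Q z Z} \<in> V" by (intro separation Z) (intro dfp2I[OF d] df Z)
    qed simp
    have "z' \<in> elts W" if z': "z' \<in> elts X" "Q z' W" for z'
    proof -
      have "Q z' Z" using mono[OF W Z _ z'(2)] unfolding eW by blast
      then show ?thesis using cl[OF z'(1)] unfolding eW by blast
    qed
    moreover have "elts W \<subseteq> elts X" unfolding eW eZ by blast
    ultimately have "z \<in> elts W" using le[OF W] z by blast
    then show ?thesis unfolding eW by blast
  qed
  moreover have "elts Z \<subseteq> elts X" unfolding eZ by blast
  ultimately show thesis using that[OF Z] cl by blast
qed

end

section \<open>Transitive closure, rank and the natural numbers of V\<close>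

definition trcl :: "'a::set_universe \<Rightarrow> 'a" where
  "trcl = recF (\<lambda>x m. vset (elts x \<union> elts (bigU m)))"

lemma elts_trcl: "elts (trcl x) = elts x \<union> (\<Union>y\<in>elts x. elts (trcl y))"
  unfolding trcl_def by (subst recF, subst elts_vset_Un) (simp only: elts_bigU elts_vset_image image_image)

lemma trcl_trans: "u \<in> elts (trcl x) \<Longrightarrow> elts u \<subseteq> elts (trcl x)"
proof (induction x rule: elts_induct)
  case (step x)
  then consider "u \<in> elts x" | y where "y \<in> elts x" "u \<in> elts (trcl y)"
    using elts_trcl[of x] by blast
  then show ?case
  proof cases
    case 1
    then show ?thesis using elts_trcl[of x] elts_trcl[of u] by blast
  next
    case 2
    then show ?thesis using step(1) elts_trcl[of x] by blast
  qed
qed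

definition rk :: "'a::set_universe \<Rightarrow> 'a" where
  "rk = recF (\<lambda>x m. bigU (vset (sucO ` elts m)))"

lemma elts_rk: "elts (rk x) = (\<Union>y\<in>elts x. insert (rk y) (elts (rk y)))"
  unfolding rk_def by (subst recF) (simp only: elts_sucO elts_bigU elts_vset_image image_image)

lemma OrdI: "(\<And>u. u \<in> elts x \<Longrightarrow> Ord u \<and> elts u \<subseteq> elts x) \<Longrightarrow> Ord x"
  unfolding Ord_def by blast

lemma Ord_rk: "Ord (rk x)"
proof (induction x rule: elts_induct)
  case (step x)
  show ?case
  proof (rule OrdI)
    fix u assume "u \<in> elts (rk x)"
    then obtain y where "y \<in> elts x" "u = rk y \<or> u \<in> elts (rk y)" unfolding elts_rk[of x] by blast
    then show "Ord u \<and> elts u \<subseteq> elts (rk x)"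
      using step Ord_in_Ord Ord_subset elts_rk[of x] by blast
  qed
qed

context zfc begin

lemma V_trcl: "x \<in> V \<Longrightarrow> trcl x \<in> V"
  unfolding trcl_def by (rule dfn_V[OF dfn_recF]) (intro df)

lemma V_rk: "x \<in> V \<Longrightarrow> rk x \<in> V"
  unfolding rk_def by (rule dfn_V[OF dfn_recF]) (intro df)

text \<open>The least inductive set of V has no nonstandard element: an \<in>-minimal one would be
  neither zero nor a successor of an element, so it could be removed. The foundation of the ambient
  universe is used here.\<close>

lemma elts_omega: "elts (omega :: 'a) = range nat_ord"
  and V_omega: "omega \<in> V"
proof -
  let ?ind = "\<lambda>w::'a. vset {} \<in> elts w \<and> (\<forall>x\<in>elts w. sucO x \<in> elts w)"
  have "\<exists>z\<in>V. (\<exists>e\<in>elts z. elts e = {}) \<and> (\<forall>x\<in>elts z. \<exists>y\<in>elts z. elts y = insert x (elts x))"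
    using zfc unfolding zfc_model_def by (elim conjE) assumption
  then obtain z where z: "z \<in> V" "?ind z"
    unfolding sucO_def using vset_eqI by metis
  have ind: "nat_ord n \<in> elts w" if "?ind w" for n w
    using that by (induction n) (auto simp: sucO_def)
  then have sm: "small (range (nat_ord :: nat \<Rightarrow> 'a))"
    using z(2) by (intro small_subset[OF small_elts[of z]]) auto
  then show om: "elts omega = range (nat_ord :: nat \<Rightarrow> 'a)"
    unfolding omega_def by (rule elts_vset_small)
  define N where "N = vset {n \<in> elts z. \<forall>w\<in>V. ?ind w \<longrightarrow> n \<in> elts w}"
  have N: "N \<in> V" unfolding N_def by (intro separation z(1)) (intro df V_empty)
  have eN: "elts N = {n \<in> elts z. \<forall>w\<in>V. ?ind w \<longrightarrow> n \<in> elts w}"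
    unfolding N_def by (rule elts_vset_Collect)
  have "n \<in> range nat_ord" if nN: "n \<in> elts N" for n
  proof (rule ccontr)
    assume "n \<notin> range nat_ord"
    then obtain m where m: "m \<in> elts N \<and> m \<notin> range nat_ord"
        "\<And>y. y \<in> elts m \<Longrightarrow> \<not> (y \<in> elts N \<and> y \<notin> range nat_ord)"
      using elts_least[of "\<lambda>m. m \<in> elts N \<and> m \<notin> range nat_ord" n] nN by metis
    obtain W where W: "W \<in> V" and eW: "elts W = elts N - {m}"
      using V_Diff[OF N V_single[OF V_trans[OF N, of m]]] m(1) elts_vset_Diff elts_vset_single by metis
    have "?ind N" using z(2) unfolding eN by auto
    moreover have "sucO x \<noteq> m" if xN: "x \<in> elts N" for x
    proof
      assume x: "sucO x = m"
      then have "x \<in> elts m" by auto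
      then obtain i where "x = nat_ord i" using m(2) xN by blast
      then have "m = nat_ord (Suc i)" using x by (simp add: sucO_def)
      then show False using m(1) by blast
    qed
    moreover have "vset {} \<noteq> m" using m(1) nat_ord.simps(1) by (metis rangeI)
    ultimately have "?ind W" unfolding eW by blast
    then have "m \<in> elts W" using m(1) W unfolding eN by blast
    then show False unfolding eW by blast
  qed
  moreover have "range nat_ord \<subseteq> elts N" using ind unfolding eN using z by blast
  ultimately have "elts N = elts omega" using om by blast
  then show "omega \<in> V" using N vset_elts by metis
qed

lemma Ord_omega: "Ord (omega :: 'a)"
proof (rule OrdI)
  fix u :: 'a assume "u \<in> elts omega"
  then show "Ord u \<and> elts u \<subseteq> elts omega"
    unfolding elts_omega using Ord_nat_ord by (auto simp: elts_nat_ord)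
qed

end

section \<open>Normal measures\<close>

locale nmeas = zfc +
  fixes \<alpha> D
  assumes nm: "normal_measure V \<alpha> D"
begin

text \<open>The quantifier "for almost every \<xi>". \<open>Q\<close> is any predicate of the logic,
  so the rules that enlarge or complement the set ask for definability.\<close>

definition lg :: "('a \<Rightarrow> bool) \<Rightarrow> bool" where
  "lg Q \<longleftrightarrow> vset {\<xi> \<in> elts \<alpha>. Q \<xi>} \<in> elts D"

lemma nm_basic: "D \<in> V" "\<alpha> \<in> V" "Ord \<alpha>" "omega \<in> elts \<alpha>"
  "X \<in> elts D \<Longrightarrow> elts X \<subseteq> elts \<alpha>" "vset {} \<notin> elts D"
  "X \<in> elts D \<Longrightarrow> Y \<in> V \<Longrightarrow> elts X \<subseteq> elts Y \<Longrightarrow> elts Y \<subseteq> elts \<alpha> \<Longrightarrow> Y \<in> elts D"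
  "X \<in> elts D \<Longrightarrow> Y \<in> elts D \<Longrightarrow> vset (elts X \<inter> elts Y) \<in> elts D"
  "X \<in> V \<Longrightarrow> elts X \<subseteq> elts \<alpha> \<Longrightarrow> X \<in> elts D \<or> vset (elts \<alpha> - elts X) \<in> elts D"
  "\<xi> \<in> elts \<alpha> \<Longrightarrow> vset {\<xi>} \<notin> elts D"
  using nm unfolding normal_measure_def by meson+

lemma nm_complete: "\<forall>\<gamma>\<in>elts \<alpha>. \<forall>f\<in>V. is_fun f \<gamma> \<and> (\<forall>\<xi>\<in>elts \<gamma>. app f \<xi> \<in> elts D) \<longrightarrow>
        vset {\<eta> \<in> elts \<alpha>. \<forall>\<xi>\<in>elts \<gamma>. \<eta> \<in> elts (app f \<xi>)} \<in> elts D"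
  using nm unfolding normal_measure_def by (elim conjE) assumption

lemma nm_diag: "\<forall>f\<in>V. is_fun f \<alpha> \<and> (\<forall>\<xi>\<in>elts \<alpha>. app f \<xi> \<in> elts D) \<longrightarrow>
        vset {\<eta> \<in> elts \<alpha>. \<forall>\<xi>\<in>elts \<eta>. \<eta> \<in> elts (app f \<xi>)} \<in> elts D"
  using nm unfolding normal_measure_def by (elim conjE) assumption

lemma V_slice: "dfp (\<lambda>s. Q (s 0)) \<Longrightarrow> vset {\<xi> \<in> elts \<alpha>. Q \<xi>} \<in> V"
  using separation nm_basic(2) by blast

lemma lg_mono: "lg Q \<Longrightarrow> dfp (\<lambda>s. Q' (s 0)) \<Longrightarrow> (\<And>\<xi>. \<xi> \<in> elts \<alpha> \<Longrightarrow> Q \<xi> \<Longrightarrow> Q' \<xi>) \<Longrightarrow> lg Q'"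
  unfolding lg_def by (rule nm_basic(7)[OF _ V_slice]) auto

lemma lg_cong: "(\<And>\<xi>. \<xi> \<in> elts \<alpha> \<Longrightarrow> Q \<xi> = Q' \<xi>) \<Longrightarrow> lg Q = lg Q'"
  unfolding lg_def by (metis (mono_tags, lifting) Collect_cong)

lemma lg_conj: "lg Q \<Longrightarrow> lg Q' \<Longrightarrow> lg (\<lambda>\<xi>. Q \<xi> \<and> Q' \<xi>)"
proof -
  assume "lg Q" "lg Q'"
  from nm_basic(8)[OF this[unfolded lg_def]]
  show ?thesis unfolding lg_def elts_vset_Collect
    by (rule back_subst[of "\<lambda>X. vset X \<in> elts D"]) blast
qed

lemma lg_not: assumes "dfp (\<lambda>s. Q (s 0))" shows "lg (\<lambda>\<xi>. \<not> Q \<xi>) \<longleftrightarrow> \<not> lg Q"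
proof -
  have "lg Q \<or> vset (elts \<alpha> - {\<xi> \<in> elts \<alpha>. Q \<xi>}) \<in> elts D"
    using nm_basic(9)[OF V_slice[OF assms]] unfolding lg_def elts_vset_Collect by blast
  moreover have "elts \<alpha> - {\<xi> \<in> elts \<alpha>. Q \<xi>} = {\<xi> \<in> elts \<alpha>. \<not> Q \<xi>}" by blast
  ultimately have "lg Q \<or> lg (\<lambda>\<xi>. \<not> Q \<xi>)" unfolding lg_def by metis
  moreover have "\<not> (lg Q \<and> lg (\<lambda>\<xi>. \<not> Q \<xi>))"
  proof
    assume "lg Q \<and> lg (\<lambda>\<xi>. \<not> Q \<xi>)"
    then have "lg (\<lambda>\<xi>. Q \<xi> \<and> \<not> Q \<xi>)" using lg_conj by blast
    then show False using nm_basic(6) unfolding lg_def by simp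
  qed
  ultimately show ?thesis by blast
qed

lemma lg_ex: "lg Q \<Longrightarrow> \<exists>\<xi>\<in>elts \<alpha>. Q \<xi>"
  using nm_basic(6) unfolding lg_def by (metis (no_types, lifting) Collect_empty_eq)

lemma lg_memD: "X \<in> elts D \<Longrightarrow> lg (\<lambda>\<xi>. \<xi> \<in> elts X)"
proof -
  assume "X \<in> elts D"
  then have "{\<xi> \<in> elts \<alpha>. \<xi> \<in> elts X} = elts X" using nm_basic(5) by blast
  then show ?thesis using \<open>X \<in> elts D\<close> by (simp add: lg_def)
qed

lemma lg_mem_iff: "elts X \<subseteq> elts \<alpha> \<Longrightarrow> lg (\<lambda>\<xi>. \<xi> \<in> elts X) \<longleftrightarrow> X \<in> elts D"
proof -
  assume "elts X \<subseteq> elts \<alpha>"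
  then have "{\<xi> \<in> elts \<alpha>. \<xi> \<in> elts X} = elts X" by blast
  then show ?thesis by (simp add: lg_def)
qed

lemma lg_True: "lg (\<lambda>\<xi>. True)"
  using lg_not[of "\<lambda>_. False"] lg_ex[of "\<lambda>_. False"] by (auto intro: df)

lemma lg_all: "dfp (\<lambda>s. Q (s 0)) \<Longrightarrow> (\<And>\<xi>. \<xi> \<in> elts \<alpha> \<Longrightarrow> Q \<xi>) \<Longrightarrow> lg Q"
  using lg_mono[OF lg_True] by blast

lemma lg_forall_index:
  assumes d: "dfp (\<lambda>s. Q (s 0) (s 1))" and Q: "\<And>\<eta>. \<eta> \<in> elts \<gamma> \<Longrightarrow> lg (Q \<eta>)" and g: "\<gamma> \<in> V"
  obtains f where "f \<in> V" "is_fun f \<gamma>" "\<And>\<eta>. \<eta> \<in> elts \<gamma> \<Longrightarrow> app f \<eta> \<in> elts D"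
    "\<And>\<eta> \<xi>. \<eta> \<in> elts \<gamma> \<Longrightarrow> \<xi> \<in> elts (app f \<eta>) \<longleftrightarrow> \<xi> \<in> elts \<alpha> \<and> Q \<eta> \<xi>"
proof -
  let ?h = "\<lambda>\<eta>. vset {\<xi> \<in> elts \<alpha>. Q \<eta> \<xi>}"
  have "dfn ?h" unfolding dfn_def by (intro df nm_basic dfp2I[OF d])
  then show thesis
    using that[of "lamV \<gamma> ?h"] Q g by (auto simp: V_lamV is_fun_lamV lg_def)
qed

text \<open>Pressing down: if no \<eta> were good for almost every \<xi>, the diagonal intersection
  of the complements would meet the set in the hypothesis. The regressive function stays a relation,
  so nothing has to be chosen.\<close>

lemma pd_ord:
  assumes d: "dfp (\<lambda>s. Q (s 0) (s 1))" and l: "lg (\<lambda>\<xi>. \<exists>\<eta>\<in>elts \<xi>. Q \<eta> \<xi>)"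
  shows "\<exists>\<eta>\<in>elts \<alpha>. lg (Q \<eta>)"
proof (rule ccontr)
  assume "\<not> ?thesis"
  then have n: "lg (\<lambda>\<xi>. \<not> Q \<eta> \<xi>)" if "\<eta> \<in> elts \<alpha>" for \<eta>
    using lg_not[OF dfp2I[OF d dff_const[OF V_trans[OF nm_basic(2) that]] dff_var[of 0]]] that by blast
  obtain f where f: "f \<in> V" "is_fun f \<alpha>" "\<And>\<eta>. \<eta> \<in> elts \<alpha> \<Longrightarrow> app f \<eta> \<in> elts D"
    "\<And>\<eta> \<xi>. \<eta> \<in> elts \<alpha> \<Longrightarrow> \<xi> \<in> elts (app f \<eta>) \<longleftrightarrow> \<xi> \<in> elts \<alpha> \<and> \<not> Q \<eta> \<xi>"
    using lg_forall_index[OF dfp_not[OF d] n nm_basic(2)] by blast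
  then have "lg (\<lambda>\<xi>. \<forall>\<eta>\<in>elts \<xi>. \<xi> \<in> elts (app f \<eta>))"
    using nm_diag unfolding lg_def by blast
  from lg_ex[OF lg_conj[OF l this]] obtain \<xi> \<eta> where "\<xi> \<in> elts \<alpha>" "\<eta> \<in> elts \<xi>" "Q \<eta> \<xi>" "\<xi> \<in> elts (app f \<eta>)"
    by blast
  then show False using f(4) nm_basic(3) Ord_trans by blast
qed

text \<open>Nonprincipality removes the single ordinals up to \<eta>, and completeness removes all
  of them together.\<close>

lemma lg_above: assumes "\<eta> \<in> elts \<alpha>" shows "lg (\<lambda>\<xi>. \<eta> \<in> elts \<xi>)"
proof -
  have V: "\<eta> \<in> V" using V_trans nm_basic(2) assms by blast
  have s: "lg (\<lambda>\<xi>. \<xi> \<noteq> \<zeta>)" if "\<zeta> \<in> elts \<alpha>" for \<zeta>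
  proof -
    have "\<not> lg (\<lambda>\<xi>. \<xi> = \<zeta>)"
      using nm_basic(10)[OF that] that unfolding lg_def
      by (metis (mono_tags, lifting) Collect_cong singleton_conv)
    then show ?thesis
      by (subst lg_not) (intro df V_trans[OF nm_basic(2) that])
  qed
  have dq: "dfp (\<lambda>s. s 1 \<noteq> s 0)" by (intro df)
  obtain f where f: "f \<in> V" "is_fun f \<eta>" "\<And>\<zeta>. \<zeta> \<in> elts \<eta> \<Longrightarrow> app f \<zeta> \<in> elts D"
    "\<And>\<zeta> \<xi>. \<zeta> \<in> elts \<eta> \<Longrightarrow> \<xi> \<in> elts (app f \<zeta>) \<longleftrightarrow> \<xi> \<in> elts \<alpha> \<and> \<xi> \<noteq> \<zeta>"
    by (rule lg_forall_index[of "\<lambda>\<zeta> \<xi>. \<xi> \<noteq> \<zeta>" \<eta>, OF dq s[OF Ord_trans[OF nm_basic(3) _ assms]] V]) blast+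
  then have "lg (\<lambda>\<xi>. \<forall>\<zeta>\<in>elts \<eta>. \<xi> \<in> elts (app f \<zeta>))"
    using nm_complete assms unfolding lg_def by blast
  then have "lg (\<lambda>\<xi>. (\<forall>\<zeta>\<in>elts \<eta>. \<xi> \<in> elts (app f \<zeta>)) \<and> \<xi> \<noteq> \<eta>)"
    using lg_conj s[OF assms] by blast
  then show ?thesis
  proof (rule lg_mono)
    show "\<eta> \<in> elts \<xi>" if "\<xi> \<in> elts \<alpha>" "(\<forall>\<zeta>\<in>elts \<eta>. \<xi> \<in> elts (app f \<zeta>)) \<and> \<xi> \<noteq> \<eta>" for \<xi>
      using that f(4) Ord_linear[of \<xi> \<eta>] Ord_in_Ord[OF nm_basic(3)] assms by blast
  qed (intro df V)
qed

lemma limit: "\<eta> \<in> elts \<alpha> \<Longrightarrow> \<exists>\<xi>\<in>elts \<alpha>. \<eta> \<in> elts \<xi>"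
  using lg_ex[OF lg_above] by blast

lemma pd_bound:
  assumes d: "dfp (\<lambda>s. Q (s 0) (s 1))" and l: "lg (\<lambda>\<xi>. \<exists>\<eta>\<in>elts \<gamma>. Q \<eta> \<xi>)" and g: "\<gamma> \<in> elts \<alpha>"
  shows "\<exists>\<eta>\<in>elts \<gamma>. lg (Q \<eta>)"
proof -
  have V: "\<gamma> \<in> V" using V_trans nm_basic(2) g by blast
  have d': "dfp (\<lambda>s. s 0 \<in> elts \<gamma> \<and> Q (s 0) (s 1))" by (intro df V dfp2I[OF d])
  have "lg (\<lambda>\<xi>. (\<exists>\<eta>\<in>elts \<gamma>. Q \<eta> \<xi>) \<and> \<gamma> \<in> elts \<xi>)" using l lg_above[OF g] lg_conj by blast
  then have "lg (\<lambda>\<xi>. \<exists>\<eta>\<in>elts \<xi>. \<eta> \<in> elts \<gamma> \<and> Q \<eta> \<xi>)"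
  proof (rule lg_mono)
    show "\<exists>\<eta>\<in>elts \<xi>. \<eta> \<in> elts \<gamma> \<and> Q \<eta> \<xi>" if "\<xi> \<in> elts \<alpha>" "(\<exists>\<eta>\<in>elts \<gamma>. Q \<eta> \<xi>) \<and> \<gamma> \<in> elts \<xi>" for \<xi>
      using that Ord_trans[OF Ord_in_Ord[OF nm_basic(3) that(1)]] by blast
  qed (intro df V dfp2I[OF d])
  from pd_ord[OF d' this] obtain \<eta> where e: "\<eta> \<in> elts \<alpha>" "lg (\<lambda>\<xi>. \<eta> \<in> elts \<gamma> \<and> Q \<eta> \<xi>)" by blast
  moreover have "lg (Q \<eta>)"
    by (rule lg_mono[OF e(2)]) (use V_trans[OF nm_basic(2) e(1)] in \<open>auto intro!: df dfp2I[OF d]\<close>)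
  ultimately show ?thesis using lg_ex by blast
qed

text \<open>Completeness for definable relations comes from pressing down applied to the negation,
  so that no function into the measure need be produced.\<close>

lemma complete:
  assumes d: "dfp (\<lambda>s. Q (s 0) (s 1))" and l: "\<And>\<eta>. \<eta> \<in> elts \<gamma> \<Longrightarrow> lg (Q \<eta>)" and g: "\<gamma> \<in> elts \<alpha>"
  shows "lg (\<lambda>\<xi>. \<forall>\<eta>\<in>elts \<gamma>. Q \<eta> \<xi>)"
proof (rule ccontr)
  have V: "\<gamma> \<in> V" using V_trans nm_basic(2) g by blast
  assume "\<not> ?thesis"
  then have "lg (\<lambda>\<xi>. \<not> (\<forall>\<eta>\<in>elts \<gamma>. Q \<eta> \<xi>))"
    by (subst lg_not) (auto intro!: df V dfp2I[OF d])
  then have "lg (\<lambda>\<xi>. \<exists>\<eta>\<in>elts \<gamma>. \<not> Q \<eta> \<xi>)" by simp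
  from pd_bound[OF dfp_not[OF d] this g] obtain \<eta> where e: "\<eta> \<in> elts \<gamma>" "lg (\<lambda>\<xi>. \<not> Q \<eta> \<xi>)" by blast
  then show False
    using lg_ex[OF lg_conj[OF l[OF e(1)] e(2)]] by blast
qed

text \<open>A measurable cardinal is a strong limit: functions into a small power set are constant on a large set.\<close>

lemma pd_pow:
  assumes d: "dfp (\<lambda>s. Q (s 0) (s 1))" and a: "a \<in> elts \<alpha>"
    and l: "lg (\<lambda>\<xi>. \<exists>B\<in>elts (powV a). Q B \<xi>)"
  shows "\<exists>B\<in>elts (powV a). lg (Q B)"
proof -
  have V: "a \<in> V" using V_trans nm_basic(2) a by blast
  have X: "vset {\<xi> \<in> elts \<alpha>. \<exists>B\<in>elts (powV a). Q B \<xi>} \<in> V"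
    using l nm_basic(1) V_trans unfolding lg_def by blast
  have dr: "dfp (\<lambda>s. Q (s 1) (s 0))" by (rule dfp2I[OF d]) (intro df)+
  obtain g where g: "dfn g" "\<And>\<xi>. \<xi> \<in> elts \<alpha> \<Longrightarrow> \<exists>B\<in>elts (powV a). Q B \<xi> \<Longrightarrow> g \<xi> \<in> elts (powV a) \<and> Q (g \<xi>) \<xi>"
  proof (rule choice_fun[OF X powV(1)[OF V] dr])
    show "\<exists>w\<in>elts (powV a). Q w u" if "u \<in> elts (vset {\<xi> \<in> elts \<alpha>. \<exists>B\<in>elts (powV a). Q B \<xi>})" for u
      using that unfolding elts_vset_Collect by blast
  qed (use that in \<open>unfold elts_vset_Collect, blast\<close>)
  \<comment> \<open>The constant value is found bit by bit: \<eta> belongs to it iff almost every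
    \<open>g \<xi>\<close> contains \<eta>. Completeness handles all \<eta> in \<open>a\<close> at
    once.\<close>
  let ?B = "vset {\<eta> \<in> elts a. lg (\<lambda>\<xi>. \<eta> \<in> elts (g \<xi>))}"
  have B: "?B \<in> V"
    unfolding lg_def by (intro separation V) (intro df V nm_basic dfnD[OF g(1)])
  have B': "?B \<in> elts (powV a)" unfolding powV(2)[OF V] using B by auto
  have c: "lg (\<lambda>\<xi>. \<eta> \<in> elts (g \<xi>) \<longleftrightarrow> \<eta> \<in> elts ?B)" if e: "\<eta> \<in> elts a" for \<eta>
  proof (cases "lg (\<lambda>\<xi>. \<eta> \<in> elts (g \<xi>))")
    case True
    then show ?thesis using e by (simp cong: lg_cong)
  next
    case False
    have "\<eta> \<in> V" using V_trans[OF V e] .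
    then have "lg (\<lambda>\<xi>. \<not> \<eta> \<in> elts (g \<xi>))"
      using False by (subst lg_not) (intro df dfnD[OF g(1)])
    then show ?thesis using False e by (simp cong: lg_cong)
  qed
  have dB: "dfp (\<lambda>s. s 0 \<in> elts (g (s 1)) \<longleftrightarrow> s 0 \<in> elts ?B)"
    by (rule dfp_iff; rule dfp_mem) (intro dff_var dff_const[OF B] dfnD[OF g(1)])+
  have "lg (\<lambda>\<xi>. \<forall>\<eta>\<in>elts a. \<eta> \<in> elts (g \<xi>) \<longleftrightarrow> \<eta> \<in> elts ?B)"
    by (rule complete[of "\<lambda>\<eta> \<xi>. \<eta> \<in> elts (g \<xi>) \<longleftrightarrow> \<eta> \<in> elts ?B", OF dB _ a]) (rule c)
  from lg_conj[OF this l] have "lg (Q ?B)"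
  proof (rule lg_mono)
    fix \<xi> assume x: "\<xi> \<in> elts \<alpha>" "(\<forall>\<eta>\<in>elts a. \<eta> \<in> elts (g \<xi>) \<longleftrightarrow> \<eta> \<in> elts ?B) \<and> (\<exists>B\<in>elts (powV a). Q B \<xi>)"
    then have "g \<xi> \<in> elts (powV a)" "Q (g \<xi>) \<xi>" using g(2) by blast+
    moreover from this have "g \<xi> = ?B"
      using x B' unfolding powV(2)[OF V] by (intro elts_extensionality) blast
    ultimately show "Q ?B \<xi>" by simp
  qed (intro dfp2I[OF d] df B)
  then show ?thesis using B' by blast
qed

end

section \<open>Coherence\<close>

locale coherent = zfc +
  fixes \<kappa> U
  assumes coh: "coherent_sequence V \<kappa> U"
begin

definition ob :: "'a \<Rightarrow> 'a \<Rightarrow> bool" where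
  "ob \<alpha> \<beta> \<longleftrightarrow> (\<exists>W\<in>V. opair (opair \<alpha> \<beta>) W \<in> elts U)"

definition meas :: "'a \<Rightarrow> 'a \<Rightarrow> 'a" where
  "meas \<alpha> \<beta> = app U (opair \<alpha> \<beta>)"

lemma coh_basic: "U \<in> V" "\<kappa> \<in> V" "Ord \<kappa>"
  "opair x y \<in> elts U \<Longrightarrow> opair x y' \<in> elts U \<Longrightarrow> y = y'"
  "z \<in> elts U \<Longrightarrow> \<exists>\<alpha>\<in>insert \<kappa> (elts \<kappa>). \<exists>\<beta> y. z = opair (opair \<alpha> \<beta>) y"
  "\<alpha> \<in> insert \<kappa> (elts \<kappa>) \<Longrightarrow> Ord (o_seq U \<alpha>)"
  using coh unfolding coherent_sequence_def by (elim conjE; blast)+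

lemma elts_o_seq: "elts (o_seq U \<alpha>) = {\<beta>. ob \<alpha> \<beta>}"
proof -
  have "small {\<beta>. \<exists>y. opair (opair \<alpha> \<beta>) y \<in> elts U}"
  proof (rule small_subset[OF small_elts[of "bigU (bigU (bigU (bigU U)))"]])
    show "{\<beta>. \<exists>y. opair (opair \<alpha> \<beta>) y \<in> elts U} \<subseteq> elts (bigU (bigU (bigU (bigU U))))"
      using opair_bigU by blast
  qed
  moreover have "(\<exists>y. opair (opair \<alpha> \<beta>) y \<in> elts U) \<longleftrightarrow> ob \<alpha> \<beta>" for \<beta>
    unfolding ob_def using V_trans[OF coh_basic(1)] V_opairD by blast
  ultimately show ?thesis by (simp add: o_seq_def elts_vset_small)
qed

lemma obD: assumes "ob \<alpha> \<beta>"
  shows "\<alpha> \<in> insert \<kappa> (elts \<kappa>)" "\<alpha> \<in> V" "\<beta> \<in> V" "Ord \<alpha>" "Ord \<beta>" "opair (opair \<alpha> \<beta>) (meas \<alpha> \<beta>) \<in> elts U"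
   "i \<in> elts \<beta> \<Longrightarrow> ob \<alpha> i"
proof -
  obtain W where W: "opair (opair \<alpha> \<beta>) W \<in> elts U" using assms by (auto simp: ob_def)
  then show "\<alpha> \<in> insert \<kappa> (elts \<kappa>)" using coh_basic(5)[OF W] by auto
  then have o: "Ord (o_seq U \<alpha>)" "\<beta> \<in> elts (o_seq U \<alpha>)" using coh_basic(6) assms elts_o_seq by auto
  then show "Ord \<beta>" using Ord_in_Ord by blast
  show "i \<in> elts \<beta> \<Longrightarrow> ob \<alpha> i" using Ord_trans[OF o(1) _ o(2)] elts_o_seq by auto
  show "\<alpha> \<in> V" "\<beta> \<in> V" using V_trans[OF coh_basic(1) W] V_opairD by blast+
  show "Ord \<alpha>" using \<open>\<alpha> \<in> insert \<kappa> (elts \<kappa>)\<close> coh_basic(3) Ord_in_Ord by blast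
  have "meas \<alpha> \<beta> = W"
    unfolding meas_def app_def by (rule the_equality) (use W coh_basic(4) in blast)+
  then show "opair (opair \<alpha> \<beta>) (meas \<alpha> \<beta>) \<in> elts U" using W by simp
qed

lemma meas_eq: "opair (opair \<alpha> \<beta>) W \<in> elts U \<Longrightarrow> W = meas \<alpha> \<beta>"
  using obD(6)[of \<alpha> \<beta>] coh_basic(4) V_trans[OF coh_basic(1)] V_opairD unfolding ob_def by blast

lemma nmeas: assumes "ob \<alpha> \<beta>" shows "nmeas V \<alpha> (meas \<alpha> \<beta>)"
proof -
  have "\<forall>\<alpha>\<in>insert \<kappa> (elts \<kappa>). \<forall>\<beta>\<in>elts (o_seq U \<alpha>). normal_measure V \<alpha> (app U (opair \<alpha> \<beta>)) \<and>
        (\<exists>j. ultrapower_embedding V \<alpha> (app U (opair \<alpha> \<beta>)) j \<and>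
          {z \<in> elts (j U). \<exists>\<alpha>' \<beta>' y. z = opair (opair \<alpha>' \<beta>') y \<and> (\<alpha>' \<in> elts \<alpha> \<or> \<alpha>' = \<alpha>)} =
          {z \<in> elts U. \<exists>\<alpha>' \<beta>' y. z = opair (opair \<alpha>' \<beta>') y \<and>
              (\<alpha>' \<in> elts \<alpha> \<or> \<alpha>' = \<alpha> \<and> \<beta>' \<in> elts \<beta>)})"
    using coh unfolding coherent_sequence_def by (elim conjE) assumption
  then have "normal_measure V \<alpha> (meas \<alpha> \<beta>)"
    unfolding meas_def using obD(1)[OF assms] assms elts_o_seq by blast
  then show ?thesis by unfold_locales
qed

definition MI :: "'a \<Rightarrow> 'a \<Rightarrow> bool" where
  "MI \<alpha> X \<longleftrightarrow> (\<forall>\<beta>\<in>V. \<forall>W\<in>V. opair (opair \<alpha> \<beta>) W \<in> elts U \<longrightarrow> X \<in> elts W)"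

lemma dfp_ob [df]: "dff t \<Longrightarrow> dff u \<Longrightarrow> dfp (\<lambda>s. ob (t s) (u s))"
  unfolding ob_def by (intro df dff_shift coh_basic)

lemma dfp_MI [df]: "dff t \<Longrightarrow> dff u \<Longrightarrow> dfp (\<lambda>s. MI (t s) (u s))"
  unfolding MI_def by (intro df dff_shift coh_basic)

lemma MI_iff: "MI \<alpha> X \<longleftrightarrow> (\<forall>\<beta>. ob \<alpha> \<beta> \<longrightarrow> X \<in> elts (meas \<alpha> \<beta>))"
  unfolding MI_def
proof (intro iffI allI impI ballI)
  fix \<beta> assume a: "\<forall>\<beta>\<in>V. \<forall>W\<in>V. opair (opair \<alpha> \<beta>) W \<in> elts U \<longrightarrow> X \<in> elts W" "ob \<alpha> \<beta>"
  then show "X \<in> elts (meas \<alpha> \<beta>)"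
    using obD(6)[OF a(2)] V_trans[OF coh_basic(1)] V_opairD by blast
next
  fix \<beta> W assume "\<forall>\<beta>. ob \<alpha> \<beta> \<longrightarrow> X \<in> elts (meas \<alpha> \<beta>)" "W \<in> V" "opair (opair \<alpha> \<beta>) W \<in> elts U"
  then show "X \<in> elts W" using meas_eq unfolding ob_def by blast
qed

lemma MI_measure_inter: "X \<in> measure_inter U \<alpha> \<longleftrightarrow> MI \<alpha> X"
  unfolding measure_inter_def MI_iff meas_def elts_o_seq by simp

text \<open>The only consequence of coherence that is used: what the measures of smaller index on \<^term>\<open>\<gamma>\<close>
  say is reflected to almost every \<^term>\<open>\<nu>\<close>, where it concerns all measures.\<close>

lemma coherence_all:
  assumes k: "ob \<gamma> k" and X: "X \<in> V" "elts X \<subseteq> elts \<gamma>"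
  shows "nmeas.lg \<gamma> (meas \<gamma> k) (\<lambda>\<nu>. MI \<nu> (vset (elts X \<inter> elts \<nu>))) \<longleftrightarrow> (\<forall>i\<in>elts k. X \<in> elts (meas \<gamma> i))"
proof -
  interpret nmeas V \<gamma> "meas \<gamma> k" using nmeas[OF k] .
  note VI = V_trans[OF coh_basic(1)]
  have "\<forall>\<alpha>\<in>insert \<kappa> (elts \<kappa>). \<forall>\<beta>\<in>elts (o_seq U \<alpha>). normal_measure V \<alpha> (app U (opair \<alpha> \<beta>)) \<and>
        (\<exists>j. ultrapower_embedding V \<alpha> (app U (opair \<alpha> \<beta>)) j \<and>
          {z \<in> elts (j U). \<exists>\<alpha>' \<beta>' y. z = opair (opair \<alpha>' \<beta>') y \<and> (\<alpha>' \<in> elts \<alpha> \<or> \<alpha>' = \<alpha>)} =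
          {z \<in> elts U. \<exists>\<alpha>' \<beta>' y. z = opair (opair \<alpha>' \<beta>') y \<and>
              (\<alpha>' \<in> elts \<alpha> \<or> \<alpha>' = \<alpha> \<and> \<beta>' \<in> elts \<beta>)})"
    using coh unfolding coherent_sequence_def by (elim conjE) assumption
  then obtain j where j: "ultrapower_embedding V \<gamma> (meas \<gamma> k) j"
     and jU: "{z \<in> elts (j U). \<exists>\<alpha>' \<beta>' y. z = opair (opair \<alpha>' \<beta>') y \<and> (\<alpha>' \<in> elts \<gamma> \<or> \<alpha>' = \<gamma>)} =
          {z \<in> elts U. \<exists>\<alpha>' \<beta>' y. z = opair (opair \<alpha>' \<beta>') y \<and> (\<alpha>' \<in> elts \<gamma> \<or> \<alpha>' = \<gamma> \<and> \<beta>' \<in> elts k)}"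
    unfolding meas_def using obD(1)[OF k] k elts_o_seq by blast
  obtain \<pi> where p0: "\<forall>f\<in>{f \<in> V. is_fun f \<gamma>}. \<forall>g\<in>{f \<in> V. is_fun f \<gamma>}. \<pi> f = \<pi> g \<longleftrightarrow>
           vset {\<xi> \<in> elts \<gamma>. app f \<xi> = app g \<xi>} \<in> elts (meas \<gamma> k)"
        "\<forall>f\<in>{f \<in> V. is_fun f \<gamma>}. \<forall>g\<in>{f \<in> V. is_fun f \<gamma>}. \<pi> f \<in> elts (\<pi> g) \<longleftrightarrow>
           vset {\<xi> \<in> elts \<gamma>. app f \<xi> \<in> elts (app g \<xi>)} \<in> elts (meas \<gamma> k)"
        "\<forall>f\<in>{f \<in> V. is_fun f \<gamma>}. elts (\<pi> f) \<subseteq> \<pi> ` {f \<in> V. is_fun f \<gamma>}"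
        "\<forall>x\<in>V. j x = \<pi> (const_fun \<gamma> x)"
    using j unfolding ultrapower_embedding_def Let_def by (elim exE conjE) blast
  \<comment> \<open>\<open>P h\<close> is the element represented by \<open>h\<close>. The embedding
    gives Los' theorem for equality and membership only, so pairs, constants and intersections are
    evaluated from these two.\<close>
  define P where "P h = \<pi> (lamV \<gamma> h)" for h
  have F: "lamV \<gamma> h \<in> {f \<in> V. is_fun f \<gamma>}" if "dfn h" for h
    using V_lamV[OF that nm_basic(2)] is_fun_lamV by blast
  have lg': "vset {\<xi> \<in> elts \<gamma>. R (app (lamV \<gamma> h) \<xi>) (app (lamV \<gamma> h') \<xi>)} \<in> elts (meas \<gamma> k) \<longleftrightarrow> lg (\<lambda>\<xi>. R (h \<xi>) (h' \<xi>))"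
    for h h' R
  proof -
    have "{\<xi> \<in> elts \<gamma>. R (app (lamV \<gamma> h) \<xi>) (app (lamV \<gamma> h') \<xi>)} = {\<xi> \<in> elts \<gamma>. R (h \<xi>) (h' \<xi>)}" by auto
    then show ?thesis unfolding lg_def by (simp only:)
  qed
  have Peq: "P h = P h' \<longleftrightarrow> lg (\<lambda>\<xi>. h \<xi> = h' \<xi>)" if "dfn h" "dfn h'" for h h'
    unfolding P_def using p0(1) F[OF that(1)] F[OF that(2)] lg'[of "(=)"] by blast
  have Pmem: "P h \<in> elts (P h') \<longleftrightarrow> lg (\<lambda>\<xi>. h \<xi> \<in> elts (h' \<xi>))" if "dfn h" "dfn h'" for h h'
    unfolding P_def using p0(2) F[OF that(1)] F[OF that(2)] lg'[of "\<lambda>x y. x \<in> elts y"] by blast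
  have Ptrans: "\<exists>h'. dfn h' \<and> z = P h'" if h: "dfn h" and z: "z \<in> elts (P h)" for h z
  proof -
    obtain f where f: "f \<in> V" "is_fun f \<gamma>" "z = \<pi> f" using p0(3) F[OF h] z unfolding P_def by blast
    obtain h' where h': "dfn h'" "\<And>u. u \<in> elts \<gamma> \<Longrightarrow> h' u = app f u"
      using fun_dfn[OF f(1,2) nm_basic(2)] by blast
    have "{\<xi> \<in> elts \<gamma>. app f \<xi> = app (lamV \<gamma> h') \<xi>} = elts \<gamma>" using h'(2) by auto
    then have "\<pi> f = P h'"
      unfolding P_def using p0(1) F[OF h'(1)] f(1,2) lg_True unfolding lg_def by (simp add: P_def)
    then show ?thesis using h' f(3) by blast
  qed
  have dconst: "dfn (\<lambda>_. c)" if "c \<in> V" for c using that unfolding dfn_def by (intro df)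
  have jP: "j x = P (\<lambda>_. x)" if "x \<in> V" for x
  proof -
    have "const_fun \<gamma> x = lamV \<gamma> (\<lambda>_. x)" unfolding const_fun_def lamV_def by (simp add: Setcompr_eq_image)
    then show ?thesis using p0(4) that unfolding P_def by simp
  qed
  have Ppair: "P (\<lambda>\<xi>. vset {h \<xi>, h' \<xi>}) = vset {P h, P h'}" if d: "dfn h" "dfn h'" for h h'
  proof (rule elts_extensionality)
    have dp: "dfn (\<lambda>\<xi>. vset {h \<xi>, h' \<xi>})" unfolding dfn_def by (intro df dfnD[OF d(1)] dfnD[OF d(2)])
    have "P h \<in> elts (P (\<lambda>\<xi>. vset {h \<xi>, h' \<xi>}))" "P h' \<in> elts (P (\<lambda>\<xi>. vset {h \<xi>, h' \<xi>}))"
      using Pmem[OF d(1) dp] Pmem[OF d(2) dp] lg_True by auto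
    moreover have "z = P h \<or> z = P h'" if zp: "z \<in> elts (P (\<lambda>\<xi>. vset {h \<xi>, h' \<xi>}))" for z
    proof -
      obtain g where g: "dfn g" "z = P g" using Ptrans[OF dp zp] by blast
      have l: "lg (\<lambda>\<xi>. g \<xi> = h \<xi> \<or> g \<xi> = h' \<xi>)" using zp Pmem[OF g(1) dp] g(2) by simp
      show ?thesis
      proof (cases "lg (\<lambda>\<xi>. g \<xi> = h \<xi>)")
        case True then show ?thesis using Peq g d by blast
      next
        case False
        then have "lg (\<lambda>\<xi>. \<not> g \<xi> = h \<xi>)" by (subst lg_not) (intro df dfnD[OF g(1)] dfnD[OF d(1)])
        from lg_conj[OF l this] have "lg (\<lambda>\<xi>. g \<xi> = h' \<xi>)"
          by (rule lg_mono) (auto intro!: df dfnD[OF g(1)] dfnD[OF d(2)])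
        then show ?thesis using Peq g d by blast
      qed
    qed
    ultimately show "elts (P (\<lambda>\<xi>. vset {h \<xi>, h' \<xi>})) = elts (vset {P h, P h'})" by auto
  qed
  have Popair: "P (\<lambda>\<xi>. opair (h \<xi>) (h' \<xi>)) = opair (P h) (P h')" if d: "dfn h" "dfn h'" for h h'
  proof -
    have 1: "dfn (\<lambda>\<xi>. vset {h \<xi>, h \<xi>})" "dfn (\<lambda>\<xi>. vset {h \<xi>, h' \<xi>})"
      unfolding dfn_def by (intro df dfnD[OF d(1)] dfnD[OF d(2)])+
    show ?thesis using Ppair[OF 1] Ppair[OF d(1) d(1)] Ppair[OF d] by (simp add: opair_def)
  qed
  \<comment> \<open>Completeness: a function into \<eta> < \<gamma> is constant on a large set, so
    by induction the embedding fixes the ordinals below \<gamma>.\<close>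
  have Pconst: "P (\<lambda>_. \<eta>) = \<eta>" if "\<eta> \<in> elts \<gamma>" for \<eta>
    using that
  proof (induction \<eta> rule: elts_induct)
    case (step \<eta>)
    have eV: "\<eta> \<in> V" using V_trans nm_basic(2) step(2) by blast
    have sub: "\<And>\<eta>'. \<eta>' \<in> elts \<eta> \<Longrightarrow> \<eta>' \<in> elts \<gamma>" using Ord_trans nm_basic(3) step(2) by blast
    show ?case
    proof (rule elts_extensionality, rule set_eqI, rule iffI)
      fix z assume z: "z \<in> elts (P (\<lambda>_. \<eta>))"
      then obtain g where g: "dfn g" "z = P g" using Ptrans[OF dconst[OF eV]] by blast
      have "lg (\<lambda>\<xi>. \<exists>\<eta>'\<in>elts \<eta>. g \<xi> = \<eta>')"
        using z Pmem[OF g(1) dconst[OF eV]] g(2) by (simp add: lg_def)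
      moreover have "dfp (\<lambda>s. g (s 1) = s 0)" by (intro df dfnD[OF g(1)])
      ultimately obtain \<eta>' where e: "\<eta>' \<in> elts \<eta>" "lg (\<lambda>\<xi>. g \<xi> = \<eta>')"
        using pd_bound[of "\<lambda>\<eta> \<xi>. g \<xi> = \<eta>", OF _ _ step(2)] by blast
      have "P g = P (\<lambda>_. \<eta>')" using e Peq[OF g(1) dconst] V_trans[OF eV] by blast
      then show "z \<in> elts \<eta>" using g(2) step(1)[OF e(1) sub[OF e(1)]] e(1) by simp
    next
      fix z assume z: "z \<in> elts \<eta>"
      then have "z = P (\<lambda>_. z)" using step(1) sub by simp
      moreover have "P (\<lambda>_. z) \<in> elts (P (\<lambda>_. \<eta>))"
        using Pmem[OF dconst dconst] V_trans[OF eV z] eV z lg_True by simp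
      ultimately show "z \<in> elts (P (\<lambda>_. \<eta>))" by simp
    qed
  qed
  have dI: "dfn (\<lambda>\<nu>. vset (elts Y \<inter> elts \<nu>))" if "Y \<in> V" for Y
    using that unfolding dfn_def by (intro df)
  \<comment> \<open>Normality: a function with values in Y \<inter> \<xi> is constant on a large
    set, so this function represents \<open>Y\<close>. With Y = \<gamma> the identity is seen to
    represent \<gamma>.\<close>
  have PI: "P (\<lambda>\<nu>. vset (elts Y \<inter> elts \<nu>)) = Y" if Y: "Y \<in> V" "elts Y \<subseteq> elts \<gamma>" for Y
  proof (rule elts_extensionality, rule set_eqI, rule iffI)
    fix z assume z: "z \<in> elts (P (\<lambda>\<nu>. vset (elts Y \<inter> elts \<nu>)))"
    then obtain g where g: "dfn g" "z = P g" using Ptrans[OF dI[OF Y(1)]] by blast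
    have "lg (\<lambda>\<xi>. g \<xi> \<in> elts Y \<and> g \<xi> \<in> elts \<xi>)"
      using z Pmem[OF g(1) dI[OF Y(1)]] g(2) by simp
    then have "lg (\<lambda>\<xi>. \<exists>\<eta>\<in>elts \<xi>. g \<xi> = \<eta> \<and> \<eta> \<in> elts Y)"
      by (rule lg_mono) (auto intro!: df dfnD[OF g(1)] Y)
    moreover have "dfp (\<lambda>s. g (s 1) = s 0 \<and> s 0 \<in> elts Y)" by (intro df dfnD[OF g(1)] Y)
    ultimately obtain \<eta> where e: "\<eta> \<in> elts \<gamma>" "lg (\<lambda>\<xi>. g \<xi> = \<eta> \<and> \<eta> \<in> elts Y)"
      using pd_ord[of "\<lambda>\<eta> \<xi>. g \<xi> = \<eta> \<and> \<eta> \<in> elts Y"] by blast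
    have eY: "\<eta> \<in> elts Y" using lg_ex[OF e(2)] by blast
    have "lg (\<lambda>\<xi>. g \<xi> = \<eta>)" by (rule lg_mono[OF e(2)]) (auto intro!: df dfnD[OF g(1)] V_trans[OF Y(1) eY])
    then have "P g = P (\<lambda>_. \<eta>)" using Peq[OF g(1) dconst] V_trans[OF Y(1) eY] by blast
    then show "z \<in> elts Y" using g(2) Pconst[OF e(1)] eY by simp
  next
    fix z assume z: "z \<in> elts Y"
    then have zg: "z \<in> elts \<gamma>" using Y(2) by blast
    have "lg (\<lambda>\<xi>. z \<in> elts (vset (elts Y \<inter> elts \<xi>)))"
      by (rule lg_mono[OF lg_above[OF zg]]) (use z in \<open>auto intro!: df V_trans[OF Y(1)] Y\<close>)
    then have "P (\<lambda>_. z) \<in> elts (P (\<lambda>\<nu>. vset (elts Y \<inter> elts \<nu>)))"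
      using Pmem[OF dconst[OF V_trans[OF Y(1) z]] dI[OF Y(1)]] by blast
    then show "z \<in> elts (P (\<lambda>\<nu>. vset (elts Y \<inter> elts \<nu>)))" using Pconst[OF zg] by simp
  qed
  have did: "dfn (\<lambda>\<nu>. \<nu>)" unfolding dfn_def by (intro df)
  have Pid: "P (\<lambda>\<nu>. \<nu>) = \<gamma>"
  proof -
    have "lg (\<lambda>\<nu>. \<nu> = vset (elts \<gamma> \<inter> elts \<nu>))"
    proof (rule lg_all)
      show "\<nu> = vset (elts \<gamma> \<inter> elts \<nu>)" if "\<nu> \<in> elts \<gamma>" for \<nu>
        using Ord_subset[OF nm_basic(3) that] by (metis inf.absorb_iff2 vset_elts)
    qed (intro df nm_basic)
    then show ?thesis using Peq[OF did dI[OF nm_basic(2)]] PI[OF nm_basic(2)] by simp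
  qed
  have dtr: "dfn (\<lambda>\<nu>. opair (opair \<nu> (f \<nu>)) (w \<nu>))" if "dfn f" "dfn w" for f w
    unfolding dfn_def by (intro df dfnD[OF that(1)] dfnD[OF that(2)])
  have Ptr: "P (\<lambda>\<nu>. opair (opair \<nu> (f \<nu>)) (w \<nu>)) = opair (opair \<gamma> (P f)) (P w)" if d: "dfn f" "dfn w" for f w
  proof -
    have "dfn (\<lambda>\<nu>. opair \<nu> (f \<nu>))" unfolding dfn_def by (intro df dfnD[OF d(1)])
    then show ?thesis using Popair[OF _ d(2)] Popair[OF did d(1)] Pid by simp
  qed
  have jUP: "j U = P (\<lambda>_. U)" using jP coh_basic(1) .
  have dMI: "dfp (\<lambda>s. MI (s 0) (vset (elts X \<inter> elts (s 0))))"
    by (intro df X)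
  show ?thesis
  proof
    assume l: "lg (\<lambda>\<nu>. MI \<nu> (vset (elts X \<inter> elts \<nu>)))"
    show "\<forall>i\<in>elts k. X \<in> elts (meas \<gamma> i)"
    proof (rule ballI, rule ccontr)
      fix i assume i: "i \<in> elts k" and n: "X \<notin> elts (meas \<gamma> i)"
      have obi: "ob \<gamma> i" using obD(7)[OF k i] .
      interpret i: nmeas V \<gamma> "meas \<gamma> i" using nmeas[OF obi] .
      let ?Y = "vset (elts \<gamma> - elts X)"
      have Y: "?Y \<in> elts (meas \<gamma> i)" using i.nm_basic(9)[OF X] n by blast
      have YV: "?Y \<in> V" using V_Diff nm_basic(2) X by blast
      \<comment> \<open>By coherence this triple belongs to \<open>j U\<close>, and its components
        are represented by functions \<open>f\<close> and \<open>w\<close>. Then for almost every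
        \<nu> the measure \<open>w \<nu>\<close> on \<nu> contains the trace of the complement of
        \<open>X\<close>, against \<open>MI\<close>.\<close>
      let ?z = "opair (opair \<gamma> i) (meas \<gamma> i)"
      have z: "?z \<in> elts (j U)" using jU obD(6)[OF obi] i by blast
      obtain h where h: "dfn h" "?z = P h" using Ptrans[OF dconst[OF coh_basic(1)]] z jUP by auto
      have 1: "\<exists>h. dfn h \<and> x = P h" "\<exists>h. dfn h \<and> y = P h" if e: "opair x y = P g" "dfn g" for x y g
      proof -
        have "vset {x, y} \<in> elts (P g)" using elts_opair[of x y] e(1) by simp
        then obtain g' where g': "dfn g'" "vset {x, y} = P g'" using Ptrans[OF e(2)] by blast
        have "x \<in> elts (P g')" "y \<in> elts (P g')" using elts_vset_pair[of x y] g'(2) by auto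
        then show "\<exists>h. dfn h \<and> x = P h" "\<exists>h. dfn h \<and> y = P h" using Ptrans[OF g'(1)] by blast+
      qed
      obtain w where w: "dfn w" "meas \<gamma> i = P w" using 1(2)[OF h(2,1)] by blast
      obtain g where g: "dfn g" "opair \<gamma> i = P g" using 1(1)[OF h(2,1)] by blast
      obtain f where f: "dfn f" "i = P f" using 1(2)[OF g(2,1)] by blast
      have "P (\<lambda>\<nu>. opair (opair \<nu> (f \<nu>)) (w \<nu>)) \<in> elts (P (\<lambda>_. U))"
        using Ptr[OF f(1) w(1)] z f(2) w(2) jUP by simp
      then have a: "lg (\<lambda>\<nu>. opair (opair \<nu> (f \<nu>)) (w \<nu>) \<in> elts U)"
        using Pmem[OF dtr[OF f(1) w(1)] dconst[OF coh_basic(1)]] by blast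
      have "P (\<lambda>\<nu>. vset (elts ?Y \<inter> elts \<nu>)) \<in> elts (P w)"
        using PI[OF YV] Y w(2) by simp
      then have b: "lg (\<lambda>\<nu>. vset (elts ?Y \<inter> elts \<nu>) \<in> elts (w \<nu>))"
        using Pmem[OF dI[OF YV] w(1)] by blast
      obtain \<nu> where \<nu>: "\<nu> \<in> elts \<gamma>" "MI \<nu> (vset (elts X \<inter> elts \<nu>))" "opair (opair \<nu> (f \<nu>)) (w \<nu>) \<in> elts U"
         "vset (elts ?Y \<inter> elts \<nu>) \<in> elts (w \<nu>)"
        using lg_ex[OF lg_conj[OF l lg_conj[OF a b]]] by blast
      have obn: "ob \<nu> (f \<nu>)" unfolding ob_def using \<nu>(3) V_trans[OF coh_basic(1)] V_opairD by blast
      interpret n: nmeas V \<nu> "meas \<nu> (f \<nu>)" using nmeas[OF obn] .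
      have "w \<nu> = meas \<nu> (f \<nu>)" using meas_eq \<nu>(3) by blast
      then have "vset (elts ?Y \<inter> elts \<nu>) \<in> elts (meas \<nu> (f \<nu>))" "vset (elts X \<inter> elts \<nu>) \<in> elts (meas \<nu> (f \<nu>))"
        using \<nu>(2,4) obn unfolding MI_iff by auto
      from n.nm_basic(8)[OF this] show False using n.nm_basic(6)
        by (simp add: Int_Diff Diff_Int_distrib2 Int_commute Int_left_commute)
           (metis (no_types, lifting) Diff_disjoint Int_Diff Int_commute inf_left_commute)
    qed
  next
    assume a: "\<forall>i\<in>elts k. X \<in> elts (meas \<gamma> i)"
    show "lg (\<lambda>\<nu>. MI \<nu> (vset (elts X \<inter> elts \<nu>)))"
    proof (rule ccontr)
      assume "\<not> ?thesis"
      then have l: "lg (\<lambda>\<nu>. \<not> MI \<nu> (vset (elts X \<inter> elts \<nu>)))"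
        using lg_not[OF dMI] by blast
      \<comment> \<open>For each bad \<nu> an index and a measure omitting the trace of
        \<open>X\<close> are chosen. The choice represents an index i and a measure on \<gamma> in
        \<open>j U\<close>; by coherence i < k and the measure is the one of \<open>U\<close> at
        (\<gamma>, i), which contains \<open>X\<close> by assumption.\<close>
      let ?R = "\<lambda>\<nu> z. \<exists>i\<in>V. \<exists>W\<in>V. z = opair i W \<and> opair (opair \<nu> i) W \<in> elts U \<and> vset (elts X \<inter> elts \<nu>) \<notin> elts W"
      let ?S = "vset {\<nu> \<in> elts \<gamma>. \<not> MI \<nu> (vset (elts X \<inter> elts \<nu>))}"
      have S: "?S \<in> V" using l V_trans nm_basic(1) unfolding lg_def by blast
      let ?B = "prodV (bigU (bigU (bigU (bigU U)))) (bigU (bigU U))"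
      have BV: "?B \<in> V" by (intro V_prodV V_bigU coh_basic)
      have ex: "\<exists>z\<in>elts ?B. ?R \<nu> z" if "\<nu> \<in> elts ?S" for \<nu>
      proof -
        from that obtain i W where "i \<in> V" "W \<in> V" "opair (opair \<nu> i) W \<in> elts U" "vset (elts X \<inter> elts \<nu>) \<notin> elts W"
          unfolding elts_vset_Collect MI_def by blast
        moreover from this have "opair i W \<in> elts ?B" unfolding elts_prodV using opair_bigU by blast
        ultimately show ?thesis by blast
      qed
      have dR: "dfp (\<lambda>s. ?R (s 0) (s 1))" by (intro df coh_basic X)
      obtain h where h: "dfn h" "\<And>\<nu>. \<nu> \<in> elts ?S \<Longrightarrow> h \<nu> \<in> elts ?B \<and> ?R \<nu> (h \<nu>)"
        by (rule choice_fun[of ?S ?B ?R, OF S BV dR ex]) blast+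
      have "\<exists>i W. opair (opair \<nu> i) W \<in> elts U \<and> vset (elts X \<inter> elts \<nu>) \<notin> elts W \<and> h \<nu> = opair i W" if "\<nu> \<in> elts ?S" for \<nu>
        using h(2)[OF that] by blast
      let ?f = "\<lambda>\<nu>. if \<nu> \<in> elts ?S then THE i. \<exists>W\<in>V. h \<nu> = opair i W else vset {}"
      let ?w = "\<lambda>\<nu>. if \<nu> \<in> elts ?S then THE W. \<exists>i\<in>V. h \<nu> = opair i W else vset {}"
      have fw: "h \<nu> = opair (?f \<nu>) (?w \<nu>)" "?f \<nu> \<in> V" "?w \<nu> \<in> V" if s: "\<nu> \<in> elts ?S" for \<nu>
      proof -
        obtain i W where "i \<in> V" "W \<in> V" "h \<nu> = opair i W" using h(2)[OF s] by blast
        then show "h \<nu> = opair (?f \<nu>) (?w \<nu>)" "?f \<nu> \<in> V" "?w \<nu> \<in> V" using s by auto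
      qed
      have df': "dfn ?f"
      proof (rule dfn_graph)
        show "?f \<nu> \<in> V" for \<nu> using fw V_empty by (cases "\<nu> \<in> elts ?S") (auto simp del: elts_vset_Collect)
        show "dfp (\<lambda>s. (s 0 \<in> elts ?S \<and> (\<exists>W\<in>V. h (s 0) = opair (s 1) W)) \<or> s 0 \<notin> elts ?S \<and> s 1 = vset {})"
          by (intro df dff_const[OF S] dfnD[OF h(1)] V_empty)
        show "(\<nu> \<in> elts ?S \<and> (\<exists>W\<in>V. h \<nu> = opair y W)) \<or> \<nu> \<notin> elts ?S \<and> y = vset {} \<longleftrightarrow> y = ?f \<nu>" for \<nu> y
          using fw[of \<nu>] by (cases "\<nu> \<in> elts ?S") (auto simp del: elts_vset_Collect)
      qed
      have dw': "dfn ?w"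
      proof (rule dfn_graph)
        show "?w \<nu> \<in> V" for \<nu> using fw V_empty by (cases "\<nu> \<in> elts ?S") (auto simp del: elts_vset_Collect)
        show "dfp (\<lambda>s. (s 0 \<in> elts ?S \<and> (\<exists>i\<in>V. h (s 0) = opair i (s 1))) \<or> s 0 \<notin> elts ?S \<and> s 1 = vset {})"
          by (intro df dff_const[OF S] dfnD[OF h(1)] V_empty)
        show "(\<nu> \<in> elts ?S \<and> (\<exists>i\<in>V. h \<nu> = opair i y)) \<or> \<nu> \<notin> elts ?S \<and> y = vset {} \<longleftrightarrow> y = ?w \<nu>" for \<nu> y
          using fw[of \<nu>] by (cases "\<nu> \<in> elts ?S") (auto simp del: elts_vset_Collect)
      qed
      obtain f w where fw2: "dfn f" "dfn w" "\<And>\<nu>. \<nu> \<in> elts ?S \<Longrightarrow> h \<nu> = opair (f \<nu>) (w \<nu>)"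
        using df' dw' fw(1) by blast
      have R: "opair (opair \<nu> (f \<nu>)) (w \<nu>) \<in> elts U \<and> vset (elts X \<inter> elts \<nu>) \<notin> elts (w \<nu>)" if "\<nu> \<in> elts ?S" for \<nu>
        using h(2)[OF that] fw2(3)[OF that] by auto
      have "lg (\<lambda>\<nu>. opair (opair \<nu> (f \<nu>)) (w \<nu>) \<in> elts U)"
        by (rule lg_mono[OF l]) (use R in \<open>auto intro!: df dfnD[OF fw2(1)] dfnD[OF fw2(2)] coh_basic\<close>)
      then have "P (\<lambda>\<nu>. opair (opair \<nu> (f \<nu>)) (w \<nu>)) \<in> elts (P (\<lambda>_. U))"
        using Pmem[OF dtr[OF fw2(1,2)] dconst[OF coh_basic(1)]] by blast
      then have "opair (opair \<gamma> (P f)) (P w) \<in> elts (j U)" using Ptr[OF fw2(1,2)] jUP by simp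
      then have "opair (opair \<gamma> (P f)) (P w) \<in> {z \<in> elts U. \<exists>\<alpha>' \<beta>' y. z = opair (opair \<alpha>' \<beta>') y \<and>
              (\<alpha>' \<in> elts \<gamma> \<or> \<alpha>' = \<gamma> \<and> \<beta>' \<in> elts k)}"
        unfolding jU[symmetric] by blast
      then have pU: "opair (opair \<gamma> (P f)) (P w) \<in> elts U" "P f \<in> elts k"
        by (auto simp del: elts_vset_Collect)
      then have "X \<in> elts (P w)" using a meas_eq by metis
      then have "lg (\<lambda>\<nu>. vset (elts X \<inter> elts \<nu>) \<in> elts (w \<nu>))"
        using Pmem[OF dI[OF X(1)] fw2(2)] PI[OF X] by simp
      from lg_ex[OF lg_conj[OF l this]] show False using R by auto
    qed
  qed
qed

end

section \<open>The order on conditions\<close>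

definition mtch :: "'a::set_universe block \<Rightarrow> 'a block \<Rightarrow> bool" where
  "mtch t s \<longleftrightarrow> kap s = kap t \<and> bset s \<subseteq> bset t"

definition insb :: "'a::set_universe block \<Rightarrow> 'a block \<Rightarrow> bool" where
  "insb t s \<longleftrightarrow> kap s \<in> bset t \<and> bset s \<subseteq> bset t \<inter> elts (kap s)"

text \<open>A recursion replaces the index function of \<open>magidor_seq_le\<close>: the next block
  of the stronger list either matches the current block of the weaker one or is inserted in front of
  it. Extensions can then be taken apart by list induction.\<close>

fun ble :: "'a::set_universe block list \<Rightarrow> 'a block list \<Rightarrow> bool" where
  "ble [] ss \<longleftrightarrow> ss = []"
| "ble (t # ts) [] \<longleftrightarrow> False"
| "ble (t # ts) (s # ss) \<longleftrightarrow> (mtch t s \<and> ble ts ss) \<or> (insb t s \<and> ble (t # ts) ss)"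

lemma ble_Cons:
  "ble (t # ts) ss \<longleftrightarrow> (\<exists>w s ss'. ss = w @ s # ss' \<and> (\<forall>x\<in>set w. insb t x) \<and> mtch t s \<and> ble ts ss')"
proof (induction ss)
  case (Cons s ss)
  show ?case
  proof
    assume "ble (t # ts) (s # ss)"
    then consider "mtch t s" "ble ts ss" | "insb t s" "ble (t # ts) ss" by auto
    then show "\<exists>w s' ss'. s # ss = w @ s' # ss' \<and> (\<forall>x\<in>set w. insb t x) \<and> mtch t s' \<and> ble ts ss'"
    proof cases
      case 1 then show ?thesis by (intro exI[of _ "[]"]) auto
    next
      case 2
      then obtain w s' ss' where "ss = w @ s' # ss'" "\<forall>x\<in>set w. insb t x" "mtch t s'" "ble ts ss'"
        using Cons by blast
      then show ?thesis using 2 by (intro exI[of _ "s # w"]) auto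
    qed
  next
    assume "\<exists>w s' ss'. s # ss = w @ s' # ss' \<and> (\<forall>x\<in>set w. insb t x) \<and> mtch t s' \<and> ble ts ss'"
    then obtain w s' ss' where *: "s # ss = w @ s' # ss'" "\<forall>x\<in>set w. insb t x" "mtch t s'" "ble ts ss'"
      by blast
    show "ble (t # ts) (s # ss)"
    proof (cases w)
      case Nil then show ?thesis using * by simp
    next
      case (Cons x w')
      then have "ble (t # ts) ss" using * Cons.IH by auto
      then show ?thesis using * Cons by simp
    qed
  qed
qed simp

text \<open>Every block takes along what is inserted in front of it, so an extension of a
  concatenation splits at the corresponding place. The cutting and pasting of conditions rests on
  this.\<close>

lemma ble_append: "ble (a @ b) ss \<longleftrightarrow> (\<exists>s1 s2. ss = s1 @ s2 \<and> ble a s1 \<and> ble b s2)"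
proof (induction a arbitrary: ss)
  case (Cons t a)
  show ?case
  proof
    assume "ble ((t # a) @ b) ss"
    then obtain w s ss' where *: "ss = w @ s # ss'" "\<forall>x\<in>set w. insb t x" "mtch t s" "ble (a @ b) ss'"
      using ble_Cons[of t "a @ b"] by auto
    then obtain s1 s2 where "ss' = s1 @ s2" "ble a s1" "ble b s2" using Cons by blast
    then show "\<exists>s1 s2. ss = s1 @ s2 \<and> ble (t # a) s1 \<and> ble b s2"
      using * by (intro exI[of _ "w @ s # s1"] exI[of _ s2]) (auto simp: ble_Cons)
  next
    assume "\<exists>s1 s2. ss = s1 @ s2 \<and> ble (t # a) s1 \<and> ble b s2"
    then obtain w s s1 s2 where "ss = w @ s # s1 @ s2" "\<forall>x\<in>set w. insb t x" "mtch t s" "ble a s1" "ble b s2"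
      by (auto simp: ble_Cons)
    moreover from this have "ble (a @ b) (s1 @ s2)" using Cons by blast
    ultimately have "ble (t # (a @ b)) ss" unfolding ble_Cons by blast
    then show "ble ((t # a) @ b) ss" by simp
  qed
qed simp

lemma ble_appendI: "ble a s1 \<Longrightarrow> ble b s2 \<Longrightarrow> ble (a @ b) (s1 @ s2)"
  using ble_append by blast

lemma ble_single: "ble [t] ss \<longleftrightarrow> (\<exists>w s. ss = w @ [s] \<and> (\<forall>x\<in>set w. insb t x) \<and> mtch t s)"
  by (auto simp: ble_Cons)

lemma ble_singleI: "(\<forall>x\<in>set w. insb t x) \<Longrightarrow> mtch t s \<Longrightarrow> ble [t] (w @ [s])"
  by (auto simp: ble_single)

lemma mtch_refl [simp]: "mtch t t"
  by (simp add: mtch_def)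

lemma ble_refl [simp]: "ble ts ts"
  by (induction ts) auto

lemma insb_trans: "insb t x \<Longrightarrow> insb x y \<Longrightarrow> insb t y"
  "insb t x \<Longrightarrow> mtch x y \<Longrightarrow> insb t y" "mtch t x \<Longrightarrow> insb x y \<Longrightarrow> insb t y"
  "mtch t x \<Longrightarrow> mtch x y \<Longrightarrow> mtch t y"
  unfolding insb_def mtch_def by auto

lemma ble_insb: "ble w us \<Longrightarrow> \<forall>x\<in>set w. insb t x \<Longrightarrow> \<forall>x\<in>set us. insb t x"
proof (induction w arbitrary: us)
  case (Cons x w)
  then obtain w' s us' where *: "us = w' @ s # us'" "\<forall>y\<in>set w'. insb x y" "mtch x s" "ble w us'"
    by (auto simp: ble_Cons)
  then have "\<forall>x\<in>set us'. insb t x" using Cons by auto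
  then show ?case using * Cons(3) insb_trans by (metis Un_iff list.set_intros(1) set_ConsD set_append)
qed simp

lemma ble_trans: "ble ts ss \<Longrightarrow> ble ss us \<Longrightarrow> ble ts us"
proof (induction ts arbitrary: ss us)
  case (Cons t ts)
  then obtain w s ss' where *: "ss = w @ [s] @ ss'" "\<forall>x\<in>set w. insb t x" "mtch t s" "ble ts ss'"
    by (auto simp: ble_Cons)
  then obtain u1 u2 u3 where u: "us = u1 @ u2 @ u3" "ble w u1" "ble [s] u2" "ble ss' u3"
    using Cons(3) unfolding *(1) ble_append by blast
  then obtain w' s' where "u2 = w' @ [s']" "\<forall>x\<in>set w'. insb s x" "mtch s s'"
    by (auto simp: ble_single)
  then have "us = (u1 @ w') @ s' # u3" "\<forall>x\<in>set (u1 @ w'). insb t x" "mtch t s'"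
    using u(1) ble_insb[OF u(2) *(2)] insb_trans(3)[OF *(3)] insb_trans(4)[OF *(3)] by auto
  then show ?case using Cons(1)[OF *(4) u(4)] unfolding ble_Cons by blast
qed simp

lemma magidor_seq_le_iff: "magidor_seq_le ts ss \<longleftrightarrow> ble ts ss"
proof (induction ts arbitrary: ss)
  case Nil
  show ?case unfolding magidor_seq_le_def by (auto intro!: exI[of _ "\<lambda>_. 0"] simp: strict_mono_on_def)
next
  case (Cons t ts)
  show ?case
  proof
    assume "magidor_seq_le (t # ts) ss"
    then obtain i where i: "i 0 = 0" "i (Suc (length ts)) = length ss"
       "strict_mono_on {0..Suc (length ts)} i"
       "\<And>r. r \<in> {1..Suc (length ts)} \<Longrightarrow> kap (ss ! (i r - 1)) = kap ((t # ts) ! (r - 1)) \<and>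
           bset (ss ! (i r - 1)) \<subseteq> bset ((t # ts) ! (r - 1)) \<and>
           (\<forall>k. i (r - 1) < k \<and> k < i r \<longrightarrow>
              kap (ss ! (k - 1)) \<in> bset ((t # ts) ! (r - 1)) \<and>
              bset (ss ! (k - 1)) \<subseteq> bset ((t # ts) ! (r - 1)) \<inter> elts (kap (ss ! (k - 1))))"
      unfolding magidor_seq_le_def by auto
    have i1: "0 < i 1" using strict_mono_onD[OF i(3), of 0 1] i(1) by simp
    have i1l: "i 1 \<le> length ss"
      using strict_mono_on_leD[OF i(3), of 1 "Suc (length ts)"] i(2) by simp
    have split: "ss = take (i 1 - 1) ss @ ss ! (i 1 - 1) # drop (i 1) ss"
      using i1 i1l id_take_nth_drop[of "i 1 - 1" ss] by simp
    have "insb t x" if "x \<in> set (take (i 1 - 1) ss)" for x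
    proof -
      obtain m where m: "m < i 1 - 1" "x = ss ! m"
        using \<open>x \<in> _\<close> by (auto simp: in_set_conv_nth)
      then show ?thesis using i(4)[of 1] i(1) spec[of _ "Suc m"] unfolding insb_def
        by (auto dest!: spec[of _ "Suc m"])
    qed
    moreover have "mtch t (ss ! (i 1 - 1))" using i(4)[of 1] unfolding mtch_def by simp
    moreover have "magidor_seq_le ts (drop (i 1) ss)"
      unfolding magidor_seq_le_def
    proof (intro exI[of _ "\<lambda>r. i (Suc r) - i 1"] conjI ballI)
      have ge: "i 1 < i (Suc r)" if "1 \<le> r" "r \<le> length ts" for r
        using strict_mono_onD[OF i(3), of 1 "Suc r"] that by simp
      show "strict_mono_on {0..length ts} (\<lambda>r. i (Suc r) - i 1)"
      proof (rule strict_mono_onI)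
        fix r s assume rs: "r \<in> {0..length ts}" "s \<in> {0..length ts}" "r < s"
        have "i (Suc r) < i (Suc s)" using strict_mono_onD[OF i(3), of "Suc r" "Suc s"] rs by simp
        moreover have "i 1 \<le> i (Suc r)" using strict_mono_on_leD[OF i(3), of 1 "Suc r"] rs by simp
        ultimately show "i (Suc r) - i 1 < i (Suc s) - i 1" by simp
      qed
      fix r assume r: "r \<in> {1..length ts}"
      have g: "i 1 < i (Suc r)" "i 1 \<le> i r" "i r < i (Suc r)" "i (Suc r) \<le> length ss"
        using ge[of r] strict_mono_on_leD[OF i(3), of 1 r] strict_mono_onD[OF i(3), of r "Suc r"]
          strict_mono_on_leD[OF i(3), of "Suc r" "Suc (length ts)"] i(2) r by auto
      have rr: "Suc (r - 1) = r" "(t # ts) ! (Suc r - 1) = ts ! (r - 1)" using r by (auto simp: nth_Cons')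
      have nth: "drop (i 1) ss ! (k - i 1 - 1) = ss ! (k - 1)" if "i 1 < k" "k \<le> length ss" for k
        using that by (simp add: nth_drop)
      have I: "kap (ss ! (i (Suc r) - 1)) = kap (ts ! (r - 1)) \<and>
           bset (ss ! (i (Suc r) - 1)) \<subseteq> bset (ts ! (r - 1)) \<and>
           (\<forall>k. i r < k \<and> k < i (Suc r) \<longrightarrow>
              kap (ss ! (k - 1)) \<in> bset (ts ! (r - 1)) \<and>
              bset (ss ! (k - 1)) \<subseteq> bset (ts ! (r - 1)) \<inter> elts (kap (ss ! (k - 1))))"
        using i(4)[of "Suc r"] rr r by auto
      show "kap (drop (i 1) ss ! (i (Suc r) - i 1 - 1)) = kap (ts ! (r - 1))"
        "bset (drop (i 1) ss ! (i (Suc r) - i 1 - 1)) \<subseteq> bset (ts ! (r - 1))"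
        using nth[OF g(1,4)] I by auto
      show "\<forall>k. i (Suc (r - 1)) - i 1 < k \<and> k < i (Suc r) - i 1 \<longrightarrow>
              kap (drop (i 1) ss ! (k - 1)) \<in> bset (ts ! (r - 1)) \<and>
              bset (drop (i 1) ss ! (k - 1)) \<subseteq> bset (ts ! (r - 1)) \<inter> elts (kap (drop (i 1) ss ! (k - 1)))"
      proof (intro allI impI)
        fix k assume k: "i (Suc (r - 1)) - i 1 < k \<and> k < i (Suc r) - i 1"
        then have "i r < k + i 1" "k + i 1 < i (Suc r)" using rr(1) g by auto
        moreover have "drop (i 1) ss ! (k - 1) = ss ! (k + i 1 - 1)"
          using nth[of "k + i 1"] g k by auto
        ultimately show "kap (drop (i 1) ss ! (k - 1)) \<in> bset (ts ! (r - 1)) \<and>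
              bset (drop (i 1) ss ! (k - 1)) \<subseteq> bset (ts ! (r - 1)) \<inter> elts (kap (drop (i 1) ss ! (k - 1)))"
          using I by simp
      qed
    qed (use i i1l in auto)
    ultimately show "ble (t # ts) ss"
      unfolding ble_Cons using split Cons by blast
  next
    assume "ble (t # ts) ss"
    then obtain w s ss' where *: "ss = w @ s # ss'" "\<forall>x\<in>set w. insb t x" "mtch t s" "ble ts ss'"
      unfolding ble_Cons by blast
    then obtain i where i: "i 0 = 0" "i (length ts) = length ss'"
       "strict_mono_on {0..length ts} i"
       "\<And>r. r \<in> {1..length ts} \<Longrightarrow> kap (ss' ! (i r - 1)) = kap (ts ! (r - 1)) \<and>
           bset (ss' ! (i r - 1)) \<subseteq> bset (ts ! (r - 1)) \<and>
           (\<forall>k. i (r - 1) < k \<and> k < i r \<longrightarrow>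
              kap (ss' ! (k - 1)) \<in> bset (ts ! (r - 1)) \<and>
              bset (ss' ! (k - 1)) \<subseteq> bset (ts ! (r - 1)) \<inter> elts (kap (ss' ! (k - 1))))"
      using Cons[of ss'] unfolding magidor_seq_le_def by auto
    \<comment> \<open>Counted from 1, the block matching \<open>t\<close> is entry number
      \<open>?n\<close>, behind the inserted \<open>w\<close>. Index 0 has to stay 0, hence the case
      distinction in \<open>?j\<close>.\<close>
    let ?n = "Suc (length w)"
    let ?j = "\<lambda>r. case r of 0 \<Rightarrow> 0 | Suc r \<Rightarrow> i r + ?n"
    show "magidor_seq_le (t # ts) ss"
      unfolding magidor_seq_le_def
    proof (intro exI[of _ ?j] conjI ballI)
      show "strict_mono_on {0..length (t # ts)} ?j"
        using i(3) by (auto simp: strict_mono_on_def split: nat.splits)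
      fix r assume r: "r \<in> {1..length (t # ts)}"
      then obtain r' where r': "r = Suc r'" "r' \<le> length ts" by (cases r) auto
      have nth: "ss ! (m + ?n - 1) = (if m = 0 then s else ss' ! (m - 1))" for m
        using *(1) by (auto simp: nth_append nth_Cons')
      show "kap (ss ! (?j r - 1)) = kap ((t # ts) ! (r - 1))"
        "bset (ss ! (?j r - 1)) \<subseteq> bset ((t # ts) ! (r - 1))"
      proof (atomize (full), cases r')
        case 0
        then show "kap (ss ! (?j r - 1)) = kap ((t # ts) ! (r - 1)) \<and>
           bset (ss ! (?j r - 1)) \<subseteq> bset ((t # ts) ! (r - 1))"
          using *(3) i(1) nth[of 0] r' unfolding mtch_def by simp
      next
        case (Suc q)
        have "0 < i r'" using strict_mono_onD[OF i(3), of 0 r'] i(1) r' Suc by simp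
        then show "kap (ss ! (?j r - 1)) = kap ((t # ts) ! (r - 1)) \<and>
           bset (ss ! (?j r - 1)) \<subseteq> bset ((t # ts) ! (r - 1))"
          using i(4)[of r'] nth[of "i r'"] r' Suc by simp
      qed
      show "\<forall>k. ?j (r - 1) < k \<and> k < ?j r \<longrightarrow>
              kap (ss ! (k - 1)) \<in> bset ((t # ts) ! (r - 1)) \<and>
              bset (ss ! (k - 1)) \<subseteq> bset ((t # ts) ! (r - 1)) \<inter> elts (kap (ss ! (k - 1)))"
      proof (intro allI impI)
        fix k assume k: "?j (r - 1) < k \<and> k < ?j r"
        show "kap (ss ! (k - 1)) \<in> bset ((t # ts) ! (r - 1)) \<and>
              bset (ss ! (k - 1)) \<subseteq> bset ((t # ts) ! (r - 1)) \<inter> elts (kap (ss ! (k - 1)))"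
        proof (cases r')
          case 0
          then have "0 < k" "k - 1 < length w" using k r' i(1) by auto
          then have "ss ! (k - 1) \<in> set w" using *(1) by (auto simp: nth_append)
          then show ?thesis using *(2) r' 0 unfolding insb_def by auto
        next
          case (Suc q)
          define m where "m = k - ?n"
          have km: "k = m + ?n" "i q < m" "m < i r'" using k r' Suc unfolding m_def by auto
          then show ?thesis using i(4)[of r'] nth[of m] r' Suc by simp
        qed
      qed
    qed (use i * in auto)
  qed
qed

section \<open>Conditions described by requirements on blocks and neighbours\<close>

context coherent begin

text \<open>\<open>ob\<close> and \<open>MI\<close> stand in for \<open>o_seq\<close> and
  \<open>measure_inter\<close>, because their quantifiers range over V and so are definable
  there.\<close>

definition okb :: "'a block \<Rightarrow> bool" where
  "okb t \<longleftrightarrow> (case t of Point a \<Rightarrow> \<not> (\<exists>\<beta>\<in>V. ob a \<beta>) | Large a B \<Rightarrow> (\<exists>\<beta>\<in>V. ob a \<beta>) \<and> MI a B)"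

definition lk :: "'a block \<Rightarrow> 'a block \<Rightarrow> bool" where
  "lk t t' \<longleftrightarrow> kap t \<in> elts (kap t') \<and> (\<forall>\<xi>\<in>bset t'. kap t \<in> elts \<xi>)"

text \<open>Only neighbours are compared, which suits recursion on lists; the other inequalities
  follow from transitivity of ordinals.\<close>

definition cond :: "'a block list \<Rightarrow> bool" where
  "cond ts \<longleftrightarrow> ts \<noteq> [] \<and> (\<exists>B. last ts = Large \<kappa> B) \<and> (\<forall>t\<in>set ts. okb t) \<and> successively lk ts"

lemma lk_sorted:
  "successively lk ts \<Longrightarrow> ts \<noteq> [] \<Longrightarrow> Ord (kap (last ts)) \<Longrightarrow>
    sorted_wrt (\<lambda>x y. kap x \<in> elts (kap y)) ts \<and> (\<forall>x\<in>set ts. Ord (kap x))"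
proof (induction ts)
  case (Cons t ts)
  show ?case
  proof (cases "ts = []")
    case True
    then show ?thesis using Cons by simp
  next
    case False
    have 2: "lk t (hd ts)" and s: "successively lk ts"
      using Cons(2) False by (simp_all add: successively_Cons)
    have "Ord (kap (last ts))" using Cons(4) False by simp
    then have 1: "sorted_wrt (\<lambda>x y. kap x \<in> elts (kap y)) ts" "\<forall>x\<in>set ts. Ord (kap x)"
      using Cons(1)[OF s False] by blast+
    have "kap t \<in> elts (kap y)" if "y \<in> set ts" for y
    proof -
      have "y = hd ts \<or> kap (hd ts) \<in> elts (kap y)" using 1(1) that False by (cases ts) auto
      then show ?thesis using 2 1(2) that Ord_trans[of "kap y" "kap t" "kap (hd ts)"] unfolding lk_def by auto
    qed
    moreover have "Ord (kap t)"
      using 2 1(2) False Ord_in_Ord unfolding lk_def by (metis list.set_sel(1))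
    ultimately show ?thesis using 1 by simp
  qed
qed simp

lemma cond_sorted: "cond ts \<Longrightarrow> sorted_wrt (\<lambda>x y. kap x \<in> elts (kap y)) ts"
  and cond_Ord: "cond ts \<Longrightarrow> t \<in> set ts \<Longrightarrow> Ord (kap t)"
  using lk_sorted[of ts] coh_basic(3) unfolding cond_def by auto

lemma okb_iff: "okb t \<longleftrightarrow> (case t of Point a \<Rightarrow> elts (o_seq U a) = {} 
   | Large a B \<Rightarrow> elts (o_seq U a) \<noteq> {} \<and> B \<in> measure_inter U a)"
  unfolding okb_def elts_o_seq MI_measure_inter using obD(3) by (auto split: block.splits)

lemma magidor_seq_iff: "magidor_seq \<kappa> U ts \<longleftrightarrow> cond ts"
proof
  assume m: "magidor_seq \<kappa> U ts"
  have "successively lk ts"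
    unfolding successively_conv_nth lk_def using m unfolding magidor_seq_def by simp
  then show "cond ts"
    using m unfolding cond_def okb_iff magidor_seq_def by (auto split: block.splits)
next
  assume c: "cond ts"
  then have "successively lk ts" by (simp add: cond_def)
  then show "magidor_seq \<kappa> U ts"
    unfolding magidor_seq_def using c cond_sorted[OF c]
    by (fastforce simp: cond_def okb_iff sorted_wrt_iff_nth_less successively_conv_nth lk_def)
qed

section \<open>Codes of lists of blocks\<close>

definition blk :: "'a block \<Rightarrow> bool" where
  "blk t \<longleftrightarrow> (case t of Point a \<Rightarrow> a \<in> elts \<kappa> | Large a B \<Rightarrow> a \<in> insert \<kappa> (elts \<kappa>) \<and> B \<in> V \<and> elts B \<subseteq> elts a)"

text \<open>Large enough to contain all conditions and their parts, and simple enough that the codes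
  form a set of V. Quantifiers over lists thereby become bounded quantifiers of V.\<close>

definition LL :: "'a block list set" where
  "LL = {ts. \<forall>t\<in>set ts. blk t}"

lemma LL_simps [simp]: "[] \<in> LL" "t # ts \<in> LL \<longleftrightarrow> blk t \<and> ts \<in> LL" "ts @ ss \<in> LL \<longleftrightarrow> ts \<in> LL \<and> ss \<in> LL"
  by (auto simp: LL_def)

lemma okb_MI: "okb (Large a B) \<Longrightarrow> B \<in> V \<and> elts B \<subseteq> elts a \<and> a \<in> insert \<kappa> (elts \<kappa>) \<and> MI a B \<and> (\<exists>\<beta>\<in>V. ob a \<beta>)"
proof -
  assume a: "okb (Large a B)"
  then obtain \<beta> where b: "ob a \<beta>" "MI a B" "\<beta> \<in> V" by (auto simp: okb_def)
  interpret nmeas V a "meas a \<beta>" using nmeas[OF b(1)] .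
  have "B \<in> elts (meas a \<beta>)" using b MI_iff by blast
  then show ?thesis using b nm_basic(1,5) V_trans obD(1)[OF b(1)] by blast
qed

lemma cond_kap: "cond ts \<Longrightarrow> t \<in> set ts \<Longrightarrow> kap t \<in> insert \<kappa> (elts \<kappa>)"
proof -
  assume c: "cond ts" "t \<in> set ts"
  have "ts = butlast ts @ [last ts]" using c by (simp add: cond_def)
  then have "t = last ts \<or> kap t \<in> elts (kap (last ts))"
    using cond_sorted[OF c(1)] c(2) by (metis (no_types, lifting) Un_iff list.set_intros(1) set_ConsD set_append sorted_wrt_append empty_iff list.set(1))
  then show ?thesis using c(1) unfolding cond_def by auto
qed

lemma cond_LL: "cond ts \<Longrightarrow> ts \<in> LL"
  unfolding LL_def
proof (clarify)
  fix t assume c: "cond ts" "t \<in> set ts"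
  then have o: "okb t" by (simp add: cond_def)
  show "blk t"
  proof (cases t)
    case (Point a)
    have "a \<noteq> \<kappa>"
    proof
      assume "a = \<kappa>"
      obtain B where "last ts = Large \<kappa> B" using c(1) by (auto simp: cond_def)
      then have "okb (Large \<kappa> B)" using c(1) unfolding cond_def by (metis last_in_set)
      then show False using o Point \<open>a = \<kappa>\<close> by (simp add: okb_def)
    qed
    then show ?thesis using cond_kap[OF c] Point by (simp add: blk_def)
  next
    case (Large a B)
    then show ?thesis using okb_MI o by (simp add: blk_def)
  qed
qed

lemma blk_Ord: "blk t \<Longrightarrow> Ord (kap t)"
  unfolding blk_def using coh_basic(3) Ord_in_Ord by (auto split: block.splits)

lemma code_block_inj: "blk t \<Longrightarrow> blk s \<Longrightarrow> code_block t = code_block s \<Longrightarrow> t = s"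
  using blk_Ord[of t] blk_Ord[of s] not_Ord_opair by (cases t; cases s) auto

lemma opair_ne_empty [simp]: "opair x y \<noteq> vset {}" "vset {} \<noteq> opair x y"
  by (metis elts_opair elts_vset_empty insert_not_empty)+

lemma code_seq_inj: "ts \<in> LL \<Longrightarrow> ss \<in> LL \<Longrightarrow> code_seq ts = code_seq ss \<Longrightarrow> ts = ss"
proof (induction ts arbitrary: ss)
  case Nil then show ?case by (cases ss) auto
next
  case (Cons t ts)
  then show ?case using code_block_inj by (cases ss) auto
qed

definition BQ :: 'a where
  "BQ = vset (elts \<kappa> \<union> elts (vset {z \<in> elts (prodV (sucO \<kappa>) (powV \<kappa>)). \<exists>a\<in>V. \<exists>B\<in>V. z = opair a B \<and> elts B \<subseteq> elts a}))"

lemma BQ_V: "BQ \<in> V"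
  unfolding BQ_def
  by (intro V_Un V_Collect V_prodV V_sucO powV coh_basic) (intro df)

lemma prodV_opair: "opair u w \<in> elts (prodV x y) \<longleftrightarrow> u \<in> elts x \<and> w \<in> elts y"
  by (auto simp: elts_prodV)

lemma elts_BQ: "elts BQ = code_block ` {t. blk t}"
proof -
  have 1: "z \<in> elts BQ \<longleftrightarrow> z \<in> elts \<kappa> \<or> (z \<in> elts (prodV (sucO \<kappa>) (powV \<kappa>)) \<and>
      (\<exists>a\<in>V. \<exists>B\<in>V. z = opair a B \<and> elts B \<subseteq> elts a))" for z
    unfolding BQ_def elts_vset_Un[of \<kappa>] unfolding elts_vset_Collect by blast
  show ?thesis
  proof (intro set_eqI iffI)
    fix z assume "z \<in> elts BQ"
    then consider "z \<in> elts \<kappa>" | a B where "z = opair a B" "opair a B \<in> elts (prodV (sucO \<kappa>) (powV \<kappa>))"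
         "B \<in> V" "elts B \<subseteq> elts a"
      using 1 by blast
    then show "z \<in> code_block ` {t. blk t}"
    proof cases
      case 1 then show ?thesis by (intro image_eqI[of _ _ "Point z"]) (auto simp: blk_def)
    next
      case 2 then show ?thesis
        by (intro image_eqI[of _ _ "Large a B"]) (auto simp: blk_def prodV_opair)
    qed
  next
    fix z assume "z \<in> code_block ` {t. blk t}"
    then obtain t where t: "z = code_block t" "blk t" by blast
    show "z \<in> elts BQ"
    proof (cases t)
      case (Point a) then show ?thesis using t 1 by (simp add: blk_def)
    next
      case (Large a B)
      then have a: "a \<in> insert \<kappa> (elts \<kappa>)" "B \<in> V" "elts B \<subseteq> elts a" using t by (auto simp: blk_def)
      then have "a \<in> V" "elts B \<subseteq> elts \<kappa>"
        using V_trans[OF coh_basic(2)] coh_basic(2) Ord_subset[OF coh_basic(3)] by blast+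
      then show ?thesis
        using 1[of z] t(1) Large a by (auto simp: prodV_opair powV(2)[OF coh_basic(2)])
    qed
  qed
qed

text \<open>At a natural number n these are the codes of the lists of length at most n; recursion
  along \<in> takes the tails from all smaller numbers.\<close>

definition FL :: "'a \<Rightarrow> 'a" where
  "FL = recF (\<lambda>x m. vset (insert (vset {}) (elts (prodV BQ (bigU m)))))"

lemma elts_FL: "elts (FL n) = insert (vset {}) {opair t c | t c. t \<in> elts BQ \<and> (\<exists>m\<in>elts n. c \<in> elts (FL m))}"
  unfolding FL_def by (subst recF, subst elts_vset_insert) (auto simp: elts_prodV elts_bigU)

lemma dfn_FL: "dfn FL"
  unfolding FL_def by (rule dfn_recF) (intro df BQ_V V_empty)

lemma dff_FL [df]: "dff t \<Longrightarrow> dff (\<lambda>s. FL (t s))"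
  by (rule dfnD[OF dfn_FL])

lemma FL_nat: "elts (FL (nat_ord n)) = code_seq ` {ts \<in> LL. length ts \<le> n}"
proof (induction n rule: less_induct)
  case (less n)
  have "z \<in> elts (FL (nat_ord n)) \<longleftrightarrow> z \<in> code_seq ` {ts \<in> LL. length ts \<le> n}" for z
  proof
    assume "z \<in> elts (FL (nat_ord n))"
    then consider "z = vset {}" | t c m where "z = opair t c" "t \<in> elts BQ" "m < n" "c \<in> elts (FL (nat_ord m))"
      unfolding elts_FL[of "nat_ord n"] elts_nat_ord by blast
    then show "z \<in> code_seq ` {ts \<in> LL. length ts \<le> n}"
    proof cases
      case 1 then show ?thesis by (intro image_eqI[of _ _ "[]"]) auto
    next
      case 2
      then obtain t' ts where "t = code_block t'" "blk t'" "c = code_seq ts" "ts \<in> LL" "length ts \<le> m"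
        using less[of m] elts_BQ by auto
      then show ?thesis using 2 by (intro image_eqI[of _ _ "t' # ts"]) auto
    qed
  next
    assume "z \<in> code_seq ` {ts \<in> LL. length ts \<le> n}"
    then obtain ts where ts: "ts \<in> LL" "length ts \<le> n" "z = code_seq ts" by blast
    show "z \<in> elts (FL (nat_ord n))"
    proof (cases ts)
      case Nil then show ?thesis using ts unfolding elts_FL[of "nat_ord n"] by simp
    next
      case (Cons t ts')
      then have "code_seq ts' \<in> elts (FL (nat_ord (n - 1)))" "n - 1 < n"
        using less[of "n - 1"] ts by auto
      moreover have "code_block t \<in> elts BQ" using ts Cons elts_BQ by auto
      ultimately show ?thesis
        unfolding elts_FL[of "nat_ord n"] elts_nat_ord using ts Cons by auto
    qed
  qed
  then show ?case by blast
qed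

definition LC :: 'a where
  "LC = bigU (vset (FL ` elts omega))"

lemma LC_V: "LC \<in> V"
  unfolding LC_def by (intro V_bigU replacement_fn dfn_FL V_omega)

lemma elts_LC: "elts LC = code_seq ` LL"
proof -
  have "elts LC = \<Union> (elts ` FL ` elts omega)"
    unfolding LC_def elts_bigU elts_vset_image ..
  also have "\<dots> = (\<Union>n. elts (FL (nat_ord n)))"
    unfolding elts_omega by blast
  finally have "elts LC = (\<Union>n. elts (FL (nat_ord n)))" .
  then show ?thesis unfolding FL_nat by blast
qed

text \<open>Total, with the default [] off \<open>LC\<close>, so that lists can be handled as
  functions of an assignment without side conditions.\<close>

definition dec :: "'a \<Rightarrow> 'a block list" where
  "dec c = (if c \<in> elts LC then inv_into LL code_seq c else [])"

lemma dec_code [simp]: "ts \<in> LL \<Longrightarrow> dec (code_seq ts) = ts"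
  unfolding dec_def using elts_LC code_seq_inj by (auto intro!: inv_into_f_eq inj_onI)

lemma dec_LL [simp]: "dec c \<in> LL"
  unfolding dec_def using elts_LC by (auto intro: inv_into_into)

lemma code_dec: "code_seq (dec c) = (if c \<in> elts LC then c else vset {})"
  unfolding dec_def using elts_LC by (auto intro: f_inv_into_f)

lemma code_LC: "ts \<in> LL \<Longrightarrow> code_seq ts \<in> elts LC"
  using elts_LC by blast

lemma LC_simps [simp]: "vset {} \<in> elts LC" "blk t \<Longrightarrow> ts \<in> LL \<Longrightarrow> opair (code_block t) (code_seq ts) \<in> elts LC"
  using code_LC[of "[]"] code_LC[of "t # ts"] by simp_all

lemma code_seq_empty [simp]: "code_seq ts = vset {} \<longleftrightarrow> ts = []"
  by (cases ts) auto

lemma code_V: "ts \<in> LL \<Longrightarrow> code_seq ts \<in> V"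
  using code_LC V_trans LC_V by blast


section \<open>Definability of the relations between blocks and between lists\<close>

definition kapc :: "'a \<Rightarrow> 'a \<Rightarrow> bool" where
  "kapc t a \<longleftrightarrow> (t \<in> elts \<kappa> \<and> a = t) \<or> (\<exists>B\<in>V. t = opair a B)"

definition bsc :: "'a \<Rightarrow> 'a \<Rightarrow> bool" where
  "bsc t \<xi> \<longleftrightarrow> (\<exists>a\<in>V. \<exists>B\<in>V. t = opair a B \<and> \<xi> \<in> elts B)"

lemma dfp_kapc [df]: "dff t \<Longrightarrow> dff u \<Longrightarrow> dfp (\<lambda>s. kapc (t s) (u s))"
  unfolding kapc_def by (intro df dff_shift coh_basic)

lemma dfp_bsc [df]: "dff t \<Longrightarrow> dff u \<Longrightarrow> dfp (\<lambda>s. bsc (t s) (u s))"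
  unfolding bsc_def by (intro df dff_shift coh_basic)

lemma opair_notin: "opair a B \<notin> elts \<kappa>"
  using not_Ord_opair Ord_in_Ord[OF coh_basic(3)] by blast

lemma blk_kap_V: "blk t \<Longrightarrow> kap t \<in> V"
  unfolding blk_def using coh_basic(2) V_trans by (auto split: block.splits)

lemma kapc: "blk t \<Longrightarrow> kapc (code_block t) a \<longleftrightarrow> a = kap t"
  unfolding kapc_def blk_def using opair_notin by (cases t) (auto simp: blk_def)

lemma bsc: "blk t \<Longrightarrow> bsc (code_block t) \<xi> \<longleftrightarrow> \<xi> \<in> bset t"
  using blk_kap_V[of t] opair_notin unfolding bsc_def by (cases t) (auto simp: blk_def)

lemma blk_bset_V: "blk t \<Longrightarrow> \<xi> \<in> bset t \<Longrightarrow> \<xi> \<in> V"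
  unfolding blk_def using V_trans by (auto split: block.splits)

lemma blk_code_V: "blk t \<Longrightarrow> code_block t \<in> V"
  using elts_BQ BQ_V V_trans by blast

definition mtchc where "mtchc t s \<longleftrightarrow> (\<exists>a\<in>V. kapc t a \<and> kapc s a) \<and> (\<forall>\<xi>\<in>V. bsc s \<xi> \<longrightarrow> bsc t \<xi>)"
definition insc where "insc t s \<longleftrightarrow> (\<exists>a\<in>V. kapc s a \<and> bsc t a \<and> (\<forall>\<xi>\<in>V. bsc s \<xi> \<longrightarrow> bsc t \<xi> \<and> \<xi> \<in> elts a))"
definition lkc where "lkc t s \<longleftrightarrow> (\<exists>a\<in>V. \<exists>b\<in>V. kapc t a \<and> kapc s b \<and> a \<in> elts b \<and> (\<forall>\<xi>\<in>V. bsc s \<xi> \<longrightarrow> a \<in> elts \<xi>))"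
definition okc where "okc t \<longleftrightarrow> (t \<in> elts \<kappa> \<and> \<not> (\<exists>\<beta>\<in>V. ob t \<beta>)) \<or>
   (\<exists>a\<in>V. \<exists>B\<in>V. t = opair a B \<and> (\<exists>\<beta>\<in>V. ob a \<beta>) \<and> MI a B)"

lemma block_codes:
  assumes "blk t" "blk s"
  shows "mtchc (code_block t) (code_block s) \<longleftrightarrow> mtch t s"
    "insc (code_block t) (code_block s) \<longleftrightarrow> insb t s"
    "lkc (code_block t) (code_block s) \<longleftrightarrow> lk t s"
    "okc (code_block t) \<longleftrightarrow> okb t"
proof -
  note V = blk_bset_V[OF assms(1)] blk_bset_V[OF assms(2)] blk_kap_V[OF assms(1)] blk_kap_V[OF assms(2)]
  show "mtchc (code_block t) (code_block s) \<longleftrightarrow> mtch t s"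
    "insc (code_block t) (code_block s) \<longleftrightarrow> insb t s"
    "lkc (code_block t) (code_block s) \<longleftrightarrow> lk t s"
    unfolding mtchc_def insc_def lkc_def mtch_def insb_def lk_def kapc[OF assms(1)] kapc[OF assms(2)]
      bsc[OF assms(1)] bsc[OF assms(2)] using V by auto
  show "okc (code_block t) \<longleftrightarrow> okb t"
    using assms(1) opair_notin blk_kap_V[OF assms(1)]
    unfolding okc_def okb_def by (cases t) (auto simp: blk_def)
qed

lemma dfp_mtchc [df]: "dff t \<Longrightarrow> dff u \<Longrightarrow> dfp (\<lambda>s. mtchc (t s) (u s))"
  unfolding mtchc_def by (intro df dff_shift coh_basic)

lemma dfp_insc [df]: "dff t \<Longrightarrow> dff u \<Longrightarrow> dfp (\<lambda>s. insc (t s) (u s))"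
  unfolding insc_def by (intro df dff_shift coh_basic)

lemma dfp_lkc [df]: "dff t \<Longrightarrow> dff u \<Longrightarrow> dfp (\<lambda>s. lkc (t s) (u s))"
  unfolding lkc_def by (intro df dff_shift coh_basic)

lemma dfp_okc [df]: "dff t \<Longrightarrow> dfp (\<lambda>s. okc (t s))"
  unfolding okc_def by (intro df dff_shift coh_basic)

lemma blk_code_eq: "blk t \<Longrightarrow> blk s \<Longrightarrow> code_block t = code_block s \<longleftrightarrow> t = s"
  using code_block_inj by blast

text \<open>Each relation on lists is the restriction of a fixed point, in \<^term>\<open>V\<close>, of the operator that
  describes its recursion on codes.\<close>

lemma append_set:
  obtains Z where "Z \<in> V" "\<And>x y z. x \<in> LL \<Longrightarrow> y \<in> LL \<Longrightarrow> z \<in> LL \<Longrightarrow>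
    opair (code_seq x) (opair (code_seq y) (code_seq z)) \<in> elts Z \<longleftrightarrow> z = x @ y"
proof -
  let ?Q = "\<lambda>z W. (\<exists>y\<in>V. z = opair (vset {}) (opair y y)) \<or> (\<exists>h\<in>V. \<exists>x\<in>V. \<exists>y\<in>V. \<exists>u\<in>V.
     z = opair (opair h x) (opair y (opair h u)) \<and> opair x (opair y u) \<in> elts W)"
  have d: "dfp (\<lambda>s. ?Q (s 0) (s 1))" by (intro df V_empty)
  have X: "prodV LC (prodV LC LC) \<in> V" by (intro V_prodV LC_V V_sucO coh_basic)
  have mn: "?Q z W'" if "elts W \<subseteq> elts W'" "?Q z W" for z W W'
    using that by blast
  obtain Z where Z: "Z \<in> V" "elts Z \<subseteq> elts (prodV LC (prodV LC LC))"
      "\<And>z. z \<in> elts (prodV LC (prodV LC LC)) \<Longrightarrow> z \<in> elts Z \<longleftrightarrow> ?Q z Z"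
    by (rule fixpoint[of "prodV LC (prodV LC LC)" ?Q, OF X d]; (rule mn; assumption | rule that; assumption))
  have "opair (code_seq x) (opair (code_seq y) (code_seq z)) \<in> elts Z \<longleftrightarrow> z = x @ y"
    if "x \<in> LL" "y \<in> LL" "z \<in> LL" for x y z
    using that
  proof (induction x arbitrary: z)
    case Nil
    then show ?case
      using code_seq_inj code_V by (subst Z(3)) (auto simp: prodV_opair code_LC dest: code_seq_inj)
  next
    case (Cons h x)
    then have V: "code_block h \<in> V" "code_seq x \<in> V" "code_seq y \<in> V" "code_seq z \<in> V"
      using blk_code_V code_V by auto
    have "opair (code_seq (h # x)) (opair (code_seq y) (code_seq z)) \<in> elts Z \<longleftrightarrow>
      (\<exists>u\<in>V. code_seq z = opair (code_block h) u \<and> opair (code_seq x) (opair (code_seq y) u) \<in> elts Z)"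
      using Cons V by (subst Z(3)) (auto simp: prodV_opair code_LC)
    also have "\<dots> \<longleftrightarrow> z = (h # x) @ y"
    proof (cases z)
      case (Cons h' z')
      then show ?thesis using Cons.IH[of z'] Cons.prems V_opairD[of "code_block h'" "code_seq z'"] V blk_code_eq by auto
    qed simp
    finally show ?case .
  qed
  then show thesis using that Z(1) by blast
qed

lemma ble_set:
  obtains Z where "Z \<in> V" "\<And>x y. x \<in> LL \<Longrightarrow> y \<in> LL \<Longrightarrow> opair (code_seq x) (code_seq y) \<in> elts Z \<longleftrightarrow> ble x y"
proof -
  let ?Q = "\<lambda>z W. z = opair (vset {}) (vset {}) \<or> (\<exists>h\<in>V. \<exists>x\<in>V. \<exists>g\<in>V. \<exists>y\<in>V. z = opair (opair h x) (opair g y) \<and>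
     ((mtchc h g \<and> opair x y \<in> elts W) \<or> (insc h g \<and> opair (opair h x) y \<in> elts W)))"
  have d: "dfp (\<lambda>s. ?Q (s 0) (s 1))" by (intro df V_empty)
  have X: "prodV LC LC \<in> V" by (intro V_prodV LC_V V_sucO coh_basic)
  have mn: "?Q z W'" if "elts W \<subseteq> elts W'" "?Q z W" for z W W'
    using that by blast
  obtain Z where Z: "Z \<in> V" "elts Z \<subseteq> elts (prodV LC LC)" "\<And>z. z \<in> elts (prodV LC LC) \<Longrightarrow> z \<in> elts Z \<longleftrightarrow> ?Q z Z"
    by (rule fixpoint[of "prodV LC LC" ?Q, OF X d]; (rule mn; assumption | rule that; assumption))
  have "opair (code_seq x) (code_seq y) \<in> elts Z \<longleftrightarrow> ble x y" if "x \<in> LL" "y \<in> LL" for x y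
    using that
  proof (induction x y rule: ble.induct)
    case (1 ss)
    then show ?case by (subst Z(3)) (cases ss, auto simp: prodV_opair code_LC)
  next
    case (2 t ts)
    then show ?case by (subst Z(3)) (auto simp: prodV_opair code_LC)
  next
    case (3 t ts s ss)
    then have V: "code_block t \<in> V" "code_seq ts \<in> V" "code_block s \<in> V" "code_seq ss \<in> V" "blk t" "blk s"
      using blk_code_V code_V by auto
    have m: "opair (code_seq (t # ts)) (code_seq (s # ss)) \<in> elts (prodV LC LC)"
      using 3 code_LC prodV_opair by blast
    have "opair (code_seq (t # ts)) (code_seq (s # ss)) \<in> elts Z \<longleftrightarrow>
      (mtchc (code_block t) (code_block s) \<and> opair (code_seq ts) (code_seq ss) \<in> elts Z) \<or>
      (insc (code_block t) (code_block s) \<and> opair (code_seq (t # ts)) (code_seq ss) \<in> elts Z)"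
      unfolding Z(3)[OF m] using V by auto
    then show ?case using 3 block_codes[OF V(5,6)] by auto
  qed
  then show thesis using that Z(1) by blast
qed

lemma cond_set:
  obtains Z where "Z \<in> V" "elts Z = code_seq ` {ts. cond ts}"
proof -
  let ?Q = "\<lambda>z W. \<exists>h\<in>V. \<exists>x\<in>V. z = opair h x \<and> okc h \<and> ((x = vset {} \<and> (\<exists>B\<in>V. h = opair \<kappa> B)) \<or>
     (x \<in> elts W \<and> (\<exists>g\<in>V. \<exists>y\<in>V. x = opair g y \<and> lkc h g)))"
  have d: "dfp (\<lambda>s. ?Q (s 0) (s 1))" by (intro df V_empty coh_basic)
  have X: "LC \<in> V" by (intro V_prodV LC_V V_sucO coh_basic)
  have mn: "?Q z W'" if "elts W \<subseteq> elts W'" "?Q z W" for z W W'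
    using that by blast
  obtain Z where Z: "Z \<in> V" "elts Z \<subseteq> elts LC" "\<And>z. z \<in> elts LC \<Longrightarrow> z \<in> elts Z \<longleftrightarrow> ?Q z Z"
    by (rule fixpoint[of "LC" ?Q, OF X d]; (rule mn; assumption | rule that; assumption))
  have *: "code_seq x \<in> elts Z \<longleftrightarrow> cond x" if "x \<in> LL" for x
    using that
  proof (induction x)
    case Nil
    show ?case using Z(3)[OF code_LC[of "[]"]] by (simp add: cond_def)
  next
    case (Cons t ts)
    then have V: "code_block t \<in> V" "code_seq ts \<in> V" "blk t" "ts \<in> LL"
      using blk_code_V code_V by auto
    have tl: "(\<exists>g\<in>V. \<exists>y\<in>V. code_seq ts = opair g y \<and> lkc (code_block t) g) \<longleftrightarrow> ts \<noteq> [] \<and> lk t (hd ts)"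
    proof (cases ts)
      case (Cons s ss)
      then have "blk s" "code_block s \<in> V" "code_seq ss \<in> V" using V(4) blk_code_V code_V by auto
      then show ?thesis using Cons block_codes(3)[OF V(3), of s] by auto
    qed simp
    have lst: "(\<exists>B\<in>V. code_block t = opair \<kappa> B) \<longleftrightarrow> (\<exists>B. t = Large \<kappa> B)"
      using V(3) opair_notin unfolding blk_def by (cases t) auto
    have nil: "code_seq ts = vset {} \<longleftrightarrow> ts = []" by (cases ts) auto
    have "code_seq (t # ts) \<in> elts Z \<longleftrightarrow> okb t \<and> ((ts = [] \<and> (\<exists>B. t = Large \<kappa> B)) \<or>
       (cond ts \<and> ts \<noteq> [] \<and> lk t (hd ts)))"
      unfolding Z(3)[OF code_LC[OF Cons(2)]] using V tl lst nil Cons(1) block_codes(4)[OF V(3) V(3)] by simp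
    also have "\<dots> \<longleftrightarrow> cond (t # ts)"
      by (cases "ts = []") (auto simp: cond_def successively_Cons)
    finally show ?case .
  qed
  have "elts Z = code_seq ` {ts. cond ts}"
  proof (intro set_eqI iffI)
    fix z assume "z \<in> elts Z"
    then obtain x where "x \<in> LL" "z = code_seq x" using Z(2) elts_LC by blast
    then show "z \<in> code_seq ` {ts. cond ts}" using * \<open>z \<in> elts Z\<close> by blast
  next
    fix z assume "z \<in> code_seq ` {ts. cond ts}"
    then show "z \<in> elts Z" using * cond_LL by blast
  qed
  then show thesis using that Z(1) by blast
qed

lemma cond_code: "ts \<in> LL \<Longrightarrow> code_seq ts \<in> code_seq ` {ts. cond ts} \<longleftrightarrow> cond ts"
  using code_seq_inj cond_LL by (auto simp: image_iff)

definition below :: "'a block list \<Rightarrow> 'a \<Rightarrow> bool" where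
  "below l b \<longleftrightarrow> (\<forall>t\<in>set l. kap t \<in> elts b)"

lemma below_simps [simp]: "below [] b" "below (t # l) b \<longleftrightarrow> kap t \<in> elts b \<and> below l b"
  "below (l @ l') b \<longleftrightarrow> below l b \<and> below l' b"
  by (auto simp: below_def)

text \<open>The bound \<open>b\<close> is confined to a set of V so that the relation is one too.
  Ordinals of blocks do not exceed \<kappa>, so \<open>dfp_below\<close> may cut an arbitrary bound
  down to this range.\<close>

lemma below_set:
  obtains Z where "Z \<in> V" "\<And>x b. x \<in> LL \<Longrightarrow> b \<in> elts (powV (sucO \<kappa>)) \<Longrightarrow> opair (code_seq x) b \<in> elts Z \<longleftrightarrow> below x b"
proof -
  let ?Q = "\<lambda>z W. \<exists>c\<in>V. \<exists>b\<in>V. z = opair c b \<and> (c = vset {} \<or> (\<exists>h\<in>V. \<exists>x\<in>V. c = opair h x \<and>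
     (\<exists>a\<in>V. kapc h a \<and> a \<in> elts b) \<and> opair x b \<in> elts W))"
  have d: "dfp (\<lambda>s. ?Q (s 0) (s 1))" by (intro df V_empty coh_basic)
  have X: "prodV LC (powV (sucO \<kappa>)) \<in> V" by (intro V_prodV LC_V powV(1) V_sucO coh_basic)
  have mn: "?Q z W'" if "elts W \<subseteq> elts W'" "?Q z W" for z W W'
    using that by blast
  obtain Z where Z: "Z \<in> V" "elts Z \<subseteq> elts (prodV LC (powV (sucO \<kappa>)))" 
      "\<And>z. z \<in> elts (prodV LC (powV (sucO \<kappa>))) \<Longrightarrow> z \<in> elts Z \<longleftrightarrow> ?Q z Z"
    by (rule fixpoint[of "prodV LC (powV (sucO \<kappa>))" ?Q, OF X d]; (rule mn; assumption | rule that; assumption))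
  have "opair (code_seq x) b \<in> elts Z \<longleftrightarrow> below x b" if "x \<in> LL" "b \<in> elts (powV (sucO \<kappa>))" for x b
    using that
  proof (induction x)
    case Nil
    then have "opair (code_seq []) b \<in> elts (prodV LC (powV (sucO \<kappa>)))" by (simp add: prodV_opair)
    moreover have "b \<in> V" using Nil powV(2)[OF V_sucO[OF coh_basic(2)]] by simp
    ultimately show ?case using Z(3) V_empty by auto
  next
    case (Cons t ts)
    then have m: "opair (code_seq (t # ts)) b \<in> elts (prodV LC (powV (sucO \<kappa>)))"
      by (simp add: prodV_opair)
    have V: "code_block t \<in> V" "code_seq ts \<in> V" "blk t" "b \<in> V" "code_seq (t # ts) \<in> V"
      using Cons blk_code_V code_V[of "t # ts"] code_V powV(2)[OF V_sucO[OF coh_basic(2)]] by auto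
    have "opair (code_seq (t # ts)) b \<in> elts Z \<longleftrightarrow> kap t \<in> elts b \<and> opair (code_seq ts) b \<in> elts Z"
      unfolding Z(3)[OF m] using V kapc[OF V(3)] blk_kap_V[OF V(3)] by auto
    then show ?case using Cons by auto
  qed
  then show thesis using that Z(1) by blast
qed

definition dfl :: "((nat \<Rightarrow> 'a) \<Rightarrow> 'a block list) \<Rightarrow> bool" where
  "dfl x \<longleftrightarrow> dff (\<lambda>s. code_seq (x s)) \<and> (\<forall>s. x s \<in> LL)"

lemma dfl_code: "dfl x \<Longrightarrow> dff (\<lambda>s. code_seq (x s))"
  by (simp add: dfl_def)

lemma dfl_LL: "dfl x \<Longrightarrow> x s \<in> LL"
  by (simp add: dfl_def)

lemma dfl_dec [df]: "dff t \<Longrightarrow> dfl (\<lambda>s. dec (t s))"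
proof -
  have "dfn (\<lambda>c. code_seq (dec c))"
    by (rule dfn_graph[where R = "\<lambda>c y. (c \<in> elts LC \<and> y = c) \<or> (c \<notin> elts LC \<and> y = vset {})"])
      (auto intro: code_V intro!: df LC_V V_empty simp: code_dec)
  then show "dff t \<Longrightarrow> dfl (\<lambda>s. dec (t s))"
    unfolding dfl_def using dfnD by auto
qed

lemma dfl_const [df]: "l \<in> LL \<Longrightarrow> dfl (\<lambda>s. l)"
  unfolding dfl_def using code_V by (auto intro: df)

lemma dff_code [df]: "dfl x \<Longrightarrow> dff (\<lambda>s. code_seq (x s))"
  by (simp add: dfl_def)

lemma dfl_append [df]: assumes "dfl x" "dfl y" shows "dfl (\<lambda>s. x s @ y s)"
proof -
  obtain Z where Z: "Z \<in> V" "\<And>x y z. x \<in> LL \<Longrightarrow> y \<in> LL \<Longrightarrow> z \<in> LL \<Longrightarrow>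
    opair (code_seq x) (opair (code_seq y) (code_seq z)) \<in> elts Z \<longleftrightarrow> z = x @ y"
    using append_set by blast
  have "dfp (\<lambda>s. s 0 = code_seq (x (\<lambda>n. s (Suc n)) @ y (\<lambda>n. s (Suc n))))"
  proof (rule dfp_cong)
    show "dfp (\<lambda>s. s 0 \<in> elts LC \<and> opair (code_seq (x (\<lambda>n. s (Suc n)))) (opair (code_seq (y (\<lambda>n. s (Suc n)))) (s 0)) \<in> elts Z)"
      by (intro df LC_V Z(1) dff_shift[OF dfl_code[OF assms(1)]] dff_shift[OF dfl_code[OF assms(2)]])
    fix s
    show "(s 0 \<in> elts LC \<and> opair (code_seq (x (\<lambda>n. s (Suc n)))) (opair (code_seq (y (\<lambda>n. s (Suc n)))) (s 0)) \<in> elts Z) =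
      (s 0 = code_seq (x (\<lambda>n. s (Suc n)) @ y (\<lambda>n. s (Suc n))))"
      using Z(2) dfl_LL[OF assms(1)] dfl_LL[OF assms(2)] elts_LC by auto
  qed
  then show ?thesis
    unfolding dfl_def dff_def using dfl_LL[OF assms(1)] dfl_LL[OF assms(2)] code_V by auto
qed

lemma dfp_ble [df]: assumes "dfl x" "dfl y" shows "dfp (\<lambda>s. ble (x s) (y s))"
proof -
  obtain Z where Z: "Z \<in> V" "\<And>x y. x \<in> LL \<Longrightarrow> y \<in> LL \<Longrightarrow> opair (code_seq x) (code_seq y) \<in> elts Z \<longleftrightarrow> ble x y"
    using ble_set by blast
  have "dfp (\<lambda>s. opair (code_seq (x s)) (code_seq (y s)) \<in> elts Z)"
    by (intro df Z(1) assms)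
  then show ?thesis using Z(2) dfl_LL assms by (simp add: dfl_LL)
qed

lemma dfp_leq [df]: assumes "dfl x" "dfl y" shows "dfp (\<lambda>s. x s = y s)"
proof -
  have "dfp (\<lambda>s. code_seq (x s) = code_seq (y s))"
    by (intro df assms)
  then show ?thesis
  proof (rule dfp_cong)
    show "(code_seq (x s) = code_seq (y s)) = (x s = y s)" for s
      using code_seq_inj[OF dfl_LL[OF assms(1), of s] dfl_LL[OF assms(2), of s]] by (intro iffI) simp_all
  qed
qed

lemma dfp_cond [df]: assumes "dfl x" shows "dfp (\<lambda>s. cond (x s))"
proof -
  obtain Z where Z: "Z \<in> V" "elts Z = code_seq ` {ts. cond ts}" using cond_set by blast
  have "dfp (\<lambda>s. code_seq (x s) \<in> elts Z)"
    by (intro df Z(1) assms)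
  then show ?thesis
    unfolding Z(2) cond_code[OF dfl_LL[OF assms]] .
qed

lemma LL_kap: "l \<in> LL \<Longrightarrow> t \<in> set l \<Longrightarrow> kap t \<in> insert \<kappa> (elts \<kappa>)"
  unfolding LL_def blk_def by (cases t) (force dest!: bspec split: block.splits)+

lemma dfp_below [df]: assumes "dfl x" "dff t" shows "dfp (\<lambda>s. below (x s) (t s))"
proof -
  obtain Z where Z: "Z \<in> V" "\<And>x b. x \<in> LL \<Longrightarrow> b \<in> elts (powV (sucO \<kappa>)) \<Longrightarrow> opair (code_seq x) b \<in> elts Z \<longleftrightarrow> below x b"
    using below_set by blast
  note kV = V_sucO[OF coh_basic(2)]
  have "dfp (\<lambda>s. opair (code_seq (x s)) (vset (elts (t s) \<inter> elts (sucO \<kappa>))) \<in> elts Z)"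
    by (intro df Z(1) assms kV)
  then show ?thesis
  proof (rule dfp_cong)
    fix s :: "nat \<Rightarrow> 'a" assume s: "range s \<subseteq> V"
    have "vset (elts (t s) \<inter> elts (sucO \<kappa>)) \<in> elts (powV (sucO \<kappa>))"
      unfolding powV(2)[OF kV] using V_Int[OF dff_V[OF assms(2) s] kV] by auto
    then have "(opair (code_seq (x s)) (vset (elts (t s) \<inter> elts (sucO \<kappa>))) \<in> elts Z) \<longleftrightarrow>
        below (x s) (vset (elts (t s) \<inter> elts (sucO \<kappa>)))"
      using Z(2) dfl_LL[OF assms(1)] by blast
    also have "\<dots> \<longleftrightarrow> below (x s) (t s)"
      using LL_kap[OF dfl_LL[OF assms(1)]] unfolding below_def by auto
    finally show "(opair (code_seq (x s)) (vset (elts (t s) \<inter> elts (sucO \<kappa>))) \<in> elts Z) = below (x s) (t s)" .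
  qed
qed

lemma dfp_exl [df]:
  assumes "dfp (\<lambda>s. Q (dec (s 0)) (\<lambda>n. s (Suc n)))" shows "dfp (\<lambda>s. \<exists>l\<in>LL. Q l s)"
proof -
  have "dfp (\<lambda>s. \<exists>c\<in>elts LC. Q (dec c) s)" by (intro df assms LC_V)
  moreover have "(\<exists>c\<in>elts LC. Q (dec c) s) = (\<exists>l\<in>LL. Q l s)" for s
    using elts_LC by (metis (no_types, lifting) dec_LL dec_code code_LC)
  ultimately show ?thesis by simp
qed

lemma dfp_alll [df]:
  assumes "dfp (\<lambda>s. Q (dec (s 0)) (\<lambda>n. s (Suc n)))" shows "dfp (\<lambda>s. \<forall>l\<in>LL. Q l s)"
  using dfp_not[OF dfp_exl[OF dfp_not[OF assms]]] by simp

end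

section \<open>Pressing down and diagonal intersections over lists of blocks\<close>

context nmeas begin

lemma lg_disj:
  assumes "dfp (\<lambda>s. Q (s 0))" "dfp (\<lambda>s. Q' (s 0))" "lg (\<lambda>\<xi>. Q \<xi> \<or> Q' \<xi>)"
  shows "lg Q \<or> lg Q'"
proof (rule ccontr)
  assume "\<not> ?thesis"
  then have "lg (\<lambda>\<xi>. \<not> Q \<xi>)" "lg (\<lambda>\<xi>. \<not> Q' \<xi>)"
    using lg_not[OF assms(1)] lg_not[OF assms(2)] by auto
  from lg_ex[OF lg_conj[OF assms(3) lg_conj[OF this]]] show False by blast
qed

end

context coherent begin

text \<open>A constructor that is total into \<open>LL\<close>, with default [] on improper
  arguments; it can thus be used under quantifiers over V without guards.\<close>

definition mkP :: "'a \<Rightarrow> 'a block list" where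
  "mkP a = (if a \<in> elts \<kappa> then [Point a] else [])"

definition mkL :: "'a \<Rightarrow> 'a \<Rightarrow> 'a block list" where
  "mkL a B = (if a \<in> insert \<kappa> (elts \<kappa>) \<and> B \<in> V \<and> elts B \<subseteq> elts a then [Large a B] else [])"

lemma dfl_mkP [df]: "dff t \<Longrightarrow> dfl (\<lambda>s. mkP (t s))"
proof -
  have "dfn (\<lambda>a. code_seq (mkP a))"
    by (rule dfn_graph[where R = "\<lambda>a y. (a \<in> elts \<kappa> \<and> y = opair a (vset {})) \<or> (a \<notin> elts \<kappa> \<and> y = vset {})"])
      (auto simp: mkP_def blk_def intro!: df coh_basic V_empty V_opair)
  then show "dff t \<Longrightarrow> dfl (\<lambda>s. mkP (t s))"
    unfolding dfl_def using dfnD by (auto simp: mkP_def blk_def)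
qed

lemma mkL_LL: "mkL a B \<in> LL"
  by (auto simp: mkL_def blk_def)

lemma dfl_mkL [df]: assumes "dff t" "dff u" shows "dfl (\<lambda>s. mkL (t s) (u s))"
proof -
  have "dff (\<lambda>s. code_seq (mkL (t s) (u s)))"
  proof (rule dff2I[of "\<lambda>a B. code_seq (mkL a B)"])
    have "dfp (\<lambda>s. ((s 1 = \<kappa> \<or> s 1 \<in> elts \<kappa>) \<and> elts (s 2) \<subseteq> elts (s 1) \<and> s 0 = opair (opair (s 1) (s 2)) (vset {})) \<or>
       (\<not> ((s 1 = \<kappa> \<or> s 1 \<in> elts \<kappa>) \<and> elts (s 2) \<subseteq> elts (s 1)) \<and> s 0 = vset {}))"
      by (intro df coh_basic V_empty)
    then show "dfp (\<lambda>s. s 0 = code_seq (mkL (s 1) (s 2)))"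
      by (rule dfp_cong) (auto simp: mkL_def image_subset_iff)
  qed (use assms mkL_LL code_V in auto)
  then show ?thesis unfolding dfl_def using mkL_LL by blast
qed

lemma below_mkL: "a \<in> elts \<xi> \<Longrightarrow> below (mkL a B) \<xi>"
  by (simp add: mkL_def)

lemma dfl_shift: "dfl x \<Longrightarrow> dfl (\<lambda>s. x (\<lambda>n. s (Suc n)))"
  unfolding dfl_def using dff_shift[of "\<lambda>s. code_seq (x s)"] by blast

lemma mkL_eq: "a \<in> insert \<kappa> (elts \<kappa>) \<Longrightarrow> B \<in> V \<Longrightarrow> elts B \<subseteq> elts a \<Longrightarrow> mkL a B = [Large a B]"
  by (simp add: mkL_def)

abbreviation lgm :: "'a \<Rightarrow> 'a \<Rightarrow> ('a \<Rightarrow> bool) \<Rightarrow> bool" where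
  "lgm \<gamma> k \<equiv> nmeas.lg \<gamma> (meas \<gamma> k)"

lemma FL_length: "l \<in> LL \<Longrightarrow> code_seq l \<in> elts (FL (nat_ord n)) \<longleftrightarrow> length l \<le> n"
  unfolding FL_nat using code_seq_inj by blast

lemma nat_ord_V: "nat_ord n \<in> V"
  using V_trans[OF V_omega] elts_omega by blast

text \<open>Pressing down for finite sequences of blocks: the sequences below a fixed ordinal are few.\<close>

lemma pd_list:
  assumes k: "ob \<gamma> k" and d: "dfp (\<lambda>s. Q (dec (s 0)) (s 1))"
    and l: "lgm \<gamma> k (\<lambda>\<xi>. \<exists>l\<in>LL. below l \<xi> \<and> Q l \<xi>)"
  shows "\<exists>l\<in>LL. lgm \<gamma> k (\<lambda>\<xi>. below l \<xi> \<and> Q l \<xi>)"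
proof -
  interpret nmeas V \<gamma> "meas \<gamma> k" using nmeas[OF k] .
  have gk: "\<xi> \<in> elts \<kappa>" if "\<xi> \<in> elts \<gamma>" for \<xi>
    using obD(1)[OF k] Ord_trans[OF coh_basic(3) that] that by auto
  \<comment> \<open>Induction on the length with the head absorbed into \<open>Q\<close>: the tail
    is made constant first, then the ordinal of the head by normality, then its set by
    \<open>pd_pow\<close>. The length itself is fixed at the end by completeness.\<close>
  have claim: "\<exists>l\<in>LL. lg (\<lambda>\<xi>. below l \<xi> \<and> Q l \<xi>)"
    if "dfp (\<lambda>s. Q (dec (s 0)) (s 1))" "lg (\<lambda>\<xi>. \<exists>l\<in>LL. code_seq l \<in> elts (FL (nat_ord n)) \<and> below l \<xi> \<and> Q l \<xi>)" for Q n
    using that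
  proof (induction n arbitrary: Q)
    case 0
    have dQ: "dfp (\<lambda>s. Q (x s) (t s))" if "dfl x" "dff t" for x t
      using dfp2I[OF 0(1) dfl_code[OF that(1)] that(2)] dfl_LL[OF that(1)] by simp
    have "lg (Q [])"
      by (rule lg_mono[OF 0(2)]) (use FL_length[of _ 0] in \<open>auto intro!: dQ df\<close>)
    then show ?case by (intro bexI[of _ "[]"]) auto
  next
    case (Suc n)
    have dQ: "dfp (\<lambda>s. Q (x s) (t s))" if "dfl x" "dff t" for x t
      using dfp2I[OF Suc(2) dfl_code[OF that(1)] that(2)] dfl_LL[OF that(1)] by simp
    let ?Q2 = "\<lambda>l \<xi>. \<exists>a\<in>elts \<xi>. a \<in> elts \<kappa> \<and> Q (mkP a @ l) \<xi>"
    let ?Q3 = "\<lambda>l \<xi>. \<exists>a\<in>elts \<xi>. \<exists>B\<in>elts (powV a). a \<in> elts \<kappa> \<and> Q (mkL a B @ l) \<xi>"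
    let ?E = "\<lambda>Q \<xi>. \<exists>l\<in>LL. code_seq l \<in> elts (FL (nat_ord n)) \<and> below l \<xi> \<and> Q l \<xi>"
    have d2: "dfp (\<lambda>s. ?Q2 (dec (s 0)) (s 1))" "dfp (\<lambda>s. ?Q3 (dec (s 0)) (s 1))"
      by (intro df dQ coh_basic)+
    have dE: "dfp (\<lambda>s. ?E ?Q2 (s 0))" "dfp (\<lambda>s. ?E ?Q3 (s 0))"
      by (intro df dQ coh_basic nat_ord_V LL_simps(1) dfn_V[OF dfn_FL])+
    have "lg (\<lambda>\<xi>. Q [] \<xi> \<or> ?E ?Q2 \<xi> \<or> ?E ?Q3 \<xi>)"
    proof (rule lg_mono[OF Suc(3)])
      fix \<xi> assume xi: "\<xi> \<in> elts \<gamma>" and "\<exists>l\<in>LL. code_seq l \<in> elts (FL (nat_ord (Suc n))) \<and> below l \<xi> \<and> Q l \<xi>"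
      then obtain l where l: "l \<in> LL" "length l \<le> Suc n" "below l \<xi>" "Q l \<xi>" using FL_length by blast
      show "Q [] \<xi> \<or> ?E ?Q2 \<xi> \<or> ?E ?Q3 \<xi>"
      proof (cases l)
        case Nil then show ?thesis using l by simp
      next
        case (Cons t l')
        then have l': "l' \<in> LL" "code_seq l' \<in> elts (FL (nat_ord n))" "below l' \<xi>" "kap t \<in> elts \<xi>" "blk t"
          using l FL_length by auto
        have kt: "kap t \<in> elts \<kappa>" using l'(4) gk[OF xi] Ord_trans[OF coh_basic(3)] by blast
        show ?thesis
        proof (cases t)
          case (Point a)
          then have "?Q2 l' \<xi>" using l' kt l(4) Cons by (auto simp: mkP_def)
          then show ?thesis using l' by blast
        next
          case (Large a B)
          then have aB: "B \<in> V" "elts B \<subseteq> elts a" "a \<in> V" "a \<in> elts \<kappa>"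
            using l'(5) kt V_trans[OF coh_basic(2)] by (auto simp: blk_def)
          then have "B \<in> elts (powV a)" "mkL a B = [Large a B]"
            using powV(2) by (auto simp: mkL_def)
          moreover from this have "Q (mkL a B @ l') \<xi>" using l(4) Cons Large by simp
          ultimately have "?Q3 l' \<xi>" using l'(4) aB(4) Large by (intro bexI[of _ a] bexI[of _ B]) auto
          then show ?thesis using l' by blast
        qed
      qed
    qed (intro df dQ coh_basic nat_ord_V LL_simps(1) dfn_V[OF dfn_FL])
    then consider "lg (Q [])" | "lg (?E ?Q2)" | "lg (?E ?Q3)"
      using lg_disj[OF dQ[OF dfl_const[of "[]"] dff_var[of 0]] dfp_disj[OF dE]] lg_disj[OF dE] by fastforce
    then show ?case
    proof cases
      case 1
      then show ?thesis by (intro bexI[of _ "[]"]) auto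
    next
      case 2
      from Suc(1)[OF d2(1) 2] obtain l where l: "l \<in> LL" "lg (\<lambda>\<xi>. below l \<xi> \<and> ?Q2 l \<xi>)" by blast
      have dd: "dfp (\<lambda>s. below l (s 1) \<and> s 0 \<in> elts \<kappa> \<and> Q (mkP (s 0) @ l) (s 1))"
        by (intro df dQ l(1) coh_basic)
      have "lg (\<lambda>\<xi>. \<exists>a\<in>elts \<xi>. below l \<xi> \<and> a \<in> elts \<kappa> \<and> Q (mkP a @ l) \<xi>)"
        by (rule lg_mono[OF l(2)]) (auto intro!: df dQ l(1) coh_basic)
      from pd_ord[OF dd this] obtain a where a: "a \<in> elts \<gamma>" "lg (\<lambda>\<xi>. below l \<xi> \<and> a \<in> elts \<kappa> \<and> Q (mkP a @ l) \<xi>)"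
        by blast
      have aV: "a \<in> V" using V_trans nm_basic(2) a by blast
      have "lg (\<lambda>\<xi>. below (mkP a @ l) \<xi> \<and> Q (mkP a @ l) \<xi>)"
        by (rule lg_mono[OF lg_conj[OF a(2) lg_above[OF a(1)]]])
          (auto simp: mkP_def intro!: df dQ l(1) aV blk_def[THEN iffD2])
      then show ?thesis using l(1) by (intro bexI[of _ "mkP a @ l"]) (auto simp: mkP_def blk_def)
    next
      case 3
      from Suc(1)[OF d2(2) 3] obtain l where l: "l \<in> LL" "lg (\<lambda>\<xi>. below l \<xi> \<and> ?Q3 l \<xi>)" by blast
      have dd: "dfp (\<lambda>s. below l (s 1) \<and> (\<exists>B\<in>elts (powV (s 0)). s 0 \<in> elts \<kappa> \<and> Q (mkL (s 0) B @ l) (s 1)))"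
        by (intro df dQ l(1) coh_basic)
      have "lg (\<lambda>\<xi>. \<exists>a\<in>elts \<xi>. below l \<xi> \<and> (\<exists>B\<in>elts (powV a). a \<in> elts \<kappa> \<and> Q (mkL a B @ l) \<xi>))"
        by (rule lg_mono[OF l(2)]) (auto intro!: df dQ l(1) coh_basic)
      from pd_ord[OF dd this] obtain a where a: "a \<in> elts \<gamma>"
          "lg (\<lambda>\<xi>. below l \<xi> \<and> (\<exists>B\<in>elts (powV a). a \<in> elts \<kappa> \<and> Q (mkL a B @ l) \<xi>))"
        by blast
      have aV: "a \<in> V" using V_trans nm_basic(2) a by blast
      have dd: "dfp (\<lambda>s. below l (s 1) \<and> a \<in> elts \<kappa> \<and> Q (mkL a (s 0) @ l) (s 1))"
        by (intro df dQ l(1) coh_basic aV)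
      have "lg (\<lambda>\<xi>. \<exists>B\<in>elts (powV a). below l \<xi> \<and> a \<in> elts \<kappa> \<and> Q (mkL a B @ l) \<xi>)"
        by (rule lg_mono[OF a(2)]) (auto intro!: df dQ l(1) coh_basic aV)
      from pd_pow[OF dd a(1) this] obtain B where B: "B \<in> elts (powV a)"
         "lg (\<lambda>\<xi>. below l \<xi> \<and> a \<in> elts \<kappa> \<and> Q (mkL a B @ l) \<xi>)" by blast
      have BV: "B \<in> V" using B powV(2)[OF aV] by blast
      have lL: "mkL a B @ l \<in> LL" using mkL_LL l(1) by simp
      have "lg (\<lambda>\<xi>. below (mkL a B @ l) \<xi> \<and> Q (mkL a B @ l) \<xi>)"
      proof (rule lg_mono[OF lg_conj[OF B(2) lg_above[OF a(1)]]])
        show "dfp (\<lambda>s. below (mkL a B @ l) (s 0) \<and> Q (mkL a B @ l) (s 0))"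
          by (intro dfp_conj dfp_below dQ dfl_const[OF lL] dff_var)
      qed (simp add: below_mkL)
      then show ?thesis using l(1) mkL_LL by (intro bexI[of _ "mkL a B @ l"]) auto
    qed
  qed
  have dQ: "dfp (\<lambda>s. Q (x s) (t s))" if "dfl x" "dff t" for x t
    using dfp2I[OF d dfl_code[OF that(1)] that(2)] dfl_LL[OF that(1)] by simp
  have "lg (\<lambda>\<xi>. \<exists>n\<in>elts omega. \<exists>l\<in>LL. code_seq l \<in> elts (FL n) \<and> below l \<xi> \<and> Q l \<xi>)"
  proof (rule lg_mono[OF l])
    fix \<xi> assume "\<exists>l\<in>LL. below l \<xi> \<and> Q l \<xi>"
    then obtain l where "l \<in> LL" "below l \<xi>" "Q l \<xi>" by blast
    then show "\<exists>n\<in>elts omega. \<exists>l\<in>LL. code_seq l \<in> elts (FL n) \<and> below l \<xi> \<and> Q l \<xi>"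
      using FL_length[of l "length l"] elts_omega by (intro bexI[of _ "nat_ord (length l)"] bexI[of _ l]) auto
  qed (intro df V_omega dQ)
  moreover have "dfp (\<lambda>s. \<exists>l\<in>LL. code_seq l \<in> elts (FL (s 0)) \<and> below l (s 1) \<and> Q l (s 1))"
    by (intro df dQ)
  ultimately obtain n where n: "n \<in> elts omega" "lg (\<lambda>\<xi>. \<exists>l\<in>LL. code_seq l \<in> elts (FL n) \<and> below l \<xi> \<and> Q l \<xi>)"
    using pd_bound[of "\<lambda>n \<xi>. \<exists>l\<in>LL. code_seq l \<in> elts (FL n) \<and> below l \<xi> \<and> Q l \<xi>" omega] nm_basic(4) by blast
  then obtain m where "n = nat_ord m" using elts_omega by blast
  then show ?thesis using claim[OF d] n(2) by blast
qed

lemma MI_lg: "MI \<gamma> (vset {\<xi> \<in> elts \<gamma>. Q \<xi>}) \<longleftrightarrow> (\<forall>k. ob \<gamma> k \<longrightarrow> lgm \<gamma> k Q)"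
  unfolding MI_iff using nmeas nmeas.lg_def by blast

text \<open>Pressing down for lists in contrapositive form, applied to each measure on \<gamma>
  separately.\<close>

lemma MI_diag:
  assumes d: "dfp (\<lambda>s. Q (dec (s 0)) (s 1))" 
    and m: "\<And>l. l \<in> LL \<Longrightarrow> below l \<gamma> \<Longrightarrow> MI \<gamma> (vset {\<xi> \<in> elts \<gamma>. Q l \<xi>})"
  shows "MI \<gamma> (vset {\<xi> \<in> elts \<gamma>. \<forall>l\<in>LL. below l \<xi> \<longrightarrow> Q l \<xi>})"
  unfolding MI_lg
proof (intro allI impI)
  fix k assume k: "ob \<gamma> k"
  interpret nmeas V \<gamma> "meas \<gamma> k" using nmeas[OF k] .
  have dQ: "dfp (\<lambda>s. Q (x s) (t s))" if "dfl x" "dff t" for x t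
    using dfp2I[OF d dfl_code[OF that(1)] that(2)] dfl_LL[OF that(1)] by simp
  show "lg (\<lambda>\<xi>. \<forall>l\<in>LL. below l \<xi> \<longrightarrow> Q l \<xi>)"
  proof (rule ccontr)
    assume n: "\<not> lg (\<lambda>\<xi>. \<forall>l\<in>LL. below l \<xi> \<longrightarrow> Q l \<xi>)"
    have "lg (\<lambda>\<xi>. \<not> (\<forall>l\<in>LL. below l \<xi> \<longrightarrow> Q l \<xi>))"
      using n by (subst lg_not) (auto intro!: df dQ)
    then have "lg (\<lambda>\<xi>. \<exists>l\<in>LL. below l \<xi> \<and> \<not> Q l \<xi>)" by (simp cong: conj_cong)
    from pd_list[OF k dfp_not[OF d] this] obtain l where l: "l \<in> LL" "lg (\<lambda>\<xi>. below l \<xi> \<and> \<not> Q l \<xi>)" by blast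
    from lg_ex[OF l(2)] have "below l \<gamma>" using Ord_trans[OF nm_basic(3)] unfolding below_def by blast
    then have "lg (Q l)" using m[OF l(1)] k MI_lg by blast
    from lg_ex[OF lg_conj[OF l(2) this]] show False by blast
  qed
qed

text \<open>The dual of \<open>coherence_all\<close>, obtained from the complement of
  \<open>X\<close>: an ultrafilter omits the complement iff it contains \<open>X\<close>.\<close>

lemma coherence_ex:
  assumes k: "ob \<gamma> k" and X: "X \<in> V" "elts X \<subseteq> elts \<gamma>"
  shows "lgm \<gamma> k (\<lambda>\<nu>. \<exists>i\<in>V. ob \<nu> i \<and> vset (elts X \<inter> elts \<nu>) \<in> elts (meas \<nu> i)) \<longleftrightarrow> (\<exists>i\<in>elts k. X \<in> elts (meas \<gamma> i))"
proof -
  interpret nmeas V \<gamma> "meas \<gamma> k" using nmeas[OF k] .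
  let ?Y = "vset (elts \<gamma> - elts X)"
  have Y: "?Y \<in> V" "elts ?Y \<subseteq> elts \<gamma>" using V_Diff nm_basic(2) X by auto
  have comp: "vset (elts ?Y \<inter> elts \<nu>) \<in> elts (meas \<nu> i) \<longleftrightarrow> vset (elts X \<inter> elts \<nu>) \<notin> elts (meas \<nu> i)"
    if o: "ob \<nu> i" and sub: "elts \<nu> \<subseteq> elts \<gamma>" for \<nu> i
  proof -
    interpret n: nmeas V \<nu> "meas \<nu> i" using nmeas[OF o] .
    have 1: "{\<xi> \<in> elts \<nu>. \<xi> \<in> elts X} = elts X \<inter> elts \<nu>" "{\<xi> \<in> elts \<nu>. \<xi> \<notin> elts X} = elts ?Y \<inter> elts \<nu>"
      using sub by auto
    have "n.lg (\<lambda>\<xi>. \<xi> \<notin> elts X) \<longleftrightarrow> \<not> n.lg (\<lambda>\<xi>. \<xi> \<in> elts X)"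
      by (rule n.lg_not) (intro df X)
    then show ?thesis unfolding n.lg_def 1 .
  qed
  have sub: "elts \<nu> \<subseteq> elts \<gamma>" if "\<nu> \<in> elts \<gamma>" for \<nu> using Ord_subset nm_basic(3) that by blast
  have a: "lg (\<lambda>\<nu>. \<exists>i\<in>V. ob \<nu> i \<and> vset (elts X \<inter> elts \<nu>) \<in> elts (meas \<nu> i)) \<longleftrightarrow>
     lg (\<lambda>\<nu>. \<not> MI \<nu> (vset (elts ?Y \<inter> elts \<nu>)))"
    by (rule lg_cong) (use comp sub obD(3) in \<open>auto simp: MI_iff\<close>)
  have b: "dfp (\<lambda>s. MI (s 0) (vset (elts ?Y \<inter> elts (s 0))))"
    by (intro dfp_MI dff_var dff_Int dff_const Y)
  have c: "?Y \<in> elts (meas \<gamma> i) \<longleftrightarrow> X \<notin> elts (meas \<gamma> i)" if "i \<in> elts k" for i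
    using comp[OF obD(7)[OF k that] subset_refl] X(2) by (simp add: Int_absorb2 Int_absorb1)
  show ?thesis
    unfolding a lg_not[OF b] coherence_all[OF k Y] using c by blast
qed

end

section \<open>The generic filter and the forcing relation\<close>

locale generic = coherent +
  fixes G
  assumes gen: "V_generic V (magidor \<kappa> U) (magidor_le \<kappa> U) G"
begin

definition GG :: "'a block list set" where
  "GG = {l. cond l \<and> code_seq l \<in> G}"

lemma magidor_eq: "magidor \<kappa> U = code_seq ` {ts. cond ts}"
  by (simp add: magidor_def magidor_seq_iff)

lemma magidor_le_iff: "cond p \<Longrightarrow> cond q \<Longrightarrow> magidor_le \<kappa> U (code_seq p) (code_seq q) \<longleftrightarrow> ble p q"
  unfolding magidor_le_def magidor_seq_iff magidor_seq_le_iff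
  using code_seq_inj cond_LL by blast

lemma gen_facts: "G \<subseteq> magidor \<kappa> U" "G \<noteq> {}"
  "\<forall>q\<in>G. \<forall>p\<in>magidor \<kappa> U. magidor_le \<kappa> U p q \<longrightarrow> p \<in> G"
  "\<forall>p\<in>G. \<forall>q\<in>G. \<exists>r\<in>G. magidor_le \<kappa> U p r \<and> magidor_le \<kappa> U q r"
  using gen unfolding V_generic_def by simp_all

lemma G_sub: "c \<in> G \<Longrightarrow> \<exists>p\<in>GG. c = code_seq p"
  using gen_facts(1) unfolding magidor_eq GG_def by auto

lemma GG_down: "q \<in> GG \<Longrightarrow> cond p \<Longrightarrow> ble p q \<Longrightarrow> p \<in> GG"
  using gen_facts(3) unfolding magidor_eq GG_def using magidor_le_iff by blast

lemma GG_dir: "p \<in> GG \<Longrightarrow> q \<in> GG \<Longrightarrow> \<exists>r\<in>GG. ble p r \<and> ble q r"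
proof -
  assume a: "p \<in> GG" "q \<in> GG"
  then obtain c where c: "c \<in> G" "magidor_le \<kappa> U (code_seq p) c" "magidor_le \<kappa> U (code_seq q) c"
    using gen_facts(4) unfolding GG_def by blast
  then obtain r where "r \<in> GG" "c = code_seq r" using G_sub by blast
  then show ?thesis using a c magidor_le_iff unfolding GG_def by blast
qed

lemma GG_ne: "\<exists>p. p \<in> GG"
  using gen_facts(2) G_sub by blast

lemma GG_cond: "p \<in> GG \<Longrightarrow> cond p"
  by (simp add: GG_def)

lemma genericity:
  assumes d: "dfp (\<lambda>s. Q (dec (s 0)))" and dense: "\<And>p. cond p \<Longrightarrow> \<exists>q. cond q \<and> ble p q \<and> Q q"
  shows "\<exists>p\<in>GG. Q p"
proof -
  let ?D = "vset {c \<in> elts LC. cond (dec c) \<and> Q (dec c)}"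
  have D: "?D \<in> V" by (intro V_Collect LC_V) (intro df d)
  have eD: "elts ?D = code_seq ` {p. cond p \<and> Q p}"
  proof -
    have "c \<in> elts ?D \<longleftrightarrow> c \<in> code_seq ` {p. cond p \<and> Q p}" for c
      unfolding elts_vset_Collect using cond_LL elts_LC by auto
    then show ?thesis by blast
  qed
  have "elts ?D \<subseteq> magidor \<kappa> U" unfolding eD magidor_eq by blast
  moreover have "\<exists>q\<in>elts ?D. magidor_le \<kappa> U p q" if pm: "p \<in> magidor \<kappa> U" for p
  proof -
    obtain p' where p: "p = code_seq p'" "cond p'" using pm unfolding magidor_eq by blast
    then obtain q where "cond q" "ble p' q" "Q q" using dense by blast
    then show ?thesis unfolding eD using magidor_le_iff p by blast
  qed
  moreover have "\<forall>D\<in>V. elts D \<subseteq> magidor \<kappa> U \<and> (\<forall>p\<in>magidor \<kappa> U. \<exists>q\<in>elts D. magidor_le \<kappa> U p q) \<longrightarrow> G \<inter> elts D \<noteq> {}"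
    using gen unfolding V_generic_def by (elim conjE) assumption
  ultimately have "G \<inter> elts ?D \<noteq> {}" using D by blast
  then show ?thesis unfolding eD GG_def by blast
qed

text \<open>The conditions incompatible with \<open>p0\<close> are added to make the set dense;
  directedness of the filter then rules them out.\<close>

lemma genericity_below:
  assumes d: "dfp (\<lambda>s. Q (dec (s 0)))" and p0: "p0 \<in> GG"
    and dense: "\<And>p. cond p \<Longrightarrow> ble p0 p \<Longrightarrow> \<exists>q. cond q \<and> ble p q \<and> Q q"
  shows "\<exists>p\<in>GG. ble p0 p \<and> Q p"
proof -
  let ?Q = "\<lambda>q. (ble p0 q \<and> Q q) \<or> \<not> (\<exists>r\<in>LL. cond r \<and> ble q r \<and> ble p0 r)"
  have "\<exists>p\<in>GG. ?Q p"
  proof (rule genericity)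
    show "dfp (\<lambda>s. ?Q (dec (s 0)))" by (intro df d cond_LL GG_cond p0)
    fix p assume p: "cond p"
    show "\<exists>q. cond q \<and> ble p q \<and> ?Q q"
    proof (cases "\<exists>r\<in>LL. cond r \<and> ble p r \<and> ble p0 r")
      case True
      then obtain r where r: "cond r" "ble p r" "ble p0 r" by blast
      then obtain q where "cond q" "ble r q" "Q q" using dense by blast
      then show ?thesis using r ble_trans by blast
    next
      case False
      then show ?thesis using p ble_refl by blast
    qed
  qed
  then show ?thesis using GG_dir[OF _ p0] GG_cond cond_LL by blast
qed

lemma elts_val: "elts (val G \<sigma>) = val G ` {\<rho>. \<exists>p\<in>G. opair \<rho> p \<in> elts \<sigma>}"
proof -
  have "small {\<rho>. \<exists>p\<in>G. opair \<rho> p \<in> elts \<sigma>}"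
    by (rule small_subset[OF small_elts[of "bigU (bigU \<sigma>)"]]) (use opair_bigU in blast)
  then show ?thesis by (subst val.simps) (simp add: elts_vset_small small_image)
qed

lemma val_mem: "p \<in> GG \<Longrightarrow> opair \<rho> (code_seq p) \<in> elts \<sigma> \<Longrightarrow> val G \<rho> \<in> elts (val G \<sigma>)"
  unfolding elts_val GG_def by blast

abbreviation "Nm \<equiv> is_name (magidor \<kappa> U)"

lemma name_elt: "Nm \<sigma> \<Longrightarrow> z \<in> elts \<sigma> \<Longrightarrow> \<exists>\<rho> p. z = opair \<rho> (code_seq p) \<and> Nm \<rho> \<and> cond p"
  by (erule is_name.cases) (force simp: magidor_eq)

lemma name_elt': "Nm \<sigma> \<Longrightarrow> opair \<rho> c \<in> elts \<sigma> \<Longrightarrow> Nm \<rho> \<and> (\<exists>p. cond p \<and> c = code_seq p)"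
  using name_elt by fastforce

lemma val_memD: "Nm \<sigma> \<Longrightarrow> y \<in> elts (val G \<sigma>) \<Longrightarrow> \<exists>\<rho> p. p \<in> GG \<and> opair \<rho> (code_seq p) \<in> elts \<sigma> \<and> y = val G \<rho> \<and> Nm \<rho>"
  unfolding elts_val using G_sub name_elt' by blast

end

section \<open>Forcing for one name and values in the ground model\<close>

locale named = generic +
  fixes \<tau> X
  assumes tau: "\<tau> \<in> V" "is_name (magidor \<kappa> U) \<tau>"
    and X: "X \<in> V" "x \<in> elts X \<Longrightarrow> y \<in> elts x \<Longrightarrow> y \<in> elts X"
begin

definition TT :: 'a where "TT = vset (insert \<tau> (elts (trcl \<tau>)))"

lemma TT: "TT \<in> V" "\<tau> \<in> elts TT" "\<sigma> \<in> elts TT \<Longrightarrow> opair \<rho> c \<in> elts \<sigma> \<Longrightarrow> \<rho> \<in> elts TT"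
proof -
  show "TT \<in> V" unfolding TT_def by (intro V_insert V_trcl tau)
  show "\<tau> \<in> elts TT" unfolding TT_def by simp
  have tr: "u \<in> elts TT" if "\<sigma> \<in> elts TT" "u \<in> elts \<sigma>" for \<sigma> u
    using that trcl_trans[of \<sigma> \<tau>] elts_trcl[of \<tau>] unfolding TT_def elts_vset_insert by blast
  assume "\<sigma> \<in> elts TT" "opair \<rho> c \<in> elts \<sigma>"
  then have "vset {\<rho>, c} \<in> elts TT" using tr elts_opair[of \<rho> c] by blast
  then show "\<rho> \<in> elts TT" using tr by simp
qed

text \<open>The clauses for p forcing \<sigma> = x: below p the members of \<sigma> densely receive
  values in x, and every y in x is densely such a value. As x is a set of V and not a name,
  \<open>F\<close> occurs positively only, which is what \<open>fixpoint\<close> requires.\<close>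

definition fstep :: "'a \<Rightarrow> 'a \<Rightarrow> 'a block list \<Rightarrow> ('a \<Rightarrow> 'a \<Rightarrow> 'a block list \<Rightarrow> bool) \<Rightarrow> bool" where
  "fstep \<sigma> x p F \<longleftrightarrow>
     (\<forall>\<rho>\<in>V. \<forall>r\<in>V. opair \<rho> r \<in> elts \<sigma> \<longrightarrow> (\<forall>q\<in>LL. cond q \<and> ble p q \<and> ble (dec r) q \<longrightarrow>
        (\<exists>q'\<in>LL. cond q' \<and> ble q q' \<and> (\<exists>y\<in>elts x. F \<rho> y q')))) \<and>
     (\<forall>y\<in>elts x. \<forall>q\<in>LL. cond q \<and> ble p q \<longrightarrow> (\<exists>q'\<in>LL. cond q' \<and> ble q q' \<and>
        (\<exists>\<rho>\<in>V. \<exists>r\<in>V. opair \<rho> r \<in> elts \<sigma> \<and> ble (dec r) q' \<and> F \<rho> y q')))"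

lemma forcing_ex:
  "\<exists>Z\<in>V. \<forall>\<sigma>\<in>elts TT. \<forall>x\<in>elts X. \<forall>p\<in>LL. opair \<sigma> (opair x (code_seq p)) \<in> elts Z \<longleftrightarrow>
     fstep \<sigma> x p (\<lambda>\<rho> y q. opair \<rho> (opair y (code_seq q)) \<in> elts Z)"
proof -
  let ?Q = "\<lambda>z W. \<exists>\<sigma>\<in>V. \<exists>x\<in>V. \<exists>c\<in>elts LC. z = opair \<sigma> (opair x c) \<and>
     fstep \<sigma> x (dec c) (\<lambda>\<rho> y q. opair \<rho> (opair y (code_seq q)) \<in> elts W)"
  have d: "dfp (\<lambda>s. ?Q (s 0) (s 1))"
    unfolding fstep_def by (intro df LC_V)
  have C: "prodV TT (prodV X LC) \<in> V" by (intro V_prodV TT X LC_V)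
  have mn: "?Q z W'" if "elts W \<subseteq> elts W'" "?Q z W" for z W W'
  proof -
    have "fstep \<sigma> x p (\<lambda>\<rho> y q. opair \<rho> (opair y (code_seq q)) \<in> elts W) \<Longrightarrow>
      fstep \<sigma> x p (\<lambda>\<rho> y q. opair \<rho> (opair y (code_seq q)) \<in> elts W')" for \<sigma> x p
      unfolding fstep_def using that(1) by (elim conjE, intro conjI) (meson subsetD)+
    then show ?thesis using that(2) by blast
  qed
  obtain Z where Z: "Z \<in> V" "elts Z \<subseteq> elts (prodV TT (prodV X LC))"
     "\<And>z. z \<in> elts (prodV TT (prodV X LC)) \<Longrightarrow> z \<in> elts Z \<longleftrightarrow> ?Q z Z"
    by (rule fixpoint[of "prodV TT (prodV X LC)" ?Q, OF C d]; (rule mn; assumption | rule that; assumption))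
  show ?thesis
  proof (intro bexI[OF _ Z(1)] ballI)
    fix \<sigma> x p assume a: "\<sigma> \<in> elts TT" "x \<in> elts X" "p \<in> LL"
    then have m: "opair \<sigma> (opair x (code_seq p)) \<in> elts (prodV TT (prodV X LC))"
      using code_LC by (simp add: prodV_opair)
    have V: "\<sigma> \<in> V" "x \<in> V" "code_seq p \<in> elts LC" using a V_trans TT(1) X(1) code_LC by blast+
    show "opair \<sigma> (opair x (code_seq p)) \<in> elts Z \<longleftrightarrow>
     fstep \<sigma> x p (\<lambda>\<rho> y q. opair \<rho> (opair y (code_seq q)) \<in> elts Z)"
      unfolding Z(3)[OF m] using V a(3) by auto
  qed
qed

text \<open>Any fixed point will do: \<open>FF_truth\<close> uses nothing but the equation, by
  induction on names.\<close>

definition FZ :: 'a where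
  "FZ = (SOME Z. Z \<in> V \<and> (\<forall>\<sigma>\<in>elts TT. \<forall>x\<in>elts X. \<forall>p\<in>LL. opair \<sigma> (opair x (code_seq p)) \<in> elts Z \<longleftrightarrow>
     fstep \<sigma> x p (\<lambda>\<rho> y q. opair \<rho> (opair y (code_seq q)) \<in> elts Z)))"

definition FF :: "'a \<Rightarrow> 'a \<Rightarrow> 'a block list \<Rightarrow> bool" where
  "FF \<sigma> x p \<longleftrightarrow> opair \<sigma> (opair x (code_seq p)) \<in> elts FZ"

lemma FZ: "FZ \<in> V"
  and FF: "\<sigma> \<in> elts TT \<Longrightarrow> x \<in> elts X \<Longrightarrow> p \<in> LL \<Longrightarrow> FF \<sigma> x p \<longleftrightarrow> fstep \<sigma> x p FF"
proof -
  have "\<exists>Z. Z \<in> V \<and> (\<forall>\<sigma>\<in>elts TT. \<forall>x\<in>elts X. \<forall>p\<in>LL. opair \<sigma> (opair x (code_seq p)) \<in> elts Z \<longleftrightarrow>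
     fstep \<sigma> x p (\<lambda>\<rho> y q. opair \<rho> (opair y (code_seq q)) \<in> elts Z))"
    using forcing_ex by blast
  from someI_ex[OF this]
  have *: "FZ \<in> V \<and> (\<forall>\<sigma>\<in>elts TT. \<forall>x\<in>elts X. \<forall>p\<in>LL. opair \<sigma> (opair x (code_seq p)) \<in> elts FZ \<longleftrightarrow>
     fstep \<sigma> x p (\<lambda>\<rho> y q. opair \<rho> (opair y (code_seq q)) \<in> elts FZ))"
    unfolding FZ_def .
  then show "FZ \<in> V" by blast
  show "\<sigma> \<in> elts TT \<Longrightarrow> x \<in> elts X \<Longrightarrow> p \<in> LL \<Longrightarrow> FF \<sigma> x p \<longleftrightarrow> fstep \<sigma> x p FF"
    using * unfolding FF_def[abs_def] by blast
qed

lemma dfp_FF [df]: "dff t \<Longrightarrow> dff u \<Longrightarrow> dfl x \<Longrightarrow> dfp (\<lambda>s. FF (t s) (u s) (x s))"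
  unfolding FF_def by (intro df FZ)

lemma FF_mono:
  assumes "\<sigma> \<in> elts TT" "x \<in> elts X" "p \<in> LL" "q \<in> LL" "FF \<sigma> x p" "ble p q" shows "FF \<sigma> x q"
  using assms ble_trans unfolding FF[OF assms(1,2,3)] FF[OF assms(1,2,4)] fstep_def by meson

text \<open>If a condition of the filter satisfies the clauses, genericity below it realizes each of
  them. Conversely the conditions that satisfy the clauses or refute one of them for good
  (\<open>?B1\<close>, \<open>?B2\<close>) are dense, and a refutation inside the filter contradicts
  the value of the name.\<close>

lemma FF_truth:
  "Nm \<sigma> \<Longrightarrow> \<sigma> \<in> elts TT \<Longrightarrow> x \<in> elts X \<Longrightarrow> val G \<sigma> = x \<longleftrightarrow> (\<exists>p\<in>GG. FF \<sigma> x p)"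
proof (induction \<sigma> arbitrary: x rule: is_name.induct)
  case (1 \<sigma>)
  note name = 1(1) and T = 1(2) and x = 1(3)
  have nm: "Nm \<sigma>" by (rule is_name.intros) (use name in blast)
  have IH: "val G \<rho> = y \<longleftrightarrow> (\<exists>p\<in>GG. FF \<rho> y p)" if o: "opair \<rho> c \<in> elts \<sigma>" and y: "y \<in> elts X" for \<rho> c y
  proof -
    obtain \<rho>' p where "opair \<rho> c = opair \<rho>' p"
       "\<forall>x. \<rho>' \<in> elts TT \<longrightarrow> x \<in> elts X \<longrightarrow> (val G \<rho>' = x) = (\<exists>p\<in>GG. FF \<rho>' x p)"
      using name[OF o] by blast
    then show ?thesis using TT(3)[OF T o] y by simp
  qed
  have cV: "\<rho> \<in> V \<and> c \<in> V" if "opair \<rho> c \<in> elts \<sigma>" for \<rho> c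
    using that V_trans[OF V_trans[OF TT(1) T]] V_opairD by blast
  have xV: "y \<in> V" if "y \<in> elts x" for y using that x V_trans X(1) by blast
  have xs: "y \<in> elts X" if "y \<in> elts x" for y using X(2)[OF x that] .
  have sV: "\<sigma> \<in> V" "x \<in> V" using T TT(1) x X(1) V_trans by blast+
  show ?case
  proof
    assume "\<exists>p\<in>GG. FF \<sigma> x p"
    then obtain p where p: "p \<in> GG" "fstep \<sigma> x p FF" using FF[OF T x] GG_cond cond_LL by blast
    show "val G \<sigma> = x"
    proof (rule elts_extensionality, rule set_eqI, rule iffI)
      fix z assume "z \<in> elts (val G \<sigma>)"
      then obtain \<rho> r where r: "r \<in> GG" "opair \<rho> (code_seq r) \<in> elts \<sigma>" "z = val G \<rho>"
        using val_memD[OF nm] by blast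
      obtain p' where p': "p' \<in> GG" "ble p p'" "ble r p'" using GG_dir[OF p(1) r(1)] by blast
      have rL: "dec (code_seq r) = r" using r(1) GG_cond cond_LL by simp
      have "\<exists>q\<in>GG. ble p' q \<and> (\<exists>y\<in>elts x. FF \<rho> y q)"
      proof (rule genericity_below[OF _ p'(1)])
        show "dfp (\<lambda>s. \<exists>y\<in>elts x. FF \<rho> y (dec (s 0)))" using cV[OF r(2)] sV by (intro df) auto
        fix q assume q: "cond q" "ble p' q"
        then have "ble p q" "ble r q" using p' ble_trans by blast+
        then show "\<exists>q'. cond q' \<and> ble q q' \<and> (\<exists>y\<in>elts x. FF \<rho> y q')"
          using p(2) q(1) cond_LL[OF q(1)] cV[OF r(2)] r(2) rL unfolding fstep_def by metis
      qed
      then obtain y where "y \<in> elts x" "\<exists>q\<in>GG. FF \<rho> y q" by blast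
      then show "z \<in> elts x" using IH[OF r(2) xs] r(3) by blast
    next
      fix z assume z: "z \<in> elts x"
      have "\<exists>q\<in>GG. ble p q \<and> (\<exists>\<rho>\<in>V. \<exists>r\<in>V. opair \<rho> r \<in> elts \<sigma> \<and> ble (dec r) q \<and> FF \<rho> z q)"
      proof (rule genericity_below[OF _ p(1)])
        show "dfp (\<lambda>s. \<exists>\<rho>\<in>V. \<exists>r\<in>V. opair \<rho> r \<in> elts \<sigma> \<and> ble (dec r) (dec (s 0)) \<and> FF \<rho> z (dec (s 0)))"
          using sV xV[OF z] by (intro df) auto
        fix q assume q: "cond q" "ble p q"
        then show "\<exists>q'. cond q' \<and> ble q q' \<and> (\<exists>\<rho>\<in>V. \<exists>r\<in>V. opair \<rho> r \<in> elts \<sigma> \<and> ble (dec r) q' \<and> FF \<rho> z q')"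
          using p(2) cond_LL[OF q(1)] z unfolding fstep_def by blast
      qed
      then obtain q \<rho> r where q: "q \<in> GG" "opair \<rho> r \<in> elts \<sigma>" "ble (dec r) q" "FF \<rho> z q" by blast
      obtain r' where r': "cond r'" "r = code_seq r'" using name_elt'[OF nm q(2)] by blast
      then have "r' \<in> GG" using GG_down[OF q(1)] q(3) cond_LL by simp
      moreover have "val G \<rho> = z" using IH[OF q(2) xs[OF z]] q by blast
      ultimately show "z \<in> elts (val G \<sigma>)" using val_mem q(2) r'(2) by blast
    qed
  next
    assume v: "val G \<sigma> = x"
    let ?B1 = "\<lambda>q. \<exists>\<rho>\<in>V. \<exists>r\<in>V. opair \<rho> r \<in> elts \<sigma> \<and> ble (dec r) q \<and>
         (\<forall>q'\<in>LL. cond q' \<and> ble q q' \<longrightarrow> \<not> (\<exists>y\<in>elts x. FF \<rho> y q'))"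
    let ?B2 = "\<lambda>q. \<exists>y\<in>elts x. \<forall>q'\<in>LL. cond q' \<and> ble q q' \<longrightarrow> \<not> (\<exists>\<rho>\<in>V. \<exists>r\<in>V. opair \<rho> r \<in> elts \<sigma> \<and> ble (dec r) q' \<and> FF \<rho> y q')"
    have "\<exists>p\<in>GG. fstep \<sigma> x p FF \<or> ?B1 p \<or> ?B2 p"
    proof (rule genericity)
      show "dfp (\<lambda>s. fstep \<sigma> x (dec (s 0)) FF \<or> ?B1 (dec (s 0)) \<or> ?B2 (dec (s 0)))"
        unfolding fstep_def using sV by (intro df) auto
      fix p assume p: "cond p"
      show "\<exists>q. cond q \<and> ble p q \<and> (fstep \<sigma> x q FF \<or> ?B1 q \<or> ?B2 q)"
      proof (cases "fstep \<sigma> x p FF")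
        case True then show ?thesis using p ble_refl by blast
      next
        case False
        then consider \<rho> r q where "\<rho> \<in> V" "r \<in> V" "opair \<rho> r \<in> elts \<sigma>" "cond q" "ble p q" "ble (dec r) q"
            "\<not> (\<exists>q'\<in>LL. cond q' \<and> ble q q' \<and> (\<exists>y\<in>elts x. FF \<rho> y q'))"
          | y q where "y \<in> elts x" "cond q" "ble p q" "\<not> (\<exists>q'\<in>LL. cond q' \<and> ble q q' \<and>
               (\<exists>\<rho>\<in>V. \<exists>r\<in>V. opair \<rho> r \<in> elts \<sigma> \<and> ble (dec r) q' \<and> FF \<rho> y q'))"
          unfolding fstep_def by blast
        then show ?thesis
        proof cases
          case 1 then have "?B1 q" by blast
          then show ?thesis using 1 by blast
        next
          case 2 then have "?B2 q" by blast
          then show ?thesis using 2 by blast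
        qed
      qed
    qed
    then obtain p where p: "p \<in> GG" "fstep \<sigma> x p FF \<or> ?B1 p \<or> ?B2 p" by blast
    have "\<not> ?B1 p"
    proof
      assume "?B1 p"
      then obtain \<rho> r where r: "opair \<rho> r \<in> elts \<sigma>" "ble (dec r) p"
         "\<forall>q'\<in>LL. cond q' \<and> ble p q' \<longrightarrow> \<not> (\<exists>y\<in>elts x. FF \<rho> y q')" by blast
      obtain r' where r': "cond r'" "r = code_seq r'" using name_elt'[OF nm r(1)] by blast
      then have "r' \<in> GG" using GG_down[OF p(1)] r(2) cond_LL by simp
      then have y: "val G \<rho> \<in> elts x" using val_mem r(1) r'(2) v by blast
      then obtain q where q: "q \<in> GG" "FF \<rho> (val G \<rho>) q" using IH[OF r(1) xs[OF y]] by blast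
      obtain q' where q': "q' \<in> GG" "ble p q'" "ble q q'" using GG_dir[OF p(1) q(1)] by blast
      have "FF \<rho> (val G \<rho>) q'"
        using FF_mono[OF TT(3)[OF T r(1)] xs[OF y] _ _ q(2) q'(3)] q(1) q'(1) GG_cond cond_LL by blast
      then show False using r(3) q' y GG_cond cond_LL by blast
    qed
    moreover have "\<not> ?B2 p"
    proof
      assume "?B2 p"
      then obtain y where y: "y \<in> elts x" "\<forall>q'\<in>LL. cond q' \<and> ble p q' \<longrightarrow>
           \<not> (\<exists>\<rho>\<in>V. \<exists>r\<in>V. opair \<rho> r \<in> elts \<sigma> \<and> ble (dec r) q' \<and> FF \<rho> y q')" by blast
      then obtain \<rho> r where r: "r \<in> GG" "opair \<rho> (code_seq r) \<in> elts \<sigma>" "y = val G \<rho>"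
        using val_memD[OF nm] v by blast
      then obtain q where q: "q \<in> GG" "FF \<rho> y q" using IH[OF r(2) xs[OF y(1)]] by blast
      obtain q0 where q0: "q0 \<in> GG" "ble p q0" "ble q q0" using GG_dir[OF p(1) q(1)] by blast
      obtain q' where q': "q' \<in> GG" "ble q0 q'" "ble r q'" using GG_dir[OF q0(1) r(1)] by blast
      have "ble p q'" "ble q q'" using q0 q' ble_trans by blast+
      moreover have "FF \<rho> y q'"
        using FF_mono[OF TT(3)[OF T r(2)] xs[OF y(1)] _ _ q(2) \<open>ble q q'\<close>] q(1) q'(1) GG_cond cond_LL by blast
      moreover have "dec (code_seq r) = r" using r(1) GG_cond cond_LL by simp
      ultimately show False using y(2) q' cV[OF r(2)] r(2) GG_cond cond_LL by metis
    qed
    ultimately show "\<exists>p\<in>GG. FF \<sigma> x p"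
      using p FF[OF T x] GG_cond cond_LL by blast
  qed
qed

definition FA :: "'a block list \<Rightarrow> 'a \<Rightarrow> bool" where
  "FA p x \<longleftrightarrow> (\<exists>\<rho>\<in>V. \<exists>r\<in>V. opair \<rho> r \<in> elts \<tau> \<and> ble (dec r) p \<and> FF \<rho> x p)"

lemma FA_mono: assumes "x \<in> elts X" "p \<in> LL" "q \<in> LL" "FA p x" "ble p q" shows "FA q x"
proof -
  obtain \<rho> r where *: "\<rho> \<in> V" "r \<in> V" "opair \<rho> r \<in> elts \<tau>" "ble (dec r) p" "FF \<rho> x p"
    using assms(4) unfolding FA_def by blast
  then show ?thesis
    using FF_mono[OF TT(3)[OF TT(2) *(3)] assms(1-3) *(5) assms(5)] ble_trans assms(5) unfolding FA_def by blast
qed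

lemma FA_truth: assumes x: "x \<in> elts X" shows "x \<in> elts (val G \<tau>) \<longleftrightarrow> (\<exists>p\<in>GG. FA p x)"
proof
  assume "x \<in> elts (val G \<tau>)"
  then obtain \<rho> r where r: "r \<in> GG" "opair \<rho> (code_seq r) \<in> elts \<tau>" "x = val G \<rho>" "Nm \<rho>"
    using val_memD[OF tau(2)] by blast
  then obtain q where q: "q \<in> GG" "FF \<rho> x q" using FF_truth[OF r(4) TT(3)[OF TT(2) r(2)] x] by blast
  obtain q' where q': "q' \<in> GG" "ble q q'" "ble r q'" using GG_dir[OF q(1) r(1)] by blast
  have "FF \<rho> x q'" using FF_mono[OF TT(3)[OF TT(2) r(2)] x _ _ q(2) q'(2)] q q' GG_cond cond_LL by blast
  moreover have "dec (code_seq r) = r" using r(1) GG_cond cond_LL by simp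
  moreover have "\<rho> \<in> V" "code_seq r \<in> V" using V_trans[OF tau(1) r(2)] V_opairD by blast+
  ultimately show "\<exists>p\<in>GG. FA p x" using q' r(2) unfolding FA_def by metis
next
  assume "\<exists>p\<in>GG. FA p x"
  then obtain p \<rho> r where *: "p \<in> GG" "opair \<rho> r \<in> elts \<tau>" "ble (dec r) p" "FF \<rho> x p"
    unfolding FA_def by blast
  obtain r' where r': "cond r'" "r = code_seq r'" "Nm \<rho>" using name_elt'[OF tau(2) *(2)] by blast
  then have "r' \<in> GG" using GG_down[OF *(1)] *(3) cond_LL by simp
  moreover have "val G \<rho> = x" using FF_truth[OF r'(3) TT(3)[OF TT(2) *(2)] x] * by blast
  ultimately show "x \<in> elts (val G \<tau>)" using val_mem *(2) r'(2) by blast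
qed

text \<open>\<open>RR p \<zeta> a\<close>: the condition \<^term>\<open>p\<close> forces that the set named by \<^term>\<open>\<tau>\<close> meets
  \<^term>\<open>\<zeta>\<close> in \<^term>\<open>a\<close>; \<open>FA p x\<close> forces that \<^term>\<open>x\<close> belongs to it.\<close>

definition RR :: "'a block list \<Rightarrow> 'a \<Rightarrow> 'a \<Rightarrow> bool" where
  "RR p \<zeta> a \<longleftrightarrow> cond p \<and> elts a \<subseteq> elts \<zeta> \<and> (\<forall>x\<in>elts \<zeta>.
     (x \<in> elts a \<longrightarrow> (\<forall>q\<in>LL. cond q \<and> ble p q \<longrightarrow> (\<exists>r\<in>LL. cond r \<and> ble q r \<and> FA r x))) \<and>
     (x \<notin> elts a \<longrightarrow> (\<forall>q\<in>LL. cond q \<and> ble p q \<longrightarrow> \<not> FA q x)))"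

lemma dfp_FA [df]: "dfl x \<Longrightarrow> dff t \<Longrightarrow> dfp (\<lambda>s. FA (x s) (t s))"
  unfolding FA_def by (intro df dff_shift dfl_shift tau)

lemma dfp_RR [df]: "dfl x \<Longrightarrow> dff t \<Longrightarrow> dff u \<Longrightarrow> dfp (\<lambda>s. RR (x s) (t s) (u s))"
  unfolding RR_def by (intro df dff_shift dfl_shift)

lemma RR_cond: "RR p \<zeta> a \<Longrightarrow> cond p" "RR p \<zeta> a \<Longrightarrow> elts a \<subseteq> elts \<zeta>"
  by (simp_all add: RR_def)

lemma RR_mono: "RR p \<zeta> a \<Longrightarrow> cond q \<Longrightarrow> ble p q \<Longrightarrow> RR q \<zeta> a"
  unfolding RR_def using ble_trans[of p q] by blast

text \<open>The positive clause of \<open>RR\<close> asks for \<open>FA\<close> densely only, and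
  the negative one excludes it everywhere below; both pass from a dense set of extensions to p, by
  monotonicity of \<open>FA\<close>.\<close>

lemma RR_dense:
  assumes z: "elts \<zeta> \<subseteq> elts X" and p: "cond p" and dense: "\<And>q. cond q \<Longrightarrow> ble p q \<Longrightarrow> \<exists>r. cond r \<and> ble q r \<and> RR r \<zeta> a"
  shows "RR p \<zeta> a"
  unfolding RR_def
proof (intro conjI ballI impI)
  show "elts a \<subseteq> elts \<zeta>" using dense[OF p ble_refl] RR_cond(2) by blast
  fix x assume x: "x \<in> elts \<zeta>"
  show "\<exists>r\<in>LL. cond r \<and> ble q r \<and> FA r x" if q: "x \<in> elts a" "q \<in> LL" "cond q \<and> ble p q" for q
  proof -
    obtain r where r: "cond r" "ble q r" "RR r \<zeta> a" using dense q by blast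
    then have "\<exists>r'\<in>LL. cond r' \<and> ble r r' \<and> FA r' x" using x q(1) ble_refl cond_LL unfolding RR_def by blast
    then show ?thesis using r ble_trans by blast
  qed
  show "\<not> FA q x" if q: "x \<notin> elts a" "q \<in> LL" "cond q \<and> ble p q" for q
  proof
    assume "FA q x"
    obtain r where r: "cond r" "ble q r" "RR r \<zeta> a" using dense q by blast
    then have "FA r x" using FA_mono[OF _ q(2) cond_LL[OF r(1)] \<open>FA q x\<close>] x z by blast
    then show False using r x q(1) cond_LL ble_refl unfolding RR_def by blast
  qed
qed fact

lemma RR_coherent:
  assumes "RR p \<zeta> a" "RR q \<zeta>' b" "cond r" "ble p r" "ble q r" "x \<in> elts \<zeta>" "x \<in> elts \<zeta>'"
  shows "x \<in> elts a \<longleftrightarrow> x \<in> elts b"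
proof -
  have "False" if 1: "RR p \<zeta> a" "RR q \<zeta>' b" "ble p r" "ble q r" "x \<in> elts \<zeta>" "x \<in> elts \<zeta>'" "x \<in> elts a" "x \<notin> elts b"
    for p \<zeta> a q \<zeta>' b
  proof -
    have "RR r \<zeta> a" "RR r \<zeta>' b" using RR_mono 1 assms(3) by blast+
    then show False using 1 cond_LL[OF assms(3)] assms(3) ble_refl unfolding RR_def by meson
  qed
  then show ?thesis using assms by blast
qed

lemma RR_restrict: "RR p \<zeta> a \<Longrightarrow> elts \<zeta>' \<subseteq> elts \<zeta> \<Longrightarrow> elts a' = elts a \<inter> elts \<zeta>' \<Longrightarrow> RR p \<zeta>' a'"
  unfolding RR_def by blast

lemma RR_sound:
  assumes z: "elts \<zeta> \<subseteq> elts X" "\<zeta> \<in> V" and p: "p \<in> GG" "RR p \<zeta> a"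
  shows "elts a = elts (val G \<tau>) \<inter> elts \<zeta>"
proof -
  have "x \<in> elts a \<longleftrightarrow> x \<in> elts (val G \<tau>)" if x: "x \<in> elts \<zeta>" for x
  proof
    have xV: "x \<in> V" using V_trans x z by blast
    assume "x \<in> elts a"
    then have "\<exists>q\<in>GG. ble p q \<and> FA q x"
      using p(2) x cond_LL unfolding RR_def
      by (intro genericity_below[OF _ p(1)]) (auto intro!: df xV, blast)
    then show "x \<in> elts (val G \<tau>)" using FA_truth x z by blast
  next
    assume "x \<in> elts (val G \<tau>)"
    then obtain q where q: "q \<in> GG" "FA q x" using FA_truth x z by blast
    obtain r where r: "r \<in> GG" "ble p r" "ble q r" using GG_dir[OF p(1) q(1)] by blast
    then have "FA r x" using FA_mono[OF _ _ _ q(2) r(3)] x z q r GG_cond cond_LL by blast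
    then show "x \<in> elts a" using p(2) x r GG_cond cond_LL unfolding RR_def by blast
  qed
  then show ?thesis using RR_cond(2)[OF p(2)] by blast
qed

text \<open>A condition that fails to force the true value has an extension that settles one point
  wrongly (\<open>?B\<close>), and such an extension is not in the filter.\<close>

lemma RR_decided:
  assumes z: "elts \<zeta> \<subseteq> elts X" "\<zeta> \<in> V" and a: "a \<in> V" "elts a = elts (val G \<tau>) \<inter> elts \<zeta>"
  shows "\<exists>p\<in>GG. RR p \<zeta> a"
proof -
  let ?B = "\<lambda>p. \<exists>x\<in>elts \<zeta>. (x \<in> elts a \<and> (\<forall>q\<in>LL. cond q \<and> ble p q \<longrightarrow> \<not> FA q x)) \<or> (x \<notin> elts a \<and> FA p x)"
  have "\<exists>p\<in>GG. RR p \<zeta> a \<or> ?B p"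
  proof (rule genericity)
    show "dfp (\<lambda>s. RR (dec (s 0)) \<zeta> a \<or> ?B (dec (s 0)))" by (intro df z a)
    fix p assume p: "cond p"
    show "\<exists>q. cond q \<and> ble p q \<and> (RR q \<zeta> a \<or> ?B q)"
    proof (cases "RR p \<zeta> a")
      case True then show ?thesis using p ble_refl by blast
    next
      case False
      then obtain x where x: "x \<in> elts \<zeta>" 
        "(x \<in> elts a \<and> (\<exists>q\<in>LL. cond q \<and> ble p q \<and> \<not> (\<exists>r\<in>LL. cond r \<and> ble q r \<and> FA r x))) \<or>
         (x \<notin> elts a \<and> (\<exists>q\<in>LL. cond q \<and> ble p q \<and> FA q x))"
        using p a unfolding RR_def by blast
      then obtain q where "cond q" "ble p q" "(x \<in> elts a \<and> (\<forall>r\<in>LL. cond r \<and> ble q r \<longrightarrow> \<not> FA r x)) \<or> (x \<notin> elts a \<and> FA q x)"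
        by blast
      then show ?thesis using x(1) by blast
    qed
  qed
  then obtain p where p: "p \<in> GG" "RR p \<zeta> a \<or> ?B p" by blast
  have "\<not> ?B p"
  proof
    assume "?B p"
    then obtain x where x: "x \<in> elts \<zeta>" "(x \<in> elts a \<and> (\<forall>q\<in>LL. cond q \<and> ble p q \<longrightarrow> \<not> FA q x)) \<or> (x \<notin> elts a \<and> FA p x)"
      by blast
    have xX: "x \<in> elts X" using x z by blast
    show False
    proof (cases "x \<in> elts a")
      case True
      then obtain q where q: "q \<in> GG" "FA q x" using FA_truth[OF xX] a by blast
      obtain r where r: "r \<in> GG" "ble p r" "ble q r" using GG_dir[OF p(1) q(1)] by blast
      then have "FA r x" using FA_mono[OF xX _ _ q(2) r(3)] q r GG_cond cond_LL by blast
      then show False using x True r GG_cond cond_LL by blast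
    next
      case False
      then show False using x FA_truth[OF xX] a p(1) by blast
    qed
  qed
  then show ?thesis using p by blast
qed

end

section \<open>Decomposing conditions\<close>

context coherent begin

definition stem :: "'a block list \<Rightarrow> bool" where
  "stem l \<longleftrightarrow> (\<forall>t\<in>set l. okb t) \<and> successively lk l"

lemma cond_append:
  "b \<noteq> [] \<Longrightarrow> cond (a @ b) \<longleftrightarrow> stem a \<and> (a \<noteq> [] \<longrightarrow> lk (last a) (hd b)) \<and> cond b"
  unfolding cond_def stem_def by (auto simp: successively_append_iff)

lemma stem_append: "stem (a @ b) \<longleftrightarrow> stem a \<and> stem b \<and> (a \<noteq> [] \<longrightarrow> b \<noteq> [] \<longrightarrow> lk (last a) (hd b))"
  unfolding stem_def by (auto simp: successively_append_iff)

lemma cond_distinct: "cond ts \<Longrightarrow> distinct (map kap ts)"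
proof -
  assume "cond ts"
  from cond_sorted[OF this] show ?thesis
    by (induction ts) auto
qed

lemma split_unique:
  "distinct (map kap (a @ s # b)) \<Longrightarrow> a @ s # b = a' @ s' # b' \<Longrightarrow> kap s = kap s' \<Longrightarrow> a = a' \<and> s = s' \<and> b = b'"
proof (induction a arbitrary: a')
  case Nil
  then show ?case by (cases a') auto
next
  case (Cons x a)
  show ?case
  proof (cases a')
    case Nil
    then show ?thesis using Cons.prems by auto
  next
    case c: (Cons y a'')
    have "distinct (map kap (a @ s # b))" using Cons.prems(1) by simp
    moreover have "a @ s # b = a'' @ s' # b'" using Cons.prems(2) c by simp
    ultimately have "a = a'' \<and> s = s' \<and> b = b'" using Cons.IH Cons.prems(3) by blast
    then show ?thesis using c Cons.prems by simp
  qed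
qed

text \<open>The ordinals in a condition are distinct, so the ordinal of a block determines the place
  of the split. Decompositions of one condition that come from different weaker ones can thus be
  compared.\<close>

lemma cond_split_unique:
  "cond (a @ s # b) \<Longrightarrow> a @ s # b = a' @ s' # b' \<Longrightarrow> kap s = kap s' \<Longrightarrow> a = a' \<and> s = s' \<and> b = b'"
  using split_unique cond_distinct by blast

lemma cond_below:
  assumes "cond (a @ s # b)" shows "below a (kap s)"
  using cond_sorted[OF assms] by (auto simp: sorted_wrt_append below_def)

lemma bset_kap: "okb t \<Longrightarrow> \<xi> \<in> bset t \<Longrightarrow> \<xi> \<in> elts (kap t)"
  using okb_MI by (cases t) auto

lemma below_trans: "below l a \<Longrightarrow> a \<in> elts b \<Longrightarrow> Ord b \<Longrightarrow> below l b"
  unfolding below_def using Ord_trans by blast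

lemma below_last: "cond (a @ b) \<Longrightarrow> b \<noteq> [] \<Longrightarrow> a \<noteq> [] \<Longrightarrow> kap (last a) \<in> elts \<xi> \<Longrightarrow> Ord \<xi> \<Longrightarrow> below a \<xi>"
proof -
  assume c: "cond (a @ b)" "b \<noteq> []" "a \<noteq> []" "kap (last a) \<in> elts \<xi>" "Ord \<xi>"
  have "a @ b = butlast a @ last a # b" using c by simp
  then have "below (butlast a) (kap (last a))" using cond_below c(1) by metis
  then have "below (butlast a) \<xi>" using below_trans c by blast
  then have "below (butlast a @ [last a]) \<xi>" using c(4) unfolding below_simps by simp
  then show ?thesis using c(3) by simp
qed

text \<open>A link relates a set to the preceding point only; since the ordinals increase, the set
  lies above all earlier points.\<close>

lemma cond_bset_above:
  assumes c: "cond (a @ b)" and t: "t \<in> set b" and \<xi>: "\<xi> \<in> bset t" shows "below a \<xi>"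
proof -
  obtain b1 b2 where b: "b = b1 @ t # b2" using t by (meson split_list)
  have tab: "t \<in> set (a @ b)" using t by simp
  have o: "okb t" using c tab unfolding cond_def by blast
  have Ok: "Ord (kap t)" using cond_Ord[OF c tab] .
  have Ox: "Ord \<xi>" using bset_kap[OF o \<xi>] Ok Ord_in_Ord by blast
  show ?thesis
  proof (cases "a @ b1 = []")
    case False
    have "cond ((a @ b1) @ t # b2)" using c b by simp
    then have "lk (last (a @ b1)) t" using cond_append[of "t # b2" "a @ b1"] False by simp
    then have "kap (last (a @ b1)) \<in> elts \<xi>" using \<xi> by (simp add: lk_def)
    then have "below (a @ b1) \<xi>" using below_last[OF \<open>cond ((a @ b1) @ t # b2)\<close> _ False _ Ox] by simp
    then show ?thesis by simp
  qed simp
qed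

lemma ble_last: "ble (m @ [s]) r \<Longrightarrow> \<exists>m' w s'. r = m' @ w @ [s'] \<and> ble m m' \<and> (\<forall>x\<in>set w. insb s x) \<and> mtch s s'"
  unfolding ble_append ble_single by auto

lemma okb_same: "okb t \<Longrightarrow> okb s \<Longrightarrow> kap t = kap s \<Longrightarrow> (\<exists>\<beta>\<in>V. ob (kap t) \<beta>) \<Longrightarrow> \<exists>B. t = Large (kap s) B"
  "okb t \<Longrightarrow> \<not> (\<exists>\<beta>\<in>V. ob (kap t) \<beta>) \<Longrightarrow> t = Point (kap t)"
  by (cases t; auto simp: okb_def)+

lemma MI_Int: assumes "MI \<alpha> X" "MI \<alpha> Y" shows "MI \<alpha> (vset (elts X \<inter> elts Y))"
  unfolding MI_iff
proof (intro allI impI)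
  fix \<beta> assume b: "ob \<alpha> \<beta>"
  interpret nmeas V \<alpha> "meas \<alpha> \<beta>" using nmeas[OF b] .
  show "vset (elts X \<inter> elts Y) \<in> elts (meas \<alpha> \<beta>)"
    using nm_basic(8) assms b MI_iff by blast
qed

lemma MI_below: assumes l: "l \<in> LL" and b: "below l \<gamma>"
  shows "MI \<gamma> (vset {\<xi> \<in> elts \<gamma>. below l \<xi>})"
  unfolding MI_lg
proof (intro allI impI)
  fix k assume "ob \<gamma> k"
  then interpret nmeas V \<gamma> "meas \<gamma> k" by (rule nmeas)
  show "lg (below l)"
    using l b
  proof (induction l)
    case Nil
    show ?case using lg_True by simp
  next
    case (Cons t l)
    then have "lg (\<lambda>\<xi>. kap t \<in> elts \<xi> \<and> below l \<xi>)"
      using lg_conj[OF lg_above[of "kap t"]] by simp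
    then show ?case
      by (rule lg_mono) (use Cons(2) in \<open>auto intro!: dfp_below df blk_kap_V\<close>)
  qed
qed

end

section \<open>The fresh set and the decisions in the generic filter\<close>

text \<open>\<^term>\<open>\<delta>\<close> is the supremum of the fresh set, which is the interpretation of the name \<^term>\<open>\<tau>\<close>.\<close>

locale fresh_core = named V \<kappa> U G \<tau> \<delta> for V :: "'a::set_universe set" and \<kappa> U G \<tau> \<delta> +
  assumes od: "Ord \<delta>" and ne: "elts \<delta> \<noteq> {}" and lim: "\<zeta> \<in> elts \<delta> \<Longrightarrow> \<exists>\<zeta>'\<in>elts \<delta>. \<zeta> \<in> elts \<zeta>'"
    and fr: "\<zeta> \<in> elts \<delta> \<Longrightarrow> vset (elts (val G \<tau>) \<inter> elts \<zeta>) \<in> V"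
    and nV: "vset (elts (val G \<tau>) \<inter> elts \<delta>) \<notin> V"
begin

lemma dV: "\<delta> \<in> V" using X(1) .

lemma zV: "\<zeta> \<in> elts \<delta> \<Longrightarrow> \<zeta> \<in> V" using dV V_trans by blast

lemma zsub: "\<zeta> \<in> elts \<delta> \<Longrightarrow> elts \<zeta> \<subseteq> elts \<delta>" using od Ord_subset by blast

definition tv :: "'a \<Rightarrow> 'a" where "tv \<zeta> = vset (elts (val G \<tau>) \<inter> elts \<zeta>)"

lemma tv: "elts (tv \<zeta>) = elts (val G \<tau>) \<inter> elts \<zeta>" "\<zeta> \<in> elts \<delta> \<Longrightarrow> tv \<zeta> \<in> V"
  unfolding tv_def using fr by auto

lemma decided: "\<zeta> \<in> elts \<delta> \<Longrightarrow> \<exists>p\<in>GG. RR p \<zeta> (tv \<zeta>)"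
  using RR_decided[OF zsub zV tv(2) tv(1)] by blast

lemma sound: "\<zeta> \<in> elts \<delta> \<Longrightarrow> p \<in> GG \<Longrightarrow> RR p \<zeta> a \<Longrightarrow> a = tv \<zeta>"
  using RR_sound[OF zsub zV, of \<zeta> p a] tv(1) by (metis elts_extensionality)

text \<open>A recurrent source of contradictions: whatever computes the fresh set on \<delta> by a
  definition over V puts it into V, by separation.\<close>

lemma not_definable:
  assumes "dfp (\<lambda>s. Q (s 0))" "\<And>x. x \<in> elts \<delta> \<Longrightarrow> x \<in> elts (val G \<tau>) \<longleftrightarrow> Q x" shows False
proof -
  have "vset {x \<in> elts \<delta>. Q x} \<in> V" by (intro V_Collect dV assms(1))
  moreover have "{x \<in> elts \<delta>. Q x} = elts (val G \<tau>) \<inter> elts \<delta>" using assms(2) by blast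
  ultimately show False using nV by simp
qed

lemma above: "x \<in> elts \<delta> \<Longrightarrow> \<exists>\<zeta>\<in>elts \<delta>. x \<in> elts \<zeta>"
  using lim .

text \<open>The lower part and the block at \<gamma> vary with \<zeta>, only \<open>v\<close> is
  fixed. With all of them fixed, \<open>decided_by_one\<close> gives a contradiction.\<close>

definition EE :: "'a \<Rightarrow> 'a block list \<Rightarrow> bool" where
  "EE \<gamma> v \<longleftrightarrow> (\<forall>\<zeta>\<in>elts \<delta>. \<exists>l t a. l @ t # v \<in> GG \<and> kap t = \<gamma> \<and> RR (l @ t # v) \<zeta> a)"

lemma EE_top: "EE \<kappa> []"
  unfolding EE_def
proof
  fix \<zeta> assume "\<zeta> \<in> elts \<delta>"
  then obtain p where p: "p \<in> GG" "RR p \<zeta> (tv \<zeta>)" using decided by blast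
  then obtain B where "p = butlast p @ [Large \<kappa> B]"
    using GG_cond[of p] unfolding cond_def by (metis append_butlast_last_id)
  then show "\<exists>l t a. l @ [t] \<in> GG \<and> kap t = \<kappa> \<and> RR (l @ [t]) \<zeta> a"
    using p by (intro exI[of _ "butlast p"] exI[of _ "Large \<kappa> B"] exI[of _ "tv \<zeta>"]) auto
qed

lemma decided_by_one:
  assumes "p \<in> GG" "\<And>\<zeta>. \<zeta> \<in> elts \<delta> \<Longrightarrow> \<exists>a. RR p \<zeta> a" shows False
proof (rule not_definable)
  have pL: "p \<in> LL" using assms(1) GG_cond cond_LL by blast
  show "dfp (\<lambda>s. \<exists>\<zeta>\<in>elts \<delta>. \<exists>a\<in>V. RR p \<zeta> a \<and> s 0 \<in> elts a)"
    by (intro df dV pL)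
  fix x assume x: "x \<in> elts \<delta>"
  obtain \<zeta> where z: "\<zeta> \<in> elts \<delta>" "x \<in> elts \<zeta>" using above[OF x] by blast
  show "x \<in> elts (val G \<tau>) \<longleftrightarrow> (\<exists>\<zeta>\<in>elts \<delta>. \<exists>a\<in>V. RR p \<zeta> a \<and> x \<in> elts a)"
  proof
    assume "x \<in> elts (val G \<tau>)"
    then have "x \<in> elts (tv \<zeta>)" using z tv(1) by blast
    moreover have "RR p \<zeta> (tv \<zeta>)" using assms(2)[OF z(1)] sound[OF z(1) assms(1)] by blast
    ultimately show "\<exists>\<zeta>\<in>elts \<delta>. \<exists>a\<in>V. RR p \<zeta> a \<and> x \<in> elts a" using z(1) tv(2) by blast
  next
    assume "\<exists>\<zeta>\<in>elts \<delta>. \<exists>a\<in>V. RR p \<zeta> a \<and> x \<in> elts a"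
    then show "x \<in> elts (val G \<tau>)" using sound[OF _ assms(1)] tv(1) by blast
  qed
qed

text \<open>A point without measures has an empty set, so nothing can be inserted in front of it:
  the block preceding \<open>Point \<gamma>\<close> keeps its ordinal in every extension, and
  \<open>EE\<close> descends to that ordinal. If there is never a block below
  \<open>Point \<gamma>\<close>, a single condition decides everything.\<close>

lemma EE_point:
  assumes E: "EE \<gamma> v" and np: "\<not> (\<exists>\<beta>\<in>V. ob \<gamma> \<beta>)"
  shows "\<exists>\<nu>\<in>elts \<gamma>. \<exists>v'. EE \<nu> v'"
proof -
  have P: "t = Point \<gamma>" if "l @ t # r \<in> GG" "kap t = \<gamma>" for l t r
  proof -
    have "okb t" using that(1) GG_cond unfolding cond_def by auto
    then show ?thesis using okb_same(2) that(2) np by blast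
  qed
  have E': "\<exists>l a. l @ Point \<gamma> # v \<in> GG \<and> RR (l @ Point \<gamma> # v) \<zeta> a" if z: "\<zeta> \<in> elts \<delta>" for \<zeta>
    using E z P unfolding EE_def by metis
  show ?thesis
  proof (cases "\<exists>l. l \<noteq> [] \<and> l @ Point \<gamma> # v \<in> GG")
    case False
    then have "[] @ Point \<gamma> # v \<in> GG" using E' ne by (metis equals0I)
    moreover have "\<exists>a. RR ([] @ Point \<gamma> # v) \<zeta> a" if z: "\<zeta> \<in> elts \<delta>" for \<zeta>
      using E'[OF z] False by metis
    ultimately show ?thesis using decided_by_one by blast
  next
    case True
    then obtain l0 where l0: "l0 \<noteq> []" "l0 @ Point \<gamma> # v \<in> GG" by blast
    obtain m s where ms: "l0 = m @ [s]" using l0(1) by (metis append_butlast_last_id)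
    have c0: "cond (m @ s # Point \<gamma> # v)" using l0(2) ms GG_cond by fastforce
    have nu: "kap s \<in> elts \<gamma>" using cond_sorted[OF c0] by (simp add: sorted_wrt_append)
    have "EE (kap s) (Point \<gamma> # v)"
      unfolding EE_def
    proof
      fix \<zeta> assume "\<zeta> \<in> elts \<delta>"
      then obtain l a where l: "l @ Point \<gamma> # v \<in> GG" "RR (l @ Point \<gamma> # v) \<zeta> a" using E' by blast
      obtain r where r: "r \<in> GG" "ble (l @ Point \<gamma> # v) r" "ble (l0 @ Point \<gamma> # v) r"
        using GG_dir[OF l(1) l0(2)] by blast
      have dcmp: "\<exists>r1 r2. r = r1 @ Point \<gamma> # r2 \<and> ble k r1 \<and> ble v r2" if b: "ble (k @ Point \<gamma> # v) r" for k
      proof -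
        have "ble (k @ [Point \<gamma>] @ v) r" using b by simp
        then obtain r1 r2 r3 where r': "r = r1 @ r2 @ r3" "ble k r1" "ble [Point \<gamma>] r2" "ble v r3"
          unfolding ble_append by blast
        then obtain s' where "r2 = [s']" "kap s' = \<gamma>" unfolding ble_single insb_def mtch_def by auto
        moreover from this have "s' = Point \<gamma>" using P r(1) r'(1) by auto
        ultimately show ?thesis using r' by auto
      qed
      obtain r1 r2 where r1: "r = r1 @ Point \<gamma> # r2" "ble l0 r1" "ble v r2" using dcmp[OF r(3)] by blast
      obtain r1' r2' where r1': "r = r1' @ Point \<gamma> # r2'" "ble l r1'" "ble v r2'" using dcmp[OF r(2)] by blast
      have cr: "cond r" using r(1) GG_cond by blast
      have "r1' = r1"
        using cond_split_unique[OF cr[unfolded r1(1)] trans[OF r1(1)[symmetric] r1'(1)] refl] by blast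
      \<comment> \<open>The part above \<gamma> is put back to \<open>v\<close>. The decision
        survives because it was made with the lower part \<open>l\<close>, which \<open>r1\<close>
        refines.\<close>
      let ?q = "r1 @ Point \<gamma> # v"
      have cq: "cond ?q"
        using cr l0(2)[THEN GG_cond] unfolding r1(1)
        using cond_append[of "Point \<gamma> # r2" r1] cond_append[of "Point \<gamma> # v" r1] cond_append[of "Point \<gamma> # v" l0]
        by simp
      have "ble ?q r" unfolding r1(1) using r1(3) ble_appendI[OF ble_refl, of "Point \<gamma> # v" "Point \<gamma> # r2"] by simp
      then have q: "?q \<in> GG" using GG_down[OF r(1) cq] by blast
      have "ble (l @ Point \<gamma> # v) ?q" using r1'(2) \<open>r1' = r1\<close> ble_appendI[OF _ ble_refl] by blast
      then have R: "RR ?q \<zeta> a" using RR_mono[OF l(2) cq] by blast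
      obtain m' w s' where "r1 = m' @ w @ [s']" "mtch s s'" using ble_last[OF r1(2)[unfolded ms]] by blast
      then have "(m' @ w) @ s' # Point \<gamma> # v = ?q" "kap s' = kap s" by (auto simp: mtch_def)
      then show "\<exists>l t a. l @ t # Point \<gamma> # v \<in> GG \<and> kap t = kap s \<and> RR (l @ t # Point \<gamma> # v) \<zeta> a"
        using q R by metis
    qed
    then show ?thesis using nu by blast
  qed
qed

end

section \<open>Lower parts below \<gamma> and what they decide\<close>

text \<open>\<^term>\<open>\<gamma>\<close> is least such that every initial segment of the fresh set is decided by a condition in the
  generic filter whose part above \<^term>\<open>\<gamma>\<close> is the fixed list \<^term>\<open>v\<close>.\<close>

locale core = fresh_core V \<kappa> U G \<tau> \<delta> for V :: "'a::set_universe set" and \<kappa> U G \<tau> \<delta> +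
  fixes \<gamma> v
  assumes Ev: "EE \<gamma> v" and Emin: "\<nu> \<in> elts \<gamma> \<Longrightarrow> \<not> EE \<nu> v'"
begin

lemma meas_ex: "\<exists>\<beta>\<in>V. ob \<gamma> \<beta>"
  using EE_point[OF Ev] Emin by blast

lemma gammaV: "\<gamma> \<in> V" "Ord \<gamma>" "\<gamma> \<in> insert \<kappa> (elts \<kappa>)"
  using meas_ex obD by blast+

lemma gk: "\<xi> \<in> elts \<gamma> \<Longrightarrow> \<xi> \<in> elts \<kappa>"
  using gammaV(3) Ord_trans[OF coh_basic(3)] by blast

lemma glim: "\<xi> \<in> elts \<gamma> \<Longrightarrow> \<exists>\<xi>'\<in>elts \<gamma>. \<xi> \<in> elts \<xi>'"
  using meas_ex nmeas nmeas.limit by blast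

definition CC :: "'a block list \<Rightarrow> 'a \<Rightarrow> 'a block list" where
  "CC l B = l @ mkL \<gamma> B @ v"

lemma CC_eq: "B \<in> elts (powV \<gamma>) \<Longrightarrow> CC l B = l @ Large \<gamma> B # v"
  unfolding CC_def using mkL_eq[OF gammaV(3)] powV(2)[OF gammaV(1)] by simp

lemma okb_gamma: "okb t \<Longrightarrow> kap t = \<gamma> \<Longrightarrow> \<exists>B\<in>elts (powV \<gamma>). t = Large \<gamma> B \<and> MI \<gamma> B"
  using okb_MI okb_same(1)[of t t] meas_ex powV(2)[OF gammaV(1)] by (metis (no_types, lifting) mem_Collect_eq)

lemma vcond: "\<exists>B\<in>elts (powV \<gamma>). cond (Large \<gamma> B # v)"
proof -
  obtain \<zeta> where "\<zeta> \<in> elts \<delta>" using ne by blast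
  then obtain l t where l: "l @ t # v \<in> GG" "kap t = \<gamma>" using Ev unfolding EE_def by blast
  then have "cond (t # v)" using GG_cond[OF l(1)] cond_append[of "t # v" l] by simp
  moreover from this have "okb t" by (simp add: cond_def)
  ultimately show ?thesis using okb_gamma[of t] l(2) by blast
qed

lemma vLL: "v \<in> LL"
  using vcond cond_LL by fastforce

text \<open>The link from the block at \<gamma> to \<open>v\<close> mentions the ordinal \<gamma>
  alone, so \<open>B\<close> matters only for its own measures.\<close>

lemma vcond_iff: "B \<in> elts (powV \<gamma>) \<Longrightarrow> cond (Large \<gamma> B # v) \<longleftrightarrow> MI \<gamma> B"
proof -
  obtain B0 where "cond (Large \<gamma> B0 # v)" using vcond by blast
  then show "cond (Large \<gamma> B # v) \<longleftrightarrow> MI \<gamma> B"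
    using meas_ex unfolding cond_def by (cases v) (auto simp: okb_def lk_def)
qed

lemma CC_cond: assumes B: "B \<in> elts (powV \<gamma>)"
  shows "cond (CC l B) \<longleftrightarrow> stem l \<and> below l \<gamma> \<and> MI \<gamma> B \<and> (\<forall>\<xi>\<in>elts B. below l \<xi>)"
proof
  assume c: "cond (CC l B)"
  have c': "cond (l @ Large \<gamma> B # v)" using c CC_eq[OF B] by simp
  then show "stem l \<and> below l \<gamma> \<and> MI \<gamma> B \<and> (\<forall>\<xi>\<in>elts B. below l \<xi>)"
    using cond_append[of "Large \<gamma> B # v" l] vcond_iff[OF B] cond_below[OF c'] cond_bset_above[OF c', of "Large \<gamma> B"]
    by auto
next
  assume a: "stem l \<and> below l \<gamma> \<and> MI \<gamma> B \<and> (\<forall>\<xi>\<in>elts B. below l \<xi>)"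
  then have "l \<noteq> [] \<longrightarrow> lk (last l) (Large \<gamma> B)" unfolding lk_def below_def by simp
  then show "cond (CC l B)"
    using a cond_append[of "Large \<gamma> B # v" l] vcond_iff[OF B] CC_eq[OF B] by simp
qed

definition stemok :: "'a block list \<Rightarrow> bool" where
  "stemok l \<longleftrightarrow> stem l \<and> below l \<gamma>"

lemma stem_LL: "stemok l \<Longrightarrow> l \<in> LL"
proof -
  assume "stemok l"
  then have "blk t" if "t \<in> set l" for t
    using that okb_MI gk unfolding stemok_def stem_def below_def blk_def by (cases t) fastforce+
  then show ?thesis by (simp add: LL_def)
qed

definition topB :: "'a block list \<Rightarrow> 'a" where
  "topB l = vset {\<xi> \<in> elts \<gamma>. below l \<xi>}"

lemma topB: assumes "stemok l" shows "topB l \<in> elts (powV \<gamma>)" "MI \<gamma> (topB l)" "cond (CC l (topB l))"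
    "elts (topB l) = {\<xi> \<in> elts \<gamma>. below l \<xi>}"
proof -
  note L = stem_LL[OF assms]
  have "topB l \<in> V" unfolding topB_def by (intro V_Collect gammaV df L)
  then show 1: "topB l \<in> elts (powV \<gamma>)" unfolding powV(2)[OF gammaV(1)] by (auto simp: topB_def)
  show 2: "MI \<gamma> (topB l)" unfolding topB_def using MI_below[OF L] assms stemok_def by blast
  show "elts (topB l) = {\<xi> \<in> elts \<gamma>. below l \<xi>}" by (simp add: topB_def)
  then show "cond (CC l (topB l))" using CC_cond[OF 1] 2 assms unfolding stemok_def by simp
qed

lemma CC_cond': "B \<in> elts (powV \<gamma>) \<Longrightarrow> cond (CC l B) \<longleftrightarrow> stemok l \<and> MI \<gamma> B \<and> elts B \<subseteq> elts (topB l)"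
  using CC_cond topB(4) powV(2)[OF gammaV(1)] unfolding stemok_def by auto

text \<open>In \<open>VD\<close> the set \<^term>\<open>B\<close> ranges over \<^term>\<open>V\<close>, not over the generic filter; so adding
  points to \<^term>\<open>l\<close> need not preserve the decision.\<close>

definition VD :: "'a block list \<Rightarrow> 'a \<Rightarrow> 'a \<Rightarrow> bool" where
  "VD l \<zeta> a \<longleftrightarrow> (\<exists>B\<in>elts (powV \<gamma>). cond (CC l B) \<and> RR (CC l B) \<zeta> a)"

lemma dfl_CC [df]: "dfl x \<Longrightarrow> dff t \<Longrightarrow> dfl (\<lambda>s. CC (x s) (t s))"
  unfolding CC_def by (intro df gammaV vLL)

lemma dfp_VD [df]: "dfl x \<Longrightarrow> dff t \<Longrightarrow> dff u \<Longrightarrow> dfp (\<lambda>s. VD (x s) (t s) (u s))"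
  unfolding VD_def by (intro df dfl_shift dff_shift gammaV powV)

lemma CC_le: "B \<in> elts (powV \<gamma>) \<Longrightarrow> B' \<in> elts (powV \<gamma>) \<Longrightarrow> ble l l' \<Longrightarrow> elts B' \<subseteq> elts B \<Longrightarrow> ble (CC l B) (CC l' B')"
  unfolding CC_eq by (auto intro!: ble_appendI simp: mtch_def)

lemma pow_Int: "B \<in> elts (powV \<gamma>) \<Longrightarrow> C \<in> V \<Longrightarrow> vset (elts B \<inter> elts C) \<in> elts (powV \<gamma>)"
  unfolding powV(2)[OF gammaV(1)] using V_Int by auto

lemma powV_V: "B \<in> elts (powV \<gamma>) \<Longrightarrow> B \<in> V"
  unfolding powV(2)[OF gammaV(1)] by simp

lemma VD_stem: "VD l \<zeta> a \<Longrightarrow> stemok l"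
  unfolding VD_def using CC_cond' by blast

text \<open>Two witnesses for the same lower part are compatible through the intersection of their
  sets, so \<open>l\<close> alone determines the value.\<close>

lemma VD_coherent:
  assumes "VD l \<zeta> a" "VD l \<zeta>' a'" "x \<in> elts \<zeta>" "x \<in> elts \<zeta>'" shows "x \<in> elts a \<longleftrightarrow> x \<in> elts a'"
proof -
  obtain B B' where B: "B \<in> elts (powV \<gamma>)" "cond (CC l B)" "RR (CC l B) \<zeta> a"
    "B' \<in> elts (powV \<gamma>)" "cond (CC l B')" "RR (CC l B') \<zeta>' a'" using assms unfolding VD_def by blast
  let ?C = "vset (elts B \<inter> elts B')"
  have C: "?C \<in> elts (powV \<gamma>)" using pow_Int B powV_V by blast
  have "cond (CC l ?C)" using CC_cond'[OF C] CC_cond'[OF B(1)] CC_cond'[OF B(4)] B MI_Int by auto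
  moreover have "ble (CC l B) (CC l ?C)" "ble (CC l B') (CC l ?C)"
    using CC_le[OF B(1) C ble_refl] CC_le[OF B(4) C ble_refl] by auto
  ultimately show ?thesis using RR_coherent[OF B(3,6)] assms by blast
qed

lemma VD_sub: "VD l \<zeta> a \<Longrightarrow> elts a \<subseteq> elts \<zeta>"
  unfolding VD_def using RR_cond(2) by blast

lemma VD_unique: "VD l \<zeta> a \<Longrightarrow> VD l \<zeta> a' \<Longrightarrow> a = a'"
  using VD_coherent[of l \<zeta> a \<zeta> a'] VD_sub by (intro elts_extensionality) blast

lemma VD_restrict: "VD l \<zeta> a \<Longrightarrow> elts \<zeta>' \<subseteq> elts \<zeta> \<Longrightarrow> elts a' = elts a \<inter> elts \<zeta>' \<Longrightarrow> VD l \<zeta>' a'"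
  unfolding VD_def using RR_restrict by blast

lemma VD_tv: "VD l \<zeta> (tv \<zeta>) \<Longrightarrow> elts \<zeta>' \<subseteq> elts \<zeta> \<Longrightarrow> VD l \<zeta>' (tv \<zeta>')"
  using VD_restrict[of l \<zeta> "tv \<zeta>" \<zeta>' "tv \<zeta>'"] by (auto simp: tv(1))

text \<open>\<open>ble l l'\<close> adds blocks only in front of blocks of \<open>l\<close>, never
  behind the last one, and a smaller set at \<gamma> repairs the condition. Blocks behind the last
  one would have to come from the unknown witness \<open>B\<close>.\<close>

lemma VD_mono:
  assumes "VD l \<zeta> a" "stemok l'" "ble l l'" shows "VD l' \<zeta> a"
proof -
  obtain B where B: "B \<in> elts (powV \<gamma>)" "cond (CC l B)" "RR (CC l B) \<zeta> a"
    using assms unfolding VD_def by blast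
  let ?C = "vset (elts B \<inter> elts (topB l'))"
  have C: "?C \<in> elts (powV \<gamma>)" using pow_Int B powV_V topB(1) assms by blast
  have c: "cond (CC l' ?C)" using CC_cond'[OF C] CC_cond'[OF B(1)] B MI_Int topB(2) assms(2) by auto
  moreover have "ble (CC l B) (CC l' ?C)" using CC_le[OF B(1) C assms(3)] by auto
  ultimately show ?thesis using RR_mono[OF B(3)] C unfolding VD_def by blast
qed

text \<open>Two kinds of added blocks are separated: those inside \<open>l\<close>, leading to
  \<open>x\<close>, preserve decisions by \<open>VD_mono\<close>; those in \<open>w\<close>, taken
  from the set at \<gamma>, are the ones to be controlled.\<close>

lemma ext_decomp:
  assumes c: "cond q" and b: "ble (CC l B) q" and B: "B \<in> elts (powV \<gamma>)"
  obtains x w B' v' where "q = x @ w @ Large \<gamma> B' # v'" "ble l x" "\<forall>y\<in>set w. insb (Large \<gamma> B) y"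
    "B' \<in> elts (powV \<gamma>)" "elts B' \<subseteq> elts B" "ble v v'"
proof -
  have "ble (l @ [Large \<gamma> B] @ v) q" using b CC_eq[OF B] by simp
  then obtain x y v' where q: "q = x @ y @ v'" "ble l x" "ble [Large \<gamma> B] y" "ble v v'"
    unfolding ble_append by blast
  then obtain w s where s: "y = w @ [s]" "\<forall>x\<in>set w. insb (Large \<gamma> B) x" "mtch (Large \<gamma> B) s"
    unfolding ble_single by blast
  have "okb s" using c q s by (auto simp: cond_def)
  then obtain B' where "B' \<in> elts (powV \<gamma>)" "s = Large \<gamma> B'" using okb_gamma s(3) by (auto simp: mtch_def)
  then show thesis using that[of x w B' v'] q s by (auto simp: mtch_def)
qed

definition SG :: "'a block list \<Rightarrow> bool" where
  "SG l \<longleftrightarrow> (\<exists>B\<in>elts (powV \<gamma>). CC l B \<in> GG)"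

lemma SG_stem: "SG l \<Longrightarrow> stemok l"
  unfolding SG_def using CC_cond' GG_cond by blast

text \<open>\<open>topB x\<close> contains every ordinal below \<gamma> that lies above
  \<open>x\<close>, so all blocks behind \<open>x\<close> could have been inserted from it. Hence
  the condition with lower part \<open>x\<close> and this set is weaker than one in the
  filter.\<close>

lemma SG_prefix:
  assumes r: "x @ y @ Large \<gamma> B # v' \<in> GG" and v: "ble v v'" shows "SG x"
proof -
  have c: "cond (x @ y @ Large \<gamma> B # v')" using r GG_cond by blast
  have st: "stemok x"
    unfolding stemok_def using cond_append[of "y @ Large \<gamma> B # v'" x] cond_below[of "x @ y" "Large \<gamma> B" v'] c by simp
  note t = topB[OF st]
  have m: "MI \<gamma> B \<and> B \<in> elts (powV \<gamma>)" using okb_gamma[of "Large \<gamma> B"] c by (auto simp: cond_def)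
  have ab: "below x \<xi>" if "t \<in> set (y @ [Large \<gamma> B])" "\<xi> \<in> bset t" for t \<xi>
    using cond_bset_above[of x "y @ Large \<gamma> B # v'" t \<xi>] c that by auto
  have "insb (Large \<gamma> (topB x)) s" if s: "s \<in> set y" for s
  proof -
    obtain y1 y2 where y: "y = y1 @ s # y2" using s by (meson split_list)
    have "below (x @ y1) (kap s)" using cond_below[of "x @ y1" s "y2 @ Large \<gamma> B # v'"] c y by simp
    moreover have "kap s \<in> elts \<gamma>" using cond_below[of "x @ y" "Large \<gamma> B" v'] c s by (auto simp: below_def)
    moreover have "\<xi> \<in> elts \<gamma> \<and> \<xi> \<in> elts (kap s) \<and> below x \<xi>" if "\<xi> \<in> bset s" for \<xi>
    proof -
      have "okb s" using c s by (auto simp: cond_def)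
      then have "\<xi> \<in> elts (kap s)" using bset_kap that by blast
      then show ?thesis using ab[of s \<xi>] s that Ord_trans[OF gammaV(2) _ \<open>kap s \<in> elts \<gamma>\<close>] by auto
    qed
    ultimately show ?thesis unfolding insb_def by (auto simp: t(4))
  qed
  moreover have "mtch (Large \<gamma> (topB x)) (Large \<gamma> B)"
    using m ab[of "Large \<gamma> B"] powV(2)[OF gammaV(1)] unfolding mtch_def by (auto simp: t(4))
  ultimately have "ble [Large \<gamma> (topB x)] (y @ [Large \<gamma> B])" using ble_singleI by blast
  then have "ble (x @ [Large \<gamma> (topB x)] @ v) (x @ (y @ [Large \<gamma> B]) @ v')"
    by (intro ble_appendI ble_refl v)
  then have "CC x (topB x) \<in> GG" using GG_down[OF r t(3)] CC_eq[OF t(1)] by simp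
  then show ?thesis using t(1) unfolding SG_def by blast
qed

lemma SG_decides: "\<zeta> \<in> elts \<delta> \<Longrightarrow> \<exists>l. SG l \<and> VD l \<zeta> (tv \<zeta>)"
proof -
  assume z: "\<zeta> \<in> elts \<delta>"
  then obtain l t a where l: "l @ t # v \<in> GG" "kap t = \<gamma>" "RR (l @ t # v) \<zeta> a" using Ev unfolding EE_def by blast
  then have "okb t" using GG_cond by (auto simp: cond_def)
  then obtain B where B: "B \<in> elts (powV \<gamma>)" "t = Large \<gamma> B" using okb_gamma l(2) by blast
  have "a = tv \<zeta>" using sound z l by blast
  then show ?thesis using l B CC_eq[OF B(1)] GG_cond unfolding SG_def VD_def by metis
qed

end

section \<open>From one-point extensions back to the lower part\<close>

context nmeas begin

lemma diag:
  assumes d: "dfp (\<lambda>s. Q (s 0) (s 1))" and l: "\<And>\<eta>. \<eta> \<in> elts \<alpha> \<Longrightarrow> lg (Q \<eta>)"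
  shows "lg (\<lambda>\<xi>. \<forall>\<eta>\<in>elts \<xi>. Q \<eta> \<xi>)"
proof (rule ccontr)
  assume n: "\<not> ?thesis"
  have "lg (\<lambda>\<xi>. \<not> (\<forall>\<eta>\<in>elts \<xi>. Q \<eta> \<xi>))"
    using n by (subst lg_not) (auto intro!: df dfp2I[OF d])
  then have "lg (\<lambda>\<xi>. \<exists>\<eta>\<in>elts \<xi>. \<not> Q \<eta> \<xi>)" by simp
  from pd_ord[OF dfp_not[OF d] this] obtain \<eta> where "\<eta> \<in> elts \<alpha>" "lg (\<lambda>\<xi>. \<not> Q \<eta> \<xi>)" by blast
  then show False using lg_ex[OF lg_conj[OF l]] by blast
qed

end

context coherent begin

definition msr :: "'a \<Rightarrow> 'a \<Rightarrow> 'a \<Rightarrow> bool" where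
  "msr \<alpha> \<beta> X \<longleftrightarrow> (\<exists>W\<in>V. opair (opair \<alpha> \<beta>) W \<in> elts U \<and> X \<in> elts W)"

lemma msr_iff: "msr \<alpha> \<beta> X \<longleftrightarrow> ob \<alpha> \<beta> \<and> X \<in> elts (meas \<alpha> \<beta>)"
  unfolding msr_def ob_def using meas_eq by metis

lemma dfp_msr [df]: "dff t \<Longrightarrow> dff u \<Longrightarrow> dff w \<Longrightarrow> dfp (\<lambda>s. msr (t s) (u s) (w s))"
  unfolding msr_def by (intro df dff_shift coh_basic)

definition shrink :: "'a \<Rightarrow> 'a block \<Rightarrow> 'a block" where
  "shrink S t = (case t of Point a \<Rightarrow> Point a | Large a B \<Rightarrow> Large a (vset (elts B \<inter> elts S)))"

lemma shrink [simp]: "kap (shrink S t) = kap t" "bset (shrink S t) = bset t \<inter> elts S"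
  by (auto simp: shrink_def split: block.splits)

lemma mtch_shrink: "mtch t (shrink S t)"
  by (simp add: mtch_def)

lemma ble_shrink: "ble l (map (shrink S) l)"
  by (induction l) (auto simp: mtch_shrink)

lemma okb_shrink:
  assumes o: "okb t" and m: "MI (kap t) (vset (elts S \<inter> elts (kap t)))" shows "okb (shrink S t)"
proof (cases t)
  case (Point a)
  then show ?thesis using o by (simp add: shrink_def)
next
  case (Large a B)
  then have B: "B \<in> V" "elts B \<subseteq> elts a" "MI a B" "\<exists>\<beta>\<in>V. ob a \<beta>" using o okb_MI by auto
  have "MI a (vset (elts B \<inter> elts (vset (elts S \<inter> elts a))))" using MI_Int[OF B(3)] m unfolding Large kap.simps by blast
  moreover have "elts B \<inter> elts (vset (elts S \<inter> elts a)) = elts B \<inter> elts S" using B(2) by auto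
  ultimately have "MI a (vset (elts B \<inter> elts S))" by metis
  then show ?thesis using B(4) Large by (simp add: shrink_def okb_def)
qed

lemma lk_shrink: "lk t s \<Longrightarrow> kap t' = kap t \<Longrightarrow> kap s' = kap s \<Longrightarrow> bset s' \<subseteq> bset s \<Longrightarrow> lk t' s'"
  unfolding lk_def by auto

lemma successively_shrink:
  "successively lk l \<Longrightarrow> successively lk (map (shrink S) l)"
  by (induction l rule: induct_list012) (auto intro: lk_shrink)

lemma MI_above: assumes "\<xi> \<in> elts \<eta>" shows "MI \<eta> (vset {\<zeta> \<in> elts \<eta>. \<xi> \<in> elts \<zeta>})"
  unfolding MI_lg using nmeas nmeas.lg_above assms by blast

end

context core begin

definition blkat :: "'a \<Rightarrow> 'a block list \<Rightarrow> bool" where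
  "blkat \<xi> w \<longleftrightarrow> w = mkP \<xi> \<or> (\<exists>b\<in>elts (powV \<xi>). w = mkL \<xi> b)"

text \<open>The set of the appended block is left open, so that the predicate depends on the ordinal
  \<xi> only; by \<open>VD1_unique\<close> so does the value.\<close>

definition VD1 :: "'a block list \<Rightarrow> 'a \<Rightarrow> 'a \<Rightarrow> 'a \<Rightarrow> bool" where
  "VD1 l \<xi> \<zeta> a \<longleftrightarrow> (\<exists>w\<in>LL. blkat \<xi> w \<and> VD (l @ w) \<zeta> a)"

lemma dfp_blkat [df]: "dff t \<Longrightarrow> dfl x \<Longrightarrow> dfp (\<lambda>s. blkat (t s) (x s))"
  unfolding blkat_def by (intro df dff_shift dfl_shift)

lemma dfp_VD1 [df]: "dfl x \<Longrightarrow> dff t \<Longrightarrow> dff u \<Longrightarrow> dff w \<Longrightarrow> dfp (\<lambda>s. VD1 (x s) (t s) (u s) (w s))"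
  unfolding VD1_def by (intro df dff_shift dfl_shift)

lemma blkat_single: "\<xi> \<in> elts \<gamma> \<Longrightarrow> blkat \<xi> w \<Longrightarrow> \<exists>t. w = [t] \<and> kap t = \<xi>"
proof -
  assume x: "\<xi> \<in> elts \<gamma>" and w: "blkat \<xi> w"
  have k: "\<xi> \<in> elts \<kappa>" "\<xi> \<in> V" using gk[OF x] V_trans[OF coh_basic(2)] by blast+
  then show ?thesis using w powV(2)[OF k(2)] unfolding blkat_def by (auto simp: mkP_def mkL_def)
qed

lemma VD1_iff: assumes "\<xi> \<in> elts \<gamma>" shows "VD1 l \<xi> \<zeta> a \<longleftrightarrow> (\<exists>t. kap t = \<xi> \<and> VD (l @ [t]) \<zeta> a)"
proof
  assume "VD1 l \<xi> \<zeta> a"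
  then show "\<exists>t. kap t = \<xi> \<and> VD (l @ [t]) \<zeta> a" using blkat_single[OF assms] unfolding VD1_def by metis
next
  assume "\<exists>t. kap t = \<xi> \<and> VD (l @ [t]) \<zeta> a"
  then obtain t where t: "kap t = \<xi>" "VD (l @ [t]) \<zeta> a" by blast
  then have L: "[t] \<in> LL" using stem_LL VD_stem by fastforce
  have k: "\<xi> \<in> elts \<kappa>" "\<xi> \<in> V" using gk[OF assms] V_trans[OF coh_basic(2)] by blast+
  have "blkat \<xi> [t]"
    using L t(1) k powV(2)[OF k(2)] unfolding blkat_def
    by (cases t) (auto simp: blk_def mkP_def mkL_def)
  then show "VD1 l \<xi> \<zeta> a" using L t(2) unfolding VD1_def by blast
qed

definition inb :: "'a \<Rightarrow> 'a \<Rightarrow> bool" where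
  "inb c \<eta> \<longleftrightarrow> (\<exists>d\<in>V. c = opair d (vset {}) \<and> bsc d \<eta>)"

lemma dfp_inb [df]: "dff t \<Longrightarrow> dff u \<Longrightarrow> dfp (\<lambda>s. inb (t s) (u s))"
  unfolding inb_def by (intro df dff_shift V_empty)

lemma inb: "blk t \<Longrightarrow> inb (code_seq [t]) \<eta> \<longleftrightarrow> \<eta> \<in> bset t"
  unfolding inb_def using bsc blk_code_V by auto

text \<open>If almost every (for one of the measures on \<^term>\<open>\<gamma>\<close>) one-point extension of \<^term>\<open>l\<close> decides the same
  value, then so does \<^term>\<open>l\<close>: below the set \<^term>\<open>B\<close> constructed here, every condition is compatible
  with one of these extensions.\<close>

lemma one_step:
  assumes i: "ob \<gamma> i" and l: "l \<in> LL" and z: "\<zeta> \<in> V" "elts \<zeta> \<subseteq> elts \<delta>" and a: "a \<in> V"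
    and lg1: "lgm \<gamma> i (\<lambda>\<xi>. VD1 l \<xi> \<zeta> a)"
  shows "VD l \<zeta> a"
proof -
  interpret nmeas V \<gamma> "meas \<gamma> i" using nmeas[OF i] .
  obtain Y where Y: "Y \<in> V" and eY: "elts Y = {\<xi> \<in> elts \<gamma>. VD1 l \<xi> \<zeta> a}"
  proof
    show "vset {\<xi> \<in> elts \<gamma>. VD1 l \<xi> \<zeta> a} \<in> V" by (intro V_Collect df gammaV l z a)
  qed simp
  have lgY: "lg (\<lambda>\<xi>. \<xi> \<in> elts Y)"
  proof (rule lg_mono[OF lg1])
    show "dfp (\<lambda>s. s 0 \<in> elts Y)" by (intro df Y)
  qed (simp add: eY)
  have st: "stemok l"
  proof -
    obtain \<xi> where "\<xi> \<in> elts \<gamma>" "VD1 l \<xi> \<zeta> a" using lg_ex[OF lg1] by blast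
    then obtain t where "VD (l @ [t]) \<zeta> a" using VD1_iff by blast
    then have "stemok (l @ [t])" using VD_stem by blast
    then show ?thesis unfolding stemok_def by (simp add: stem_append)
  qed
  \<comment> \<open>The appended block and then the set at \<gamma> are chosen by definable
    functions of \<xi>, so that diagonal intersections can be formed from them in V.\<close>
  have q1: "dfp (\<lambda>s. blkat (s 0) (dec (s 1)) \<and> VD (l @ dec (s 1)) \<zeta> a)" by (intro df l z a)
  have q1ex: "\<exists>c\<in>elts LC. blkat \<xi> (dec c) \<and> VD (l @ dec c) \<zeta> a" if xi: "\<xi> \<in> elts Y" for \<xi>
  proof -
    obtain w where "w \<in> LL" "blkat \<xi> w" "VD (l @ w) \<zeta> a" using xi unfolding eY VD1_def by blast
    then show ?thesis using code_LC by (intro bexI[of _ "code_seq w"]) auto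
  qed
  obtain h1 where h1: "dfn h1" "\<And>\<xi>. \<xi> \<in> elts Y \<Longrightarrow> h1 \<xi> \<in> elts LC \<and> blkat \<xi> (dec (h1 \<xi>)) \<and> VD (l @ dec (h1 \<xi>)) \<zeta> a"
    by (rule choice_fun[of Y LC "\<lambda>\<xi> c. blkat \<xi> (dec c) \<and> VD (l @ dec c) \<zeta> a", OF Y LC_V q1 q1ex]) blast+
  have q2: "dfp (\<lambda>s. cond (CC (l @ dec (h1 (s 0))) (s 1)) \<and> RR (CC (l @ dec (h1 (s 0))) (s 1)) \<zeta> a)"
    by (intro df l z a dfnD[OF h1(1)])
  have q2ex: "\<exists>B\<in>elts (powV \<gamma>). cond (CC (l @ dec (h1 \<xi>)) B) \<and> RR (CC (l @ dec (h1 \<xi>)) B) \<zeta> a" if xi: "\<xi> \<in> elts Y" for \<xi>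
    using h1(2)[OF xi] unfolding VD_def by blast
  obtain h2 where h2: "dfn h2" "\<And>\<xi>. \<xi> \<in> elts Y \<Longrightarrow> h2 \<xi> \<in> elts (powV \<gamma>) \<and> cond (CC (l @ dec (h1 \<xi>)) (h2 \<xi>)) \<and>
       RR (CC (l @ dec (h1 \<xi>)) (h2 \<xi>)) \<zeta> a"
    by (rule choice_fun[of Y "powV \<gamma>" "\<lambda>\<xi> B. cond (CC (l @ dec (h1 \<xi>)) B) \<and> RR (CC (l @ dec (h1 \<xi>)) B) \<zeta> a",
      OF Y powV(1)[OF gammaV(1)] q2 q2ex]) blast+
  define tt where "tt \<xi> = hd (dec (h1 \<xi>))" for \<xi>
  have tt: "dec (h1 \<xi>) = [tt \<xi>]" "kap (tt \<xi>) = \<xi>" "inb (h1 \<xi>) \<eta> \<longleftrightarrow> \<eta> \<in> bset (tt \<xi>)" "okb (tt \<xi>)" "\<xi> \<in> elts \<gamma>"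
      "bset (tt \<xi>) \<subseteq> elts \<xi>" if xi: "\<xi> \<in> elts Y" for \<xi> \<eta>
  proof -
    show xg: "\<xi> \<in> elts \<gamma>" using xi eY by blast
    obtain t where t: "dec (h1 \<xi>) = [t]" "kap t = \<xi>" using blkat_single[OF xg] h1(2)[OF xi] by blast
    then show 1: "dec (h1 \<xi>) = [tt \<xi>]" "kap (tt \<xi>) = \<xi>" by (auto simp: tt_def)
    have bl: "blk (tt \<xi>)" using dec_LL[of "h1 \<xi>"] unfolding 1 by simp
    have "h1 \<xi> = code_seq [tt \<xi>]" using code_dec[of "h1 \<xi>"] h1(2)[OF xi] 1 by simp
    then show "inb (h1 \<xi>) \<eta> \<longleftrightarrow> \<eta> \<in> bset (tt \<xi>)" using inb[OF bl] by simp
    have "stemok (l @ [tt \<xi>])" using h1(2)[OF xi] VD_stem 1 by metis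
    then show ok: "okb (tt \<xi>)" unfolding stemok_def stem_def by simp
    show "bset (tt \<xi>) \<subseteq> elts \<xi>" using bset_kap[OF ok] unfolding 1(2) by blast
  qed
  \<comment> \<open>By normality the sets of the chosen blocks cohere: for almost every \<xi> the
    set at \<xi> is the trace on \<xi> of this single \<open>Blt\<close>.\<close>
  obtain Blt where Blt: "Blt \<in> V" and eBlt: "elts Blt = {\<eta> \<in> elts \<gamma>. lg (\<lambda>\<xi>. \<xi> \<in> elts Y \<and> inb (h1 \<xi>) \<eta>)}"
  proof
    show "vset {\<eta> \<in> elts \<gamma>. lg (\<lambda>\<xi>. \<xi> \<in> elts Y \<and> inb (h1 \<xi>) \<eta>)} \<in> V"
      unfolding lg_def by (intro V_Collect df gammaV Y gammaV nm_basic(1) dfnD[OF h1(1)])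
  qed simp
  have Blts: "elts Blt \<subseteq> elts \<gamma>" using eBlt by blast
  have lgB: "lg (\<lambda>\<xi>. \<forall>\<eta>\<in>elts \<xi>. inb (h1 \<xi>) \<eta> \<longleftrightarrow> \<eta> \<in> elts Blt)"
  proof (rule diag)
    show "dfp (\<lambda>s. inb (h1 (s 1)) (s 0) \<longleftrightarrow> s 0 \<in> elts Blt)" by (intro df Blt dfnD[OF h1(1)])
    fix \<eta> assume e: "\<eta> \<in> elts \<gamma>"
    have eV: "\<eta> \<in> V" using V_trans[OF gammaV(1) e] .
    have dd: "dfp (\<lambda>s. inb (h1 (s 0)) \<eta>)" by (intro df eV dfnD[OF h1(1)])
    show "lg (\<lambda>\<xi>. inb (h1 \<xi>) \<eta> \<longleftrightarrow> \<eta> \<in> elts Blt)"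
    proof (cases "\<eta> \<in> elts Blt")
      case True
      then have "lg (\<lambda>\<xi>. \<xi> \<in> elts Y \<and> inb (h1 \<xi>) \<eta>)" using eBlt by blast
      then show ?thesis by (rule lg_mono) (use True in \<open>auto intro!: dd\<close>)
    next
      case False
      then have "\<not> lg (\<lambda>\<xi>. \<xi> \<in> elts Y \<and> inb (h1 \<xi>) \<eta>)" using eBlt e by blast
      then have "\<not> lg (\<lambda>\<xi>. inb (h1 \<xi>) \<eta>)" using lg_conj[OF lgY] by blast
      then have "lg (\<lambda>\<xi>. \<not> inb (h1 \<xi>) \<eta>)" using lg_not[OF dd] by blast
      then show ?thesis using False by simp
    qed
  qed
  obtain Y' where Y': "Y' \<in> V" and eY': "elts Y' = {\<xi> \<in> elts Y. \<forall>\<eta>\<in>elts \<xi>. inb (h1 \<xi>) \<eta> \<longleftrightarrow> \<eta> \<in> elts Blt}"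
  proof
    show "vset {\<xi> \<in> elts Y. \<forall>\<eta>\<in>elts \<xi>. inb (h1 \<xi>) \<eta> \<longleftrightarrow> \<eta> \<in> elts Blt} \<in> V"
      by (intro V_Collect df Y Blt dfnD[OF h1(1)])
  qed simp
  have Y's: "elts Y' \<subseteq> elts \<gamma>" "elts Y' \<subseteq> elts Y" using eY' eY by blast+
  have Y'D: "Y' \<in> elts (meas \<gamma> i)"
  proof -
    have "lg (\<lambda>\<xi>. \<xi> \<in> elts Y')"
    proof (rule lg_mono[OF lg_conj[OF lgY lgB]])
      show "dfp (\<lambda>s. s 0 \<in> elts Y')" by (intro df Y')
    qed (simp add: eY')
    then show ?thesis using lg_mem_iff[OF Y's(1)] by blast
  qed
  have bt: "bset (tt \<xi>) = elts Blt \<inter> elts \<xi>" if "\<xi> \<in> elts Y'" for \<xi>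
    using that tt(3,6)[of \<xi>] unfolding eY' by blast
  have MIY': "MI \<xi> (vset (elts Blt \<inter> elts \<xi>))" if xi: "\<xi> \<in> elts Y'" for \<xi>
  proof -
    have xY: "\<xi> \<in> elts Y" using xi Y's by blast
    show ?thesis
    proof (cases "tt \<xi>")
      case (Point c)
      then have "\<not> (\<exists>\<beta>\<in>V. ob \<xi> \<beta>)" using tt(2,4)[OF xY] by (auto simp: okb_def)
      then show ?thesis using MI_iff obD(3) by blast
    next
      case (Large c b)
      then have "MI \<xi> b" using tt(2,4)[OF xY] by (auto simp: okb_def)
      moreover have "b = vset (elts Blt \<inter> elts \<xi>)" using bt[OF xi] Large vset_elts[of b] by simp
      ultimately show ?thesis by simp
    qed
  qed
  \<comment> \<open>The chosen blocks are legitimate, so almost every \<xi> has the trace of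
    \<open>Blt\<close> in all its measures; coherence puts \<open>Blt\<close> into the measures on
    \<gamma> of index below i.\<close>
  have Blti: "\<forall>i'\<in>elts i. Blt \<in> elts (meas \<gamma> i')"
  proof -
    have "lg (\<lambda>\<nu>. MI \<nu> (vset (elts Blt \<inter> elts \<nu>)))"
      by (rule lg_mono[OF lg_memD[OF Y'D]]) (use MIY' in \<open>auto intro!: df Blt\<close>)
    then show ?thesis using coherence_all[OF i Blt Blts] by blast
  qed
  \<comment> \<open>Three kinds of points serve all measures on \<gamma>: \<open>B1\<close> those of
    index below i, \<open>Y'\<close> the one of index i, and \<open>B3\<close>, where some measure
    concentrates on \<open>Y'\<close>, those of index above i.\<close>
  obtain B1 where B1: "B1 \<in> V" and eB1: "elts B1 = {\<eta> \<in> elts Blt. MI \<eta> (vset (elts Blt \<inter> elts \<eta>))}"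
  proof
    show "vset {\<eta> \<in> elts Blt. MI \<eta> (vset (elts Blt \<inter> elts \<eta>))} \<in> V" by (intro V_Collect df Blt Blt)
  qed simp
  obtain B3 where B3: "B3 \<in> V" and eB3: "elts B3 = {\<eta> \<in> elts \<gamma>. \<exists>k\<in>V. msr \<eta> k (vset (elts Y' \<inter> elts \<eta>))}"
  proof
    show "vset {\<eta> \<in> elts \<gamma>. \<exists>k\<in>V. msr \<eta> k (vset (elts Y' \<inter> elts \<eta>))} \<in> V" by (intro V_Collect df gammaV Y')
  qed simp
  \<comment> \<open>The diagonal intersection of the sets \<open>h2 \<xi>\<close>: points above
    \<xi> are allowed by the condition chosen for \<xi>.\<close>
  let ?P4 = "\<lambda>\<eta>. \<forall>\<xi>\<in>elts \<eta>. \<xi> \<in> elts Y \<longrightarrow> \<eta> \<in> elts (h2 \<xi>)"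
  obtain B where B: "B \<in> V" and eB: "elts B = {\<eta> \<in> elts (topB l). (\<eta> \<in> elts B1 \<or> \<eta> \<in> elts Y' \<or> \<eta> \<in> elts B3) \<and> ?P4 \<eta>}"
  proof
    have tV: "topB l \<in> V" using topB(1)[OF st] powV_V by blast
    show "vset {\<eta> \<in> elts (topB l). (\<eta> \<in> elts B1 \<or> \<eta> \<in> elts Y' \<or> \<eta> \<in> elts B3) \<and> ?P4 \<eta>} \<in> V"
      by (intro V_Collect df tV B1 Y' B3 Y dfnD[OF h2(1)])
  qed simp
  have topg: "elts (topB l) \<subseteq> elts \<gamma>" using topB(4)[OF st] by blast
  have Bpow: "B \<in> elts (powV \<gamma>)" unfolding powV(2)[OF gammaV(1)] using B eB topg by blast
  have MIB: "MI \<gamma> B"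
    unfolding MI_iff
  proof (intro allI impI)
    fix k assume k: "ob \<gamma> k"
    interpret k: nmeas V \<gamma> "meas \<gamma> k" using nmeas[OF k] .
    have "k.lg ?P4"
    proof (rule k.diag)
      show "dfp (\<lambda>s. s 0 \<in> elts Y \<longrightarrow> s 1 \<in> elts (h2 (s 0)))" by (intro df Y dfnD[OF h2(1)])
      fix \<xi> assume x: "\<xi> \<in> elts \<gamma>"
      have xV: "\<xi> \<in> V" using V_trans[OF gammaV(1) x] .
      show "k.lg (\<lambda>\<eta>. \<xi> \<in> elts Y \<longrightarrow> \<eta> \<in> elts (h2 \<xi>))"
      proof (cases "\<xi> \<in> elts Y")
        case True
        then have "MI \<gamma> (h2 \<xi>)" using h2(2) CC_cond' by blast
        then show ?thesis using k.lg_memD[of "h2 \<xi>"] k True MI_iff by simp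
      qed (simp add: k.lg_True)
    qed
    moreover have "k.lg (\<lambda>\<eta>. \<eta> \<in> elts (topB l))"
      using topB(2)[OF st] k k.lg_memD MI_iff by blast
    moreover have "k.lg (\<lambda>\<eta>. \<eta> \<in> elts B1 \<or> \<eta> \<in> elts Y' \<or> \<eta> \<in> elts B3)"
    proof -
      have dB: "dfp (\<lambda>s. s 0 \<in> elts B1 \<or> s 0 \<in> elts Y' \<or> s 0 \<in> elts B3)" by (intro df B1 Y' B3)
      consider "k \<in> elts i" | "k = i" | "i \<in> elts k" using Ord_linear obD(5) i k by blast
      then show ?thesis
      proof cases
        case 1
        have "\<forall>i'\<in>elts k. Blt \<in> elts (meas \<gamma> i')" using Blti Ord_trans[OF obD(5)[OF i] _ 1] by blast
        then have "k.lg (\<lambda>\<nu>. MI \<nu> (vset (elts Blt \<inter> elts \<nu>)))" using coherence_all[OF k Blt Blts] by blast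
        moreover have "k.lg (\<lambda>\<nu>. \<nu> \<in> elts Blt)" using Blti 1 k.lg_memD by blast
        ultimately have "k.lg (\<lambda>\<nu>. MI \<nu> (vset (elts Blt \<inter> elts \<nu>)) \<and> \<nu> \<in> elts Blt)" by (rule k.lg_conj)
        then show ?thesis
          by (rule k.lg_mono[OF _ dB]) (simp add: eB1)
      next
        case 2
        then have "k.lg (\<lambda>\<nu>. \<nu> \<in> elts Y')" using Y'D k.lg_memD by blast
        then show ?thesis
          by (rule k.lg_mono[OF _ dB]) simp
      next
        case 3
        have "k.lg (\<lambda>\<nu>. \<exists>i\<in>V. ob \<nu> i \<and> vset (elts Y' \<inter> elts \<nu>) \<in> elts (meas \<nu> i))"
          using coherence_ex[OF k Y' Y's(1)] 3 Y'D by blast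
        then show ?thesis
          by (rule k.lg_mono[OF _ dB]) (simp add: eB3 msr_iff)
      qed
    qed
    ultimately have "k.lg (\<lambda>\<eta>. ?P4 \<eta> \<and> \<eta> \<in> elts (topB l) \<and> (\<eta> \<in> elts B1 \<or> \<eta> \<in> elts Y' \<or> \<eta> \<in> elts B3))"
      using k.lg_conj by blast
    then have "k.lg (\<lambda>\<eta>. \<eta> \<in> elts B)"
    proof (rule k.lg_mono)
      show "dfp (\<lambda>s. s 0 \<in> elts B)" by (intro df B)
    qed (simp add: eB)
    then show "B \<in> elts (meas \<gamma> k)" using k.lg_mem_iff[of B] eB topg by blast
  qed
  have cB: "cond (CC l B)" using CC_cond'[OF Bpow] st MIB eB by blast
  have B4: "\<eta> \<in> elts (h2 \<xi>)" if "\<eta> \<in> elts B" "\<xi> \<in> elts \<eta>" "\<xi> \<in> elts Y'" for \<eta> \<xi>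
    using that eB Y's by blast
  have Bg: "elts B \<subseteq> elts \<gamma>" using eB topg by blast
  \<comment> \<open>The shape aimed at: between the refinement of \<open>l\<close> and
    \<open>ts\<close> only blocks inside \<open>Blt\<close>, behind \<open>ts\<close> only blocks
    from \<open>B\<close>. Such a condition extends the one chosen for \<xi> and inherits its
    decision.\<close>
  have fin: "RR (x @ (u1 @ [ts]) @ U1 @ Large \<gamma> Bx # v') \<zeta> a"
    if c: "cond (x @ (u1 @ [ts]) @ U1 @ Large \<gamma> Bx # v')" and lx: "ble l x" and xi: "\<xi> \<in> elts Y'"
      and ts: "kap ts = \<xi>" "bset ts \<subseteq> elts Blt \<inter> elts \<xi>"
      and u1: "\<forall>z\<in>set u1. kap z \<in> elts Blt \<and> bset z \<subseteq> elts Blt"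
      and U1: "\<forall>z\<in>set U1. kap z \<in> elts B \<and> bset z \<subseteq> elts B" and Bx: "elts Bx \<subseteq> elts B" and vv: "ble v v'"
    for x u1 ts U1 Bx v' \<xi>
  proof -
    have xY: "\<xi> \<in> elts Y" using xi Y's by blast
    note h = h2(2)[OF xY, unfolded tt(1)[OF xY]]
    have Ox: "Ord \<xi>" using Ord_in_Ord[OF gammaV(2) tt(5)[OF xY]] .
    have ok: "okb z" if "z \<in> set (x @ (u1 @ [ts]) @ U1 @ Large \<gamma> Bx # v')" for z
      using c that unfolding cond_def by blast
    have kz: "kap z \<in> elts \<xi>" if "z \<in> set u1" for z
      using cond_below[of "x @ u1" ts "U1 @ Large \<gamma> Bx # v'"] c ts(1) that by (auto simp: below_def)
    have "insb (tt \<xi>) z" if z: "z \<in> set u1" for z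
    proof -
      have "bset z \<subseteq> elts (kap z)" using bset_kap[OF ok] z by auto
      then show ?thesis
        unfolding insb_def bt[OF xi] using u1 z kz[OF z] Ord_subset[OF Ox kz[OF z]] by blast
    qed
    moreover have "mtch (tt \<xi>) ts" unfolding mtch_def bt[OF xi] using ts tt(2)[OF xY] by auto
    ultimately have 1: "ble [tt \<xi>] (u1 @ [ts])" using ble_singleI by blast
    have ab: "\<xi> \<in> elts \<xi>'" if "z \<in> set (U1 @ [Large \<gamma> Bx])" "\<xi>' \<in> bset z" for z \<xi>'
    proof -
      have "below (x @ u1 @ [ts]) \<xi>'"
        using cond_bset_above[of "x @ u1 @ [ts]" "U1 @ Large \<gamma> Bx # v'" z \<xi>'] c that by auto
      then show ?thesis using ts(1) by simp
    qed
    have "insb (Large \<gamma> (h2 \<xi>)) z" if z: "z \<in> set U1" for z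
    proof -
      obtain a1 a2 where U: "U1 = a1 @ z # a2" using z by (meson split_list)
      have "below (x @ u1 @ [ts] @ a1) (kap z)"
        using cond_below[of "x @ u1 @ [ts] @ a1" z "a2 @ Large \<gamma> Bx # v'"] c U by simp
      then have "kap z \<in> elts (h2 \<xi>)" using B4[of "kap z" \<xi>] U1 z xi ts(1) by simp
      moreover have "y \<in> elts (h2 \<xi>)" if "y \<in> bset z" for y
        using B4[OF _ ab[of z y] xi] U1 z that by auto
      moreover have "bset z \<subseteq> elts (kap z)" using bset_kap[OF ok] z by auto
      ultimately show ?thesis unfolding insb_def by auto
    qed
    moreover have "mtch (Large \<gamma> (h2 \<xi>)) (Large \<gamma> Bx)"
    proof -
      have "x \<in> elts (h2 \<xi>)" if "x \<in> elts Bx" for x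
        using B4[OF subsetD[OF Bx that] ab[of "Large \<gamma> Bx" x] xi] that by simp
      then show ?thesis unfolding mtch_def by auto
    qed
    ultimately have 2: "ble [Large \<gamma> (h2 \<xi>)] (U1 @ [Large \<gamma> Bx])" using ble_singleI by blast
    have "ble (l @ [tt \<xi>] @ [Large \<gamma> (h2 \<xi>)] @ v) (x @ (u1 @ [ts]) @ (U1 @ [Large \<gamma> Bx]) @ v')"
      by (intro ble_appendI lx 1 2 vv)
    then have "ble (CC (l @ [tt \<xi>]) (h2 \<xi>)) (x @ (u1 @ [ts]) @ U1 @ Large \<gamma> Bx # v')"
      using CC_eq h by simp
    then show ?thesis using RR_mono[OF _ c] h by blast
  qed
  have "RR (CC l B) \<zeta> a"
  proof (rule RR_dense[OF z(2) cB])
    fix q assume q: "cond q" "ble (CC l B) q"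
    obtain x w B' v' where qd: "q = x @ w @ Large \<gamma> B' # v'" "ble l x" "\<forall>y\<in>set w. insb (Large \<gamma> B) y"
      "B' \<in> elts (powV \<gamma>)" "elts B' \<subseteq> elts B" "ble v v'"
      using ext_decomp[OF q Bpow] by metis
    \<comment> \<open>The block at \<gamma> is included since its ordinal is not in
      \<open>B1\<close>, so a first block \<open>y\<close> outside \<open>B1\<close> exists. The
      blocks before \<open>y\<close> may be shrunk to \<open>Blt\<close>, by the definition of
      \<open>B1\<close>.\<close>
    let ?u = "w @ [Large \<gamma> B']"
    have "kap (Large \<gamma> B') \<notin> elts B1" using eB1 Blts elts_irrefl[of \<gamma>] by auto
    then have "\<exists>y\<in>set ?u. kap y \<notin> elts B1" by auto
    then obtain u1 y u2 where u: "?u = u1 @ y # u2" "kap y \<notin> elts B1" "\<forall>z\<in>set u1. kap z \<in> elts B1"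
      using split_list_first_prop[of ?u "\<lambda>y. kap y \<notin> elts B1"] by auto
    have qe: "q = x @ u1 @ y # u2 @ v'" using qd(1) u(1) by (metis append.assoc append_Cons append_Nil)
    have okq: "okb z" if "z \<in> set (x @ u1 @ y # u2 @ v')" for z using q(1) that unfolding qe cond_def by blast
    have u1w: "set u1 \<subseteq> set w"
      using u(1) by (cases u2 rule: rev_cases) auto
    have elB: "bset z \<subseteq> elts B" if "z \<in> set ?u" for z
      using that qd(3,5) unfolding insb_def by auto
    have Blt1: "kap z \<in> elts Blt" "MI (kap z) (vset (elts Blt \<inter> elts (kap z)))" if "z \<in> set u1" for z
      using u(3) that eB1 by blast+
    let ?s = "shrink Blt"
    let ?u1 = "map ?s u1"
    have u1': "\<forall>z\<in>set ?u1. kap z \<in> elts Blt \<and> bset z \<subseteq> elts Blt" using Blt1 by auto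
    have stu: "stem (x @ u1)" and juy: "x @ u1 \<noteq> [] \<longrightarrow> lk (last (x @ u1)) y" and cy: "cond (y # u2 @ v')"
      using q(1) cond_append[of "y # u2 @ v'" "x @ u1"] unfolding qe by auto
    have stu': "stem (x @ ?u1)"
    proof -
      have "stem ?u1" using stu okb_shrink okq Blt1
        unfolding stem_def by (auto intro: successively_shrink simp: successively_append_iff)
      moreover have "lk (last x) (hd ?u1)" if "x \<noteq> []" "u1 \<noteq> []"
      proof -
        have "lk (last x) (hd u1)" using stu that by (simp add: stem_append)
        moreover have "hd ?u1 = ?s (hd u1)" using that by (simp add: hd_map)
        ultimately show ?thesis
          using lk_shrink[of "last x" "hd u1" "last x" "?s (hd u1)"] by simp
      qed
      ultimately show ?thesis using stu unfolding stem_append by auto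
    qed
    have last': "kap (last (x @ ?u1)) = kap (last (x @ u1))" if "x @ u1 \<noteq> []"
      using that by (cases "u1 = []") (auto simp: last_map)
    show "\<exists>r. cond r \<and> ble q r \<and> RR r \<zeta> a"
    proof (cases "kap y \<in> elts Y'")
      \<comment> \<open>Here \<open>y\<close>, shrunk to \<open>Blt\<close>, itself takes the place
        of the block chosen at its ordinal.\<close>
      case True
      have yne: "u2 \<noteq> []"
      proof
        assume "u2 = []"
        then have "y = Large \<gamma> B'" using u(1) by simp
        then show False using True Y's(1) elts_irrefl[of \<gamma>] by auto
      qed
      then obtain u2' where u2: "u2 = u2' @ [Large \<gamma> B']" "w = u1 @ y # u2'"
        using u(1) by (cases u2 rule: rev_cases) auto
      have oy: "okb (?s y)" using okb_shrink okq MIY'[OF True] by simp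
      have cu: "cond (u2 @ v')" "lk y (hd (u2 @ v'))"
        using cy cond_append[of "u2 @ v'" "[y]"] yne by auto
      have "cond (?s y # u2 @ v')"
        using cond_append[of "u2 @ v'" "[?s y]"] cu oy yne lk_shrink[of y "hd (u2 @ v')" "?s y" "hd (u2 @ v')"]
        by (simp add: stem_def)
      moreover have "lk (last (x @ ?u1)) (?s y)" if "x @ ?u1 \<noteq> []"
        using juy that last' lk_shrink[of "last (x @ u1)" y "last (x @ ?u1)" "?s y"] by auto
      ultimately have cr: "cond ((x @ ?u1) @ ?s y # u2 @ v')"
        using cond_append[of "?s y # u2 @ v'" "x @ ?u1"] stu' unfolding list.sel by blast
      have "ble q ((x @ ?u1) @ ?s y # u2 @ v')"
      proof -
        have "ble (x @ u1 @ [y] @ u2 @ v') (x @ ?u1 @ [?s y] @ u2 @ v')"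
          by (intro ble_appendI ble_refl ble_shrink) (simp add: mtch_shrink)
        then show ?thesis unfolding qe by simp
      qed
      moreover have "RR (x @ (?u1 @ [?s y]) @ u2' @ Large \<gamma> B' # v') \<zeta> a"
      proof (rule fin[OF _ qd(2) True])
        show "cond (x @ (?u1 @ [?s y]) @ u2' @ Large \<gamma> B' # v')" using cr u2(1) by simp
        show "bset (?s y) \<subseteq> elts Blt \<inter> elts (kap y)" using bset_kap[OF okq, of y] by auto
        show "\<forall>z\<in>set u2'. kap z \<in> elts B \<and> bset z \<subseteq> elts B"
          using qd(3) u2(2) elB unfolding insb_def by auto
      qed (use u1' qd in auto)
      ultimately show ?thesis using cr u2(1) by (intro exI[of _ "(x @ ?u1) @ ?s y # u2 @ v'"]) simp
    next
      \<comment> \<open>Now the ordinal of \<open>y\<close> is \<gamma> or a point of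
        \<open>B3\<close>; either way one of its measures concentrates on \<open>Y'\<close>, so some
        \<xi> of \<open>Y'\<close> can be inserted in front of \<open>y\<close>.\<close>
      case False
      have "\<exists>k. ob (kap y) k \<and> vset (elts Y' \<inter> elts (kap y)) \<in> elts (meas (kap y) k)"
      proof (cases "y = Large \<gamma> B'")
        case True
        have "vset (elts Y' \<inter> elts \<gamma>) = Y'" using Y's(1) by (simp add: inf.absorb1)
        then show ?thesis using True i Y'D by auto
      next
        case ny: False
        then have "y \<in> set w" using u(1) by (cases u2 rule: rev_cases) auto
        then have "kap y \<in> elts B" using qd(3) unfolding insb_def by auto
        then have "kap y \<in> elts B3" using eB u(2) False by blast
        then show ?thesis using eB3 msr_iff by blast
      qed
      then obtain k where k: "ob (kap y) k" "vset (elts Y' \<inter> elts (kap y)) \<in> elts (meas (kap y) k)" by blast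
      let ?\<eta> = "kap y"
      have oy: "okb y" using okq by simp
      obtain c where yc: "y = Large ?\<eta> c" using okb_same(1)[OF oy oy refl] k(1) obD(3) by blast
      then have c: "c \<in> V" "elts c \<subseteq> elts ?\<eta>" "MI ?\<eta> c" "\<exists>\<beta>\<in>V. ob ?\<eta> \<beta>" using okb_MI oy by metis+
      interpret k: nmeas V ?\<eta> "meas ?\<eta> k" using nmeas[OF k(1)] .
      \<comment> \<open>The inserted block has to be cut down to the set \<open>c\<close> of
        \<open>y\<close>. Coherence below the ordinal of \<open>y\<close> provides \<xi> whose
        measures all contain the trace of \<open>c\<close>, so the result is a legitimate
        block.\<close>
      have "\<forall>i'\<in>elts k. c \<in> elts (meas ?\<eta> i')" using c(3) obD(7)[OF k(1)] MI_iff by blast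
      then have "k.lg (\<lambda>\<nu>. MI \<nu> (vset (elts c \<inter> elts \<nu>)))" using coherence_all[OF k(1) c(1,2)] by blast
      moreover have "c \<in> elts (meas ?\<eta> k)" using c(3) k(1) MI_iff by blast
      ultimately have "k.lg (\<lambda>\<nu>. MI \<nu> (vset (elts c \<inter> elts \<nu>)) \<and> \<nu> \<in> elts c \<and> \<nu> \<in> elts (vset (elts Y' \<inter> elts ?\<eta>)))"
        using k.lg_conj k.lg_memD k(2) by meson
      from k.lg_ex[OF this] obtain \<xi> where x: "\<xi> \<in> elts ?\<eta>" "MI \<xi> (vset (elts c \<inter> elts \<xi>))" "\<xi> \<in> elts c" "\<xi> \<in> elts Y'"
        by auto
      have xY: "\<xi> \<in> elts Y" using x(4) Y's by blast
      have bxu: "below (x @ u1) \<xi>" using cond_bset_above[of "x @ u1" "y # u2 @ v'" y \<xi>] q(1) qe x(3) yc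
        by (metis append.assoc bset.simps(2) list.set_intros(1))
      let ?t = "shrink c (tt \<xi>)"
      have ot: "okb ?t" using okb_shrink[OF tt(4)[OF xY]] x(2) tt(2)[OF xY] by simp
      have kt: "kap ?t = \<xi>" using tt(2)[OF xY] by simp
      let ?c = "vset {\<zeta> \<in> elts c. \<xi> \<in> elts \<zeta>}"
      let ?y = "Large ?\<eta> ?c"
      have Oe: "Ord ?\<eta>" "?\<eta> \<in> V" using obD k(1) by blast+
      have xV: "\<xi> \<in> V" using V_trans[OF c(1) x(3)] .
      have "MI ?\<eta> (vset (elts c \<inter> elts (vset {\<zeta> \<in> elts ?\<eta>. \<xi> \<in> elts \<zeta>})))"
        using MI_Int[OF c(3) MI_above[OF x(1)]] .
      moreover have "elts c \<inter> elts (vset {\<zeta> \<in> elts ?\<eta>. \<xi> \<in> elts \<zeta>}) = {\<zeta> \<in> elts c. \<xi> \<in> elts \<zeta>}" using c(2) by auto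
      ultimately have "MI ?\<eta> ?c" by simp
      then have oy': "okb ?y" using c(4) by (simp add: okb_def)
      have by': "bset y = elts c" using yc by (metis bset.simps(2))
      have "lk ?t ?y" unfolding lk_def using x(1) kt by auto
      moreover have "cond (?y # u2 @ v')"
      proof (cases "u2 @ v' = []")
        case True
        then have "\<exists>D. y = Large \<kappa> D" using cy unfolding cond_def by simp
        then have "?\<eta> = \<kappa>" by auto
        then show ?thesis using True oy' by (simp add: cond_def)
      next
        case ne2: False
        then have "cond (u2 @ v')" "lk y (hd (u2 @ v'))"
          using cy cond_append[of "u2 @ v'" "[y]"] by auto
        then show ?thesis
          using cond_append[of "u2 @ v'" "[?y]"] oy' ne2 by (simp add: stem_def lk_def)
      qed
      ultimately have cty: "cond (?t # ?y # u2 @ v')"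
        using cond_append[of "?y # u2 @ v'" "[?t]"] ot by (simp add: stem_def)
      have "lk (last (x @ ?u1)) ?t" if ne3: "x @ ?u1 \<noteq> []"
      proof -
        have ne4: "x @ u1 \<noteq> []" using ne3 by auto
        have "kap (last (x @ u1)) \<in> elts \<xi>" using bxu ne4 unfolding below_def by (metis last_in_set)
        moreover have "kap (last (x @ u1)) \<in> elts \<xi>'" if "\<xi>' \<in> elts c" for \<xi>'
          using juy ne4 that by' unfolding lk_def by simp
        ultimately show ?thesis unfolding lk_def using last'[OF ne4] kt by auto
      qed
      then have cr: "cond ((x @ ?u1) @ ?t # ?y # u2 @ v')"
        using cond_append[of "?t # ?y # u2 @ v'" "x @ ?u1"] stu' cty unfolding list.sel by blast
      have 1: "ble [y] ([?t] @ [?y])"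
      proof (rule ble_singleI)
        show "\<forall>z\<in>set [?t]. insb y z"
          using x(3) by' kt tt(6)[OF xY] unfolding insb_def by auto
        show "mtch y ?y" using by' unfolding mtch_def by auto
      qed
      have "ble (x @ u1 @ [y] @ u2 @ v') (x @ ?u1 @ ([?t] @ [?y]) @ u2 @ v')"
        by (intro ble_appendI ble_refl ble_shrink 1)
      then have bq: "ble q ((x @ ?u1) @ ?t # ?y # u2 @ v')" unfolding qe by simp
      have tb: "bset ?t \<subseteq> elts Blt \<inter> elts \<xi>" using bt[OF x(4)] by auto
      have "RR ((x @ ?u1) @ ?t # ?y # u2 @ v') \<zeta> a"
      proof (cases u2 rule: rev_cases)
        case Nil
        then have y: "y = Large \<gamma> B'" using u(1) by simp
        have "RR (x @ (?u1 @ [?t]) @ [] @ Large \<gamma> ?c # v') \<zeta> a"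
        proof (rule fin[OF _ qd(2) x(4) kt tb u1'])
          show "cond (x @ (?u1 @ [?t]) @ [] @ Large \<gamma> ?c # v')" using cr Nil y by simp
          have "y \<in> set ?u" using u(1) by simp
          then show "elts ?c \<subseteq> elts B" using elB[of y] by' by auto
        qed (use qd in auto)
        then show ?thesis using Nil y by simp
      next
        case (snoc u2' z)
        then have w: "z = Large \<gamma> B'" "w = u1 @ y # u2'" using u(1) by auto
        have "RR (x @ (?u1 @ [?t]) @ (?y # u2') @ Large \<gamma> B' # v') \<zeta> a"
        proof (rule fin[OF _ qd(2) x(4) kt tb u1'])
          show "cond (x @ (?u1 @ [?t]) @ (?y # u2') @ Large \<gamma> B' # v')" using cr snoc w by simp
          have "kap y \<in> elts B" using qd(3) w(2) unfolding insb_def by auto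
          moreover have "elts ?c \<subseteq> elts B" using elB[of y] by' u(1) by auto
          moreover have "kap z \<in> elts B \<and> bset z \<subseteq> elts B" if "z \<in> set u2'" for z
            using qd(3) w(2) elB that unfolding insb_def by auto
          ultimately show "\<forall>z\<in>set (?y # u2'). kap z \<in> elts B \<and> bset z \<subseteq> elts B" by simp
        qed (use qd in auto)
        then show ?thesis using snoc w by simp
      qed
      then show ?thesis using cr bq by blast
    qed
  qed
  then show ?thesis unfolding VD_def using Bpow cB by blast
qed

end

section \<open>Bounded families, uniform decisions and reflection\<close>

context core begin

lemma stemok_iff: "stemok l \<longleftrightarrow> (\<exists>B\<in>elts (powV \<gamma>). cond (CC l B))"
  using CC_cond' topB by blast

lemma dfp_stemok [df]: "dfl x \<Longrightarrow> dfp (\<lambda>s. stemok (x s))"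
  unfolding stemok_iff by (intro df dfl_shift powV gammaV)

text \<open>What \<open>l\<close> claims about the fresh set, whether true or not: a definable
  subset of \<delta> even for lower parts that are not generic.\<close>

definition inA :: "'a block list \<Rightarrow> 'a \<Rightarrow> bool" where
  "inA l x \<longleftrightarrow> (\<exists>\<zeta>\<in>elts \<delta>. \<exists>a\<in>V. VD l \<zeta> a \<and> x \<in> elts a)"

lemma dfp_inA [df]: "dfl x \<Longrightarrow> dff t \<Longrightarrow> dfp (\<lambda>s. inA (x s) (t s))"
  unfolding inA_def by (intro df dfl_shift dff_shift dV)

lemma inA_iff:
  assumes "\<zeta> \<in> elts \<delta>" "VD l \<zeta> (tv \<zeta>)" "x \<in> elts \<zeta>" shows "inA l x \<longleftrightarrow> x \<in> elts (val G \<tau>)"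
proof
  assume "inA l x"
  then obtain \<zeta>' a where a: "\<zeta>' \<in> elts \<delta>" "VD l \<zeta>' a" "x \<in> elts a" unfolding inA_def by blast
  then have "x \<in> elts \<zeta>'" using VD_sub by blast
  then have "x \<in> elts (tv \<zeta>)" using VD_coherent[OF a(2) assms(2)] a(3) assms(3) by blast
  then show "x \<in> elts (val G \<tau>)" using tv(1) by blast
next
  assume "x \<in> elts (val G \<tau>)"
  then have "x \<in> elts (tv \<zeta>)" using assms(3) tv(1) by blast
  then show "inA l x" unfolding inA_def using assms tv(2) by blast
qed

lemma above_two: assumes "\<zeta>1 \<in> elts \<delta>" "\<zeta>2 \<in> elts \<delta>" shows "\<exists>\<zeta>\<in>elts \<delta>. \<zeta>1 \<in> elts \<zeta> \<and> \<zeta>2 \<in> elts \<zeta>"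
proof -
  obtain \<zeta>3 where z: "\<zeta>3 \<in> elts \<delta>" "\<zeta>1 \<in> elts \<zeta>3" using lim assms(1) by blast
  obtain \<zeta>4 where z': "\<zeta>4 \<in> elts \<delta>" "\<zeta>2 \<in> elts \<zeta>4" using lim assms(2) by blast
  have "\<zeta>3 \<in> elts \<zeta>4 \<or> \<zeta>3 = \<zeta>4 \<or> \<zeta>4 \<in> elts \<zeta>3" using Ord_linear Ord_in_Ord od z z' by blast
  then show ?thesis using z z' Ord_trans Ord_in_Ord[OF od] by metis
qed

lemma empty_delta: "vset {} \<in> elts \<delta>"
  using Ord_empty_mem[OF od] ne by fastforce

lemma least_delta: "least_in \<delta> P \<in> elts \<delta>"
proof (cases "\<exists>y\<in>elts \<delta>. P y")
  case True
  then show ?thesis using least_in(1)[OF od] by blast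
qed (simp add: least_in_def empty_delta)

text \<open>If no definable map from the stems in \<^term>\<open>S\<close> is cofinal in \<^term>\<open>\<delta>\<close>, the decided values for different
  stems differ early, so that one stem gives the whole fresh set.\<close>

lemma bounded_family:
  assumes dS: "dfp (\<lambda>s. S (dec (s 0)))" and SS: "\<And>l. S l \<Longrightarrow> stemok l"
    and H: "\<And>h. dfn h \<Longrightarrow> (\<And>l. S l \<Longrightarrow> h (code_seq l) \<in> elts \<delta>) \<Longrightarrow> \<exists>\<zeta>\<in>elts \<delta>. \<forall>l. S l \<longrightarrow> h (code_seq l) \<in> elts \<zeta>"
    and cov: "\<And>\<zeta>. \<zeta> \<in> elts \<delta> \<Longrightarrow> \<exists>l. S l \<and> VD l \<zeta> (tv \<zeta>)"
  shows False
proof -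
  have dS': "dfp (\<lambda>s. S (x s))" if "dfl x" for x
    using dfp1I[OF dS dfl_code[OF that]] dfl_LL[OF that] by simp
  define h2 where "h2 l c = least_in \<delta> (\<lambda>x. inA l x \<noteq> inA (dec c) x)" for l c
  have dh2: "dff (\<lambda>s. h2 (x s) (t s))" if "dfl x" "dff t" for x t
    unfolding h2_def by (intro df dV od dfl_shift dff_shift that)
  have h2b: "\<exists>\<zeta>\<in>elts \<delta>. \<forall>l'\<in>LL. S l' \<longrightarrow> h2 l (code_seq l') \<in> elts \<zeta>" if l: "l \<in> LL" for l
  proof -
    have "dfn (h2 l)" unfolding dfn_def by (intro dh2 df l)
    moreover have "h2 l c \<in> elts \<delta>" for c unfolding h2_def by (rule least_delta)
    ultimately show ?thesis using H[of "h2 l"] by blast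
  qed
  \<comment> \<open>Boundedness is used twice: \<open>h3\<close> bounds the first disagreements of
    one stem with all stems in \<open>S\<close>, and \<open>\<zeta>2\<close> bounds these bounds. A
    stem that is right up to \<open>\<zeta>2\<close> then agrees with every correct one and so is
    right everywhere.\<close>
  define h3 where "h3 c = least_in \<delta> (\<lambda>\<zeta>. \<forall>l'\<in>LL. S l' \<longrightarrow> h2 (dec c) (code_seq l') \<in> elts \<zeta>)" for c
  have "dfn h3" unfolding dfn_def h3_def by (intro df dh2 dV od dS')
  moreover have "h3 c \<in> elts \<delta>" for c unfolding h3_def by (rule least_delta)
  ultimately obtain \<zeta>2 where z2: "\<zeta>2 \<in> elts \<delta>" "\<And>l. S l \<Longrightarrow> h3 (code_seq l) \<in> elts \<zeta>2"
    using H[of h3] by blast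
  obtain l0 where l0: "S l0" "VD l0 \<zeta>2 (tv \<zeta>2)" using cov[OF z2(1)] by blast
  have l0L: "l0 \<in> LL" using SS[OF l0(1)] stem_LL by blast
  show False
  proof (rule not_definable)
    show "dfp (\<lambda>s. inA l0 (s 0))" by (intro df l0L)
    fix x assume x: "x \<in> elts \<delta>"
    obtain \<zeta> where z: "\<zeta> \<in> elts \<delta>" "x \<in> elts \<zeta>" "\<zeta>2 \<in> elts \<zeta>" using above_two[OF x z2(1)] by blast
    obtain l where l: "S l" "VD l \<zeta> (tv \<zeta>)" using cov[OF z(1)] by blast
    have lL: "l \<in> LL" using SS[OF l(1)] stem_LL by blast
    have agree: "inA l0 y = inA l y" if "y \<in> elts \<zeta>2" for y
      using inA_iff[OF z2(1) l0(2) that] inA_iff[OF z(1) l(2)] that Ord_trans[OF Ord_in_Ord[OF od z(1)] _ z(3)]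
      by blast
    have "inA l0 x = inA l x"
    proof (rule ccontr)
      assume n: "inA l0 x \<noteq> inA l x"
      let ?y = "h2 l0 (code_seq l)"
      have d: "inA l0 ?y \<noteq> inA l ?y"
        using least_in(2)[of \<delta> x "\<lambda>x. inA l0 x \<noteq> inA (dec (code_seq l)) x", OF od x] n lL
        unfolding h2_def by simp
      have "\<exists>\<zeta>\<in>elts \<delta>. \<forall>l'\<in>LL. S l' \<longrightarrow> h2 (dec (code_seq l0)) (code_seq l') \<in> elts \<zeta>"
        using h2b[OF l0L] l0L by simp
      then have "\<forall>l'\<in>LL. S l' \<longrightarrow> h2 (dec (code_seq l0)) (code_seq l') \<in> elts (h3 (code_seq l0))"
        unfolding h3_def using least_in(2)[OF od, of _ "\<lambda>\<zeta>. \<forall>l'\<in>LL. S l' \<longrightarrow> h2 (dec (code_seq l0)) (code_seq l') \<in> elts \<zeta>"]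
        by blast
      then have "?y \<in> elts (h3 (code_seq l0))" using lL l(1) l0L by simp
      then have "?y \<in> elts \<zeta>2" using Ord_trans[OF Ord_in_Ord[OF od z2(1)] _ z2(2)[OF l0(1)]] by blast
      then show False using agree d by blast
    qed
    then show "x \<in> elts (val G \<tau>) \<longleftrightarrow> inA l0 x" using inA_iff[OF z(1) l(2) z(2)] by blast
  qed
qed

lemma MI_self: "MI \<gamma> \<gamma>"
proof -
  have "MI \<gamma> (vset {\<xi> \<in> elts \<gamma>. True})"
    unfolding MI_lg using nmeas nmeas.lg_True by blast
  then show ?thesis by simp
qed

lemma MI_gamma: "MI \<gamma> X \<Longrightarrow> X \<in> elts (powV \<gamma>)"
proof -
  assume m: "MI \<gamma> X"
  obtain \<beta> where b: "ob \<gamma> \<beta>" using meas_ex by blast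
  interpret nmeas V \<gamma> "meas \<gamma> \<beta>" using nmeas[OF b] .
  have "X \<in> elts (meas \<gamma> \<beta>)" using m b MI_iff by blast
  then show ?thesis unfolding powV(2)[OF gammaV(1)] using nm_basic(1,5) V_trans by blast
qed

text \<open>A diagonal intersection gives one set that serves for all decisions at once.\<close>

lemma uniform:
  assumes h: "dfn h"
  obtains E where "MI \<gamma> E" "\<And>l l' a D. l' \<in> LL \<Longrightarrow> VD l (h (code_seq l')) a \<Longrightarrow> a \<in> V \<Longrightarrow>
    MI \<gamma> D \<Longrightarrow> elts D \<subseteq> elts E \<Longrightarrow> (\<forall>\<xi>\<in>elts D. below l \<xi> \<and> below l' \<xi>) \<Longrightarrow>
    cond (CC l D) \<and> RR (CC l D) (h (code_seq l')) a"
proof -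
  let ?Q = "\<lambda>u B. \<exists>c\<in>elts LC. \<exists>c'\<in>elts LC. u = opair c c' \<and>
      (\<exists>a\<in>V. cond (CC (dec c) B) \<and> RR (CC (dec c) B) (h c') a)"
  have dQ: "dfp (\<lambda>s. ?Q (s 0) (s 1))" by (intro df LC_V dfnD[OF h])
  obtain X where X: "X \<in> V" and eX: "elts X = {u \<in> elts (prodV LC LC). \<exists>B\<in>elts (powV \<gamma>). ?Q u B}"
  proof
    show "vset {u \<in> elts (prodV LC LC). \<exists>B\<in>elts (powV \<gamma>). ?Q u B} \<in> V"
      by (intro V_Collect V_prodV LC_V dfp_bex dff_const powV gammaV dfp2I[OF dQ] dff_var)
  qed simp
  have ex: "\<exists>B\<in>elts (powV \<gamma>). ?Q u B" if "u \<in> elts X" for u using that unfolding eX by blast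
  obtain k where k: "dfn k" "\<And>u. u \<in> elts X \<Longrightarrow> k u \<in> elts (powV \<gamma>) \<and> ?Q u (k u)"
    by (rule choice_fun[of X "powV \<gamma>" ?Q, OF X powV(1)[OF gammaV(1)] dQ ex]) blast+
  let ?P = "\<lambda>l l' \<eta>. opair (code_seq l) (code_seq l') \<in> elts X \<longrightarrow> \<eta> \<in> elts (k (opair (code_seq l) (code_seq l')))"
  have kM: "MI \<gamma> (k u)" if u: "u \<in> elts X" for u
    using k(2)[OF u] CC_cond' by blast
  have m1: "MI \<gamma> (vset {\<eta> \<in> elts \<gamma>. ?P l l' \<eta>})" if "l \<in> LL" "l' \<in> LL" for l l'
  proof (cases "opair (code_seq l) (code_seq l') \<in> elts X")
    case True
    have "{\<eta> \<in> elts \<gamma>. ?P l l' \<eta>} = elts (k (opair (code_seq l) (code_seq l')))"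
      using k(2)[OF True] True powV(2)[OF gammaV(1)] by auto
    then show ?thesis using kM[OF True] by simp
  next
    case False
    then show ?thesis using MI_self by simp
  qed
  have dP: "dfp (\<lambda>s. ?P (x s) (y s) (t s))" if "dfl x" "dfl y" "dff t" for x y t
    by (intro df X dfnD[OF k(1)] that)
  have m2: "MI \<gamma> (vset {\<eta> \<in> elts \<gamma>. \<forall>l'\<in>LL. below l' \<eta> \<longrightarrow> ?P l l' \<eta>})" if l: "l \<in> LL" for l
    by (rule MI_diag[of "?P l"]) (intro dP df l, rule m1[OF l])
  have dP2: "dfp (\<lambda>s. \<forall>l'\<in>LL. below l' (s 1) \<longrightarrow> ?P (dec (s 0)) l' (s 1))"
    by (intro dfp_alll dfp_imp dfp_below dP dfl_dec dff_var)
  \<comment> \<open>Two nested diagonal intersections, one over the stem and one over the argument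
    of \<open>h\<close>.\<close>
  let ?E = "vset {\<eta> \<in> elts \<gamma>. \<forall>l\<in>LL. below l \<eta> \<longrightarrow> (\<forall>l'\<in>LL. below l' \<eta> \<longrightarrow> ?P l l' \<eta>)}"
  have E: "MI \<gamma> ?E"
    by (rule MI_diag[of "\<lambda>l \<eta>. \<forall>l'\<in>LL. below l' \<eta> \<longrightarrow> ?P l l' \<eta>", OF dP2 m2])
  show thesis
  proof (rule that[OF E])
    fix l l' a D
    assume l': "l' \<in> LL" and v: "VD l (h (code_seq l')) a" and a: "a \<in> V" and D: "MI \<gamma> D" "elts D \<subseteq> elts ?E"
      "\<forall>\<xi>\<in>elts D. below l \<xi> \<and> below l' \<xi>"
    have st: "stemok l" using VD_stem[OF v] .
    have l: "l \<in> LL" using stem_LL[OF st] .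
    let ?u = "opair (code_seq l) (code_seq l')"
    obtain B where "B \<in> elts (powV \<gamma>)" "cond (CC l B)" "RR (CC l B) (h (code_seq l')) a"
      using v unfolding VD_def by blast
    then have u: "?u \<in> elts X"
      unfolding eX using l l' a code_LC dec_code by (auto simp: prodV_opair)
    note ku = k(2)[OF u]
    then obtain a' where a': "cond (CC l (k ?u))" "RR (CC l (k ?u)) (h (code_seq l')) a'" using l l' by auto
    then have "a' = a" using VD_unique[OF _ v] ku unfolding VD_def by blast
    have Dp: "D \<in> elts (powV \<gamma>)" using MI_gamma D(1) .
    have c: "cond (CC l D)"
      using CC_cond'[OF Dp] st D topB(4)[OF st] powV(2)[OF gammaV(1)] Dp by auto
    have "\<eta> \<in> elts (k ?u)" if "\<eta> \<in> elts D" for \<eta>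
      using D that l l' u unfolding elts_vset_Collect by blast
    then have "ble (CC l (k ?u)) (CC l D)" using CC_le[OF _ Dp ble_refl, of "k ?u"] ku by blast
    then show "cond (CC l D) \<and> RR (CC l D) (h (code_seq l')) a"
      using RR_mono[OF a'(2) c] c \<open>a' = a\<close> by blast
  qed
qed

lemma stem_snoc: "stem (l @ [t]) \<longleftrightarrow> stem l \<and> okb t \<and> (l \<noteq> [] \<longrightarrow> lk (last l) t)"
  by (simp only: stem_append) (auto simp: stem_def)

text \<open>Blocks with the same ordinal are equal points or have a common refinement with the
  intersection of their sets. So the value is attached to \<xi>, and pressing down on \<xi> fixes
  the value as well.\<close>

lemma VD1_unique:
  assumes x: "\<xi> \<in> elts \<gamma>" and "VD1 l \<xi> \<zeta> a" "VD1 l \<xi> \<zeta> a'" shows "a = a'"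
proof -
  obtain t t' where t: "kap t = \<xi>" "VD (l @ [t]) \<zeta> a" "kap t' = \<xi>" "VD (l @ [t']) \<zeta> a'"
    using assms VD1_iff[OF x] by blast
  have s: "stemok (l @ [t])" "stemok (l @ [t'])" using t VD_stem by blast+
  have ok: "okb t" "okb t'" using s unfolding stemok_def stem_snoc by blast+
  show ?thesis
  proof (cases "\<exists>\<beta>\<in>V. ob \<xi> \<beta>")
    case False
    then have "t = t'" using okb_same(2)[OF ok(1)] okb_same(2)[OF ok(2)] t by metis
    then show ?thesis using t VD_unique by blast
  next
    case True
    obtain B B' where B: "t = Large \<xi> B" "t' = Large \<xi> B'"
      using okb_same(1)[OF ok(1,1) refl] okb_same(1)[OF ok(2,2) refl] t True by metis
    let ?s = "Large \<xi> (vset (elts B \<inter> elts B'))"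
    have "okb ?s" using ok B MI_Int unfolding okb_def by auto
    then have "stemok (l @ [?s])"
      using s(1) B unfolding stemok_def stem_snoc by (auto simp: lk_def)
    moreover have "ble (l @ [t]) (l @ [?s])" "ble (l @ [t']) (l @ [?s])"
      using B by (auto intro!: ble_appendI simp: mtch_def)
    ultimately show ?thesis using VD_mono[OF t(2)] VD_mono[OF t(4)] VD_unique by blast
  qed
qed

lemma VD1_restrict: "VD1 l \<xi> \<zeta> a \<Longrightarrow> elts \<zeta>' \<subseteq> elts \<zeta> \<Longrightarrow> elts a' = elts a \<inter> elts \<zeta>' \<Longrightarrow> VD1 l \<xi> \<zeta>' a'"
  unfolding VD1_def using VD_restrict by blast

text \<open>The analogue of \<open>one_step\<close> for a measure on \<nu>, restricted to the values
  of \<open>h\<close>. The proof of \<open>one_step\<close> does not cover it, since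
  \<open>VD\<close> still refers to the block at \<gamma>.\<close>

definition refl_at :: "('a \<Rightarrow> 'a) \<Rightarrow> 'a block list \<Rightarrow> 'a block list \<Rightarrow> 'a \<Rightarrow> bool" where
  "refl_at h l l' \<nu> \<longleftrightarrow> (h (code_seq l') \<in> elts \<delta> \<longrightarrow> (\<forall>i\<in>V. \<forall>a\<in>V. msr \<nu> i (vset {\<xi> \<in> elts \<nu>. VD1 l \<xi> (h (code_seq l')) a}) \<longrightarrow> VD l (h (code_seq l')) a))"

lemma dfp_refl_at: "dfn h \<Longrightarrow> dfl x \<Longrightarrow> dfl y \<Longrightarrow> dff t \<Longrightarrow> dfp (\<lambda>s. refl_at h (x s) (y s) (t s))"
  unfolding refl_at_def by (intro df dfl_shift dff_shift dfnD[of h] dV)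

text \<open>If it failed for almost every \<nu>, pressing down would fix one \<open>\<xi>0\<close>
  and, through \<open>VD1_unique\<close>, one value; the value is not pressed down directly, being a
  subset of an ordinal that is not known to lie below \<gamma>. Coherence turns the measures on the
  \<nu> into one on \<gamma>, and \<open>one_step\<close> yields the contradiction.\<close>

lemma refl_MI:
  assumes h: "dfn h" and l: "l \<in> LL" and l': "l' \<in> LL"
  shows "MI \<gamma> (vset {\<nu> \<in> elts \<gamma>. refl_at h l l' \<nu>})"
  unfolding MI_lg
proof (intro allI impI)
  fix k assume k: "ob \<gamma> k"
  interpret nmeas V \<gamma> "meas \<gamma> k" using nmeas[OF k] .
  let ?e = "h (code_seq l')"
  show "lg (refl_at h l l')"
  proof (rule ccontr)
    assume n: "\<not> lg (refl_at h l l')"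
    then have ln: "lg (\<lambda>\<nu>. \<not> refl_at h l l' \<nu>)"
      by (subst lg_not) (intro dfp_refl_at h df l l')
    then have e: "?e \<in> elts \<delta>" using lg_ex[OF ln] unfolding refl_at_def by blast
    have eV: "?e \<in> V" using zV[OF e] .
    let ?S = "\<lambda>\<nu> a. vset {\<xi> \<in> elts \<nu>. VD1 l \<xi> ?e a}"
    let ?R = "\<lambda>\<xi> \<nu>. \<exists>i\<in>V. \<exists>a\<in>V. msr \<nu> i (?S \<nu> a) \<and> VD1 l \<xi> ?e a \<and> \<not> VD l ?e a"
    have dR: "dfp (\<lambda>s. ?R (s 0) (s 1))" by (intro df l eV)
    have "lg (\<lambda>\<nu>. \<exists>\<xi>\<in>elts \<nu>. ?R \<xi> \<nu>)"
    proof (rule lg_mono[OF ln])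
      fix \<nu> assume "\<nu> \<in> elts \<gamma>" "\<not> refl_at h l l' \<nu>"
      then obtain i a where ia: "i \<in> V" "a \<in> V" "msr \<nu> i (?S \<nu> a)" "\<not> VD l ?e a" unfolding refl_at_def by blast
      then have o: "ob \<nu> i" "?S \<nu> a \<in> elts (meas \<nu> i)" using msr_iff by blast+
      interpret n: nmeas V \<nu> "meas \<nu> i" using nmeas[OF o(1)] .
      obtain \<xi> where "\<xi> \<in> elts \<nu>" "\<xi> \<in> elts (?S \<nu> a)" using n.lg_ex[OF n.lg_memD[OF o(2)]] by blast
      then show "\<exists>\<xi>\<in>elts \<nu>. ?R \<xi> \<nu>" using ia by auto
    qed (intro df l eV)
    from pd_ord[OF dR this] obtain \<xi>0 where x0: "\<xi>0 \<in> elts \<gamma>" "lg (\<lambda>\<nu>. ?R \<xi>0 \<nu>)" by blast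
    from lg_ex[OF x0(2)] obtain a where a: "a \<in> V" "VD1 l \<xi>0 ?e a" "\<not> VD l ?e a" by blast
    let ?X = "vset {\<xi> \<in> elts \<gamma>. VD1 l \<xi> ?e a}"
    have X: "?X \<in> V" "elts ?X \<subseteq> elts \<gamma>" by (intro V_Collect df gammaV l eV a) auto
    have "lg (\<lambda>\<nu>. \<exists>i\<in>V. ob \<nu> i \<and> vset (elts ?X \<inter> elts \<nu>) \<in> elts (meas \<nu> i))"
    proof (rule lg_mono[OF x0(2)])
      fix \<nu> assume nu: "\<nu> \<in> elts \<gamma>" "?R \<xi>0 \<nu>"
      then obtain i a' where ia: "i \<in> V" "msr \<nu> i (?S \<nu> a')" "VD1 l \<xi>0 ?e a'" by blast
      then have "a' = a" using VD1_unique[OF x0(1)] a(2) by blast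
      moreover have "elts ?X \<inter> elts \<nu> = {\<xi> \<in> elts \<nu>. VD1 l \<xi> ?e a}"
        using Ord_subset[OF gammaV(2) nu(1)] by auto
      ultimately show "\<exists>i\<in>V. ob \<nu> i \<and> vset (elts ?X \<inter> elts \<nu>) \<in> elts (meas \<nu> i)"
        using ia msr_iff by metis
    next
      have "dfp (\<lambda>s. \<exists>i\<in>V. msr (s 0) i (vset (elts ?X \<inter> elts (s 0))))" by (intro dfp_ex dfp_msr dff_Int dff_var dff_const X)
      then show "dfp (\<lambda>s. \<exists>i\<in>V. ob (s 0) i \<and> vset (elts ?X \<inter> elts (s 0)) \<in> elts (meas (s 0) i))"
        unfolding msr_iff .
    qed
    then obtain i where i: "i \<in> elts k" "?X \<in> elts (meas \<gamma> i)" using coherence_ex[OF k X] by blast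
    have "lgm \<gamma> i (\<lambda>\<xi>. VD1 l \<xi> ?e a)"
      using i(2) nmeas.lg_def[OF nmeas[OF obD(7)[OF k i(1)]]] by simp
    then have "VD l ?e a" using one_step[OF obD(7)[OF k i(1)] l eV zsub[OF e] a(1)] by blast
    then show False using a(3) by blast
  qed
qed

lemma refl_set:
  assumes h: "dfn h"
  obtains E where "MI \<gamma> E" "\<And>\<nu> l l'. \<nu> \<in> elts E \<Longrightarrow> l \<in> LL \<Longrightarrow> l' \<in> LL \<Longrightarrow> below l \<nu> \<Longrightarrow> below l' \<nu> \<Longrightarrow> refl_at h l l' \<nu>"
proof -
  have m2: "MI \<gamma> (vset {\<nu> \<in> elts \<gamma>. \<forall>l'\<in>LL. below l' \<nu> \<longrightarrow> refl_at h l l' \<nu>})" if l: "l \<in> LL" for l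
    by (rule MI_diag[of "refl_at h l"]) (intro dfp_refl_at h df l, rule refl_MI[OF h l])
  have dP2: "dfp (\<lambda>s. \<forall>l'\<in>LL. below l' (s 1) \<longrightarrow> refl_at h (dec (s 0)) l' (s 1))"
    by (intro dfp_refl_at h df)
  have "MI \<gamma> (vset {\<nu> \<in> elts \<gamma>. \<forall>l\<in>LL. below l \<nu> \<longrightarrow> (\<forall>l'\<in>LL. below l' \<nu> \<longrightarrow> refl_at h l l' \<nu>)})"
    by (rule MI_diag[of "\<lambda>l \<nu>. \<forall>l'\<in>LL. below l' \<nu> \<longrightarrow> refl_at h l l' \<nu>", OF dP2 m2])
  then show thesis by (rule that) auto
qed

text \<open>By density some extension in the filter has its set at \<gamma> inside \<open>E\<close>.
  The part above \<gamma> may have been strengthened on the way and is weakened back to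
  \<open>v\<close>.\<close>

lemma shrink_top:
  assumes E: "MI \<gamma> E" and p0: "CC l0 B0 \<in> GG" "B0 \<in> elts (powV \<gamma>)"
  obtains x w l D where "CC l D \<in> GG" "MI \<gamma> D" "elts D \<subseteq> elts E" "elts D \<subseteq> elts B0"
     "l = x @ w" "ble l0 x" "\<forall>y\<in>set w. insb (Large \<gamma> B0) y"
proof -
  have Ep: "E \<in> elts (powV \<gamma>)" using MI_gamma[OF E] .
  let ?Q = "\<lambda>r. \<exists>x\<in>LL. \<exists>y\<in>LL. \<exists>D\<in>elts (powV \<gamma>). r = x @ mkL \<gamma> D @ y \<and> elts D \<subseteq> elts E"
  have "\<exists>r\<in>GG. ble (CC l0 B0) r \<and> ?Q r"
  proof (rule genericity_below[OF _ p0(1)])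
    show "dfp (\<lambda>s. ?Q (dec (s 0)))" by (intro df gammaV powV powV_V Ep)
    fix q assume q: "cond q" "ble (CC l0 B0) q"
    obtain x w B' v' where qd: "q = x @ w @ Large \<gamma> B' # v'" "ble l0 x"
      "B' \<in> elts (powV \<gamma>)" "elts B' \<subseteq> elts B0" "ble v v'"
      using ext_decomp[OF q p0(2)] by metis
    let ?D = "vset (elts B' \<inter> elts E)"
    have D: "?D \<in> elts (powV \<gamma>)" using pow_Int[OF qd(3)] powV_V[OF Ep] by blast
    have ok: "okb (Large \<gamma> B')" using q(1) qd(1) by (auto simp: cond_def)
    then have okD: "okb (Large \<gamma> ?D)" using MI_Int[OF _ E] by (auto simp: okb_def)
    have s1: "stem (x @ w)" "x @ w \<noteq> [] \<longrightarrow> lk (last (x @ w)) (Large \<gamma> B')" "cond (Large \<gamma> B' # v')"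
      using q(1) cond_append[of "Large \<gamma> B' # v'" "x @ w"] unfolding qd(1) by auto
    have "cond (Large \<gamma> ?D # v')"
      using s1(3) okD unfolding cond_def by (cases v') (auto simp: lk_def)
    then have c: "cond ((x @ w) @ Large \<gamma> ?D # v')"
      using cond_append[of "Large \<gamma> ?D # v'" "x @ w"] s1 by (auto simp: lk_def)
    moreover have "ble q ((x @ w) @ Large \<gamma> ?D # v')"
      unfolding qd(1) using ble_appendI[OF ble_refl, of "Large \<gamma> B' # v'" "Large \<gamma> ?D # v'" "x @ w"]
      by (simp add: mtch_def)
    moreover have "?Q ((x @ w) @ Large \<gamma> ?D # v')"
    proof -
      have "(x @ w) @ Large \<gamma> ?D # v' = (x @ w) @ mkL \<gamma> ?D @ v'"
        using mkL_eq[OF gammaV(3)] D powV(2)[OF gammaV(1)] by simp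
      moreover have "x @ w \<in> LL" "v' \<in> LL" using cond_LL[OF c] by auto
      ultimately show ?thesis using D by (intro bexI[of _ "x @ w"] bexI[of _ v'] bexI[of _ ?D]) auto
    qed
    ultimately show "\<exists>r. cond r \<and> ble q r \<and> ?Q r" by blast
  qed
  then obtain r l y D where r: "r \<in> GG" "ble (CC l0 B0) r" "D \<in> elts (powV \<gamma>)" "r = l @ mkL \<gamma> D @ y" "elts D \<subseteq> elts E"
    by blast
  have rD: "r = l @ Large \<gamma> D # y" using r(3,4) mkL_eq[OF gammaV(3)] powV(2)[OF gammaV(1)] by simp
  have c: "cond r" using r(1) GG_cond by blast
  obtain x w B' v' where rd: "r = x @ w @ Large \<gamma> B' # v'" "ble l0 x" "\<forall>y\<in>set w. insb (Large \<gamma> B0) y"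
      "B' \<in> elts (powV \<gamma>)" "elts B' \<subseteq> elts B0" "ble v v'"
    using ext_decomp[OF c r(2) p0(2)] by metis
  have "l @ Large \<gamma> D # y = (x @ w) @ Large \<gamma> B' # v'" using rD rd(1) by simp
  then have e: "l = x @ w" "D = B'" "y = v'"
    using cond_split_unique[of l "Large \<gamma> D" y "x @ w" "Large \<gamma> B'" v'] c[unfolded rD] by auto
  have MD: "MI \<gamma> D" using c unfolding rD cond_def okb_def by auto
  have cc: "cond (CC l D)"
    using CC_eq[OF r(3)] vcond_iff[OF r(3)] MD cond_append[of "Large \<gamma> D # y" l] cond_append[of "Large \<gamma> D # v" l] c
    unfolding rD by simp
  have "ble (CC l D) r"
    unfolding rD CC_eq[OF r(3)] using rd(6) e(3) by (intro ble_appendI) auto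
  then have "CC l D \<in> GG" using GG_down[OF r(1) cc] by blast
  then show thesis using that[of l D x w] MD r(5) rd e by blast
qed

text \<open>\<^term>\<open>SG0\<close> collects the initial segments, containing the part coming from \<^term>\<open>lb\<close>, of conditions
  in the generic filter that extend \<^term>\<open>CC lb Db\<close>.\<close>

definition SG0 :: "'a block list \<Rightarrow> 'a \<Rightarrow> 'a block list \<Rightarrow> bool" where
  "SG0 lb Db l \<longleftrightarrow> (\<exists>x w y B v'. l = x @ w \<and> ble lb x \<and> (\<forall>z\<in>set (w @ y). insb (Large \<gamma> Db) z) \<and>
     B \<in> elts (powV \<gamma>) \<and> elts B \<subseteq> elts Db \<and> ble v v' \<and> l @ y @ Large \<gamma> B # v' \<in> GG)"

lemma SG0_SG: "SG0 lb Db l \<Longrightarrow> SG l"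
  unfolding SG0_def using SG_prefix by blast

lemma SG0_stem: "SG0 lb Db l \<Longrightarrow> stemok l"
  using SG0_SG SG_stem by blast

text \<open>A deciding condition and the base are brought together in one condition of the filter.
  Both decompositions split it at \<gamma>, so their lower parts agree: one description gives
  \<open>SG0\<close>, the other the decision.\<close>

lemma SG0_decides:
  assumes b: "CC lb Db \<in> GG" "Db \<in> elts (powV \<gamma>)" and z: "\<zeta> \<in> elts \<delta>"
  shows "\<exists>l. SG0 lb Db l \<and> VD l \<zeta> (tv \<zeta>)"
proof -
  obtain l t a where l: "l @ t # v \<in> GG" "kap t = \<gamma>" "RR (l @ t # v) \<zeta> a" using Ev z unfolding EE_def by blast
  have a: "a = tv \<zeta>" using sound z l by blast
  have "okb t" using l(1) GG_cond by (auto simp: cond_def)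
  then obtain B where B: "B \<in> elts (powV \<gamma>)" "t = Large \<gamma> B" using okb_gamma l(2) by blast
  have lC: "l @ t # v = CC l B" using CC_eq[OF B(1)] B(2) by simp
  obtain r where r: "r \<in> GG" "ble (CC lb Db) r" "ble (CC l B) r" using GG_dir b(1) l(1) lC by metis
  have c: "cond r" using r GG_cond by blast
  obtain x w D v' where 1: "r = x @ w @ Large \<gamma> D # v'" "ble lb x" "\<forall>y\<in>set w. insb (Large \<gamma> Db) y"
      "D \<in> elts (powV \<gamma>)" "elts D \<subseteq> elts Db" "ble v v'"
    using ext_decomp[OF c r(2) b(2)] by metis
  obtain x' w' D' v'' where 2: "r = x' @ w' @ Large \<gamma> D' # v''" "ble l x'" "\<forall>y\<in>set w'. insb (Large \<gamma> B) y"
     "elts D' \<subseteq> elts B"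
    using ext_decomp[OF c r(3) B(1)] by metis
  have "(x @ w) @ Large \<gamma> D # v' = (x' @ w') @ Large \<gamma> D' # v''" using 1 2 by simp
  then have e: "x @ w = x' @ w'" "D = D'"
    using cond_split_unique[of "x @ w" "Large \<gamma> D" v' "x' @ w'" "Large \<gamma> D'" v''] c[unfolded 1(1)] by auto
  have S: "SG0 lb Db (x @ w)"
    unfolding SG0_def using 1 r(1) by (intro exI[of _ x] exI[of _ w] exI[of _ "[]"] exI[of _ D] exI[of _ v']) auto
  have st: "stemok (x @ w)" using SG0_stem[OF S] .
  have MD: "MI \<gamma> D" using okb_gamma[of "Large \<gamma> D"] c unfolding 1(1) cond_def by auto
  have cc: "cond (CC (x @ w) D)"
    using CC_eq[OF 1(4)] vcond_iff[OF 1(4)] MD cond_append[of "Large \<gamma> D # v'" "x @ w"] cond_append[of "Large \<gamma> D # v" "x @ w"] c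
    unfolding 1(1) by simp
  have "ble (l @ [Large \<gamma> B] @ v) (x' @ (w' @ [Large \<gamma> D']) @ v)"
    using 2 by (intro ble_appendI ble_singleI ble_refl) (auto simp: mtch_def)
  then have "ble (CC l B) (CC (x @ w) D)"
    unfolding CC_eq[OF B(1)] CC_eq[OF 1(4)[unfolded e(2)]] e(1) e(2) by simp
  then have "RR (CC (x @ w) D) \<zeta> (tv \<zeta>)" using RR_mono[OF _ cc] l(3) a lC by metis
  then have "VD (x @ w) \<zeta> (tv \<zeta>)" unfolding VD_def using cc 1(4) by blast
  then show ?thesis using S by blast
qed

end

section \<open>Lower parts below a fixed ordinal do not decide everything\<close>

lemma ble_kap: "ble l s \<Longrightarrow> kap ` set l \<subseteq> kap ` set s"
proof (induction l s rule: ble.induct)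
  case (3 t ts s ss)
  then show ?case by (auto simp: mtch_def)
qed auto

context coherent begin

lemma below_ble: "ble l s \<Longrightarrow> below s \<xi> \<Longrightarrow> below l \<xi>"
  using ble_kap[of l s] unfolding below_def by fastforce

text \<open>The last block of an extension matches the last block of \<open>l\<close>, so the
  largest ordinal does not grow.\<close>

lemma ble_below:
  assumes b: "ble l s" and c: "cond (s @ y)" "y \<noteq> []" and bl: "below l \<xi>" and o: "Ord \<xi>"
  shows "below s \<xi>"
proof (cases "l = []")
  case True
  then show ?thesis using b by simp
next
  case False
  obtain m' w s' where s: "s = m' @ w @ [s']" "mtch (last l) s'"
    using ble_last[of "butlast l" "last l" s] b False by auto
  then have "kap (last s) \<in> elts \<xi>" using bl False by (auto simp: below_def mtch_def)
  then show ?thesis using below_last[OF c(1,2) _ _ o] s(1) by simp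
qed

lemma cond_replace:
  assumes c: "cond (a @ s # b)" and s: "okb s'" "kap s' = kap s" "bset s' \<subseteq> bset s"
  shows "cond (a @ s' # b)" "ble (a @ s # b) (a @ s' # b)"
proof -
  have "a \<noteq> [] \<longrightarrow> lk (last a) s" "cond (s # b)" "stem a" using c cond_append[of "s # b" a] by auto
  moreover have "cond (s' # b)"
  proof (cases "b = []")
    case True
    then obtain D where "s = Large \<kappa> D" using \<open>cond (s # b)\<close> unfolding cond_def by auto
    moreover from this have "\<exists>\<beta>\<in>V. ob \<kappa> \<beta>" using \<open>cond (s # b)\<close> unfolding cond_def okb_def by auto
    ultimately obtain D' where "s' = Large \<kappa> D'" using okb_same(1)[OF s(1) s(1)] s(2) by auto
    then show ?thesis using True s(1) by (simp add: cond_def)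
  next
    case False
    then show ?thesis
      using \<open>cond (s # b)\<close> cond_append[of b "[s]"] cond_append[of b "[s']"] s
      by (auto simp: stem_def lk_def)
  qed
  ultimately show "cond (a @ s' # b)"
    using cond_append[of "s' # b" a] s by (auto simp: lk_def)
  show "ble (a @ s # b) (a @ s' # b)"
    using ble_appendI[OF ble_refl, of "s # b" "s' # b" a] s by (simp add: mtch_def)
qed

end

context core begin

text \<open>\<open>SG0\<close> passes to refinements inside the filter, because whatever is inserted
  in front of the block at \<gamma> comes from a subset of \<open>Db\<close>.\<close>

lemma SG0_common:
  assumes S: "SG0 lb Db l" and q: "q \<in> GG"
  obtains r s y B v' where "r \<in> GG" "ble q r" "r = s @ y @ Large \<gamma> B # v'" "ble l s" "SG0 lb Db s"
    "\<forall>z\<in>set y. insb (Large \<gamma> Db) z" "elts B \<subseteq> elts Db"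
proof -
  obtain x w y B v' where l: "l = x @ w" "ble lb x" "\<forall>z\<in>set (w @ y). insb (Large \<gamma> Db) z"
     "B \<in> elts (powV \<gamma>)" "elts B \<subseteq> elts Db" "ble v v'" "l @ y @ Large \<gamma> B # v' \<in> GG"
    using S unfolding SG0_def by blast
  obtain r where r: "r \<in> GG" "ble q r" "ble (l @ y @ Large \<gamma> B # v') r" using GG_dir[OF q l(7)] by blast
  have "ble (x @ w @ y @ [Large \<gamma> B] @ v') r" using r(3) l(1) by simp
  then obtain x' w' y' z v'' where d: "r = x' @ w' @ y' @ z @ v''" "ble x x'" "ble w w'" "ble y y'" "ble [Large \<gamma> B] z" "ble v' v''"
    unfolding ble_append by blast
  obtain u t where u: "z = u @ [t]" "\<forall>s\<in>set u. insb (Large \<gamma> B) s" "mtch (Large \<gamma> B) t"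
    using d(5) unfolding ble_single by blast
  have "okb t" using r(1) GG_cond d(1) u(1) by (auto simp: cond_def)
  then obtain B' where B': "B' \<in> elts (powV \<gamma>)" "t = Large \<gamma> B'" using okb_gamma u(3) by (auto simp: mtch_def)
  have BB: "elts B' \<subseteq> elts B" using u(3) B' by (simp add: mtch_def)
  have 1: "\<forall>z\<in>set w'. insb (Large \<gamma> Db) z" "\<forall>z\<in>set y'. insb (Large \<gamma> Db) z"
    using ble_insb[OF d(3), of "Large \<gamma> Db"] ble_insb[OF d(4), of "Large \<gamma> Db"] l(3) by simp_all
  have "\<forall>z\<in>set u. insb (Large \<gamma> Db) z" using u(2) l(5) unfolding insb_def by auto
  then have 2: "\<forall>z\<in>set (y' @ u). insb (Large \<gamma> Db) z" using 1 by auto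
  have re: "r = (x' @ w') @ (y' @ u) @ Large \<gamma> B' # v''" using d(1) u(1) B'(2) by simp
  have "SG0 lb Db (x' @ w')"
    unfolding SG0_def
    using ble_trans[OF l(2) d(2)] 1(1) 2 B'(1) BB l(5) ble_trans[OF l(6) d(6)] r(1) re
    by (intro exI[of _ x'] exI[of _ w'] exI[of _ "y' @ u"] exI[of _ B'] exI[of _ v'']) auto
  then show thesis
    using that[OF r(1,2) re] ble_appendI[OF d(2,3)] l(1,5) 2 BB by auto
qed

text \<open>The case of an unbounded map defined on the stems below a fixed \<^term>\<open>\<nu>0\<close>: were cofinally many
  initial segments decided by stems below \<^term>\<open>\<nu>\<close>, then one part above the last point of the
  base could be fixed, against the minimality of \<^term>\<open>\<gamma>\<close>.\<close>

lemma undecided_if_cofinal: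
  assumes b: "CC lb Db \<in> GG" "Db \<in> elts (powV \<gamma>)"
    and n0: "\<nu>0 \<in> elts \<gamma>" "\<forall>\<xi>\<in>elts Db. \<nu>0 \<in> elts \<xi>"
    and unb: "\<And>\<zeta>. \<zeta> \<in> elts \<delta> \<Longrightarrow> \<exists>l. stemok l \<and> below l \<nu>0 \<and> h (code_seq l) \<in> elts \<delta> \<and> h (code_seq l) \<notin> elts \<zeta>"
    and uni: "\<And>l l' a D. l' \<in> LL \<Longrightarrow> VD l (h (code_seq l')) a \<Longrightarrow> a \<in> V \<Longrightarrow>
      MI \<gamma> D \<Longrightarrow> elts D \<subseteq> elts Db \<Longrightarrow> (\<forall>\<xi>\<in>elts D. below l \<xi> \<and> below l' \<xi>) \<Longrightarrow> RR (CC l D) (h (code_seq l')) a"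
    and n: "\<nu> \<in> elts \<gamma>"
  shows "\<exists>\<zeta>\<in>elts \<delta>. \<forall>l. SG0 lb Db l \<and> below l \<nu> \<longrightarrow> \<not> VD l \<zeta> (tv \<zeta>)"
proof (rule ccontr)
  assume "\<not> ?thesis"
  then have dec: "\<exists>l. SG0 lb Db l \<and> below l \<nu> \<and> VD l \<zeta> (tv \<zeta>)" if "\<zeta> \<in> elts \<delta>" for \<zeta> using that by blast
  \<comment> \<open>The set at \<gamma> is moved above \<nu>, so that blocks inserted from it are
    separated from every lower part below \<nu>.\<close>
  let ?E = "vset {\<xi> \<in> elts \<gamma>. \<nu> \<in> elts \<xi>}"
  obtain x w l D where D: "CC l D \<in> GG" "MI \<gamma> D" "elts D \<subseteq> elts ?E" "elts D \<subseteq> elts Db"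
    by (rule shrink_top[OF MI_above[OF n] b]) blast
  have Dp: "D \<in> elts (powV \<gamma>)" using MI_gamma D(2) .
  have st: "stemok l" using CC_cond'[OF Dp] D(1) GG_cond by blast
  have Dnu: "\<nu> \<in> elts \<xi>" if "\<xi> \<in> elts D" for \<xi> using D(3) that by auto
  have Dl: "below l \<xi>" if "\<xi> \<in> elts D" for \<xi> using CC_cond[OF Dp] GG_cond[OF D(1)] that by blast
  have Onu: "Ord \<nu>" using Ord_in_Ord gammaV(2) n by blast
  have Og: "Ord \<xi>" if "\<xi> \<in> elts Db" for \<xi>
    using that b(2) powV(2)[OF gammaV(1)] Ord_in_Ord[OF gammaV(2)] by blast
  \<comment> \<open>Since \<open>h\<close> is unbounded on stems below \<open>\<nu>0\<close>, it
    suffices to decide a value of \<open>h\<close> not below \<zeta>. For such values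
    \<open>uni\<close> replaces the witness of \<open>lz\<close> by a set known in advance, and the
    decision passes to \<open>x'\<close>, which refines \<open>l\<close> and keeps the fixed set
    \<open>D\<close>.\<close>
  have key: "\<exists>x'. ble l x' \<and> CC x' D \<in> GG \<and> RR (CC x' D) \<zeta> (tv \<zeta>)" if z: "\<zeta> \<in> elts \<delta>" for \<zeta>
  proof -
    obtain l' where l': "stemok l'" "below l' \<nu>0" "h (code_seq l') \<in> elts \<delta>" "h (code_seq l') \<notin> elts \<zeta>"
      using unb[OF z] by blast
    let ?e = "h (code_seq l')"
    have ze: "elts \<zeta> \<subseteq> elts ?e"
      using Ord_linear[of \<zeta> ?e] Ord_in_Ord[OF od] z l'(3,4) Ord_subset by blast
    obtain lz where lz: "SG0 lb Db lz" "below lz \<nu>" "VD lz ?e (tv ?e)" using dec[OF l'(3)] by blast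
    obtain r s y B v' where r: "r \<in> GG" "ble (CC l D) r" "r = s @ y @ Large \<gamma> B # v'" "ble lz s"
        "\<forall>z\<in>set y. insb (Large \<gamma> Db) z" "elts B \<subseteq> elts Db"
      using SG0_common[OF lz(1) D(1)] by metis
    have c: "cond r" using r(1) GG_cond by blast
    obtain x' w' D' v'' where d: "r = x' @ w' @ Large \<gamma> D' # v''" "ble l x'" "\<forall>y\<in>set w'. insb (Large \<gamma> D) y"
        "D' \<in> elts (powV \<gamma>)" "elts D' \<subseteq> elts D" "ble v v''"
      using ext_decomp[OF c r(2) Dp] by metis
    have "(s @ y) @ Large \<gamma> B # v' = (x' @ w') @ Large \<gamma> D' # v''" using r(3) d(1) by simp
    then have e: "s @ y = x' @ w'" "B = D'" "v' = v''"
      using cond_split_unique[of "s @ y" "Large \<gamma> B" v' "x' @ w'" "Large \<gamma> D'" v''] c[unfolded r(3)] by auto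
    have snu: "below s \<nu>" using ble_below[OF r(4) _ _ lz(2) Onu] c[unfolded r(3)] by auto
    \<comment> \<open>The blocks of \<open>s\<close> lie below \<nu> and those of \<open>w'\<close>,
      coming from \<open>D\<close>, above it; so \<open>s\<close> cannot reach into
      \<open>w'\<close>.\<close>
    have "\<exists>u. x' = s @ u \<and> y = u @ w'"
    proof -
      consider us where "s = x' @ us" "us @ y = w'" | us where "s @ us = x'" "y = us @ w'"
        using e(1) unfolding append_eq_append_conv2 by blast
      then show ?thesis
      proof cases
        case 1
        have "us = []"
        proof (rule ccontr)
          assume "us \<noteq> []"
          then have t: "last us \<in> set w'" "last us \<in> set s" using 1 by auto
          then have "\<nu> \<in> elts (kap (last us))" using Dnu d(3) unfolding insb_def by auto
          moreover have "kap (last us) \<in> elts \<nu>" using snu t(2) unfolding below_def by blast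
          ultimately show False using elts_asym by blast
        qed
        then show ?thesis using 1 by simp
      qed auto
    qed
    then obtain u where u: "x' = s @ u" "y = u @ w'" by blast
    have cx: "cond (x' @ w' @ Large \<gamma> D' # v'')" using c d(1) by simp
    have bx: "below x' \<xi>" if xi: "\<xi> \<in> elts D" for \<xi>
      using ble_below[OF d(2) cx _ Dl[OF xi]] Og D(4) xi by auto
    have bxg: "below x' \<gamma>" using ble_below[OF d(2) cx _ _ gammaV(2)] st unfolding stemok_def by auto
    have sx: "stem x'" using cond_append[of "w' @ Large \<gamma> D' # v''" x'] cx by simp
    have ccx: "cond (CC x' D)" using CC_cond[OF Dp] sx bxg D(2) bx by blast
    have "ble (x' @ [Large \<gamma> D] @ v) (x' @ (w' @ [Large \<gamma> D']) @ v'')"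
      by (intro ble_appendI ble_singleI ble_refl) (use d in \<open>auto simp: mtch_def\<close>)
    then have "ble (CC x' D) r" unfolding CC_eq[OF Dp] using d(1) by simp
    then have G: "CC x' D \<in> GG" using GG_down[OF r(1) ccx] by blast
    have stz: "stemok lz" using SG0_stem[OF lz(1)] .
    \<comment> \<open>\<open>uni\<close> asks for a set above both lists: intersecting with
      \<open>topB lz\<close> gets above \<open>lz\<close>, and all of \<open>Db\<close> is above
      \<open>\<nu>0\<close>, hence above \<open>l'\<close>.\<close>
    let ?D3 = "vset (elts Db \<inter> elts (topB lz))"
    have D3p: "?D3 \<in> elts (powV \<gamma>)" using pow_Int[OF b(2)] powV_V topB(1)[OF stz] by blast
    have MDb: "MI \<gamma> Db" using CC_cond[OF b(2)] GG_cond[OF b(1)] by blast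
    have D3: "MI \<gamma> ?D3" using MI_Int[OF MDb topB(2)[OF stz]] .
    have "RR (CC lz ?D3) ?e (tv ?e)"
    proof (rule uni[OF stem_LL[OF l'(1)] lz(3) tv(2)[OF l'(3)] D3])
      show "\<forall>\<xi>\<in>elts ?D3. below lz \<xi> \<and> below l' \<xi>"
        using topB(4)[OF stz] n0(2) below_trans[OF l'(2)] Og by auto
    qed auto
    moreover have "ble (CC lz ?D3) (CC x' D)"
    proof -
      have ab: "below lz \<xi>" if "t \<in> set (u @ [Large \<gamma> D])" "\<xi> \<in> bset t" for t \<xi>
      proof -
        have "s @ u @ Large \<gamma> D # v = CC x' D" using CC_eq[OF Dp] u(1) by simp
        then have "cond (s @ (u @ Large \<gamma> D # v))" using ccx by simp
        from cond_bset_above[OF this, of t \<xi>] have "below s \<xi>" using that by auto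
        then show ?thesis using below_ble[OF r(4)] by blast
      qed
      have su: "insb (Large \<gamma> ?D3) t" if t: "t \<in> set u" for t
      proof -
        obtain u1 u2 where u12: "u = u1 @ t # u2" using t by (meson split_list)
        have "cond ((s @ u1) @ t # u2 @ w' @ Large \<gamma> D' # v'')" using cx u(1) u12 by simp
        then have "below s (kap t)" using cond_below by fastforce
        then have "below lz (kap t)" using below_ble[OF r(4)] by blast
        moreover have "insb (Large \<gamma> Db) t" using r(5) u(2) t by auto
        moreover have "elts Db \<subseteq> elts \<gamma>" using b(2) powV(2)[OF gammaV(1)] by blast
        ultimately show ?thesis using ab[of t] t unfolding insb_def by (auto simp: topB(4)[OF stz])
      qed
      have "elts D \<subseteq> elts ?D3" 
        using D(4) ab[of "Large \<gamma> D"] Dp powV(2)[OF gammaV(1)] by (auto simp: topB(4)[OF stz])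
      then have "ble (lz @ [Large \<gamma> ?D3] @ v) (s @ (u @ [Large \<gamma> D]) @ v)"
        by (intro ble_appendI ble_singleI ble_refl r(4)) (use su in \<open>auto simp: mtch_def\<close>)
      then show ?thesis unfolding CC_eq[OF D3p] CC_eq[OF Dp] u(1) by simp
    qed
    ultimately have "RR (CC x' D) ?e (tv ?e)" using RR_mono[OF _ ccx] by blast
    then have "RR (CC x' D) \<zeta> (tv \<zeta>)"
      by (rule RR_restrict[OF _ ze]) (use ze in \<open>auto simp: tv(1)\<close>)
    then show ?thesis using d(2) G by blast
  qed
  \<comment> \<open>Every \<zeta> is decided by a refinement of \<open>l\<close> followed by the
    same block and \<open>v\<close>. So either one condition decides everything, or
    \<open>EE\<close> holds at the last ordinal of \<open>l\<close>, which is smaller than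
    \<gamma>.\<close>
  show False
  proof (cases "l = []")
    case True
    then show False using decided_by_one[OF D(1)] key by fastforce
  next
    case False
    have "EE (kap (last l)) (Large \<gamma> D # v)"
      unfolding EE_def
    proof
      fix \<zeta> assume "\<zeta> \<in> elts \<delta>"
      then obtain x' where x': "ble l x'" "CC x' D \<in> GG" "RR (CC x' D) \<zeta> (tv \<zeta>)" using key by blast
      have bl: "ble (butlast l @ [last l]) x'" using x'(1) False by simp
      obtain m w s where s: "x' = m @ w @ [s]" "mtch (last l) s" using ble_last[OF bl] by blast
      have "CC x' D = (m @ w) @ s # Large \<gamma> D # v" using s(1) CC_eq[OF Dp] by simp
      then show "\<exists>l' t a. l' @ t # Large \<gamma> D # v \<in> GG \<and> kap t = kap (last l) \<and> RR (l' @ t # Large \<gamma> D # v) \<zeta> a"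
        using x' s(2) unfolding mtch_def by metis
    qed
    moreover have "kap (last l) \<in> elts \<gamma>" using st False unfolding stemok_def below_def by simp
    ultimately show False using Emin by blast
  qed
qed

text \<open>If a definable map on the stems below a single \<open>\<nu>0\<close> is unbounded in
  \<delta>, then \<open>undecided_if_cofinal\<close> applies to it. If there is none,
  \<open>bounded_family\<close> is used twice: for all stems it yields an unbounded map, and for the
  stems below any given \<nu> it shows that they do not decide enough.\<close>

lemma undecided_below:
  obtains h lb Db where "dfn h" "\<And>\<zeta>. \<zeta> \<in> elts \<delta> \<Longrightarrow> \<exists>l. stemok l \<and> h (code_seq l) \<in> elts \<delta> \<and> h (code_seq l) \<notin> elts \<zeta>"
    "CC lb Db \<in> GG" "Db \<in> elts (powV \<gamma>)"
    "\<And>\<nu> l l'. \<nu> \<in> elts Db \<Longrightarrow> l \<in> LL \<Longrightarrow> l' \<in> LL \<Longrightarrow> below l \<nu> \<Longrightarrow> below l' \<nu> \<Longrightarrow> refl_at h l l' \<nu>"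
    "\<And>\<nu>. \<nu> \<in> elts \<gamma> \<Longrightarrow> \<exists>\<zeta>\<in>elts \<delta>. \<forall>l. SG0 lb Db l \<and> below l \<nu> \<longrightarrow> \<not> VD l \<zeta> (tv \<zeta>)"
proof -
  obtain l0 B0 where p0: "CC l0 B0 \<in> GG" "B0 \<in> elts (powV \<gamma>)"
    using SG_decides[of "vset {}"] empty_delta unfolding SG_def by blast
  show thesis
  proof (cases "\<exists>\<nu>0\<in>elts \<gamma>. \<exists>h. dfn h \<and> (\<forall>\<zeta>\<in>elts \<delta>. \<exists>l. stemok l \<and> below l \<nu>0 \<and> h (code_seq l) \<in> elts \<delta> \<and> h (code_seq l) \<notin> elts \<zeta>)")
    case True
    then obtain \<nu>0 h where h: "\<nu>0 \<in> elts \<gamma>" "dfn h"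
       "\<And>\<zeta>. \<zeta> \<in> elts \<delta> \<Longrightarrow> \<exists>l. stemok l \<and> below l \<nu>0 \<and> h (code_seq l) \<in> elts \<delta> \<and> h (code_seq l) \<notin> elts \<zeta>" by blast
    obtain E1 where E1: "MI \<gamma> E1" "\<And>l l' a D. l' \<in> LL \<Longrightarrow> VD l (h (code_seq l')) a \<Longrightarrow> a \<in> V \<Longrightarrow>
      MI \<gamma> D \<Longrightarrow> elts D \<subseteq> elts E1 \<Longrightarrow> (\<forall>\<xi>\<in>elts D. below l \<xi> \<and> below l' \<xi>) \<Longrightarrow>
      cond (CC l D) \<and> RR (CC l D) (h (code_seq l')) a" using uniform[OF h(2)] by metis
    obtain E2 where E2: "MI \<gamma> E2" "\<And>\<nu> l l'. \<nu> \<in> elts E2 \<Longrightarrow> l \<in> LL \<Longrightarrow> l' \<in> LL \<Longrightarrow> below l \<nu> \<Longrightarrow> below l' \<nu> \<Longrightarrow> refl_at h l l' \<nu>"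
      using refl_set[OF h(2)] by metis
    \<comment> \<open>One set meets three demands: \<open>E1\<close> makes decisions uniform,
      \<open>E2\<close> gives the reflection, and the last factor lies above
      \<open>\<nu>0\<close>.\<close>
    let ?E = "vset (elts E1 \<inter> elts (vset (elts E2 \<inter> elts (vset {\<xi> \<in> elts \<gamma>. \<nu>0 \<in> elts \<xi>}))))"
    have ME: "MI \<gamma> ?E" by (intro MI_Int E1(1) E2(1) MI_above h(1))
    obtain lb Db where b: "CC lb Db \<in> GG" "MI \<gamma> Db" "elts Db \<subseteq> elts ?E"
      by (rule shrink_top[OF ME p0]) blast
    have Dp: "Db \<in> elts (powV \<gamma>)" using MI_gamma b(2) .
    have sub: "elts Db \<subseteq> elts E1" "elts Db \<subseteq> elts E2" "\<forall>\<xi>\<in>elts Db. \<nu>0 \<in> elts \<xi>" using b(3) by auto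
    show thesis
    proof (rule that[OF h(2) _ b(1) Dp])
      show "\<exists>\<zeta>\<in>elts \<delta>. \<forall>l. SG0 lb Db l \<and> below l \<nu> \<longrightarrow> \<not> VD l \<zeta> (tv \<zeta>)" if "\<nu> \<in> elts \<gamma>" for \<nu>
      proof (rule undecided_if_cofinal[OF b(1) Dp h(1) sub(3) h(3) _ that])
        fix l l' a D assume "l' \<in> LL" "VD l (h (code_seq l')) a" "a \<in> V" "MI \<gamma> D" "elts D \<subseteq> elts Db" "\<forall>\<xi>\<in>elts D. below l \<xi> \<and> below l' \<xi>"
        then show "RR (CC l D) (h (code_seq l')) a" using E1(2) sub(1) by (meson order_trans)
      qed
    qed (use h E2 sub in blast)+
  next
    case False
    have bd: "\<exists>\<zeta>\<in>elts \<delta>. \<forall>l. stemok l \<and> below l \<nu> \<longrightarrow> h (code_seq l) \<in> elts \<zeta>"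
      if "\<nu> \<in> elts \<gamma>" "dfn h" "\<And>l. stemok l \<and> below l \<nu> \<Longrightarrow> h (code_seq l) \<in> elts \<delta>" for \<nu> h
      using False that by blast
    have "\<exists>h. dfn h \<and> (\<forall>l. stemok l \<longrightarrow> h (code_seq l) \<in> elts \<delta>) \<and> (\<forall>\<zeta>\<in>elts \<delta>. \<exists>l. stemok l \<and> h (code_seq l) \<notin> elts \<zeta>)"
    proof (rule ccontr)
      assume n: "\<not> ?thesis"
      show False
      proof (rule bounded_family[of stemok])
        show "dfp (\<lambda>s. stemok (dec (s 0)))" by (intro df)
        show "\<exists>l. stemok l \<and> VD l \<zeta> (tv \<zeta>)" if "\<zeta> \<in> elts \<delta>" for \<zeta> using SG_decides[OF that] SG_stem by blast
        show "\<exists>\<zeta>\<in>elts \<delta>. \<forall>l. stemok l \<longrightarrow> h (code_seq l) \<in> elts \<zeta>" if "dfn h" "\<And>l. stemok l \<Longrightarrow> h (code_seq l) \<in> elts \<delta>" for h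
          using n that by blast
      qed
    qed
    then obtain h where h: "dfn h" "\<And>l. stemok l \<Longrightarrow> h (code_seq l) \<in> elts \<delta>"
       "\<And>\<zeta>. \<zeta> \<in> elts \<delta> \<Longrightarrow> \<exists>l. stemok l \<and> h (code_seq l) \<notin> elts \<zeta>" by blast
    obtain E2 where E2: "MI \<gamma> E2" "\<And>\<nu> l l'. \<nu> \<in> elts E2 \<Longrightarrow> l \<in> LL \<Longrightarrow> l' \<in> LL \<Longrightarrow> below l \<nu> \<Longrightarrow> below l' \<nu> \<Longrightarrow> refl_at h l l' \<nu>"
      using refl_set[OF h(1)] by metis
    obtain lb Db where b: "CC lb Db \<in> GG" "MI \<gamma> Db" "elts Db \<subseteq> elts E2"
      by (rule shrink_top[OF E2(1) p0]) blast
    have Dp: "Db \<in> elts (powV \<gamma>)" using MI_gamma b(2) .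
    show thesis
    proof (rule that[OF h(1) _ b(1) Dp])
      show "\<exists>\<zeta>\<in>elts \<delta>. \<forall>l. SG0 lb Db l \<and> below l \<nu> \<longrightarrow> \<not> VD l \<zeta> (tv \<zeta>)" if n: "\<nu> \<in> elts \<gamma>" for \<nu>
      proof (rule ccontr)
        assume neg: "\<not> ?thesis"
        have nV: "\<nu> \<in> V" using V_trans gammaV(1) n by blast
        show False
        proof (rule bounded_family[of "\<lambda>l. stemok l \<and> below l \<nu>"])
          show "dfp (\<lambda>s. stemok (dec (s 0)) \<and> below (dec (s 0)) \<nu>)" by (intro df nV)
          show "\<exists>l. (stemok l \<and> below l \<nu>) \<and> VD l \<zeta> (tv \<zeta>)" if "\<zeta> \<in> elts \<delta>" for \<zeta>
            using neg that SG0_stem by blast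
        qed (use bd[OF n] in blast)+
      qed
    qed (use h E2 b in blast)+
  qed
qed

end

section \<open>The values along the sequence are unbounded\<close>

lemma first_change:
  "\<not> P [] \<Longrightarrow> P w \<Longrightarrow> \<exists>p z q. w = p @ z # q \<and> \<not> P p \<and> P (p @ [z])"
proof (induction w rule: rev_induct)
  case (snoc z w)
  then show ?case by (cases "P w") force+
qed simp

context core begin

text \<open>The set of points added by the generic filter is closed: a limit of such points, or a gap above it, is visible in
  some condition.\<close>

lemma limit_block:
  assumes n: "\<nu>w \<in> elts \<gamma>" and b': "b' \<in> V" "elts b' \<subseteq> elts \<nu>w" "MI \<nu>w b'" and p0: "p0 \<in> GG"
  obtains r a s c where "r \<in> GG" "ble p0 r" "r = a @ s # c" "below a \<nu>w"
    "(\<exists>b. s = Large \<nu>w b \<and> elts b \<subseteq> elts b') \<or> (kap s \<notin> elts \<nu>w \<and> (\<forall>\<xi>\<in>bset s. \<nu>w \<in> elts \<xi>))"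
proof -
  have nV: "\<nu>w \<in> V" "\<nu>w \<in> elts \<kappa>" "Ord \<nu>w" using V_trans gammaV n gk Ord_in_Ord by blast+
  \<comment> \<open>The first block not below \<open>\<nu>w\<close> is a pair at
    \<open>\<nu>w\<close> with its set inside \<open>b'\<close>, or a point, or a pair above
    \<open>\<nu>w\<close> whose set has been cut above \<open>\<nu>w\<close>. In the last two cases
    no extension adds a point between \<open>x\<close> and \<open>\<nu>w\<close>.\<close>
  let ?Q = "\<lambda>q. \<exists>x\<in>LL. \<exists>y\<in>LL. below x \<nu>w \<and> ((\<exists>B\<in>elts (powV b'). q = x @ mkL \<nu>w B @ y) \<or>
     (\<exists>\<eta>\<in>elts \<kappa>. \<eta> \<notin> elts \<nu>w \<and> q = x @ mkP \<eta> @ y) \<or>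
     (\<exists>\<eta>\<in>V. (\<eta> = \<kappa> \<or> \<eta> \<in> elts \<kappa>) \<and> \<eta> \<notin> elts \<nu>w \<and> (\<exists>B\<in>elts (powV \<eta>). (\<forall>\<xi>\<in>elts B. \<nu>w \<in> elts \<xi>) \<and> q = x @ mkL \<eta> B @ y)))"
  have "\<exists>r\<in>GG. ble p0 r \<and> ?Q r"
  proof (rule genericity_below[OF _ p0])
    show "dfp (\<lambda>s. ?Q (dec (s 0)))" by (intro df nV coh_basic powV b')
    fix q assume q: "cond q"
    obtain D where D: "last q = Large \<kappa> D" "q \<noteq> []" using q unfolding cond_def by blast
    have "\<exists>t\<in>set q. kap t \<notin> elts \<nu>w"
      using D elts_asym[OF nV(2)] last_in_set[OF D(2)] by (intro bexI[of _ "last q"]) auto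
    then obtain x s y where sp: "q = x @ s # y" "kap s \<notin> elts \<nu>w" "\<forall>t\<in>set x. kap t \<in> elts \<nu>w"
      using split_list_first_prop[of q "\<lambda>t. kap t \<notin> elts \<nu>w"] by auto
    have bx: "below x \<nu>w" using sp(3) unfolding below_def by blast
    have L: "x \<in> LL" "y \<in> LL" "blk s" using cond_LL[OF q] unfolding sp(1) by auto
    have ok: "okb s" using q unfolding sp(1) cond_def by simp
    show "\<exists>r. cond r \<and> ble q r \<and> ?Q r"
    proof (cases s)
      case (Point \<eta>)
      then have "\<eta> \<in> elts \<kappa>" "q = x @ mkP \<eta> @ y" using L(3) sp(1) by (auto simp: blk_def mkP_def)
      then have "?Q q" using L bx sp(2) Point by auto
      then show ?thesis using q ble_refl by blast
    next
      case (Large \<eta> B)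
      then have B: "B \<in> V" "elts B \<subseteq> elts \<eta>" "\<eta> \<in> insert \<kappa> (elts \<kappa>)" "MI \<eta> B" "\<exists>\<beta>\<in>V. ob \<eta> \<beta>"
        using ok okb_MI by auto
      have eV: "\<eta> \<in> V" using B(3) coh_basic(2) V_trans by blast
      show ?thesis
      proof (cases "\<eta> = \<nu>w")
        case True
        let ?B = "vset (elts B \<inter> elts b')"
        have o: "okb (Large \<nu>w ?B)" using B MI_Int[OF B(4)] b'(3) True by (auto simp: okb_def)
        have "bset (Large \<nu>w ?B) \<subseteq> bset s" using Large by auto
        note c = cond_replace[OF q[unfolded sp(1)] o _ this]
        have "?B \<in> V" using V_Int B(1) b'(1) by blast
        moreover from this have "x @ mkL \<nu>w ?B @ y = x @ Large \<nu>w ?B # y"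
          using mkL_eq[of \<nu>w ?B] nV(2) b'(2) by auto
        ultimately have "?Q (x @ Large \<nu>w ?B # y)"
          using L bx powV(2)[OF b'(1)] by (intro bexI[of _ x] bexI[of _ y] conjI disjI1 bexI[of _ ?B]) auto
        then show ?thesis using c Large True sp(1) by (metis kap.simps(2))
      next
        case False
        then have ne: "\<nu>w \<in> elts \<eta>" using Ord_linear[OF nV(3) blk_Ord[OF L(3)]] sp(2) Large by auto
        let ?B = "vset (elts B \<inter> elts (vset {\<xi> \<in> elts \<eta>. \<nu>w \<in> elts \<xi>}))"
        have eB: "elts ?B = {\<xi> \<in> elts B. \<nu>w \<in> elts \<xi>}" using B(2) by auto
        have M: "MI \<eta> ?B" using MI_Int[OF B(4) MI_above[OF ne]] .
        then have o: "okb (Large \<eta> ?B)" using B(5) by (auto simp: okb_def)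
        have "bset (Large \<eta> ?B) \<subseteq> bset s" using Large by auto
        note c = cond_replace[OF q[unfolded sp(1)] o _ this]
        have BV: "?B \<in> V" using o okb_MI by blast
        have sub: "elts ?B \<subseteq> elts \<eta>" using eB B(2) by blast
        have "x @ mkL \<eta> ?B @ y = x @ Large \<eta> ?B # y" unfolding mkL_eq[OF B(3) BV sub] by simp
        then have "\<exists>B\<in>elts (powV \<eta>). (\<forall>\<xi>\<in>elts B. \<nu>w \<in> elts \<xi>) \<and> x @ Large \<eta> ?B # y = x @ mkL \<eta> B @ y"
        proof (intro bexI[of _ ?B] conjI)
          show "?B \<in> elts (powV \<eta>)" using BV powV(2)[OF eV] sub by blast
          show "\<forall>\<xi>\<in>elts ?B. \<nu>w \<in> elts \<xi>" unfolding eB by blast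
        qed simp
        moreover have "\<eta> = \<kappa> \<or> \<eta> \<in> elts \<kappa>" "\<eta> \<notin> elts \<nu>w" using B(3) sp(2) Large by auto
        ultimately have "?Q (x @ Large \<eta> ?B # y)"
          by (intro bexI[OF _ L(1)] bexI[OF _ L(2)] conjI[OF bx] disjI2[OF disjI2] bexI[OF _ eV] conjI) assumption+
        moreover have "kap (Large \<eta> ?B) = kap s" using Large by simp
        ultimately show ?thesis using c unfolding sp(1) by blast
      qed
    qed
  qed
  then obtain r x y where r: "r \<in> GG" "ble p0 r" "below x \<nu>w" "(\<exists>B\<in>elts (powV b'). r = x @ mkL \<nu>w B @ y) \<or>
     (\<exists>\<eta>\<in>elts \<kappa>. \<eta> \<notin> elts \<nu>w \<and> r = x @ mkP \<eta> @ y) \<or>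
     (\<exists>\<eta>\<in>V. \<eta> \<in> insert \<kappa> (elts \<kappa>) \<and> \<eta> \<notin> elts \<nu>w \<and> (\<exists>B\<in>elts (powV \<eta>). (\<forall>\<xi>\<in>elts B. \<nu>w \<in> elts \<xi>) \<and> r = x @ mkL \<eta> B @ y))"
    unfolding insert_iff by blast
  from r(4) show thesis
  proof (elim disjE bexE conjE)
    fix B assume B: "B \<in> elts (powV b')" "r = x @ mkL \<nu>w B @ y"
    then have "r = x @ Large \<nu>w B # y" using mkL_eq[of \<nu>w B] nV powV(2)[OF b'(1)] b'(2) by auto
    then show thesis using that[of r x "Large \<nu>w B" y] r B powV(2)[OF b'(1)] by auto
  next
    fix \<eta> assume "\<eta> \<in> elts \<kappa>" "\<eta> \<notin> elts \<nu>w" "r = x @ mkP \<eta> @ y"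
    then show thesis using that[of r x "Point \<eta>" y] r by (auto simp: mkP_def)
  next
    fix \<eta> B assume e: "\<eta> \<in> V" "\<eta> \<in> insert \<kappa> (elts \<kappa>)" "\<eta> \<notin> elts \<nu>w" "B \<in> elts (powV \<eta>)" "\<forall>\<xi>\<in>elts B. \<nu>w \<in> elts \<xi>" "r = x @ mkL \<eta> B @ y"
    then have "r = x @ Large \<eta> B # y" using mkL_eq[of \<eta> B] powV(2)[of \<eta>] by auto
    then show thesis using that[of r x "Large \<eta> B" y] r e by auto
  qed
qed

text \<open>The sequences \<nu> and \<open>lh\<close> need not belong to V. Under the contrary
  assumption, statements about them are replaced by statements about all stems below their limit
  whose value under \<open>h\<close> is below \<zeta>; these are definable, as the limit and, by
  freshness, the part of the fresh set below \<zeta> are in V. The limit turns out to lie in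
  \<open>Db\<close>, so that \<open>refl\<close> applies to it.\<close>

lemma seq_unbounded:
  fixes \<nu> :: "nat \<Rightarrow> 'a" and lh :: "nat \<Rightarrow> 'a block list"
  assumes h: "dfn h" and b: "CC lb Db \<in> GG" "Db \<in> elts (powV \<gamma>)"
    and refl: "\<And>\<nu> l l'. \<nu> \<in> elts Db \<Longrightarrow> l \<in> LL \<Longrightarrow> l' \<in> LL \<Longrightarrow> below l \<nu> \<Longrightarrow> below l' \<nu> \<Longrightarrow> refl_at h l l' \<nu>"
    and nu: "\<And>n. \<nu> n \<in> elts \<gamma>" and lb0: "below lb (\<nu> 0)"
    and lh: "\<And>n. lh n \<in> LL" "\<And>n. below (lh n) (\<nu> (Suc n))"
    and no: "\<And>n l. SG0 lb Db l \<Longrightarrow> below l (\<nu> n) \<Longrightarrow> \<not> VD l (h (code_seq (lh n))) (tv (h (code_seq (lh n))))"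
    and yes: "\<And>n. \<exists>l. SG0 lb Db l \<and> below l (\<nu> (Suc n)) \<and> VD l (h (code_seq (lh n))) (tv (h (code_seq (lh n))))"
    and z: "\<zeta> \<in> elts \<delta>"
  shows "\<exists>n. h (code_seq (lh n)) \<notin> elts \<zeta>"
proof (rule ccontr)
  let ?e = "\<lambda>n. h (code_seq (lh n))"
  assume "\<not> ?thesis"
  then have ez: "?e n \<in> elts \<zeta>" for n by blast
  have ezs: "elts (?e n) \<subseteq> elts \<zeta>" for n using ez Ord_subset[OF Ord_in_Ord[OF od z]] by blast
  have On: "Ord (\<nu> n)" for n using Ord_in_Ord gammaV(2) nu by blast
  have step: "\<nu> n \<in> elts (\<nu> (Suc n))" for n
  proof -
    obtain l where l: "SG0 lb Db l" "below l (\<nu> (Suc n))" "VD l (?e n) (tv (?e n))" using yes by blast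
    then obtain t where t: "t \<in> set l" "kap t \<notin> elts (\<nu> n)" "kap t \<in> elts (\<nu> (Suc n))"
      using no unfolding below_def by blast
    then have "\<nu> n = kap t \<or> \<nu> n \<in> elts (kap t)"
      using Ord_linear[OF On Ord_in_Ord[OF On t(3)]] by blast
    then show ?thesis using t(3) Ord_trans[OF On] by metis
  qed
  have mono: "elts (\<nu> m) \<subseteq> elts (\<nu> n)" if "m \<le> n" for m n
    by (rule lift_Suc_mono_le[of "\<lambda>n. elts (\<nu> n)", OF _ that]) (rule Ord_subset[OF On step])
  define \<nu>w where "\<nu>w = vset (\<Union>n. elts (\<nu> n))"
  have nus: "elts (\<nu> n) \<subseteq> elts \<gamma>" for n using Ord_subset[OF gammaV(2) nu] .
  have enw: "elts \<nu>w = (\<Union>n. elts (\<nu> n))"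
    unfolding \<nu>w_def by (rule elts_vset_small, rule small_subset[OF small_elts[of \<gamma>]]) (use nus in blast)
  have Ow: "Ord \<nu>w"
  proof (rule OrdI)
    fix u assume "u \<in> elts \<nu>w"
    then obtain n where "u \<in> elts (\<nu> n)" unfolding enw by blast
    then have "Ord u" "elts u \<subseteq> elts (\<nu> n)" using Ord_in_Ord[OF On] Ord_subset[OF On] by blast+
    then show "Ord u \<and> elts u \<subseteq> elts \<nu>w" unfolding enw by blast
  qed
  have fin: "\<exists>n. below l (\<nu> n)" if "below l \<nu>w" for l
    using that
  proof (induction l)
    case (Cons t l)
    then have "\<exists>n. below l (\<nu> n)" "kap t \<in> elts \<nu>w" by simp_all
    then obtain n m where "below l (\<nu> n)" "kap t \<in> elts (\<nu> m)" unfolding enw by blast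
    then have "below (t # l) (\<nu> (max n m))" using mono[of n "max n m"] mono[of m "max n m"] by (auto simp: below_def)
    then show ?case by blast
  qed simp
  have up: "below l \<nu>w" if "below l (\<nu> n)" for l n using that unfolding below_def enw by blast
  have nw: "\<nu>w \<in> elts \<gamma>"
  proof (rule ccontr)
    assume "\<nu>w \<notin> elts \<gamma>"
    moreover have "elts \<nu>w \<subseteq> elts \<gamma>" unfolding enw using nus by blast
    ultimately have wg: "\<nu>w = \<gamma>" using Ord_subset_iff[OF Ow gammaV(2)] by blast
    obtain l where l: "SG0 lb Db l" "VD l \<zeta> (tv \<zeta>)" using SG0_decides[OF b z] by blast
    have "below l \<nu>w" using SG0_stem[OF l(1)] unfolding stemok_def wg by blast
    then obtain n where "below l (\<nu> n)" using fin by blast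
    then show False using no[OF l(1)] VD_tv[OF l(2) ezs] by blast
  qed
  have nwV: "\<nu>w \<in> V" using V_trans gammaV(1) nw by blast
  \<comment> \<open>The filter has points between each \<open>\<nu> n\<close> and
    \<open>\<nu>w\<close>: a deciding lower part is not below \<open>\<nu> n\<close>. This excludes
    a gap below \<open>\<nu>w\<close>.\<close>
  have hit: "\<exists>t'\<in>set r. kap t' \<notin> elts (\<nu> n) \<and> kap t' \<in> elts \<nu>w"
    if l: "SG0 lb Db l" "below l (\<nu> (Suc n))" "VD l (?e n) (tv (?e n))" "ble l s1" "set s1 \<subseteq> set r" for l n s1 r
  proof -
    obtain t where t: "t \<in> set l" "kap t \<notin> elts (\<nu> n)" using no[OF l(1)] l(3) unfolding below_def by blast
    moreover have "kap t \<in> elts \<nu>w" using up[OF l(2)] t(1) unfolding below_def by blast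
    moreover obtain t' where "t' \<in> set s1" "kap t' = kap t" using ble_kap[OF l(4)] t(1) by force
    ultimately show ?thesis using l(5) by (metis subsetD)
  qed
  define a where "a = tv \<zeta>"
  have aV: "a \<in> V" using tv(2)[OF z] unfolding a_def .
  let ?aa = "\<lambda>e. vset (elts a \<inter> elts e)"
  have ea: "elts a = elts (val G \<tau>) \<inter> elts \<zeta>" unfolding a_def by (rule tv(1))
  have aa: "?aa (?e n) = tv (?e n)" for n
    by (rule elts_extensionality, unfold elts_vset_Int tv(1)) (use ezs[of n] ea in blast)
  have zv: "\<zeta> \<in> V" using zV[OF z] .
  \<comment> \<open>Appending a block at \<xi> to \<open>l0\<close> decides correctly some value
    that \<open>l0\<close> leaves undecided. All parameters are in V, so the measures on
    \<open>\<nu>w\<close> apply to this set of \<xi>.\<close>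
  define Yp where "Yp l0 \<xi> \<longleftrightarrow> (\<exists>l\<in>LL. below l \<nu>w \<and> h (code_seq l) \<in> elts \<zeta> \<and> \<not> VD l0 (h (code_seq l)) (?aa (h (code_seq l))) \<and>
       VD1 l0 \<xi> (h (code_seq l)) (?aa (h (code_seq l))))" for l0 \<xi>
  have dYp: "dfp (\<lambda>s. Yp (x s) (t s))" if "dfl x" "dff t" for x t
    unfolding Yp_def by (intro df dfl_shift dff_shift that zv nwV aV dfnD[OF h])
  let ?W = "\<lambda>l0 \<xi>. (\<forall>i\<in>V. \<not> msr \<nu>w i (vset {\<xi> \<in> elts \<nu>w. Yp l0 \<xi>})) \<longrightarrow> \<not> Yp l0 \<xi>"
  have dW: "dfp (\<lambda>s. ?W (dec (s 0)) (s 1))"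
    by (intro df dYp nwV)
  have mW: "MI \<nu>w (vset {\<xi> \<in> elts \<nu>w. ?W l0 \<xi>})" if l0: "l0 \<in> LL" for l0
  proof -
    have dY0: "dfp (\<lambda>s. Yp l0 (s 0))" by (intro dYp df l0)
    show ?thesis
      unfolding MI_lg
    proof (intro allI impI)
      fix i assume i: "ob \<nu>w i"
      interpret nmeas V \<nu>w "meas \<nu>w i" using nmeas[OF i] .
      show "lg (?W l0)"
      proof (cases "\<forall>i\<in>V. \<not> msr \<nu>w i (vset {\<xi> \<in> elts \<nu>w. Yp l0 \<xi>})")
        case True
        then have "\<not> lg (Yp l0)" using i obD(3)[OF i] unfolding lg_def msr_iff by blast
        then have "lg (\<lambda>\<xi>. \<not> Yp l0 \<xi>)" using lg_not[OF dY0] by blast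
        then show ?thesis by (rule lg_mono) (intro df dY0, simp)
      next
        case False
        then have "lg (?W l0) = lg (\<lambda>\<xi>. True)" by (intro lg_cong) blast
          then show ?thesis using lg_True by blast
      qed
    qed
  qed
  \<comment> \<open>Diagonally, those \<xi> are discarded at which this happens although the set of
    such \<xi> is null for every measure on \<open>\<nu>w\<close>. Hence a single occurrence at a
    point of this set makes it happen almost everywhere for some measure.\<close>
  let ?b = "vset {\<xi> \<in> elts \<nu>w. \<forall>l0\<in>LL. below l0 \<xi> \<longrightarrow> ?W l0 \<xi>}"
  have Mb: "MI \<nu>w ?b" by (rule MI_diag[of ?W, OF dW mW])
  have bV: "?b \<in> V"
  proof (rule V_Collect[OF nwV])
    show "dfp (\<lambda>s. \<forall>l0\<in>LL. below l0 (s 0) \<longrightarrow> ?W l0 (s 0))" by (intro df dYp nwV)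
  qed
  obtain b' where b': "b' \<in> V" "elts b' \<subseteq> elts \<nu>w" "MI \<nu>w b'" "\<And>\<xi> l0. \<xi> \<in> elts b' \<Longrightarrow> l0 \<in> LL \<Longrightarrow> below l0 \<xi> \<Longrightarrow> ?W l0 \<xi>"
  proof
    show "MI \<nu>w ?b" "?b \<in> V" by (fact Mb bV)+
    show "elts ?b \<subseteq> elts \<nu>w" by auto
    fix \<xi> l0 assume "\<xi> \<in> elts ?b" "l0 \<in> LL" "below l0 \<xi>"
    then show "?W l0 \<xi>" unfolding elts_vset_Collect by blast
  qed
  obtain r aa0 s c where r: "r \<in> GG" "ble (CC lb Db) r" "r = aa0 @ s # c" "below aa0 \<nu>w"
    "(\<exists>b. s = Large \<nu>w b \<and> elts b \<subseteq> elts b') \<or> (kap s \<notin> elts \<nu>w \<and> (\<forall>\<xi>\<in>bset s. \<nu>w \<in> elts \<xi>))"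
    by (rule limit_block[OF nw b'(1-3) b(1)]) blast
  have cr: "cond r" using r(1) GG_cond by blast
  obtain n where n: "below aa0 (\<nu> n)" using fin[OF r(4)] by blast
  obtain l3 where l3: "SG0 lb Db l3" "below l3 (\<nu> (Suc n))" "VD l3 (?e n) (tv (?e n))" using yes by blast
  obtain r3 s1 y B1 v1 where r3: "r3 \<in> GG" "ble r r3" "r3 = s1 @ y @ Large \<gamma> B1 # v1" "ble l3 s1" "SG0 lb Db s1"
    by (rule SG0_common[OF l3(1) r(1)]) blast
  have c3: "cond r3" using r3(1) GG_cond by blast
  consider (gap) "kap s \<notin> elts \<nu>w" "\<forall>\<xi>\<in>bset s. \<nu>w \<in> elts \<xi>" | (blk) b where "s = Large \<nu>w b" "elts b \<subseteq> elts b'"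
    using r(5) by blast
  then show False
  proof cases
    case gap
    have "ble (aa0 @ [s] @ c) r3" using r3(2) r(3) by simp
    then obtain x p w where d: "r3 = x @ p @ w" "ble aa0 x" "ble [s] p" "ble c w" unfolding ble_append by blast
    obtain u s' where u: "p = u @ [s']" "\<forall>t\<in>set u. insb s t" "mtch s s'" using d(3) unfolding ble_single by blast
    have r3e: "r3 = (x @ u) @ s' # w" using d(1) u(1) by simp
    have bx: "below x (\<nu> n)" using ble_below[OF d(2) _ _ n On] c3[unfolded d(1) u(1)] by auto
    obtain t where t: "t \<in> set r3" "kap t \<notin> elts (\<nu> n)" "kap t \<in> elts \<nu>w"
      using hit[OF l3 r3(4), of r3] unfolding r3(3) set_append by blast
    have "t \<notin> set x" using bx t(2) unfolding below_def by blast
    moreover have "t \<notin> set u" using u(2) gap(2) t(3) elts_asym unfolding insb_def by blast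
    moreover have "t \<noteq> s'" using u(3) gap(1) t(3) unfolding mtch_def by metis
    moreover have "t \<notin> set w"
    proof
      assume "t \<in> set w"
      then have "kap s' \<in> elts (kap t)" using cond_sorted[OF c3] unfolding r3e sorted_wrt_append by simp
      then show False using Ord_trans[OF Ow _ t(3)] gap(1) u(3) unfolding mtch_def by metis
    qed
    ultimately show False using t(1) unfolding r3e by auto
  next
    case (blk b0)
    obtain xr wr Br vr where e: "r = xr @ wr @ Large \<gamma> Br # vr" "ble lb xr" "\<forall>y\<in>set wr. insb (Large \<gamma> Db) y"
        "Br \<in> elts (powV \<gamma>)" "elts Br \<subseteq> elts Db" "ble v vr"
      by (rule ext_decomp[OF cr r(2) b(2)]) blast
    \<comment> \<open>As \<open>lb\<close> lies below \<open>\<nu> 0\<close>, the block at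
      \<open>\<nu>w\<close> is not part of its refinement and must have been inserted from
      \<open>Db\<close>; therefore \<open>refl\<close> is available at
      \<open>\<nu>w\<close>.\<close>
    have bxr: "below xr (\<nu> 0)" using ble_below[OF e(2) _ _ lb0 On] cr[unfolded e(1)] by auto
    have "s \<notin> set xr" using up[OF bxr] blk(1) unfolding below_def by auto
    moreover have "s \<noteq> Large \<gamma> Br" using blk(1) nw by auto
    moreover have "s \<notin> set vr"
    proof
      assume "s \<in> set vr"
      then have "\<gamma> \<in> elts (kap s)" using cond_sorted[OF cr] unfolding e(1) sorted_wrt_append by simp
      then show False using blk(1) nw elts_asym by auto
    qed
    moreover have "s \<in> set r" using r(3) by simp
    ultimately have "s \<in> set wr" unfolding e(1) by auto
    then obtain us wc where wr: "wr = us @ s # wc" by (meson split_list)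
    have "(xr @ us) @ s # wc @ Large \<gamma> Br # vr = aa0 @ s # c" using e(1) wr r(3) by simp
    then have a0: "aa0 = xr @ us"
      using cond_split_unique[of aa0 s c "xr @ us" s "wc @ Large \<gamma> Br # vr"] cr r(3) by metis
    have sDb: "insb (Large \<gamma> Db) s" using e(3) wr by simp
    then have nDb: "\<nu>w \<in> elts Db" using blk(1) unfolding insb_def by auto
    have "ble (xr @ us @ [s] @ wc @ [Large \<gamma> Br] @ vr) r3" using r3(2) e(1) wr by simp
    then obtain x3 us3 p wc3 p' v3 where d: "r3 = x3 @ us3 @ p @ wc3 @ p' @ v3" "ble xr x3" "ble us us3" "ble [s] p"
        "ble wc wc3" "ble [Large \<gamma> Br] p'" "ble vr v3"
      unfolding ble_append by blast
    obtain w3 s3 where s3: "p = w3 @ [s3]" "\<forall>t\<in>set w3. insb s t" "mtch s s3" using d(4) unfolding ble_single by blast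
    obtain w4 t4 where t4: "p' = w4 @ [t4]" "\<forall>t\<in>set w4. insb (Large \<gamma> Br) t" "mtch (Large \<gamma> Br) t4"
      using d(6) unfolding ble_single by blast
    have "okb t4" using c3 d(1) t4(1) by (auto simp: cond_def)
    then obtain B4 where B4: "B4 \<in> elts (powV \<gamma>)" "t4 = Large \<gamma> B4" using okb_gamma t4(3) by (auto simp: mtch_def)
    have B4D: "elts B4 \<subseteq> elts Db" using t4(3) B4(2) e(5) by (auto simp: mtch_def)
    have r3e: "r3 = (x3 @ us3) @ w3 @ s3 # wc3 @ w4 @ Large \<gamma> B4 # v3" using d(1) s3(1) t4(1) B4(2) by simp
    have i1: "\<forall>t\<in>set us3. insb (Large \<gamma> Db) t" using ble_insb[OF d(3), of "Large \<gamma> Db"] e(3) wr by simp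
    have i2: "\<forall>t\<in>set wc3. insb (Large \<gamma> Db) t" using ble_insb[OF d(5), of "Large \<gamma> Db"] e(3) wr by simp
    have i3: "\<forall>t\<in>set w3. insb (Large \<gamma> Db) t" using s3(2) insb_trans(1)[OF sDb] by blast
    have i4: "insb (Large \<gamma> Db) s3" using insb_trans(2)[OF sDb s3(3)] .
    have i5: "\<forall>t\<in>set w4. insb (Large \<gamma> Db) t" using t4(2) e(5) unfolding insb_def by auto
    have SGp: "SG0 lb Db (x3 @ us3 @ p)" if "w3 = p @ q" for p q
      unfolding SG0_def
      using ble_trans[OF e(2) d(2)] i1 i2 i3 i4 i5 B4(1) B4D ble_trans[OF e(6) d(7)] r3(1) r3e that
      by (intro exI[of _ x3] exI[of _ "us3 @ p"] exI[of _ "q @ s3 # wc3 @ w4"] exI[of _ B4] exI[of _ v3]) auto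
    have ba3: "below (x3 @ us3) (\<nu> n)"
      using ble_below[OF ble_appendI[OF d(2,3)] _ _ n[unfolded a0] On] c3[unfolded r3e] by fastforce
    have bs1: "below s1 (\<nu> (Suc n))" using ble_below[OF r3(4) _ _ l3(2) On] c3[unfolded r3(3)] by auto
    have V1: "VD s1 (?e n) (tv (?e n))" using VD_mono[OF l3(3) SG0_stem[OF r3(5)] r3(4)] .
    have k3: "kap s3 = \<nu>w" using s3(3) blk(1) by (simp add: mtch_def)
    have "\<exists>u. (x3 @ us3) @ w3 = s1 @ u"
    proof -
      have "s1 @ (y @ Large \<gamma> B1 # v1) = ((x3 @ us3) @ w3) @ (s3 # wc3 @ w4 @ Large \<gamma> B4 # v3)" using r3(3) r3e by simp
      then consider us' where "s1 = ((x3 @ us3) @ w3) @ us'" "us' @ y @ Large \<gamma> B1 # v1 = s3 # wc3 @ w4 @ Large \<gamma> B4 # v3"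
        | us' where "s1 @ us' = (x3 @ us3) @ w3"
        unfolding append_eq_append_conv2 by blast
      then show ?thesis
      proof cases
        case 1
        have "us' = []"
        proof (rule ccontr)
          assume "us' \<noteq> []"
          then have "s3 \<in> set s1" using 1 by (cases us') auto
          then have "kap s3 \<in> elts \<nu>w" using up[OF bs1] unfolding below_def by blast
          then show False using k3 by simp
        qed
        then show ?thesis using 1 by (intro exI[of _ "[]"]) simp
      next
        case 2
        then show ?thesis by metis
      qed
    qed
    then obtain u where u: "s1 @ u = (x3 @ us3) @ w3" by metis
    then consider us' where "s1 = (x3 @ us3) @ us'" "us' @ u = w3" | us' where "s1 @ us' = x3 @ us3"
      unfolding append_eq_append_conv2 by blast
    then show False
    proof cases
      case 2
      have "below s1 (\<nu> n)" using ba3 unfolding 2[symmetric] by simp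
      then show False using no[OF r3(5)] V1 by blast
    next
      case 1
      \<comment> \<open>The deciding lower part arises from an undeciding one by appending blocks
        from \<open>b'\<close> one at a time, so a single block makes the difference.\<close>
      let ?P = "\<lambda>q. VD ((x3 @ us3) @ q) (?e n) (tv (?e n))"
      have "\<not> ?P []" using no[of "x3 @ us3"] SGp[of "[]" w3] ba3 by simp
      moreover have "?P us'" using V1 1(1) by simp
      ultimately obtain q zz q' where q: "us' = q @ zz # q'" "\<not> ?P q" "?P (q @ [zz])"
        using first_change[of ?P] by blast
      let ?l0 = "(x3 @ us3) @ q"
      have "zz \<in> set w3" using 1(2) q(1) by auto
      then have kb: "kap zz \<in> elts b'" using s3(2) blk unfolding insb_def by auto
      have S0: "SG0 lb Db ?l0" using SGp[of q "zz # q' @ u"] 1(2) q(1) by simp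
      have l0L: "?l0 \<in> LL" using stem_LL[OF SG0_stem[OF S0]] .
      have "cond (?l0 @ zz # q' @ u @ s3 # wc3 @ w4 @ Large \<gamma> B4 # v3)" using c3 r3e 1(2) q(1) by auto
      from cond_below[OF this] have b0: "below ?l0 (kap zz)" .
      have kw: "kap zz \<in> elts \<nu>w" using kb b'(2) by blast
      have b0w: "below ?l0 \<nu>w" using below_trans[OF b0 kw Ow] .
      have kg: "kap zz \<in> elts \<gamma>" using Ord_trans[OF gammaV(2) kw nw] .
      have "VD (?l0 @ [zz]) (?e n) (?aa (?e n))" using q(3) by (simp add: aa)
      then have "VD1 ?l0 (kap zz) (?e n) (?aa (?e n))" using VD1_iff[OF kg] by blast
      moreover have nVD: "\<not> VD ?l0 (?e n) (?aa (?e n))" using q(2) by (simp only: aa not_False_eq_True)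
      ultimately have "Yp ?l0 (kap zz)" unfolding Yp_def using lh(1) up[OF lh(2)] ez by blast
      then obtain i where i: "msr \<nu>w i (vset {\<xi> \<in> elts \<nu>w. Yp ?l0 \<xi>})" "i \<in> V"
        using b'(4)[OF kb l0L b0] by blast
      \<comment> \<open>Different \<xi> may decide different values. Each of these is at least the
        least undecided one, so by restriction almost every \<xi> decides that one.\<close>
      define undec where "undec e \<longleftrightarrow> (\<exists>l\<in>LL. below l \<nu>w \<and> h (code_seq l) = e \<and> \<not> VD ?l0 e (?aa e))" for e
      have U: "undec (?e n)" unfolding undec_def using lh(1)[of n] up[OF lh(2)[of n]] nVD by blast
      obtain e0 where e0: "e0 \<in> elts \<zeta>" "undec e0" "\<And>e. e \<in> elts e0 \<Longrightarrow> \<not> undec e"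
        by (rule Ord_least[of \<zeta> "?e n" undec, OF Ord_in_Ord[OF od z] ez U]) blast
      obtain l where l: "l \<in> LL" "below l \<nu>w" "h (code_seq l) = e0" "\<not> VD ?l0 e0 (?aa e0)" using e0(2) unfolding undec_def by blast
      have e0V: "e0 \<in> V" using V_trans[OF zv e0(1)] .
      have aaV: "?aa e0 \<in> V" using V_Int aV e0V by blast
      have oi: "ob \<nu>w i" using i(1) msr_iff by blast
      interpret nmeas V \<nu>w "meas \<nu>w i" using nmeas[OF oi] .
      have "lg (Yp ?l0)" using i(1) unfolding lg_def msr_iff by blast
      then have "lg (\<lambda>\<xi>. VD1 ?l0 \<xi> e0 (?aa e0))"
      proof (rule lg_mono)
        show "dfp (\<lambda>s. VD1 ?l0 (s 0) e0 (?aa e0))" by (intro dfp_VD1 dff_var dff_const dfl_const l0L e0V aaV)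
        fix \<xi> assume "Yp ?l0 \<xi>"
        then obtain l' where l': "l' \<in> LL" "below l' \<nu>w" "h (code_seq l') \<in> elts \<zeta>" "\<not> VD ?l0 (h (code_seq l')) (?aa (h (code_seq l')))"
          "VD1 ?l0 \<xi> (h (code_seq l')) (?aa (h (code_seq l')))" unfolding Yp_def by blast
        have "h (code_seq l') \<notin> elts e0" using e0(3) l' unfolding undec_def by blast
        then have "elts e0 \<subseteq> elts (h (code_seq l'))"
          using Ord_linear[of e0 "h (code_seq l')"] Ord_in_Ord[OF Ord_in_Ord[OF od z]] e0(1) l'(3) Ord_subset by blast
        then show "VD1 ?l0 \<xi> e0 (?aa e0)" by (intro VD1_restrict[OF l'(5)]) auto
      qed
      then have "msr \<nu>w i (vset {\<xi> \<in> elts \<nu>w. VD1 ?l0 \<xi> (h (code_seq l)) (?aa e0)})"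
        using oi unfolding lg_def msr_iff l(3) by blast
      moreover have "refl_at h ?l0 l \<nu>w" using refl[OF nDb l0L l(1) b0w l(2)] .
      moreover have "h (code_seq l) \<in> elts \<delta>" using l(3) e0(1) zsub[OF z] by blast
      ultimately have "VD ?l0 (h (code_seq l)) (?aa e0)" unfolding refl_at_def using i(2) aaV by blast
      then show False using l(3,4) by simp
    qed
  qed
qed

end

section \<open>Definability in the generic extension\<close>

context generic begin

text \<open>Predicates definable over \<open>(V, \<in>, G)\<close>, given through a definable, upward closed forcing relation.\<close>

definition gd :: "((nat \<Rightarrow> 'a) \<Rightarrow> bool) \<Rightarrow> bool" where
  "gd Q \<longleftrightarrow> (\<exists>F. dfp (\<lambda>s. F (dec (s 0)) (\<lambda>n. s (Suc n))) \<and>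
     (\<forall>p q s. range s \<subseteq> V \<longrightarrow> cond p \<longrightarrow> cond q \<longrightarrow> ble p q \<longrightarrow> F p s \<longrightarrow> F q s) \<and>
     (\<forall>s. range s \<subseteq> V \<longrightarrow> Q s = (\<exists>p\<in>GG. F p s)))"

lemma gdI:
  assumes "dfp (\<lambda>s. F (dec (s 0)) (\<lambda>n. s (Suc n)))"
    "\<And>p q s. range s \<subseteq> V \<Longrightarrow> cond p \<Longrightarrow> cond q \<Longrightarrow> ble p q \<Longrightarrow> F p s \<Longrightarrow> F q s"
    "\<And>s. range s \<subseteq> V \<Longrightarrow> Q s = (\<exists>p\<in>GG. F p s)"
  shows "gd Q"
  unfolding gd_def using assms by blast

lemma gd_dfp: "dfp Q \<Longrightarrow> gd Q"
proof (rule gdI[of "\<lambda>p. Q"])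
  show "dfp Q \<Longrightarrow> dfp (\<lambda>s. Q (\<lambda>n. s (Suc n)))" using dfp_shift[of Q Suc] by simp
qed (use GG_ne in auto)

text \<open>The negation is forced by the conditions without an extension that forces
  \<open>Q\<close>. Together with those forcing \<open>Q\<close> they are dense, and directedness
  keeps both kinds from meeting the filter.\<close>

lemma gd_not:
  assumes "gd Q" shows "gd (\<lambda>s. \<not> Q s)"
proof -
  obtain F where F0: "dfp (\<lambda>s. F (dec (s 0)) (\<lambda>n. s (Suc n))) \<and>
     (\<forall>p q s. range s \<subseteq> V \<longrightarrow> cond p \<longrightarrow> cond q \<longrightarrow> ble p q \<longrightarrow> F p s \<longrightarrow> F q s) \<and>
     (\<forall>s. range s \<subseteq> V \<longrightarrow> Q s = (\<exists>p\<in>GG. F p s))" using assms unfolding gd_def by (elim exE)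
  note F = F0[THEN conjunct1] F0[THEN conjunct2, THEN conjunct1, rule_format]
    F0[THEN conjunct2, THEN conjunct2, rule_format]
  let ?F = "\<lambda>p s. \<forall>q\<in>LL. cond q \<and> ble p q \<longrightarrow> \<not> F q s"
  let ?g = "\<lambda>n::nat. if n = 0 then 0 else Suc n"
  have "dfp (\<lambda>s. F (dec (s (?g 0))) (\<lambda>n. s (?g (Suc n))))"
    by (rule dfp_shift[OF F(1)]) (auto simp: inj_def)
  then have d: "dfp (\<lambda>s. F (dec (s 0)) (\<lambda>n. s (Suc (Suc n))))" by simp
  have dF: "dfp (\<lambda>s. ?F (dec (s 0)) (\<lambda>n. s (Suc n)))"
    by (intro df d)
  show ?thesis
  proof (rule gdI[of ?F, OF dF])
    fix p q s assume "ble p q" "?F p s"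
    then show "?F q s" using ble_trans by blast
  next
    fix s :: "nat \<Rightarrow> 'a" assume s: "range s \<subseteq> V"
    show "(\<not> Q s) = (\<exists>p\<in>GG. ?F p s)"
    proof
      assume n: "\<not> Q s"
      have "\<exists>p\<in>GG. F p s \<or> ?F p s"
      proof (rule genericity)
        have "dfp (\<lambda>s. F (dec (s 0)) (\<lambda>n. s (Suc n)) \<or> ?F (dec (s 0)) (\<lambda>n. s (Suc n)))" by (intro dfp_disj F(1) dF)
        from dfp_fix1[of "\<lambda>c s. F (dec c) s \<or> ?F (dec c) s", OF this s]
        show "dfp (\<lambda>u. F (dec (u 0)) s \<or> ?F (dec (u 0)) s)" .
        fix p assume p: "cond p"
        show "\<exists>q. cond q \<and> ble p q \<and> (F q s \<or> ?F q s)"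
        proof (cases "?F p s")
          case True
          then show ?thesis using p ble_refl by blast
        next
          case False
          then show ?thesis by blast
        qed
      qed
      then show "\<exists>p\<in>GG. ?F p s" using n F(3)[OF s] by blast
    next
      assume "\<exists>p\<in>GG. ?F p s"
      then obtain p where p: "p \<in> GG" "?F p s" by blast
      show "\<not> Q s"
      proof
        assume "Q s"
        then obtain q where q: "q \<in> GG" "F q s" using F(3)[OF s] by blast
        obtain r where r: "r \<in> GG" "ble p r" "ble q r" using GG_dir[OF p(1) q(1)] by blast
        have "F r s" using F(2)[OF s _ _ r(3) q(2)] q(1) r(1) GG_cond by blast
        then show False using p(2) r GG_cond cond_LL by blast
      qed
    qed
  qed
qed

lemma gd_conj:
  assumes "gd Q" "gd Q'" shows "gd (\<lambda>s. Q s \<and> Q' s)"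
proof -
  obtain F where F0: "dfp (\<lambda>s. F (dec (s 0)) (\<lambda>n. s (Suc n))) \<and>
     (\<forall>p q s. range s \<subseteq> V \<longrightarrow> cond p \<longrightarrow> cond q \<longrightarrow> ble p q \<longrightarrow> F p s \<longrightarrow> F q s) \<and>
     (\<forall>s. range s \<subseteq> V \<longrightarrow> Q s = (\<exists>p\<in>GG. F p s))" using assms(1) unfolding gd_def by (elim exE)
  note F = F0[THEN conjunct1] F0[THEN conjunct2, THEN conjunct1, rule_format]
    F0[THEN conjunct2, THEN conjunct2, rule_format]
  obtain F' where F'0: "dfp (\<lambda>s. F' (dec (s 0)) (\<lambda>n. s (Suc n))) \<and>
     (\<forall>p q s. range s \<subseteq> V \<longrightarrow> cond p \<longrightarrow> cond q \<longrightarrow> ble p q \<longrightarrow> F' p s \<longrightarrow> F' q s) \<and>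
     (\<forall>s. range s \<subseteq> V \<longrightarrow> Q' s = (\<exists>p\<in>GG. F' p s))" using assms(2) unfolding gd_def by (elim exE)
  note F' = F'0[THEN conjunct1] F'0[THEN conjunct2, THEN conjunct1, rule_format]
    F'0[THEN conjunct2, THEN conjunct2, rule_format]
  show ?thesis
  proof (rule gdI[of "\<lambda>p s. F p s \<and> F' p s"])
    show "dfp (\<lambda>s. F (dec (s 0)) (\<lambda>n. s (Suc n)) \<and> F' (dec (s 0)) (\<lambda>n. s (Suc n)))" by (intro dfp_conj F(1) F'(1))
    show "F p s \<and> F' p s \<Longrightarrow> F q s \<and> F' q s" if "range s \<subseteq> V" "cond p" "cond q" "ble p q" for p q s
      using F(2)[OF that] F'(2)[OF that] by blast
    fix s :: "nat \<Rightarrow> 'a" assume s: "range s \<subseteq> V"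
    have "\<exists>r\<in>GG. F r s \<and> F' r s" if pq: "p \<in> GG" "F p s" "q \<in> GG" "F' q s" for p q
    proof -
      obtain r where "r \<in> GG" "ble p r" "ble q r" using GG_dir[OF pq(1,3)] by blast
      then show ?thesis using F(2)[OF s _ _ _ pq(2)] F'(2)[OF s _ _ _ pq(4)] pq(1,3) GG_cond by blast
    qed
    then show "(Q s \<and> Q' s) = (\<exists>p\<in>GG. F p s \<and> F' p s)" unfolding F(3)[OF s] F'(3)[OF s] by blast
  qed
qed

lemma gd_ex:
  assumes "gd (\<lambda>s. Q (s 0) (\<lambda>n. s (Suc n)))" shows "gd (\<lambda>s. \<exists>x\<in>V. Q x s)"
proof -
  obtain F where F0: "dfp (\<lambda>s. F (dec (s 0)) (\<lambda>n. s (Suc n))) \<and>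
     (\<forall>p q s. range s \<subseteq> V \<longrightarrow> cond p \<longrightarrow> cond q \<longrightarrow> ble p q \<longrightarrow> F p s \<longrightarrow> F q s) \<and>
     (\<forall>s. range s \<subseteq> V \<longrightarrow> Q (s 0) (\<lambda>n. s (Suc n)) = (\<exists>p\<in>GG. F p s))" using assms unfolding gd_def by (elim exE)
  note F = F0[THEN conjunct1] F0[THEN conjunct2, THEN conjunct1, rule_format]
    F0[THEN conjunct2, THEN conjunct2, rule_format]
  have Q: "Q x s = (\<exists>p\<in>GG. F p (case_nat x s))" if "x \<in> V" "range s \<subseteq> V" for x s
    using F(3)[OF range_case_nat[OF that]] by simp
  show ?thesis
  proof (rule gdI[of "\<lambda>p s. \<exists>x\<in>V. F p (case_nat x s)"])
    let ?g = "\<lambda>n::nat. if n = 0 then 1 else if n = 1 then 0 else n"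
    have "dfp (\<lambda>s. F (dec (s (?g 0))) (\<lambda>n. s (?g (Suc n))))"
      by (rule dfp_shift[OF F(1)]) (auto simp: inj_def)
    moreover have "(\<lambda>n. s (?g (Suc n))) = case_nat (s 0) (\<lambda>n. s (Suc (Suc n)))" for s :: "nat \<Rightarrow> 'a"
      by (auto simp: fun_eq_iff split: nat.splits)
    ultimately have "dfp (\<lambda>s. F (dec (s 1)) (case_nat (s 0) (\<lambda>n. s (Suc (Suc n)))))" by simp
    then show "dfp (\<lambda>s. \<exists>x\<in>V. F (dec (s 0)) (case_nat x (\<lambda>n. s (Suc n))))"
      by (intro dfp_ex) simp
    show "\<exists>x\<in>V. F p (case_nat x s) \<Longrightarrow> \<exists>x\<in>V. F q (case_nat x s)"
      if "range s \<subseteq> V" "cond p" "cond q" "ble p q" for p q s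
      using F(2)[OF range_case_nat[OF _ that(1)] that(2-4)] by blast
    fix s :: "nat \<Rightarrow> 'a" assume s: "range s \<subseteq> V"
    then show "(\<exists>x\<in>V. Q x s) = (\<exists>p\<in>GG. \<exists>x\<in>V. F p (case_nat x s))" using Q by blast
  qed
qed

lemma gd_disj: "gd P \<Longrightarrow> gd Q \<Longrightarrow> gd (\<lambda>s. P s \<or> Q s)"
  using gd_not[OF gd_conj[OF gd_not gd_not], of P Q] by simp

lemma gd_imp: "gd P \<Longrightarrow> gd Q \<Longrightarrow> gd (\<lambda>s. P s \<longrightarrow> Q s)"
  unfolding imp_conv_disj by (intro gd_disj gd_not)

lemma gd_all:
  assumes "gd (\<lambda>s. Q (s 0) (\<lambda>n. s (Suc n)))" shows "gd (\<lambda>s. \<forall>x\<in>V. Q x s)"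
  using gd_not[OF gd_ex[of "\<lambda>x s. \<not> Q x s", OF gd_not[OF assms]]] by simp

lemma gd_exl:
  assumes "gd (\<lambda>s. Q (dec (s 0)) (\<lambda>n. s (Suc n)))" shows "gd (\<lambda>s. \<exists>l\<in>LL. Q l s)"
proof -
  have "gd (\<lambda>s. \<exists>c\<in>V. c \<in> elts LC \<and> Q (dec c) s)"
    by (intro gd_ex gd_conj assms gd_dfp df LC_V)
  moreover have "(\<exists>c\<in>V. c \<in> elts LC \<and> Q (dec c) s) = (\<exists>l\<in>LL. Q l s)" for s
    using elts_LC code_V by (metis (no_types, lifting) dec_LL dec_code code_LC)
  ultimately show ?thesis by simp
qed

lemma gd_GG: assumes "dfl x" shows "gd (\<lambda>s. x s \<in> GG)"
proof (rule gdI[of "\<lambda>p s. cond (x s) \<and> ble (x s) p"])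
  show "dfp (\<lambda>s. cond (x (\<lambda>n. s (Suc n))) \<and> ble (x (\<lambda>n. s (Suc n))) (dec (s 0)))"
    by (intro df dfl_shift assms)
  show "x s \<in> GG \<longleftrightarrow> (\<exists>p\<in>GG. cond (x s) \<and> ble (x s) p)" for s
    using GG_down GG_cond ble_refl by blast
qed (use ble_trans in blast)

text \<open>Check names with an arbitrary \<open>e\<close> in the role of the weakest condition;
  they have the right value as soon as \<open>e\<close> is in the filter.\<close>

definition cname :: "'a \<Rightarrow> 'a \<Rightarrow> 'a" where
  "cname e = recF (\<lambda>x y. prodV y (vset {e}))"

lemma cname: "cname e x = prodV (vset (cname e ` elts x)) (vset {e})"
  unfolding cname_def by (subst recF) simp

lemma dfn_cname: "e \<in> V \<Longrightarrow> dfn (cname e)"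
  unfolding cname_def by (intro dfn_recF df)

lemma val_cname: "p \<in> GG \<Longrightarrow> val G (cname (code_seq p) x) = x"
proof (induction x rule: elts_induct)
  case (step x)
  have "code_seq p \<in> G" using step(2) unfolding GG_def by blast
  then have "{\<rho>. \<exists>q\<in>G. opair \<rho> q \<in> elts (cname (code_seq p) x)} = cname (code_seq p) ` elts x"
    unfolding cname[of _ x] prodV_opair by auto
  then have "elts (val G (cname (code_seq p) x)) = elts x"
    using step unfolding elts_val by (auto simp: image_image)
  then show ?case by (rule elts_extensionality)
qed

lemma Nm_cname: "cond p \<Longrightarrow> is_name (magidor \<kappa> U) (cname (code_seq p) x)"
proof (induction x rule: elts_induct)
  case (step x)
  have m: "code_seq p \<in> magidor \<kappa> U" unfolding magidor_eq using step(2) by blast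
  show ?case
  proof (rule is_name.intros)
    fix z assume "z \<in> elts (cname (code_seq p) x)"
    then obtain y where "y \<in> elts x" "z = opair (cname (code_seq p) y) (code_seq p)"
      unfolding cname[of _ x] elts_prodV by auto
    then show "\<exists>\<sigma> q. z = opair \<sigma> q \<and> is_name (magidor \<kappa> U) \<sigma> \<and> q \<in> magidor \<kappa> U"
      using step m by blast
  qed
qed

lemma V_gen_ext: "x \<in> V \<Longrightarrow> x \<in> gen_ext V (magidor \<kappa> U) G"
proof -
  assume x: "x \<in> V"
  obtain p where p: "p \<in> GG" using GG_ne by blast
  have "cname (code_seq p) x \<in> V" using dfn_V[OF dfn_cname x] p GG_cond cond_LL code_V by blast
  then show ?thesis unfolding gen_ext_def using val_cname[OF p, of x] Nm_cname[OF GG_cond[OF p], of x] by force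
qed

text \<open>Separation in the extension for predicates definable over (V, \<in>, G): the name pairs
  the check name of each x with the conditions forcing \<open>Q x\<close>. No forcing relation for
  formulas about the extension is involved.\<close>

lemma gd_gen_ext:
  assumes "gd (\<lambda>s. Q (s 0))" and X: "X \<in> V"
  shows "vset {x \<in> elts X. Q x} \<in> gen_ext V (magidor \<kappa> U) G"
proof -
  obtain F where F0: "dfp (\<lambda>s. F (dec (s 0)) (\<lambda>n. s (Suc n))) \<and>
     (\<forall>p q s. range s \<subseteq> V \<longrightarrow> cond p \<longrightarrow> cond q \<longrightarrow> ble p q \<longrightarrow> F p s \<longrightarrow> F q s) \<and>
     (\<forall>s. range s \<subseteq> V \<longrightarrow> Q (s 0) = (\<exists>p\<in>GG. F p s))" using assms(1) unfolding gd_def by (elim exE)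
  note F = F0[THEN conjunct1] F0[THEN conjunct2, THEN conjunct2, rule_format]
  obtain p0 where p0: "p0 \<in> GG" using GG_ne by blast
  let ?e = "code_seq p0"
  let ?c = "cname ?e"
  have eV: "?e \<in> V" using p0 GG_cond cond_LL code_V by blast
  define F' where "F' = (\<lambda>p x. F p (case_nat x (\<lambda>_. X)))"
  have "(\<lambda>n. s (Suc n)) = case_nat (s 1) (\<lambda>n. s (Suc (Suc n)))" for s :: "nat \<Rightarrow> 'a"
    by (auto simp: fun_eq_iff split: nat.splits)
  then have "dfp (\<lambda>s. F (dec (s 0)) (case_nat (s 1) (\<lambda>n. s (Suc (Suc n)))))" using F(1) by simp
  from dfp_fix2[of "\<lambda>c x r. F (dec c) (case_nat x r)" "\<lambda>_. X", OF this]
  have dF: "dfp (\<lambda>s. F' (dec (s 0)) (s 1))" using X unfolding F'_def by blast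
  have Q: "Q x = (\<exists>p\<in>GG. F' p x)" if "x \<in> V" for x
    using F(2)[of "case_nat x (\<lambda>_. X)"] range_case_nat[OF that, of "\<lambda>_. X"] X unfolding F'_def by auto
  let ?P = "\<lambda>u. \<exists>x\<in>elts X. \<exists>c\<in>elts LC. u = opair (?c x) c \<and> cond (dec c) \<and> F' (dec c) x"
  let ?N = "vset {u \<in> elts (prodV (vset (?c ` elts X)) LC). ?P u}"
  note dc = dfn_cname[OF eV]
  have NV: "?N \<in> V"
  proof (rule V_Collect)
    show "prodV (vset (?c ` elts X)) LC \<in> V" by (intro V_prodV LC_V replacement_fn[OF dc X])
    show "dfp (\<lambda>s. ?P (s 0))" by (intro df X LC_V dfnD[OF dc] dfp2I[OF dF])
  qed
  have eN: "opair \<rho> c \<in> elts ?N \<longleftrightarrow> (\<exists>x\<in>elts X. \<exists>p. cond p \<and> F' p x \<and> \<rho> = ?c x \<and> c = code_seq p)" for \<rho> c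
  proof
    assume "opair \<rho> c \<in> elts ?N"
    then obtain x c' where "x \<in> elts X" "c' \<in> elts LC" "opair \<rho> c = opair (?c x) c'" "cond (dec c')" "F' (dec c') x"
      unfolding elts_vset_Collect by blast
    then show "\<exists>x\<in>elts X. \<exists>p. cond p \<and> F' p x \<and> \<rho> = ?c x \<and> c = code_seq p"
      using code_dec[of c'] by (intro bexI[of _ x] exI[of _ "dec c'"]) auto
  next
    assume "\<exists>x\<in>elts X. \<exists>p. cond p \<and> F' p x \<and> \<rho> = ?c x \<and> c = code_seq p"
    then obtain x p where x: "x \<in> elts X" "cond p" "F' p x" "\<rho> = ?c x" "c = code_seq p" by blast
    then have "p \<in> LL" using cond_LL by blast
    then have "?P (opair \<rho> c)" using x code_LC by (intro bexI[of _ x] bexI[of _ c]) auto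
    moreover have "opair \<rho> c \<in> elts (prodV (vset (?c ` elts X)) LC)"
      using x \<open>p \<in> LL\<close> code_LC by (auto simp: prodV_opair)
    ultimately show "opair \<rho> c \<in> elts ?N" unfolding elts_vset_Collect by blast
  qed
  have nm: "is_name (magidor \<kappa> U) ?N"
  proof (rule is_name.intros)
    fix z assume z: "z \<in> elts ?N"
    then obtain \<rho> c where zc: "z = opair \<rho> c" unfolding elts_vset_Collect by blast
    then obtain x p where "cond p" "\<rho> = ?c x" "c = code_seq p" using z eN by blast
    then show "\<exists>\<sigma> q. z = opair \<sigma> q \<and> is_name (magidor \<kappa> U) \<sigma> \<and> q \<in> magidor \<kappa> U"
      using zc Nm_cname[OF GG_cond[OF p0]] unfolding magidor_eq by blast
  qed
  have "{\<rho>. \<exists>q\<in>G. opair \<rho> q \<in> elts ?N} = ?c ` {x \<in> elts X. Q x}"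
  proof -
    have "(\<exists>q\<in>G. opair \<rho> q \<in> elts ?N) \<longleftrightarrow> (\<exists>x\<in>elts X. Q x \<and> \<rho> = ?c x)" for \<rho>
    proof
      assume "\<exists>q\<in>G. opair \<rho> q \<in> elts ?N"
      then obtain q x p where "q \<in> G" "x \<in> elts X" "cond p" "F' p x" "\<rho> = ?c x" "q = code_seq p" unfolding eN by blast
      then show "\<exists>x\<in>elts X. Q x \<and> \<rho> = ?c x" using Q[OF V_trans[OF X]] unfolding GG_def by blast
    next
      assume "\<exists>x\<in>elts X. Q x \<and> \<rho> = ?c x"
      then obtain x p where "x \<in> elts X" "\<rho> = ?c x" "p \<in> GG" "F' p x" using Q[OF V_trans[OF X]] by blast
      then show "\<exists>q\<in>G. opair \<rho> q \<in> elts ?N" unfolding eN GG_def by blast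
    qed
    then show ?thesis by auto
  qed
  note eS = this
  have "elts (val G ?N) = (\<lambda>x. val G (?c x)) ` {x \<in> elts X. Q x}"
    unfolding elts_val eS by (rule image_image)
  then have "elts (val G ?N) = {x \<in> elts X. Q x}"
    unfolding val_cname[OF p0] image_ident .
  then have "vset {x \<in> elts X. Q x} = val G ?N" by (rule vset_eqI)
  then show ?thesis unfolding gen_ext_def using NV nm by blast
qed

end

section \<open>The cofinal sequence\<close>

context core begin

lemma insb_list: "Db \<in> elts (powV \<gamma>) \<Longrightarrow>
  (\<forall>z\<in>set w. insb (Large \<gamma> Db) z) \<longleftrightarrow> ble (mkL \<gamma> Db) (w @ mkL \<gamma> Db)"
  using mkL_eq[OF gammaV(3)] powV(2)[OF gammaV(1)] by (auto simp: ble_single)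

text \<open>Membership in the filter is isolated in one conjunct. The rest is definable over V,
  where insertion of a whole list from \<open>Db\<close> is expressed as an instance of
  \<open>ble\<close>.\<close>

lemma SG0_iff:
  assumes Db: "Db \<in> elts (powV \<gamma>)"
  shows "SG0 lb Db l \<longleftrightarrow> (\<exists>x\<in>LL. \<exists>w\<in>LL. \<exists>y\<in>LL. \<exists>v'\<in>LL. \<exists>B\<in>V. l @ y @ mkL \<gamma> B @ v' \<in> GG \<and>
     (l = x @ w \<and> ble lb x \<and> ble (mkL \<gamma> Db) ((w @ y) @ mkL \<gamma> Db) \<and>
     B \<in> elts (powV \<gamma>) \<and> elts B \<subseteq> elts Db \<and> ble v v'))" (is "_ \<longleftrightarrow> ?R")
proof
  assume "SG0 lb Db l"
  then obtain x w y B v' where *: "l = x @ w" "ble lb x" "\<forall>z\<in>set (w @ y). insb (Large \<gamma> Db) z"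
     "B \<in> elts (powV \<gamma>)" "elts B \<subseteq> elts Db" "ble v v'" "l @ y @ Large \<gamma> B # v' \<in> GG" unfolding SG0_def by blast
  have "l @ y @ Large \<gamma> B # v' \<in> LL" using GG_cond[OF *(7)] cond_LL by blast
  then have L: "x \<in> LL" "w \<in> LL" "y \<in> LL" "v' \<in> LL" using *(1) by auto
  have "mkL \<gamma> B = [Large \<gamma> B]" using mkL_eq[OF gammaV(3)] *(4) powV(2)[OF gammaV(1)] by blast
  then have "l @ y @ mkL \<gamma> B @ v' \<in> GG" using *(7) by simp
  moreover have "ble (mkL \<gamma> Db) ((w @ y) @ mkL \<gamma> Db)" using *(3) insb_list[OF Db] by blast
  ultimately show ?R using L * powV_V by blast
next
  assume ?R
  then obtain x w y v' B where *: "l @ y @ mkL \<gamma> B @ v' \<in> GG" "l = x @ w" "ble lb x" "ble (mkL \<gamma> Db) ((w @ y) @ mkL \<gamma> Db)"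
     "B \<in> elts (powV \<gamma>)" "elts B \<subseteq> elts Db" "ble v v'" by blast
  have "mkL \<gamma> B = [Large \<gamma> B]" using mkL_eq[OF gammaV(3)] *(5) powV(2)[OF gammaV(1)] by blast
  then have "l @ y @ Large \<gamma> B # v' \<in> GG" using *(1) by simp
  then show "SG0 lb Db l" unfolding SG0_def using * insb_list[OF Db] by blast
qed

lemma gd_SG0:
  assumes Db: "Db \<in> elts (powV \<gamma>)" and l: "lb \<in> LL" "dfl x"
  shows "gd (\<lambda>s. SG0 lb Db (x s))"
  unfolding SG0_iff[OF Db]
  by (intro gd_exl gd_ex gd_conj gd_GG; (rule gd_dfp)?;
      intro df dfl_shift gammaV(1) powV(1) powV_V[OF Db] vLL mkL_LL l)

lemma bounded_stem: "below l \<gamma> \<Longrightarrow> \<exists>\<nu>\<in>elts \<gamma>. below l \<nu>"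
proof (induction l)
  case Nil
  obtain \<beta> where "ob \<gamma> \<beta>" using meas_ex by blast
  then interpret nmeas V \<gamma> "meas \<gamma> \<beta>" by (rule nmeas)
  show ?case using nm_basic(4) by auto
next
  case (Cons t l)
  then obtain \<nu>1 where n1: "\<nu>1 \<in> elts \<gamma>" "below l \<nu>1" by auto
  obtain \<nu>2 where n2: "\<nu>2 \<in> elts \<gamma>" "kap t \<in> elts \<nu>2" using glim Cons(2) by auto
  have O: "Ord \<nu>1" "Ord \<nu>2" using Ord_in_Ord[OF gammaV(2)] n1 n2 by blast+
  then consider "\<nu>1 \<in> elts \<nu>2" | "\<nu>1 = \<nu>2" | "\<nu>2 \<in> elts \<nu>1" using Ord_linear by blast
  then show ?case
  proof cases
    case 1
    then show ?thesis using n2 below_trans[OF n1(2) 1 O(2)] by auto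
  next
    case 2
    then show ?thesis using n1 n2 by auto
  next
    case 3
    then show ?thesis using n1 Ord_trans[OF O(1) n2(2) 3] by auto
  qed
qed

text \<open>Finite pieces of a sequence of elements of V are in V, even if the sequence is not. This
  lets a recursion in the extension be described by quantifiers over V.\<close>

lemma finite_graph: "\<exists>g\<in>V. elts g = (\<lambda>i. opair (nat_ord i) (w i)) ` {..n}" if "\<And>i. w i \<in> V" for w :: "nat \<Rightarrow> 'a"
proof (induction n)
  case 0
  have "vset {opair (nat_ord 0) (w 0)} \<in> V" by (intro V_single V_opair nat_ord_V that)
  moreover have "elts (vset {opair (nat_ord 0) (w 0)}) = (\<lambda>i. opair (nat_ord i) (w i)) ` {..0}"
    by (simp only: elts_vset_single) simp
  ultimately show ?case by blast
next
  case (Suc n)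
  then obtain g where g: "g \<in> V" "elts g = (\<lambda>i. opair (nat_ord i) (w i)) ` {..n}" by blast
  let ?g = "vset (insert (opair (nat_ord (Suc n)) (w (Suc n))) (elts g))"
  have "?g \<in> V" by (intro V_insert V_opair nat_ord_V that g)
  moreover have "elts ?g = (\<lambda>i. opair (nat_ord i) (w i)) ` {..Suc n}"
    unfolding elts_vset_insert unfolding g(2) atMost_Suc image_insert by (rule refl)
  ultimately show ?case by blast
qed

lemma cofinal_ex: "\<exists>f\<in>gen_ext V (magidor \<kappa> U) G. cofinal_map f omega \<delta>"
proof -
  obtain h lb Db where h: "dfn h"
    and unb: "\<And>\<zeta>. \<zeta> \<in> elts \<delta> \<Longrightarrow> \<exists>l. stemok l \<and> h (code_seq l) \<in> elts \<delta> \<and> h (code_seq l) \<notin> elts \<zeta>"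
    and b: "CC lb Db \<in> GG" "Db \<in> elts (powV \<gamma>)"
    and refl: "\<And>\<nu> l l'. \<nu> \<in> elts Db \<Longrightarrow> l \<in> LL \<Longrightarrow> l' \<in> LL \<Longrightarrow> below l \<nu> \<Longrightarrow> below l' \<nu> \<Longrightarrow> refl_at h l l' \<nu>"
    and st: "\<And>\<nu>. \<nu> \<in> elts \<gamma> \<Longrightarrow> \<exists>\<zeta>\<in>elts \<delta>. \<forall>l. SG0 lb Db l \<and> below l \<nu> \<longrightarrow> \<not> VD l \<zeta> (tv \<zeta>)"
    by (rule undecided_below) blast
  have stb: "stemok lb" using CC_cond'[OF b(2)] GG_cond[OF b(1)] by blast
  have lbL: "lb \<in> LL" using stem_LL[OF stb] .
  obtain \<nu>0 where n0: "\<nu>0 \<in> elts \<gamma>" "below lb \<nu>0" using bounded_stem stb unfolding stemok_def by blast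
  have gV: "\<mu> \<in> V" if "\<mu> \<in> elts \<gamma>" for \<mu> using V_trans gammaV(1) that by blast
  \<comment> \<open>The map \<open>tv\<close> is defined from the extension, so correctness of
    \<open>a\<close> is expressed through a condition of the filter that forces it.\<close>
  define D where "D \<nu> \<zeta> \<longleftrightarrow> (\<exists>l\<in>LL. SG0 lb Db l \<and> below l \<nu> \<and> (\<exists>a\<in>V. (\<exists>p\<in>LL. p \<in> GG \<and> RR p \<zeta> a) \<and> VD l \<zeta> a))" for \<nu> \<zeta>
  \<comment> \<open>Here and in \<open>N\<close> the least candidate is taken, so that the whole
    sequence is determined by \<open>\<nu>0\<close> and definable over (V, \<in>, G).\<close>
  define Z where "Z \<nu> z \<longleftrightarrow> z \<in> elts \<delta> \<and> \<not> D \<nu> z \<and> (\<forall>y\<in>V. y \<in> elts z \<longrightarrow> D \<nu> y)" for \<nu> z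
  define BB where "BB \<nu> \<mu> \<longleftrightarrow> (\<exists>z\<in>V. Z \<nu> z \<and> (\<exists>l\<in>LL. (stemok l \<and> below l \<mu> \<and> h (code_seq l) \<in> elts \<delta> \<and> h (code_seq l) \<notin> elts z) \<and>
     D \<mu> (h (code_seq l))))" for \<nu> \<mu>
  define N where "N \<nu> \<nu>' \<longleftrightarrow> \<nu>' \<in> elts \<gamma> \<and> BB \<nu> \<nu>' \<and> (\<forall>\<mu>\<in>V. \<mu> \<in> elts \<nu>' \<longrightarrow> \<not> BB \<nu> \<mu>)" for \<nu> \<nu>'
  have gd_D: "gd (\<lambda>s. D (t s) (u s))" if "dff t" "dff u" for t u
    unfolding D_def
    by (intro gd_exl gd_ex gd_conj gd_GG gd_SG0 b lbL; (rule gd_dfp)?; intro df dfl_shift dff_shift that)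
  have gd_Z: "gd (\<lambda>s. Z (t s) (u s))" if "dff t" "dff u" for t u
    unfolding Z_def
    by (intro gd_conj gd_not gd_all gd_imp gd_D; (rule gd_dfp)?; intro df dff_shift that dV)
  have gd_BB: "gd (\<lambda>s. BB (t s) (u s))" if "dff t" "dff u" for t u
    unfolding BB_def
    by (intro gd_exl gd_ex gd_conj gd_Z gd_D; (rule gd_dfp)?; intro df dfl_shift dff_shift that dV dfnD[OF h])
  have gd_N: "gd (\<lambda>s. N (t s) (u s))" if "dff t" "dff u" for t u
    unfolding N_def
    by (intro gd_conj gd_not gd_all gd_imp gd_BB; (rule gd_dfp)?; intro df dff_shift that gammaV)
  have D: "D \<nu> \<zeta> \<longleftrightarrow> (\<exists>l. SG0 lb Db l \<and> below l \<nu> \<and> VD l \<zeta> (tv \<zeta>))" if z: "\<zeta> \<in> elts \<delta>" for \<nu> \<zeta>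
  proof
    assume "D \<nu> \<zeta>"
    then show "\<exists>l. SG0 lb Db l \<and> below l \<nu> \<and> VD l \<zeta> (tv \<zeta>)" unfolding D_def using sound[OF z] by blast
  next
    assume "\<exists>l. SG0 lb Db l \<and> below l \<nu> \<and> VD l \<zeta> (tv \<zeta>)"
    then show "D \<nu> \<zeta>"
      unfolding D_def using decided[OF z] tv(2)[OF z] GG_cond cond_LL stem_LL[OF SG0_stem] by blast
  qed
  have Ddown: "D \<nu> \<zeta>'" if "D \<nu> \<zeta>" "\<zeta> \<in> elts \<delta>" "\<zeta>' \<in> elts \<delta>" "elts \<zeta>' \<subseteq> elts \<zeta>" for \<nu> \<zeta> \<zeta>'
    using that(1) VD_tv[OF _ that(4)] unfolding D[OF that(2)] D[OF that(3)] by blast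
  have Od: "Ord z" if "z \<in> elts \<delta>" for z using Ord_in_Ord[OF od that] .
  have Zex: "\<exists>z. Z \<nu> z" if n: "\<nu> \<in> elts \<gamma>" for \<nu>
  proof -
    obtain \<zeta> where "\<zeta> \<in> elts \<delta>" "\<not> D \<nu> \<zeta>" using st[OF n] D by blast
    then obtain z where z: "z \<in> elts \<delta>" "\<not> D \<nu> z" "\<And>y. y \<in> elts z \<Longrightarrow> \<not> \<not> D \<nu> y"
      by (rule Ord_least[OF od]) blast
    then show ?thesis unfolding Z_def by blast
  qed
  have Zun: "z = z'" if "Z \<nu> z" "Z \<nu> z'" for \<nu> z z'
    using Ord_linear[of z z'] Od that zV unfolding Z_def by blast
  have Nun: "\<mu> = \<mu>'" if "N \<nu> \<mu>" "N \<nu> \<mu>'" for \<nu> \<mu> \<mu>'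
    using Ord_linear[of \<mu> \<mu>'] Ord_in_Ord[OF gammaV(2)] that gV unfolding N_def by blast
  \<comment> \<open>A value of \<open>h\<close> not below \<open>z\<close> is decided by some
    generic lower part; this part and the argument of \<open>h\<close> have a common bound below
    \<gamma>.\<close>
  have Nex: "\<exists>\<nu>'. N \<nu> \<nu>'" if n: "\<nu> \<in> elts \<gamma>" for \<nu>
  proof -
    obtain z where z: "Z \<nu> z" using Zex[OF n] by blast
    then have zd: "z \<in> elts \<delta>" unfolding Z_def by blast
    obtain l where l: "stemok l" "h (code_seq l) \<in> elts \<delta>" "h (code_seq l) \<notin> elts z" using unb[OF zd] by blast
    obtain l' where l': "SG0 lb Db l'" "VD l' (h (code_seq l)) (tv (h (code_seq l)))" using SG0_decides[OF b l(2)] by blast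
    have "below (l @ l') \<gamma>" using l(1) SG0_stem[OF l'(1)] unfolding stemok_def by simp
    then obtain \<mu> where m: "\<mu> \<in> elts \<gamma>" "below (l @ l') \<mu>" using bounded_stem by blast
    have "D \<mu> (h (code_seq l))" unfolding D[OF l(2)] using l' m(2) by auto
    then have "BB \<nu> \<mu>" unfolding BB_def using z zV[OF zd] l m(2) stem_LL[OF l(1)] by auto
    with m(1) obtain \<nu>' where "\<nu>' \<in> elts \<gamma>" "BB \<nu> \<nu>'" "\<And>y. y \<in> elts \<nu>' \<Longrightarrow> \<not> BB \<nu> y"
      by (rule Ord_least[OF gammaV(2)]) blast
    then show ?thesis unfolding N_def by blast
  qed
  \<comment> \<open>\<open>SOME\<close> picks the only candidate, by \<open>Nun\<close>; this makes
    the sequence agree with its definable description \<open>PP\<close>.\<close>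
  define \<nu> where "\<nu> = rec_nat \<nu>0 (\<lambda>_ \<mu>. SOME \<nu>'. N \<mu> \<nu>')"
  have nu0: "\<nu> 0 = \<nu>0" and nuS: "\<nu> (Suc n) = (SOME \<nu>'. N (\<nu> n) \<nu>')" for n by (simp_all add: \<nu>_def)
  have nu: "\<nu> n \<in> elts \<gamma>" for n
  proof (induction n)
    case (Suc n)
    then show ?case using someI_ex[OF Nex[OF Suc]] unfolding nuS N_def by blast
  qed (simp add: nu0 n0)
  have NN: "N (\<nu> n) (\<nu> (Suc n))" for n using someI_ex[OF Nex[OF nu]] unfolding nuS .
  define zs where "zs n = (SOME z. Z (\<nu> n) z)" for n
  have ZZ: "Z (\<nu> n) (zs n)" for n unfolding zs_def using someI_ex[OF Zex[OF nu]] .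
  have zd: "zs n \<in> elts \<delta>" for n using ZZ unfolding Z_def by blast
  have "\<exists>l. stemok l \<and> below l (\<nu> (Suc n)) \<and> h (code_seq l) \<in> elts \<delta> \<and> h (code_seq l) \<notin> elts (zs n) \<and>
     D (\<nu> (Suc n)) (h (code_seq l))" for n
  proof -
    have "BB (\<nu> n) (\<nu> (Suc n))" using NN unfolding N_def by blast
    then show ?thesis unfolding BB_def using Zun[OF ZZ] by blast
  qed
  then obtain lh where lh: "stemok (lh n)" "below (lh n) (\<nu> (Suc n))" "h (code_seq (lh n)) \<in> elts \<delta>"
      "h (code_seq (lh n)) \<notin> elts (zs n)" "D (\<nu> (Suc n)) (h (code_seq (lh n)))" for n
    by metis
  let ?e = "\<lambda>n. h (code_seq (lh n))"
  have ze: "elts (zs n) \<subseteq> elts (?e n)" for n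
    using Ord_linear[OF Od[OF zd] Od[OF lh(3)], of n n] lh(4)[of n] Ord_subset[OF Od[OF lh(3)], of "zs n" n] by auto
  have no: "\<not> VD l (?e n) (tv (?e n))" if "SG0 lb Db l" "below l (\<nu> n)" for n l
  proof
    assume "VD l (?e n) (tv (?e n))"
    then have "D (\<nu> n) (?e n)" unfolding D[OF lh(3)] using that by blast
    then have "D (\<nu> n) (zs n)" using Ddown lh(3) zd ze by blast
    then show False using ZZ unfolding Z_def by blast
  qed
  have yes: "\<exists>l. SG0 lb Db l \<and> below l (\<nu> (Suc n)) \<and> VD l (?e n) (tv (?e n))" for n
    using lh(5) unfolding D[OF lh(3)] .
  \<comment> \<open>The two sequences interleave: \<open>zs n\<close> is at most
    \<open>?e n\<close>, which is below \<open>zs (Suc n)\<close>. Cofinality thus passes from the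
    values of \<open>h\<close> to \<open>zs\<close>.\<close>
  have ez: "?e n \<in> elts (zs (Suc n))" for n
  proof -
    have "\<not> D (\<nu> (Suc n)) (zs (Suc n))" using ZZ unfolding Z_def by blast
    then have "\<not> elts (zs (Suc n)) \<subseteq> elts (?e n)" using Ddown[OF lh(5,3) zd] by blast
    then show ?thesis
      using Ord_linear[OF Od[OF zd] Od[OF lh(3)], of "Suc n" n] Ord_subset[OF Od[OF lh(3)], of "zs (Suc n)" n] by auto
  qed
  have cof: "\<exists>n. \<eta> \<in> elts (zs n)" if e: "\<eta> \<in> elts \<delta>" for \<eta>
  proof -
    have "\<exists>n. ?e n \<notin> elts \<eta>"
    proof (rule seq_unbounded[of h lb Db \<nu> lh \<eta>, OF h b refl nu _ _ lh(2) no yes e])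
      show "below lb (\<nu> 0)" using nu0 n0 by simp
      show "lh n \<in> LL" for n using stem_LL lh(1) by blast
    qed
    then obtain n where "?e n \<notin> elts \<eta>" by blast
    then have "\<eta> = ?e n \<or> \<eta> \<in> elts (?e n)" using Ord_linear[OF Od[OF e] Od[OF lh(3)]] by blast
    then show ?thesis using ez[of n] Ord_trans[OF Od[OF zd]] by metis
  qed
  \<comment> \<open>\<open>g\<close> codes a finite piece of \<nu>. Only steps backwards from m to 0
    are demanded of it; uniqueness of \<open>N\<close> then identifies its entries.\<close>
  define PP where "PP m z \<longleftrightarrow> (\<exists>g\<in>V. (\<forall>x\<in>V. opair (vset {}) x \<in> elts g \<longrightarrow> x = \<nu>0) \<and>
     (\<forall>i\<in>V. i \<in> elts m \<longrightarrow> (\<forall>y\<in>V. opair (sucO i) y \<in> elts g \<longrightarrow> (\<exists>x\<in>V. opair i x \<in> elts g \<and> N x y))) \<and>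
     (\<exists>x\<in>V. opair m x \<in> elts g \<and> Z x z))" for m z
  have gd_PP: "gd (\<lambda>s. PP (t s) (u s))" if "dff t" "dff u" for t u
    unfolding PP_def
    by (intro gd_ex gd_conj gd_all gd_imp gd_N gd_Z; (rule gd_dfp)?; intro df dff_shift that V_empty gV n0)
  have PP: "PP (nat_ord n) z \<longleftrightarrow> z = zs n" for n z
  proof
    assume "PP (nat_ord n) z"
    then obtain g where g: "g \<in> V" "\<forall>x\<in>V. opair (vset {}) x \<in> elts g \<longrightarrow> x = \<nu>0"
       "\<forall>i\<in>V. i \<in> elts (nat_ord n) \<longrightarrow> (\<forall>y\<in>V. opair (sucO i) y \<in> elts g \<longrightarrow> (\<exists>x\<in>V. opair i x \<in> elts g \<and> N x y))"
       "\<exists>x\<in>V. opair (nat_ord n) x \<in> elts g \<and> Z x z" unfolding PP_def by blast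
    have "m \<le> n \<Longrightarrow> opair (nat_ord m) x \<in> elts g \<Longrightarrow> x = \<nu> m" for m x
    proof (induction m arbitrary: x)
      case 0
      have "x \<in> V" using V_opairD V_trans[OF g(1) 0(2)] by blast
      then show ?case using g(2) 0(2) nu0 by simp
    next
      case (Suc m)
      have x: "x \<in> V" using V_opairD V_trans[OF g(1) Suc(3)] by blast
      have "nat_ord m \<in> elts (nat_ord n :: 'a)" using Suc(2) nat_ord_mem[of m n] by simp
      moreover have "opair (sucO (nat_ord m)) x \<in> elts g" using Suc(3) by (simp add: sucO_def)
      ultimately obtain y where "opair (nat_ord m) y \<in> elts g" "N y x" using g(3) x nat_ord_V by blast
      then have "N (\<nu> m) x" using Suc by auto
      then show ?case using Nun NN by blast
    qed
    then show "z = zs n" using g(4) Zun ZZ by blast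
  next
    assume z: "z = zs n"
    obtain g where g: "g \<in> V" "elts g = (\<lambda>i. opair (nat_ord i) (\<nu> i)) ` {..n}"
      using finite_graph[of \<nu> n] gV nu by blast
    have mem: "opair (nat_ord i) x \<in> elts g \<longleftrightarrow> i \<le> n \<and> x = \<nu> i" for i x
      unfolding g(2) by (auto simp: nat_ord_inj)
    show "PP (nat_ord n) z"
      unfolding PP_def
    proof (rule bexI[OF _ g(1)], intro conjI ballI impI)
      show "x = \<nu>0" if "opair (vset {}) x \<in> elts g" for x
        using mem[of 0 x] that nu0 by simp
      show "\<exists>x\<in>V. opair (nat_ord n) x \<in> elts g \<and> Z x z"
        using mem[of n] gV nu z ZZ by blast
      fix i y assume i: "i \<in> elts (nat_ord n)" and y: "opair (sucO i) y \<in> elts g"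
      obtain k where k: "i = nat_ord k" "k < n" using i unfolding elts_nat_ord by blast
      have "opair (nat_ord (Suc k)) y \<in> elts g" using y k by (simp add: sucO_def)
      then have "y = \<nu> (Suc k)" using mem by blast
      then show "\<exists>x\<in>V. opair i x \<in> elts g \<and> N x y"
        using mem[of k] k gV nu NN by (intro bexI[of _ "\<nu> k"]) auto
    qed
  qed
  let ?Q = "\<lambda>u. \<exists>m\<in>V. \<exists>z\<in>V. u = opair m z \<and> PP m z"
  let ?f = "vset {u \<in> elts (prodV omega \<delta>). ?Q u}"
  have "gd (\<lambda>s. ?Q (s 0))"
    by (intro gd_ex gd_conj gd_PP; (rule gd_dfp)?; intro df)
  then have fG: "?f \<in> gen_ext V (magidor \<kappa> U) G"
    by (rule gd_gen_ext) (intro V_prodV V_omega dV)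
  have ef: "opair m z \<in> elts ?f \<longleftrightarrow> (\<exists>n. m = nat_ord n \<and> z = zs n)" for m z
  proof
    assume "opair m z \<in> elts ?f"
    then have "m \<in> elts omega" "PP m z" unfolding elts_vset_Collect by (auto simp: prodV_opair)
    then show "\<exists>n. m = nat_ord n \<and> z = zs n" unfolding elts_omega using PP by auto
  next
    assume "\<exists>n. m = nat_ord n \<and> z = zs n"
    then obtain n where n: "m = nat_ord n" "z = zs n" by blast
    then have "PP m z" "m \<in> V" "z \<in> V" "m \<in> elts omega" "z \<in> elts \<delta>"
      using PP nat_ord_V zV[OF zd] zd elts_omega by auto
    then show "opair m z \<in> elts ?f" unfolding elts_vset_Collect by (auto simp: prodV_opair)
  qed
  have fn: "is_fun ?f omega"
    unfolding is_fun_def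
  proof (intro conjI ballI)
    fix u assume "u \<in> elts ?f"
    then have "u \<in> elts (prodV omega \<delta>)" unfolding elts_vset_Collect by blast
    then show "\<exists>x\<in>elts omega. \<exists>y. u = opair x y" unfolding elts_prodV by blast
  next
    fix x :: 'a assume "x \<in> elts omega"
    then obtain n where "x = nat_ord n" unfolding elts_omega by blast
    then show "\<exists>!y. opair x y \<in> elts ?f" unfolding ef by (auto simp: nat_ord_inj)
  qed
  have ap: "app ?f (nat_ord n) = zs n" for n
    by (rule app_eqI[OF fn]) (use ef elts_omega in blast)+
  have "cofinal_map ?f omega \<delta>"
    unfolding cofinal_map_def
  proof (intro conjI ballI fn)
    fix x :: 'a assume "x \<in> elts omega"
    then show "app ?f x \<in> elts \<delta>" unfolding elts_omega using ap zd by auto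
  next
    fix \<eta> assume "\<eta> \<in> elts \<delta>"
    then obtain n where "\<eta> \<in> elts (zs n)" using cof by blast
    then show "\<exists>\<xi>\<in>elts omega. \<eta> \<in> elts (app ?f \<xi>) \<or> \<eta> = app ?f \<xi>"
      using ap[of n] elts_omega by (intro bexI[of _ "nat_ord n"]) auto
  qed
  then show ?thesis using fG by blast
qed

lemma finite_bounded: "finite S \<Longrightarrow> S \<subseteq> elts \<delta> \<Longrightarrow> \<exists>\<zeta>\<in>elts \<delta>. \<forall>x\<in>S. x \<in> elts \<zeta>"
proof (induction S rule: finite_induct)
  case empty
  then show ?case using empty_delta by blast
next
  case (insert x S)
  then obtain \<zeta> where z: "\<zeta> \<in> elts \<delta>" "\<forall>x\<in>S. x \<in> elts \<zeta>" by auto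
  obtain \<zeta>' where "\<zeta>' \<in> elts \<delta>" "x \<in> elts \<zeta>'" "\<zeta> \<in> elts \<zeta>'" using above_two[of x \<zeta>] insert(4) z(1) by auto
  then show ?case using z Ord_trans[OF Ord_in_Ord[OF od]] by blast
qed

lemma cof_delta: "cof (gen_ext V (magidor \<kappa> U) G) \<delta> = omega"
  unfolding cof_def
proof (rule the_equality)
  let ?M = "gen_ext V (magidor \<kappa> U) G"
  have fin: "\<not> (\<exists>f\<in>?M. cofinal_map f \<gamma>' \<delta>)" if om: "\<gamma>' \<in> elts omega" for \<gamma>'
  proof
    assume "\<exists>f\<in>?M. cofinal_map f \<gamma>' \<delta>"
    then obtain f where f: "cofinal_map f \<gamma>' \<delta>" by blast
    obtain n where n: "\<gamma>' = nat_ord n" using om unfolding elts_omega by blast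
    have "finite (app f ` elts \<gamma>')" unfolding n elts_nat_ord by simp
    moreover have "app f ` elts \<gamma>' \<subseteq> elts \<delta>" using f unfolding cofinal_map_def by blast
    ultimately obtain \<zeta> where z: "\<zeta> \<in> elts \<delta>" "\<forall>x\<in>app f ` elts \<gamma>'. x \<in> elts \<zeta>" using finite_bounded by metis
    then obtain \<xi> where "\<xi> \<in> elts \<gamma>'" "\<zeta> \<in> elts (app f \<xi>) \<or> \<zeta> = app f \<xi>" using f unfolding cofinal_map_def by blast
    then show False using z(2) elts_asym elts_irrefl by (metis imageI)
  qed
  show *: "omega \<in> ?M \<and> Ord (omega :: 'a) \<and> (\<exists>f\<in>?M. cofinal_map f omega \<delta>) \<and> (\<forall>\<gamma>'\<in>elts omega. \<not> (\<exists>f\<in>?M. cofinal_map f \<gamma>' \<delta>))"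
    by (intro conjI ballI V_gen_ext V_omega Ord_omega cofinal_ex fin)
  fix \<mu> assume m: "\<mu> \<in> ?M \<and> Ord \<mu> \<and> (\<exists>f\<in>?M. cofinal_map f \<mu> \<delta>) \<and> (\<forall>\<gamma>'\<in>elts \<mu>. \<not> (\<exists>f\<in>?M. cofinal_map f \<gamma>' \<delta>))"
  then show "\<mu> = omega" using * Ord_linear[of \<mu> omega] by blast
qed

end

section \<open>Fresh sets\<close>

text \<open>Ordinals in the value of a name are bounded by the rank of the name, which is computed
  in V; so the supremum of the fresh set is in V. The induction is along the transitive closure of
  \<in>, since a name reaches its members through Kuratowski pairs.\<close>

lemma val_rk: "Ord x \<Longrightarrow> x \<in> elts (val G \<sigma>) \<Longrightarrow> x \<in> elts (rk (\<sigma> :: 'a::set_universe))"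
proof (induction \<sigma> arbitrary: x rule: wf_induct_rule[OF wf_trancl[OF wf_elts]])
  case (1 \<sigma>)
  have "elts (val G \<sigma>) = val G ` {\<rho>. \<exists>p\<in>G. opair \<rho> p \<in> elts \<sigma>}"
  proof -
    have "small (val G ` {\<rho>. \<exists>p\<in>G. opair \<rho> p \<in> elts \<sigma>})"
    proof (rule small_image)
      have "{\<rho>. \<exists>p\<in>G. opair \<rho> p \<in> elts \<sigma>} \<subseteq> elts (bigU (bigU \<sigma>))"
        using opair_bigU by blast
      then show "small {\<rho>. \<exists>p\<in>G. opair \<rho> p \<in> elts \<sigma>}" using small_subset small_elts by blast
    qed
    then show ?thesis by (subst val.simps) (rule elts_vset_small)
  qed
  then obtain \<rho> p where r: "opair \<rho> p \<in> elts \<sigma>" "x = val G \<rho>" using 1(3) by blast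
  have "y \<in> elts (rk \<rho>)" if "y \<in> elts x" for y
    using 1(1)[of \<rho> y] opair_trancl[OF r(1)] Ord_in_Ord[OF 1(2) that] that r(2) by blast
  then have "elts x \<subseteq> elts (rk \<rho>)" by blast
  then have "x = rk \<rho> \<or> x \<in> elts (rk \<rho>)" using Ord_subset_iff[OF 1(2) Ord_rk] by blast
  moreover have "rk \<rho> \<in> elts (rk \<sigma>)"
  proof -
    have a: "y \<in> elts z \<Longrightarrow> rk y \<in> elts (rk z)" for y z :: 'a by (subst elts_rk) blast
    have "rk \<rho> \<in> elts (rk (vset {\<rho>}))" "rk (vset {\<rho>}) \<in> elts (rk (opair \<rho> p))" "rk (opair \<rho> p) \<in> elts (rk \<sigma>)"
      using a[of \<rho> "vset {\<rho>}"] a[of "vset {\<rho>}" "opair \<rho> p"] a[OF r(1)] elts_opair[of \<rho> p] by simp_all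
    then show ?thesis using Ord_trans[OF Ord_rk] by meson
  qed
  ultimately show ?case using Ord_trans[OF Ord_rk] by blast
qed

lemma (in zfc) V_sub_pair: "a \<in> V \<Longrightarrow> b \<in> V \<Longrightarrow> vset (elts A \<inter> {a, b}) \<in> V"
proof -
  assume a: "a \<in> V" "b \<in> V"
  have "elts A \<inter> {a, b} \<in> {{}, {a}, {b}, {a, b}}" by auto
  then show ?thesis using V_empty V_single a V_pair by auto
qed

theorem theorem6p1:
  fixes V :: "'a::set_universe set" and \<kappa> U A :: 'a and G :: "'a set"
  assumes "zfc_model V"
    and "coherent_sequence V \<kappa> U"
    and "V_generic V (magidor \<kappa> U) (magidor_le \<kappa> U) G"
    and "A \<in> gen_ext V (magidor \<kappa> U) G"
    and "\<forall>x\<in>elts A. Ord x"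
    and "fresh V A"
  shows "cof (gen_ext V (magidor \<kappa> U) G) (sup_ord A) = omega"
proof -
  interpret generic V \<kappa> U G by unfold_locales fact+
  obtain \<tau> where t: "\<tau> \<in> V" "is_name (magidor \<kappa> U) \<tau>" "A = val G \<tau>" using assms(4) unfolding gen_ext_def by blast
  define \<delta> where "\<delta> = sup_ord A"
  have ed: "elts \<delta> = \<Union> (elts ` elts A)" unfolding \<delta>_def sup_ord_def by simp
  have od: "Ord \<delta>" unfolding \<delta>_def sup_ord_def by (rule Ord_Union) (use assms(5) in blast)
  have AV: "A \<notin> V" and fr: "\<And>\<zeta>. \<zeta> \<in> elts \<delta> \<Longrightarrow> vset (elts A \<inter> elts \<zeta>) \<in> V"
    using assms(6) unfolding fresh_def \<delta>_def by blast+
  have Ar: "x \<in> elts (rk \<tau>)" if "x \<in> elts A" for x using val_rk assms(5) that t(3) by blast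
  have "elts \<delta> \<subseteq> elts (rk \<tau>)" unfolding ed using Ar Ord_trans[OF Ord_rk] by blast
  then have "\<delta> = rk \<tau> \<or> \<delta> \<in> elts (rk \<tau>)" using Ord_subset_iff[OF od Ord_rk] by blast
  then have dV: "\<delta> \<in> V" using V_rk[OF t(1)] V_trans by blast
  \<comment> \<open>The supremum is the union, so \<delta> itself may be the largest element of
    \<open>A\<close>.\<close>
  have Ad: "x \<in> elts \<delta> \<or> x = \<delta>" if "x \<in> elts A" for x
    using Ord_subset_iff[of x \<delta>] od assms(5) that ed by blast
  \<comment> \<open>At most two exceptional elements are harmless: the trace of \<open>A\<close> on
    a pair from V is in V.\<close>
  have split: False if "elts A = S1 \<union> (elts A \<inter> {a, b})" "vset S1 \<in> V" "small S1" "a \<in> V" "b \<in> V" for S1 a b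
  proof -
    have "vset (elts (vset S1) \<union> elts (vset (elts A \<inter> {a, b}))) \<in> V"
      using V_Un[OF that(2) V_sub_pair[OF that(4,5)]] .
    moreover have "elts (vset S1) \<union> elts (vset (elts A \<inter> {a, b})) = elts A"
      using that(1) elts_vset_small[OF that(3)] by simp
    ultimately show False using AV by simp
  qed
  have nV: "vset (elts A \<inter> elts \<delta>) \<notin> V"
    using split[of "elts A \<inter> elts \<delta>" \<delta> \<delta>] Ad dV by auto
  have ne: "elts \<delta> \<noteq> {}"
  proof
    assume "elts \<delta> = {}"
    then have "vset (elts A \<inter> elts \<delta>) = vset {}" by simp
    then show False using nV V_empty by simp
  qed
  \<comment> \<open>If \<delta> had a largest element \<zeta>, then \<open>A\<close> would consist
    of A \<inter> \<zeta>, which is in V, and a subset of {\<zeta>, \<delta>}.\<close>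
  have lim: "\<exists>\<zeta>'\<in>elts \<delta>. \<zeta> \<in> elts \<zeta>'" if z: "\<zeta> \<in> elts \<delta>" for \<zeta>
  proof (rule ccontr)
    assume n: "\<not> ?thesis"
    have "x \<in> elts \<zeta> \<or> x = \<zeta> \<or> x = \<delta>" if "x \<in> elts A" for x
      using Ad[OF that] n Ord_linear[OF Ord_in_Ord[OF od z], of x] assms(5) that by blast
    then have "elts A = (elts A \<inter> elts \<zeta>) \<union> (elts A \<inter> {\<zeta>, \<delta>})" by blast
    then show False using split[OF _ fr[OF z]] V_trans[OF dV z] dV by simp
  qed
  interpret fresh_core V \<kappa> U G \<tau> \<delta>
    by unfold_locales
      (use t dV od ne lim fr nV Ord_trans[OF od] in auto)
  obtain \<gamma> where g: "\<exists>v. EE \<gamma> v" "\<And>\<nu>. \<nu> \<in> elts \<gamma> \<Longrightarrow> \<not> (\<exists>v. EE \<nu> v)"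
    using elts_least[of "\<lambda>\<gamma>. \<exists>v. EE \<gamma> v" \<kappa>] EE_top by blast
  then obtain v where v: "EE \<gamma> v" by blast
  interpret core V \<kappa> U G \<tau> \<delta> \<gamma> v
    by unfold_locales (use v g(2) in blast)+
  show ?thesis using cof_delta unfolding \<delta>_def .
qed

end
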